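(* Let $\Omega,\ell,Q,f,\omega,\bar\varsigma,\varphi$ satisfy the standing assumptions listed in the context, and assume $\bar\varsigma\in(0,\infty]$. Let $\gamma_\varepsilon>0$ be such that $\gamma_\varepsilon/\varepsilon\to\infty$ as $\varepsilon\to0^+$. For $\varepsilon>0$ let $\widetilde{\mathcal F}_\varepsilon:L^1(\Omega,\mathbb R^2)\to[0,\infty]$ be $$\widetilde{\mathcal F}_\varepsilon(u,v):=\int_\Omega\Big(\varphi(\gamma_\varepsilon f^2(v))|u'|^2+\frac{\omega(1-v)}{4\varepsilon}+\varepsilon|v'|^2\Big)dx$$ if $(u,v)\in H^1(\Omega,\mathbb R\times[0,1])$, and $\infty$ otherwise. Then, for all $(u,v)\in L^1(\Omega,\mathbb R^2)$, $$\Gamma(L^1)\text{-}\lim_{\varepsilon\to0}\widetilde{\mathcal F}_\varepsilon(u,v)=\widetilde F(u,v),$$ where $$\widetilde F(u,v):=\varphi(\infty)\int_\Omega|u'|^2dx+2\Psi(1)\,\mathcal H^0(J_u)$$ if $u\in SBV(\Omega)$ and $v=1$ $\mathcal L^1$-a.e. on $\Omega$, and $\widetilde F(u,v):=\infty$ otherwise, with $\Psi(t):=\int_0^t\omega^{1/2}(1-\tau)\,d\tau$ for $t\in[0,1]$.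
   Context: Standing assumptions. $\Omega\subset\mathbb R$ is a bounded open interval. $\ell,Q\in C^0([0,1],[0,\infty))$, $\ell(1)=1$, $\ell^{-1}(\{0\})=Q^{-1}(\{0\})=\{0\}$, $Q$ is non-decreasing in a right neighbourhood of $0$, and $f(t):=\big(\ell(t)/Q(1-t)\big)^{1/2}$, $t\in[0,1)$, is non-decreasing in a left neighbourhood of $t=1$. $\omega\in C^0([0,1],[0,\infty))$, $\omega^{-1}(\{0\})=\{0\}$, and the limit $\bar\varsigma:=\lim_{t\to0^+}(\omega(t)/Q(t))^{1/2}\in[0,\infty]$ exists. $\varphi\in C^0([0,\infty))$ is non-negative and non-decreasing, $\varphi(\infty):=\lim_{t\to\infty}\varphi(t)\in(0,\infty)$, $\varphi^{-1}(\{0\})=\{0\}$, and $\varphi$ is right-differentiable at $0$ with $\varphi'(0^+)\in(0,\infty)$. The function $t\mapsto\varphi(\gamma_\varepsilon f^2(t))$, defined on $[0,1)$, is extended to $t=1$ with value $\varphi(\infty)$. For $u\in SBV(\Omega)$, $u'$ is the approximate gradient (density of the absolutely continuous part of $Du$) and $J_u$ the set of jump points; $\mathcal H^0$ is the counting measure. $\Gamma(L^1)$-convergence is $\Gamma$-convergence with respect to the strong topology of $L^1(\Omega,\mathbb R^2)$. *)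

theory Defs
  imports "HOL-Analysis.Analysis"
begin

section \<open>Gamma-convergence\<close>

text \<open>
  \<^term>\<open>X\<close> is a space of representatives with a pseudometric \<^term>\<open>d\<close>; a family indexed by
  \<open>\<epsilon> > 0\<close> converges as \<open>\<epsilon> \<rightarrow> 0\<close> if it does so along every sequence \<open>\<epsilon>\<^sub>j \<rightarrow> 0\<^sup>+\<close>.
\<close>

definition Gamma_seq_limit ::
  "'a set \<Rightarrow> ('a \<Rightarrow> 'a \<Rightarrow> real) \<Rightarrow> (nat \<Rightarrow> 'a \<Rightarrow> ennreal) \<Rightarrow> ('a \<Rightarrow> ennreal) \<Rightarrow> bool" where
  "Gamma_seq_limit X d F G \<longleftrightarrow>
    (\<forall>x\<in>X.
      (\<forall>y. (\<forall>j. y j \<in> X) \<and> (\<lambda>j. d (y j) x) \<longlonglongrightarrow> 0 \<longrightarrow> G x \<le> liminf (\<lambda>j. F j (y j))) \<and>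
      (\<exists>y. (\<forall>j. y j \<in> X) \<and> (\<lambda>j. d (y j) x) \<longlonglongrightarrow> 0 \<and> limsup (\<lambda>j. F j (y j)) \<le> G x))"

definition Gamma_limit ::
  "'a set \<Rightarrow> ('a \<Rightarrow> 'a \<Rightarrow> real) \<Rightarrow> (real \<Rightarrow> 'a \<Rightarrow> ennreal) \<Rightarrow> ('a \<Rightarrow> ennreal) \<Rightarrow> bool" where
  "Gamma_limit X d F G \<longleftrightarrow>
    (\<forall>\<epsilon> :: nat \<Rightarrow> real. (\<forall>j. \<epsilon> j > 0) \<and> \<epsilon> \<longlonglongrightarrow> 0 \<longrightarrow> Gamma_seq_limit X d (\<lambda>j. F (\<epsilon> j)) G)"


section \<open>Function spaces on an open subset of the line\<close>

text \<open>
  Elements of function spaces are represented by functions on the whole line, of which only the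
  restriction to \<open>\<Omega>\<close> matters; every notion below is invariant under changes on null sets.
\<close>

definition L1_space :: "real set \<Rightarrow> (real \<Rightarrow> 'b :: euclidean_space) set" where
  "L1_space \<Omega> = {w. integrable (lebesgue_on \<Omega>) w}"

definition L1_dist :: "real set \<Rightarrow> (real \<Rightarrow> 'b :: euclidean_space) \<Rightarrow> (real \<Rightarrow> 'b) \<Rightarrow> real" where
  "L1_dist \<Omega> w z = (LINT x|lebesgue_on \<Omega>. norm (w x - z x))"

definition L2_space :: "real set \<Rightarrow> (real \<Rightarrow> real) set" where
  "L2_space \<Omega> =
    {u. u \<in> borel_measurable (lebesgue_on \<Omega>) \<and> integrable (lebesgue_on \<Omega>) (\<lambda>x. (u x)\<^sup>2)}"

definition L1_loc :: "real set \<Rightarrow> (real \<Rightarrow> real) set" where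
  "L1_loc \<Omega> = {u. \<forall>K. compact K \<and> K \<subseteq> \<Omega> \<longrightarrow> integrable (lebesgue_on K) u}"

definition test_functions :: "real set \<Rightarrow> (real \<Rightarrow> real) set" where
  "test_functions \<Omega> =
    {\<psi>. (\<forall>n x. (deriv ^^ n) \<psi> differentiable at x) \<and>
        compact (closure {x. \<psi> x \<noteq> 0}) \<and> closure {x. \<psi> x \<noteq> 0} \<subseteq> \<Omega>}"

definition is_weak_deriv :: "real set \<Rightarrow> (real \<Rightarrow> real) \<Rightarrow> (real \<Rightarrow> real) \<Rightarrow> bool" where
  "is_weak_deriv \<Omega> u g \<longleftrightarrow>
    u \<in> L1_loc \<Omega> \<and> g \<in> L1_loc \<Omega> \<and>
    (\<forall>\<psi>\<in>test_functions \<Omega>.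
      (LINT x|lebesgue_on \<Omega>. u x * deriv \<psi> x) = - (LINT x|lebesgue_on \<Omega>. g x * \<psi> x))"

definition H1_space :: "real set \<Rightarrow> (real \<Rightarrow> real) set" where
  "H1_space \<Omega> = {u. u \<in> L2_space \<Omega> \<and> (\<exists>g\<in>L2_space \<Omega>. is_weak_deriv \<Omega> u g)}"

definition weak_deriv :: "real set \<Rightarrow> (real \<Rightarrow> real) \<Rightarrow> real \<Rightarrow> real" where
  "weak_deriv \<Omega> u = (SOME g. is_weak_deriv \<Omega> u g)"


section \<open>Special functions of bounded variation\<close>

definition finite_borel_measure_on :: "real set \<Rightarrow> real measure \<Rightarrow> bool" where
  "finite_borel_measure_on \<Omega> \<mu> \<longleftrightarrow>
    sets \<mu> = sets borel \<and> finite_measure \<mu> \<and> emeasure \<mu> (- \<Omega>) = 0"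

definition lebesgue_singular :: "real measure \<Rightarrow> bool" where
  "lebesgue_singular \<mu> \<longleftrightarrow> (\<exists>Z\<in>null_sets lborel. emeasure \<mu> (- Z) = 0)"

text \<open>
  The distributional derivative of \<open>u\<close> is the finite signed measure with Lebesgue decomposition
  \<open>Du = g \<L>\<^sup>1 + (\<sigma> - \<tau>)\<close>. The singular part is written as a difference of two finite positive
  measures, which need not be its Jordan decomposition. A function \<open>u \<in> L\<^sup>1(\<Omega>)\<close> is in \<open>BV(\<Omega>)\<close> iff
  such \<open>g\<close>, \<open>\<sigma>\<close>, \<open>\<tau>\<close> exist; \<open>g\<close> is then unique almost everywhere and \<open>\<sigma> - \<tau>\<close> is unique.
\<close>

definition BV_deriv ::
  "real set \<Rightarrow> (real \<Rightarrow> real) \<Rightarrow> (real \<Rightarrow> real) \<Rightarrow> real measure \<Rightarrow> real measure \<Rightarrow> bool" where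
  "BV_deriv \<Omega> u g \<sigma> \<tau> \<longleftrightarrow>
    g \<in> L1_space \<Omega> \<and>
    finite_borel_measure_on \<Omega> \<sigma> \<and> lebesgue_singular \<sigma> \<and>
    finite_borel_measure_on \<Omega> \<tau> \<and> lebesgue_singular \<tau> \<and>
    (\<forall>\<psi>\<in>test_functions \<Omega>.
      (LINT x|lebesgue_on \<Omega>. u x * deriv \<psi> x) =
      - ((LINT x|lebesgue_on \<Omega>. g x * \<psi> x) + (LINT x|\<sigma>. \<psi> x) - (LINT x|\<tau>. \<psi> x)))"

definition BV_space :: "real set \<Rightarrow> (real \<Rightarrow> real) set" where
  "BV_space \<Omega> = {u. u \<in> L1_space \<Omega> \<and> (\<exists>g \<sigma> \<tau>. BV_deriv \<Omega> u g \<sigma> \<tau>)}"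

definition jump_set :: "real set \<Rightarrow> (real \<Rightarrow> real) \<Rightarrow> real set" where
  "jump_set \<Omega> u =
    {x\<in>\<Omega>. \<exists>p q. p \<noteq> q \<and>
      ((\<lambda>r. (LINT y|lebesgue_on {x - r<..<x}. \<bar>u y - p\<bar>) / r) \<longlongrightarrow> 0) (at_right 0) \<and>
      ((\<lambda>r. (LINT y|lebesgue_on {x<..<x + r}. \<bar>u y - q\<bar>) / r) \<longlongrightarrow> 0) (at_right 0)}"

text \<open>The singular part of \<open>Du\<close> vanishes off \<open>J\<^sub>u\<close>, i.e. \<open>Du\<close> has no Cantor part.\<close>

definition SBV_space :: "real set \<Rightarrow> (real \<Rightarrow> real) set" where
  "SBV_space \<Omega> =
    {u\<in>BV_space \<Omega>. \<forall>g \<sigma> \<tau>. BV_deriv \<Omega> u g \<sigma> \<tau> \<longrightarrow>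
      (\<forall>A\<in>sets borel. A \<subseteq> \<Omega> - jump_set \<Omega> u \<longrightarrow> measure \<sigma> A = measure \<tau> A)}"

definition approx_grad :: "real set \<Rightarrow> (real \<Rightarrow> real) \<Rightarrow> real \<Rightarrow> real" where
  "approx_grad \<Omega> u = (SOME g. \<exists>\<sigma> \<tau>. BV_deriv \<Omega> u g \<sigma> \<tau>)"


section \<open>The functionals\<close>

definition f_fun :: "(real \<Rightarrow> real) \<Rightarrow> (real \<Rightarrow> real) \<Rightarrow> real \<Rightarrow> real" where
  "f_fun l Q t = sqrt (l t / Q (1 - t))"

text \<open>\<open>t \<mapsto> \<phi>(\<gamma> f\<^sup>2(t))\<close> on \<open>[0,1)\<close>, with value \<open>\<phi>(\<infinity>)\<close> at \<open>t = 1\<close>, where \<open>Q(1 - t) = 0\<close>.\<close>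

definition elastic_coeff ::
  "(real \<Rightarrow> real) \<Rightarrow> real \<Rightarrow> (real \<Rightarrow> real) \<Rightarrow> (real \<Rightarrow> real) \<Rightarrow> real \<Rightarrow> real \<Rightarrow> real" where
  "elastic_coeff \<phi> \<phi>inf l Q \<gamma> t = (if t = 1 then \<phi>inf else \<phi> (\<gamma> * (f_fun l Q t)\<^sup>2))"

definition phase_field_energy ::
  "real set \<Rightarrow> (real \<Rightarrow> real) \<Rightarrow> real \<Rightarrow> (real \<Rightarrow> real) \<Rightarrow> (real \<Rightarrow> real) \<Rightarrow> (real \<Rightarrow> real) \<Rightarrow>
    real \<Rightarrow> real \<Rightarrow> (real \<Rightarrow> real) \<Rightarrow> (real \<Rightarrow> real) \<Rightarrow> ennreal" where
  "phase_field_energy \<Omega> \<phi> \<phi>inf l Q \<omega> \<gamma> \<epsilon> u v =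
    (if u \<in> H1_space \<Omega> \<and> v \<in> H1_space \<Omega> \<and> (AE x in lebesgue_on \<Omega>. v x \<in> {0..1})
     then \<integral>\<^sup>+x. ennreal (elastic_coeff \<phi> \<phi>inf l Q \<gamma> (v x) * \<bar>weak_deriv \<Omega> u x\<bar>\<^sup>2
                        + \<omega> (1 - v x) / (4 * \<epsilon>)
                        + \<epsilon> * \<bar>weak_deriv \<Omega> v x\<bar>\<^sup>2) \<partial>lebesgue_on \<Omega>
     else \<infinity>)"

definition Psi :: "(real \<Rightarrow> real) \<Rightarrow> real \<Rightarrow> real" where
  "Psi \<omega> t = integral {0..t} (\<lambda>s. sqrt (\<omega> (1 - s)))"

definition limit_energy ::
  "real set \<Rightarrow> real \<Rightarrow> (real \<Rightarrow> real) \<Rightarrow> (real \<Rightarrow> real) \<Rightarrow> (real \<Rightarrow> real) \<Rightarrow> ennreal" where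
  "limit_energy \<Omega> \<phi>inf \<omega> u v =
    (if u \<in> SBV_space \<Omega> \<and> (AE x in lebesgue_on \<Omega>. v x = 1)
     then ennreal \<phi>inf * (\<integral>\<^sup>+x. ennreal (\<bar>approx_grad \<Omega> u x\<bar>\<^sup>2) \<partial>lebesgue_on \<Omega>)
          + 2 * ennreal (Psi \<omega> 1) * emeasure (count_space UNIV) (jump_set \<Omega> u)
     else \<infinity>)"

end

theory Submission imports Defs
begin

text \<open>
  Lower bound. By the inequality of the means the surface part of the energy dominates the total
  variation of \<open>\<Psi>(v)\<close>, so each point at which \<open>v\<close> keeps dipping below a small \<open>\<delta>\<close> costs almost
  \<open>2 (\<Psi>(1) - \<Psi>(\<delta>))\<close>, and there are finitely many of them. Away from these points either the
  coefficient \<open>\<phi>(\<gamma> f\<^sup>2(v))\<close> is at least \<open>(1 - \<theta>) \<phi>(\<infinity>)\<close>, or its product with \<open>\<omega>(1 - v)\<close> is at least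
  \<open>c \<gamma>\<close>; as \<open>\<gamma> / \<epsilon> \<rightarrow> \<infinity>\<close>, the integral of \<open>\<bar>u'\<bar>\<close> over the second set vanishes in the limit. Hence the
  limit is piecewise \<open>H\<^sup>1\<close>, with jumps only at the exceptional points, and its gradient is a weak
  \<open>L\<^sup>2\<close> limit.

  Upper bound. Around each jump, \<open>u\<close> is made continuous by a linear ramp on a zone of length of
  order \<open>\<epsilon>\<^sup>2\<close> on which \<open>v = 0\<close>, and on both sides \<open>v\<close> returns to 1 along an almost optimal profile.
\<close>

section \<open>Smooth test functions\<close>

text \<open>The hypothesis \<open>0 < \<zeta>\<close> yields \<omega> \<ge> c Q, and the positive
  right derivative of \<phi> at 0 yields \<phi>(t) \<ge> c t as long as \<phi>(t) stays away from
  \<phi>inf. In the product of the coefficient with \<omega>(1 - v) the factor Q(1 - v) cancels and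
  c \<gamma> l(v) remains; l is bounded below only where v is, hence the threshold \<delta>. On the
  set of small coefficient this gives control of the gradient in L1 only, but with a vanishing
  constant. H1, BV and both gradients are defined by duality with test functions, and the gradients
  by arbitrary choice. On an interval, membership is equivalent to a formula: a constant plus the
  primitive of a density plus the primitive of a singular part. The analysis is done on these
  formulas. In the upper bound the coefficient is exactly 0 where v = 0, so the ramp costs nothing,
  however steep. Regularisation \<eta> = \<epsilon> and half-length \<sigma> = \<epsilon>^2 make the
  cost \<sigma>/\<epsilon> of the zero zone and the length \<epsilon>/sqrt \<eta> of the transition
  tend to 0 together.\<close>

definition smooth :: "(real \<Rightarrow> real) \<Rightarrow> bool" where
  "smooth f \<longleftrightarrow> (\<forall>n x. (deriv ^^ n) f differentiable at x)"

text \<open>Smoothness by coinduction: every iterated derivative stays in \<open>S\<close>, so a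
  class of differentiable functions that \<open>deriv\<close> maps into itself replaces explicit
  formulas for higher derivatives.\<close>

lemma smooth_coinduct:
  assumes "f \<in> S" and "\<And>h x. h \<in> S \<Longrightarrow> h differentiable at x"
    and "\<And>h. h \<in> S \<Longrightarrow> deriv h \<in> S"
  shows "smooth f"
proof -
  have "(deriv ^^ n) f \<in> S" for n
    by (induction n) (use assms in auto)
  then show ?thesis unfolding smooth_def using assms(2) by blast
qed

lemma smooth_differentiable: "smooth f \<Longrightarrow> f differentiable at x"
  unfolding smooth_def by (drule spec[of _ 0]) simp

lemma smooth_deriv: "smooth f \<Longrightarrow> smooth (deriv f)"
  unfolding smooth_def
proof (intro allI)
  fix n x assume "\<forall>n x. (deriv ^^ n) f differentiable at x"
  then have "(deriv ^^ Suc n) f differentiable at x" by blast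
  then show "(deriv ^^ n) (deriv f) differentiable at x" by (simp only: funpow_Suc_right comp_def)
qed

lemma smooth_DERIV: "smooth f \<Longrightarrow> (f has_real_derivative deriv f x) (at x)"
  using smooth_differentiable[of f x] DERIV_deriv_iff_real_differentiable by blast

lemma smooth_continuous_on: "smooth f \<Longrightarrow> continuous_on A f"
  by (meson DERIV_isCont continuous_at_imp_continuous_on smooth_DERIV)

lemma smooth_antideriv:
  assumes "\<And>x. (F has_real_derivative f x) (at x)" and "smooth f"
  shows "smooth F"
proof -
  have d: "deriv F = f" using assms(1) DERIV_imp_deriv by blast
  show ?thesis
  proof (rule smooth_coinduct[of _ "insert F {f. smooth f}"])
    show "h differentiable at x" if "h \<in> insert F {f. smooth f}" for h x
      using that assms(1) smooth_differentiable by (auto simp: real_differentiable_def)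
  qed (use assms d in \<open>auto intro: smooth_deriv\<close>)
qed

lemma smooth_lincomb:
  assumes "smooth f" and "smooth g"
  shows "smooth (\<lambda>x. \<alpha> * f x + \<beta> * g x)"
proof -
  let ?S = "{\<lambda>x. \<alpha> * f x + \<beta> * g x |f g. smooth f \<and> smooth g}"
  have D: "((\<lambda>x. \<alpha> * f x + \<beta> * g x) has_real_derivative \<alpha> * deriv f x + \<beta> * deriv g x) (at x)"
    if "smooth f" "smooth g" for f g x
    using that by (auto intro!: derivative_eq_intros smooth_DERIV)
  show ?thesis
  proof (rule smooth_coinduct[of _ ?S])
    show "(\<lambda>x. \<alpha> * f x + \<beta> * g x) \<in> ?S" using assms by blast
    show "h differentiable at x" if h: "h \<in> ?S" for h x
      using h D real_differentiable_def by blast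
    show "deriv h \<in> ?S" if h: "h \<in> ?S" for h
    proof -
      from h obtain f g where fg: "h = (\<lambda>x. \<alpha> * f x + \<beta> * g x)" "smooth f" "smooth g" by blast
      have "deriv h = (\<lambda>x. \<alpha> * deriv f x + \<beta> * deriv g x)"
        using D[OF fg(2,3)] DERIV_imp_deriv unfolding fg(1) by blast
      then show ?thesis using fg smooth_deriv by blast
    qed
  qed
qed

lemma smooth_affine:
  assumes "smooth f"
  shows "smooth (\<lambda>x. f (m * x + t))"
proof -
  \<comment> \<open>The constant \<open>k\<close> makes the class closed under \<open>deriv\<close>,
    since the chain rule produces a factor \<open>m\<close>.\<close>
  let ?S = "{\<lambda>x. k * f (m * x + t) |k f. smooth f}"
  have D: "((\<lambda>x. k * f (m * x + t)) has_real_derivative (k * m) * deriv f (m * x + t)) (at x)"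
    if "smooth f" for f x k
  proof -
    have "((\<lambda>x. f (m * x + t)) has_real_derivative deriv f (m * x + t) * m) (at x)"
      by (rule DERIV_chain2[OF smooth_DERIV[OF that]]) (auto intro!: derivative_eq_intros)
    from DERIV_cmult[OF this, of k] show ?thesis by (simp add: mult_ac)
  qed
  show ?thesis
  proof (rule smooth_coinduct[of _ ?S])
    show "(\<lambda>x. f (m * x + t)) \<in> ?S" using assms by (auto intro!: exI[of _ 1] exI[of _ f])
    show "h differentiable at x" if h: "h \<in> ?S" for h x
      using h D real_differentiable_def by blast
    show "deriv h \<in> ?S" if h: "h \<in> ?S" for h
    proof -
      from h obtain k f where fg: "h = (\<lambda>x. k * f (m * x + t))" "smooth f" by blast
      have "deriv h = (\<lambda>x. (k * m) * deriv f (m * x + t))"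
        using D[OF fg(2)] DERIV_imp_deriv unfolding fg(1) by blast
      then show ?thesis using fg smooth_deriv by blast
    qed
  qed
qed

text \<open>All derivatives of exp(-1/(x(1 - x))) on ]0, 1[, extended by 0, have this shape; the
  polynomial and the exponent are parameters so that the family is closed under
  \<open>deriv\<close>.\<close>

definition bump_fun :: "real poly \<Rightarrow> nat \<Rightarrow> real \<Rightarrow> real" where
  "bump_fun p k x = (if 0 < x \<and> x < 1
     then poly p x / (x * (1 - x)) ^ k * exp (- 1 / (x * (1 - x))) else 0)"

text \<open>With q = x(1 - x), coded \<open>[:0, 1, -1:]\<close>, and q' = 1 - 2x, coded
  \<open>[:1, -2:]\<close>, this is p' q^2 - k p q' q + p q', the numerator of the derivative of p
  q^(-k) exp(-1/q) over q^(k+2), apart from the exponential.\<close>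

definition bump_poly :: "real poly \<Rightarrow> nat \<Rightarrow> real poly" where
  "bump_poly p k = pderiv p * [:0, 1, -1:]\<^sup>2 - smult (of_nat k) (p * [:1, -2:] * [:0, 1, -1:])
     + p * [:1, -2:]"

lemma DERIV_bump_fun_inner:
  assumes "0 < x" "x < 1"
  shows "(bump_fun p k has_real_derivative bump_fun (bump_poly p k) (k + 2) x) (at x)"
proof -
  let ?q = "\<lambda>x::real. x * (1 - x)"
  have q: "?q x > 0" using assms by simp
  have pk: "((\<lambda>x. ?q x ^ k) has_real_derivative of_nat k * (1 - 2 * x) * ?q x ^ k / ?q x) (at x)"
  proof (cases k)
    case (Suc n)
    have "((\<lambda>x. ?q x ^ k) has_real_derivative of_nat k * (?q x ^ (k - 1) * (1 - 2 * x))) (at x)"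
      by (rule DERIV_cong[OF DERIV_power[where n=k]]) (auto intro!: derivative_eq_intros)
    moreover have "of_nat k * (?q x ^ (k - 1) * (1 - 2 * x)) = of_nat k * (1 - 2 * x) * ?q x ^ k / ?q x"
      using q Suc by (auto simp: power_Suc)
    ultimately show ?thesis by simp
  qed simp
  have ex: "((\<lambda>x. exp (- 1 / ?q x)) has_real_derivative
      exp (- 1 / ?q x) * ((1 - 2 * x) / (?q x)\<^sup>2)) (at x)"
    using q by (auto intro!: derivative_eq_intros simp: divide_simps power2_eq_square algebra_simps)
  have "((\<lambda>x. poly p x / ?q x ^ k * exp (- 1 / ?q x)) has_real_derivative
     ((poly (pderiv p) x * ?q x ^ k - poly p x * (of_nat k * (1 - 2 * x) * ?q x ^ k / ?q x)) / (?q x ^ k * ?q x ^ k)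
        * exp (- 1 / ?q x) + exp (- 1 / ?q x) * ((1 - 2 * x) / (?q x)\<^sup>2) * (poly p x / ?q x ^ k))) (at x)"
    by (rule DERIV_mult[OF DERIV_divide[OF poly_DERIV pk] ex]) (use q in auto)
  also have "((poly (pderiv p) x * ?q x ^ k - poly p x * (of_nat k * (1 - 2 * x) * ?q x ^ k / ?q x)) / (?q x ^ k * ?q x ^ k)
        * exp (- 1 / ?q x) + exp (- 1 / ?q x) * ((1 - 2 * x) / (?q x)\<^sup>2) * (poly p x / ?q x ^ k))
     = bump_fun (bump_poly p k) (k + 2) x"
  proof -
    define q where "q = ?q x"
    define E where "E = exp (- 1 / q)"
    define Q where "Q = q ^ k"
    have nz: "q \<noteq> 0" "Q \<noteq> 0" using q by (auto simp: q_def Q_def)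
    have pq: "poly [:0, 1, -1:] x = q" by (simp add: q_def algebra_simps)
    have "poly (bump_poly p k) x = poly (pderiv p) x * q\<^sup>2 - of_nat k * (poly p x * (1 - 2 * x) * q) + poly p x * (1 - 2 * x)"
      unfolding bump_poly_def poly_add poly_diff poly_mult poly_smult poly_power pq by (simp add: algebra_simps)
    then have r: "bump_fun (bump_poly p k) (k + 2) x =
      (poly (pderiv p) x * q\<^sup>2 - of_nat k * (poly p x * (1 - 2 * x) * q) + poly p x * (1 - 2 * x)) / (Q * q\<^sup>2) * E"
      using assms by (simp add: bump_fun_def q_def Q_def E_def power_add power2_eq_square)
    show ?thesis unfolding r unfolding q_def[symmetric] Q_def[symmetric] E_def[symmetric]
      using nz by (simp add: divide_simps power2_eq_square) (simp add: algebra_simps)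
  qed
  finally have "((\<lambda>x. poly p x / ?q x ^ k * exp (- 1 / ?q x)) has_real_derivative
      bump_fun (bump_poly p k) (k + 2) x) (at x)" .
  then show ?thesis
    by (rule has_field_derivative_transform_within_open[of _ _ _ "{0<..<1}"])
      (use assms in \<open>auto simp: bump_fun_def\<close>)
qed

lemma inverse_power_exp_tendsto_0: "((\<lambda>q::real. 1 / q ^ k * exp (- 1 / q)) \<longlongrightarrow> 0) (at_right 0)"
proof -
  have "((\<lambda>z::real. z ^ k / exp z) \<longlongrightarrow> 0) at_top" by (rule tendsto_power_div_exp_0)
  then have "((\<lambda>q::real. inverse q ^ k / exp (inverse q)) \<longlongrightarrow> 0) (at_right 0)"
    by (rule filterlim_compose[OF _ filterlim_inverse_at_top_right])
  then show ?thesis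
    by (simp add: field_simps exp_minus)
qed

text \<open>The difference quotient at an endpoint e costs a factor 1/|x - e|, and q = x(1 - x) is
  at most |x - e| inside ]0, 1[. Hence the quotient is dominated by a multiple of q^(-(k+1))
  exp(-1/q), which tends to 0 with q.\<close>

lemma DERIV_bump_fun_boundary:
  assumes e: "e = 0 \<or> e = 1"
  shows "(bump_fun p k has_real_derivative 0) (at e)"
proof -
  let ?q = "\<lambda>x::real. x * (1 - x)"
  have "continuous_on {0..1::real} (poly p)" by (intro continuous_intros)
  then have "bounded (poly p ` {0..1})" by (intro compact_imp_bounded compact_continuous_image) auto
  then have "\<exists>B. \<forall>x\<in>{0..1}. \<bar>poly p x\<bar> \<le> B"
    unfolding bounded_iff by simp
  then obtain B where B: "\<And>x. x \<in> {0..1} \<Longrightarrow> \<bar>poly p x\<bar> \<le> B" by blast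
  have B0: "B \<ge> 0" using B[of 0] by auto
  \<comment> \<open>\<open>G\<close> is set to 0 for q \<le> 0, so that \<open>isCont G 0\<close>
    composed with q treats both sides of the endpoint at once.\<close>
  define G where "G = (\<lambda>q::real. if q > 0 then B * (1 / q ^ (k+1) * exp (- 1 / q)) else 0)"
  have "((\<lambda>q. B * (1 / q ^ (k+1) * exp (- 1 / q))) \<longlongrightarrow> 0) (at_right 0)"
    using tendsto_mult_right_zero[OF inverse_power_exp_tendsto_0] by blast
  then have "(G \<longlongrightarrow> 0) (at_right 0)"
    by (rule Lim_transform_eventually) (auto simp: G_def eventually_at_filter)
  moreover have "(G \<longlongrightarrow> 0) (at_left 0)"
    by (rule tendsto_eventually) (auto simp: G_def eventually_at_filter)
  ultimately have "(G \<longlongrightarrow> 0) (at 0)" by (simp add: filterlim_split_at)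
  then have G: "isCont G 0" by (simp add: isCont_def G_def)
  have "isCont ?q e" by (intro continuous_intros)
  then have "isCont (\<lambda>x. G (?q x)) e"
    by (rule isCont_o2) (use e G in auto)
  then have Gq: "((\<lambda>x. G (?q x)) \<longlongrightarrow> 0) (at e)" using e by (auto simp: isCont_def G_def)
  have le: "\<bar>bump_fun p k x / (x - e)\<bar> \<le> G (?q x)" for x
  proof (cases "0 < x \<and> x < 1")
    case True
    then have q: "?q x > 0" by simp
    have qe: "?q x \<le> \<bar>x - e\<bar>" using e True by (auto simp: mult_le_cancel_left2 mult_le_cancel_right1 abs_if)
    have "\<bar>bump_fun p k x / (x - e)\<bar> = \<bar>poly p x\<bar> * (1 / ?q x ^ k * exp (- 1 / ?q x)) / \<bar>x - e\<bar>"
      using True by (simp add: bump_fun_def abs_mult)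
    also have "\<dots> \<le> B * (1 / ?q x ^ k * exp (- 1 / ?q x)) / ?q x"
      by (rule frac_le) (use q qe B0 B[of x] True in \<open>auto intro!: mult_right_mono divide_right_mono mult_nonneg_nonneg\<close>)
    also have "\<dots> = G (?q x)" using q by (simp add: G_def mult_ac)
    finally show ?thesis .
  qed (use B0 in \<open>auto simp: bump_fun_def G_def\<close>)
  have "((\<lambda>x. bump_fun p k x / (x - e)) \<longlongrightarrow> 0) (at e)"
    by (rule tendsto_rabs_zero_cancel, rule tendsto_sandwich[OF _ _ tendsto_const Gq]) (use le in auto)
  moreover have "bump_fun p k e = 0" using e by (auto simp: bump_fun_def)
  ultimately show ?thesis by (simp add: has_field_derivative_iff)
qed

lemma DERIV_bump_fun: "(bump_fun p k has_real_derivative bump_fun (bump_poly p k) (k + 2) x) (at x)"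
proof -
  consider "0 < x" "x < 1" | "x = 0 \<or> x = 1" | "x < 0 \<or> x > 1" by linarith
  then show ?thesis
  proof cases
    case 1 then show ?thesis by (rule DERIV_bump_fun_inner)
  next
    case 2 then show ?thesis using DERIV_bump_fun_boundary[OF 2, of p k] by (auto simp: bump_fun_def)
  next
    case 3
    have "((\<lambda>x. 0) has_real_derivative 0) (at x)" by simp
    then have "(bump_fun p k has_real_derivative 0) (at x)"
      by (rule has_field_derivative_transform_within_open[of _ _ _ "- {0..1}"])
        (use 3 in \<open>auto simp: bump_fun_def\<close>)
    then show ?thesis using 3 by (auto simp: bump_fun_def)
  qed
qed

lemma smooth_bump_fun: "smooth (bump_fun p k)"
proof (rule smooth_coinduct[of _ "{bump_fun p k |p k. True}"])
  show "h differentiable at x" if "h \<in> {bump_fun p k |p k. True}" for h x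
    using that DERIV_bump_fun real_differentiable_def by blast
  show "deriv h \<in> {bump_fun p k |p k. True}" if h: "h \<in> {bump_fun p k |p k. True}" for h
  proof -
    from h obtain p k where "h = bump_fun p k" by blast
    then have "deriv h = bump_fun (bump_poly p k) (k + 2)"
      using DERIV_bump_fun DERIV_imp_deriv by blast
    then show ?thesis by blast
  qed
qed blast

text \<open>The integral from 0, with reversed sign on the left, is defined globally; on each ]-K,
  K[ it differs by a constant from the integral from -K, to which the fundamental theorem
  applies.\<close>

lemma continuous_antideriv_exists:
  fixes f :: "real \<Rightarrow> real"
  assumes "continuous_on UNIV f"
  obtains F where "\<And>x. (F has_real_derivative f x) (at x)"
proof -
  define F where "F = (\<lambda>x. if 0 \<le> x then integral {0..x} f else - integral {x..0} f)"
  have int: "f integrable_on {u..v}" for u v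
    using assms continuous_on_subset integrable_continuous_interval by blast
  have F: "F x = integral {-K..x} f - integral {-K..0} f" if "-K < x" "0 < K" for x K
  proof (cases "0 \<le> x")
    case True
    then have "integral {-K..0} f + integral {0..x} f = integral {-K..x} f"
      using that by (intro Henstock_Kurzweil_Integration.integral_combine int) auto
    then show ?thesis using True by (simp add: F_def)
  next
    case False
    then have "integral {-K..x} f + integral {x..0} f = integral {-K..0} f"
      using that by (intro Henstock_Kurzweil_Integration.integral_combine int) auto
    then show ?thesis using False by (simp add: F_def)
  qed
  have "(F has_real_derivative f x) (at x)" for x
  proof -
    define K where "K = \<bar>x\<bar> + 1"
    have K: "-K < x" "x < K" "0 < K" unfolding K_def by linarith+
    have "((\<lambda>x. integral {-K..x} f) has_real_derivative f x) (at x within {-K..K})"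
      using K assms by (intro integral_has_real_derivative) (auto intro: continuous_on_subset)
    then have "((\<lambda>x. integral {-K..x} f) has_real_derivative f x) (at x)"
      using K by (simp add: at_within_Icc_at)
    then have "((\<lambda>x. integral {-K..x} f - integral {-K..0} f) has_real_derivative f x - 0) (at x)"
      by (intro derivative_intros) auto
    then show ?thesis
      by (simp, elim has_field_derivative_transform_within_open[of _ _ _ "{-K<..<K}"])
        (use K F in auto)
  qed
  then show ?thesis by (rule that)
qed

lemma DERIV_zero_imp_eq:
  fixes F f :: "real \<Rightarrow> real"
  assumes "\<And>x. (F has_real_derivative f x) (at x)" and "u \<le> v"
    and "\<And>x. u < x \<Longrightarrow> x < v \<Longrightarrow> f x = 0"
  shows "F v = F u"
proof (cases "u = v")
  case False
  show ?thesis
  proof (rule DERIV_isconst_end[where f = F])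
    show "u < v" using False assms(2) by linarith
    show "continuous_on {u..v} F"
      by (meson DERIV_isCont assms(1) continuous_at_imp_continuous_on)
    show "(F has_real_derivative 0) (at x)" if "u < x" "x < v" for x
      using assms(1)[of x] assms(3)[OF that] by simp
  qed
qed simp

text \<open>The primitive of the bump function, shifted and scaled to run from 0 to 1; it is
  constant where the bump vanishes.\<close>

lemma smooth_step_exists:
  obtains S :: "real \<Rightarrow> real" where "smooth S" and "\<And>x. x \<le> 0 \<Longrightarrow> S x = 0"
    and "\<And>x. 1 \<le> x \<Longrightarrow> S x = 1" and "\<And>x. 0 \<le> S x" and "\<And>x. S x \<le> 1"
proof -
  define \<beta> where "\<beta> = bump_fun 1 0"
  have sm: "smooth \<beta>" unfolding \<beta>_def by (rule smooth_bump_fun)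
  have nn: "\<beta> x \<ge> 0" and pos: "0 < x \<Longrightarrow> x < 1 \<Longrightarrow> \<beta> x > 0" and out: "x \<le> 0 \<or> 1 \<le> x \<Longrightarrow> \<beta> x = 0" for x
    by (auto simp: \<beta>_def bump_fun_def)
  obtain F where F: "\<And>x. (F has_real_derivative \<beta> x) (at x)"
    using continuous_antideriv_exists[OF smooth_continuous_on[OF sm]] by blast
  have mono: "F x \<le> F y" if "x \<le> y" for x y
    by (rule DERIV_nonneg_imp_nondecreasing[OF that]) (use F nn in blast)
  have F0: "F x = F 0" if "x \<le> 0" for x
    using DERIV_zero_imp_eq[OF F that] out by simp
  have F1: "F x = F 1" if "1 \<le> x" for x
    using DERIV_zero_imp_eq[OF F that] out by simp
  have F01: "F 0 < F 1"
  proof (rule DERIV_pos_imp_increasing_open[where f = F])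
    show "continuous_on {0..1} F"
      by (meson DERIV_isCont F continuous_at_imp_continuous_on)
  qed (use F pos in auto)
  define S where "S = (\<lambda>x. (1 / (F 1 - F 0)) * F x + (- F 0 / (F 1 - F 0)) * 1)"
  have Seq: "S x = (F x - F 0) / (F 1 - F 0)" for x
    by (simp add: S_def diff_divide_distrib)
  have one: "smooth (\<lambda>x. 1)"
    by (rule smooth_coinduct[of _ "range (\<lambda>c x. c)"]) auto
  have "smooth S"
    unfolding S_def by (rule smooth_lincomb[OF smooth_antideriv[OF F sm] one])
  moreover have "S x = 0" if "x \<le> 0" for x using F0[OF that] by (simp add: Seq)
  moreover have "S x = 1" if "1 \<le> x" for x using F1[OF that] F01 by (simp add: Seq)
  moreover have "0 \<le> S x" for x
  proof -
    have "F 0 \<le> F x" using F0[of x] mono[of 0 x] by linarith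
    then show ?thesis using F01 by (simp add: Seq)
  qed
  moreover have "S x \<le> 1" for x
  proof -
    have "F x \<le> F 1" using F1[of x] mono[of x 1] by linarith
    then show ?thesis using F01 by (simp add: Seq)
  qed
  ultimately show ?thesis by (rule that)
qed

section \<open>Test functions on an open interval\<close>

lemma test_functions_iff:
  fixes a b :: real
  assumes "a < b"
  shows "\<psi> \<in> test_functions {a<..<b} \<longleftrightarrow>
    smooth \<psi> \<and> (\<exists>c d. a < c \<and> c \<le> d \<and> d < b \<and> (\<forall>x. x \<notin> {c..d} \<longrightarrow> \<psi> x = 0))"
    (is "?L \<longleftrightarrow> ?R")
proof
  assume L: ?L
  let ?K = "closure {x. \<psi> x \<noteq> 0}"
  have K: "compact ?K" "?K \<subseteq> {a<..<b}" "smooth \<psi>" using L by (auto simp: test_functions_def smooth_def)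
  show ?R
  proof (cases "?K = {}")
    case True
    then have "\<psi> x = 0" for x using closure_subset[of "{x. \<psi> x \<noteq> 0}"] by auto
    then show ?thesis using K(3) assms by (auto intro!: exI[of _ "(a+b)/2"])
  next
    case False
    obtain c where c: "c \<in> ?K" "\<forall>x\<in>?K. c \<le> x" using compact_attains_inf[OF K(1) False] by blast
    obtain d where d: "d \<in> ?K" "\<forall>x\<in>?K. x \<le> d" using compact_attains_sup[OF K(1) False] by blast
    have "\<psi> x = 0" if "x \<notin> {c..d}" for x
      using closure_subset[of "{x. \<psi> x \<noteq> 0}"] c d that by auto
    moreover have "a < c" "c \<le> d" "d < b" using c d K(2) by auto
    ultimately show ?thesis using K(3) by blast
  qed
next
  assume ?R
  then obtain c d where cd: "smooth \<psi>" "a < c" "c \<le> d" "d < b" "\<And>x. x \<notin> {c..d} \<Longrightarrow> \<psi> x = 0" by blast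
  have sub0: "{x. \<psi> x \<noteq> 0} \<subseteq> {c..d}" using cd(5) by blast
  have sub: "closure {x. \<psi> x \<noteq> 0} \<subseteq> {c..d}"
    by (rule closure_minimal[OF sub0]) simp
  have "compact (closure {x. \<psi> x \<noteq> 0})"
    by (rule compact_closure[THEN iffD2], rule bounded_subset[OF bounded_closed_interval sub0])
  moreover have "closure {x. \<psi> x \<noteq> 0} \<subseteq> {a<..<b}"
    by (rule subset_trans[OF sub]) (use cd(2,4) in auto)
  ultimately show ?L using cd(1) unfolding test_functions_def smooth_def by blast
qed

text \<open>Bounded pointwise limits of test functions include the indicators of open subintervals,
  also of those that touch the ends of ]a, b[. This carries identities tested with smooth functions
  over to identities between measures.\<close>

lemma indicator_test_functions:
  fixes a b c d :: real
  assumes "a \<le> c" "c < d" "d \<le> b"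
  shows "\<exists>\<psi> :: nat \<Rightarrow> real \<Rightarrow> real. (\<forall>n. \<psi> n \<in> test_functions {a<..<b}) \<and>
    (\<forall>n x. 0 \<le> \<psi> n x \<and> \<psi> n x \<le> 1) \<and> (\<forall>x. (\<lambda>n. \<psi> n x) \<longlonglongrightarrow> indicator {c<..<d} x)"
proof -
  obtain S where S: "smooth S" "\<And>x. x \<le> 0 \<Longrightarrow> S x = 0" "\<And>x. 1 \<le> x \<Longrightarrow> S x = 1"
    "\<And>x. 0 \<le> S x" "\<And>x. S x \<le> 1"
    by (rule smooth_step_exists) blast
  obtain N :: nat where N: "4 / (d - c) < real N" using reals_Archimedean2 by blast
  define m where "m = (\<lambda>n. real (n + N))"
  have m: "m n * (d - c) > 4" "m n > 0" for n
  proof -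
    have "4 / (d - c) < m n" using N by (simp add: m_def)
    then show "m n * (d - c) > 4" using assms by (simp add: field_simps)
    have "0 < 4 / (d - c)" using assms by simp
    then show "m n > 0" using \<open>4 / (d - c) < m n\<close> by linarith
  qed
  \<comment> \<open>\<open>S (A n x)\<close> rises from 0 to 1 between c + 1/m and c + 2/m, and
    \<open>S (B n x)\<close> between d - 2/m and d - 1/m, with m = \<open>m n\<close>. The bound
    \<open>m n * (d - c) > 4\<close> gives \<open>A n x - B n x > 1\<close>, so the rise is complete
    before the fall begins.\<close>
  define A where "A = (\<lambda>n x. m n * x + (- m n * c - 1))"
  define B where "B = (\<lambda>n x. m n * x + (2 - m n * d))"
  have AB: "A n x - B n x > 1" for n x
    using m(1)[of n] by (simp add: A_def B_def algebra_simps)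
  define \<psi> where "\<psi> = (\<lambda>n x. 1 * S (A n x) + (-1) * S (B n x))"
  have left: "S (A n x) = 1 \<or> S (B n x) = 0" for n x
    using AB[of n x] S(2)[of "B n x"] S(3)[of "A n x"] by linarith
  have \<psi>0: "\<psi> n x = 0" if "A n x \<le> 0 \<or> 1 \<le> B n x" for n x
    using that AB[of n x] S(2)[of "A n x"] S(2)[of "B n x"] S(3)[of "A n x"] S(3)[of "B n x"]
    unfolding \<psi>_def by linarith
  have "\<psi> n \<in> test_functions {a<..<b}" for n
  proof -
    have "smooth (\<psi> n)" unfolding \<psi>_def A_def B_def by (intro smooth_lincomb smooth_affine S)
    moreover have "\<psi> n x = 0" if "x \<notin> {c + 1 / m n..d - 1 / m n}" for x
    proof (rule \<psi>0)
      from that have "x < c + 1 / m n \<or> x > d - 1 / m n" by (auto simp: not_le)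
      then show "A n x \<le> 0 \<or> 1 \<le> B n x"
        using m(2)[of n] unfolding A_def B_def by (auto simp: field_simps)
    qed
    moreover have "a < c + 1 / m n" "c + 1 / m n \<le> d - 1 / m n" "d - 1 / m n < b"
    proof -
      have pos: "0 < 1 / m n" using m(2)[of n] by simp
      have "d - c > 4 / m n" using m(1,2)[of n] by (simp add: field_simps)
      then have "d - c > 4 * (1 / m n)" by simp
      with pos assms show "a < c + 1 / m n" "c + 1 / m n \<le> d - 1 / m n" "d - 1 / m n < b" by linarith+
    qed
    moreover have "a < b" using assms by linarith
    ultimately show ?thesis using test_functions_iff[of a b] by blast
  qed
  moreover have "0 \<le> \<psi> n x" "\<psi> n x \<le> 1" for n x
    using left[of n x] S(4)[of "A n x"] S(4)[of "B n x"] S(5)[of "A n x"] S(5)[of "B n x"]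
    unfolding \<psi>_def by linarith+
  moreover have "(\<lambda>n. \<psi> n x) \<longlonglongrightarrow> indicator {c<..<d} x" for x
  proof -
    have inf: "filterlim (\<lambda>n. m n * t) at_top sequentially" if "t > 0" for t
    proof -
      have "filterlim (\<lambda>n. real (n + N)) at_top sequentially"
        by (rule filterlim_compose[OF filterlim_real_sequentially filterlim_add_const_nat_at_top])
      from filterlim_tendsto_pos_mult_at_top[OF tendsto_const that this]
      show ?thesis by (simp add: m_def mult.commute)
    qed
    consider "x \<le> c" | "c < x" "x < d" | "d \<le> x" by linarith
    then show ?thesis
    proof cases
      case 1
      then have "m n * x \<le> m n * c" for n using m(2)[of n] by simp
      then have "A n x \<le> 0" for n unfolding A_def by (smt (verit, best) mult_minus_left)
      then show ?thesis using 1 \<psi>0 by simp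
    next
      case 2
      have "eventually (\<lambda>n. m n * (x - c) \<ge> 2 \<and> m n * (d - x) \<ge> 2) sequentially"
        using inf[of "x - c"] inf[of "d - x"] 2 by (auto simp: filterlim_at_top eventually_conj)
      then have "eventually (\<lambda>n. \<psi> n x = 1) sequentially"
      proof eventually_elim
        case (elim n)
        then have "1 \<le> A n x" "B n x \<le> 0" by (auto simp: A_def B_def algebra_simps)
        then show ?case using S(2,3) by (simp add: \<psi>_def)
      qed
      then show ?thesis using 2 by (auto intro: tendsto_eventually)
    next
      case 3
      then have "m n * x \<ge> m n * d" for n using m(2)[of n] by simp
      then have "1 \<le> B n x" for n unfolding B_def by (smt (verit, best))
      then show ?thesis using 3 \<psi>0 by simp
    qed
  qed
  ultimately show ?thesis by blast
qed

text \<open>The primitive that vanishes to the left of the support is constant to its right, and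
  this constant is the integral of \<open>\<psi>\<close>. Mean zero is therefore what keeps the
  primitive compactly supported.\<close>

lemma test_functions_antideriv:
  fixes a b :: real
  assumes ab: "a < b" and \<psi>: "\<psi> \<in> test_functions {a<..<b}" and "(LINT x|lebesgue_on {a<..<b}. \<psi> x) = 0"
  obtains F where "F \<in> test_functions {a<..<b}" and "deriv F = \<psi>"
proof -
  obtain c d where cd: "smooth \<psi>" "a < c" "c \<le> d" "d < b" "\<And>x. x \<notin> {c..d} \<Longrightarrow> \<psi> x = 0"
    using \<psi> test_functions_iff[OF ab] by blast
  obtain G where G: "\<And>x. (G has_real_derivative \<psi> x) (at x)"
    using continuous_antideriv_exists[OF smooth_continuous_on[OF cd(1)]] by blast
  define F where "F = (\<lambda>x. G x - G c)"
  have F: "(F has_real_derivative \<psi> x) (at x)" for x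
    unfolding F_def by (auto intro!: derivative_eq_intros G)
  have "(\<psi> has_integral (F b - F a)) {a..b}"
    by (rule fundamental_theorem_of_calculus)
      (use ab F in \<open>auto simp: has_real_derivative_iff_has_vector_derivative[symmetric] intro: DERIV_subset\<close>)
  then have "integral {a<..<b} \<psi> = F b - F a"
    by (metis integral_open_interval_real integral_unique)
  moreover have "integrable (lebesgue_on {a<..<b}) \<psi>"
  proof -
    have "set_integrable lebesgue {a..b} \<psi>"
      by (rule absolutely_integrable_continuous_real[OF smooth_continuous_on[OF cd(1)]])
    then have "set_integrable lebesgue {a<..<b} \<psi>"
      by (rule set_integrable_subset) auto
    then show ?thesis by (simp add: integrable_restrict_space set_integrable_def)
  qed
  then have "integral {a<..<b} \<psi> = 0" using assms(3) lebesgue_integral_eq_integral[of "{a<..<b}" \<psi>] by simp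
  ultimately have Fab: "F b = F a" by simp
  have left: "F x = F c" if "x \<le> c" for x
    using DERIV_zero_imp_eq[OF F that] cd(5) by simp
  have right: "F x = F d" if "d \<le> x" for x
    using DERIV_zero_imp_eq[OF F that] cd(5) by simp
  have "F c = 0" by (simp add: F_def)
  then have "F x = 0" if "x \<notin> {c..d}" for x
    using left[of x] right[of x] left[of a] right[of b] Fab cd that by (cases "x \<le> c") auto
  then have "F \<in> test_functions {a<..<b}"
    using smooth_antideriv[OF F cd(1)] cd by (subst test_functions_iff[OF ab]) blast
  moreover have "deriv F = \<psi>" using F DERIV_imp_deriv by blast
  ultimately show ?thesis by (rule that)
qed

section \<open>Signed measures as distributions\<close>

lemma test_functions_smooth: "\<psi> \<in> test_functions \<Omega> \<Longrightarrow> smooth \<psi>"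
  by (auto simp: test_functions_def smooth_def)

lemma test_functions_vanish:
  assumes "\<psi> \<in> test_functions \<Omega>" "x \<notin> \<Omega>"
  shows "\<psi> x = 0"
proof (rule ccontr)
  assume "\<psi> x \<noteq> 0"
  then have "x \<in> closure {x. \<psi> x \<noteq> 0}" using closure_subset[of "{x. \<psi> x \<noteq> 0}"] by auto
  then show False using assms by (auto simp: test_functions_def)
qed

lemma test_functions_deriv:
  assumes "a < b" "\<psi> \<in> test_functions {a<..<b}"
  shows "deriv \<psi> \<in> test_functions {a<..<b}"
proof -
  obtain c d where cd: "smooth \<psi>" "a < c" "c \<le> d" "d < b" "\<And>x. x \<notin> {c..d} \<Longrightarrow> \<psi> x = 0"
    using assms(2) test_functions_iff[OF assms(1)] by blast
  have "deriv \<psi> x = 0" if "x \<notin> {c..d}" for x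
  proof -
    have "((\<lambda>x. 0) has_real_derivative 0) (at x)" by simp
    then have "(\<psi> has_real_derivative 0) (at x)"
      by (rule has_field_derivative_transform_within_open[of _ _ _ "- {c..d}"])
        (use that cd(5) in auto)
    then show ?thesis by (rule DERIV_imp_deriv)
  qed
  then show ?thesis using smooth_deriv[OF cd(1)] cd test_functions_iff[OF assms(1)] by blast
qed

lemma test_functions_bounded:
  assumes "a < b" "\<psi> \<in> test_functions {a<..<b}"
  shows "\<exists>B. \<forall>x. \<bar>\<psi> x\<bar> \<le> B"
proof -
  have "compact (\<psi> ` {a..b})"
    by (intro compact_continuous_image smooth_continuous_on test_functions_smooth[OF assms(2)]) auto
  then have "bounded (\<psi> ` {a..b})" by (rule compact_imp_bounded)
  then have "\<exists>B. \<forall>x\<in>{a..b}. \<bar>\<psi> x\<bar> \<le> B" unfolding bounded_iff by simp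
  then obtain B where B: "\<And>x. x \<in> {a..b} \<Longrightarrow> \<bar>\<psi> x\<bar> \<le> B" by blast
  have "\<bar>\<psi> x\<bar> \<le> \<bar>B\<bar>" for x
    using B[of x] test_functions_vanish[OF assms(2), of x] by (cases "x \<in> {a<..<b}") auto
  then show ?thesis by blast
qed

lemma smooth_borel: "smooth \<psi> \<Longrightarrow> \<psi> \<in> borel_measurable borel"
  by (intro borel_measurable_continuous_onI smooth_continuous_on)

lemma integrable_mult_bounded:
  fixes h \<psi> :: "'a \<Rightarrow> real"
  assumes "integrable M h" "\<psi> \<in> borel_measurable M" "\<And>x. \<bar>\<psi> x\<bar> \<le> B"
  shows "integrable M (\<lambda>x. h x * \<psi> x)"
proof (rule Bochner_Integration.integrable_bound)
  show "integrable M (\<lambda>x. B * h x)" using assms(1) by simp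
  show "(\<lambda>x. h x * \<psi> x) \<in> borel_measurable M" using assms by measurable
  have "\<bar>h x\<bar> * \<bar>\<psi> x\<bar> \<le> \<bar>B\<bar> * \<bar>h x\<bar>" for x
    using assms(3)[of x] mult_left_mono[of "\<bar>\<psi> x\<bar>" "\<bar>B\<bar>" "\<bar>h x\<bar>"] by (simp add: mult.commute)
  then show "AE x in M. norm (h x * \<psi> x) \<le> norm (B * h x)" by (auto simp: abs_mult)
qed

lemma borel_measurable_lebesgue_on_borel:
  "f \<in> borel_measurable borel \<Longrightarrow> f \<in> borel_measurable (lebesgue_on S)"
  by (rule measurable_restrict_space1, rule measurable_completion) simp

lemma integrable_mult_test:
  assumes "a < b" "\<psi> \<in> test_functions {a<..<b}" "integrable M h"
    "\<And>f::real\<Rightarrow>real. f \<in> borel_measurable borel \<Longrightarrow> f \<in> borel_measurable M"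
  shows "integrable M (\<lambda>x. h x * \<psi> x)"
proof -
  obtain B where B: "\<And>x. \<bar>\<psi> x\<bar> \<le> B" using test_functions_bounded[OF assms(1,2)] by blast
  show ?thesis
    by (rule integrable_mult_bounded[OF assms(3) assms(4)[OF smooth_borel[OF test_functions_smooth[OF assms(2)]]] B])
qed

text \<open>Countable additivity of the signed set function with density \<open>h\<close>:
  disjointness turns partial sums into integrals over finite unions, and |h| dominates the
  integrands.\<close>

lemma integral_indicator_sums:
  fixes h :: "'a \<Rightarrow> real"
  assumes h: "integrable M h" and A: "\<And>i::nat. A i \<inter> space M \<in> sets M" and dis: "disjoint_family A"
  shows "(\<lambda>i. LINT x|M. indicator (A i) x * h x) sums (LINT x|M. indicator (\<Union>i. A i) x * h x)"
proof -
  have meas: "(\<lambda>x. indicator (\<Union>i\<in>I. A i) x :: real) \<in> borel_measurable M" for I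
  proof -
    have "(\<Union>i\<in>I. A i) \<inter> space M = (\<Union>i\<in>I. A i \<inter> space M)" by auto
    also have "\<dots> \<in> sets M" using A by (intro sets.countable_UN') auto
    finally show ?thesis by (simp add: borel_measurable_indicator_iff)
  qed
  have [measurable]: "h \<in> borel_measurable M" using h by simp
  have int: "integrable M (\<lambda>x. indicator (A i) x * h x)" for i
  proof -
    have "integrable M (\<lambda>x. h x * indicator (A i) x)"
      by (rule integrable_mult_bounded[OF h, where B = 1]) (use meas[of "{i}"] in \<open>auto simp: indicator_def\<close>)
    then show ?thesis by (simp add: mult.commute)
  qed
  have sum: "(\<Sum>i<n. LINT x|M. indicator (A i) x * h x) = (LINT x|M. indicator (\<Union>i<n. A i) x * h x)" for n
  proof -
    have "indicator (\<Union>i<n. A i) x = (\<Sum>i<n. indicator (A i) x :: real)" for x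
      by (rule indicator_UN_disjoint) (use dis in \<open>auto intro: disjoint_family_on_mono\<close>)
    then have "(LINT x|M. indicator (\<Union>i<n. A i) x * h x) = (LINT x|M. (\<Sum>i<n. indicator (A i) x * h x))"
      by (simp only: sum_distrib_right)
    also have "\<dots> = (\<Sum>i<n. LINT x|M. indicator (A i) x * h x)"
      by (rule Bochner_Integration.integral_sum) (rule int)
    finally show ?thesis ..
  qed
  have "(\<lambda>n. LINT x|M. indicator (\<Union>i<n. A i) x * h x) \<longlonglongrightarrow> (LINT x|M. indicator (\<Union>i. A i) x * h x)"
  proof (rule integral_dominated_convergence[where w = "\<lambda>x. \<bar>h x\<bar>"])
    show "(\<lambda>x. indicator (\<Union>i. A i) x * h x) \<in> borel_measurable M" using meas[of UNIV] by measurable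
    show "(\<lambda>x. indicator (\<Union>i<n. A i) x * h x) \<in> borel_measurable M" for n using meas[of "{..<n}"] by measurable
    show "integrable M (\<lambda>x. \<bar>h x\<bar>)" using h by simp
    show "AE x in M. (\<lambda>n. indicator (\<Union>i<n. A i) x * h x) \<longlonglongrightarrow> indicator (\<Union>i. A i) x * h x"
      by (intro AE_I2 tendsto_mult tendsto_const LIMSEQ_indicator_UN)
    show "AE x in M. norm (indicator (\<Union>i<n. A i) x * h x) \<le> \<bar>h x\<bar>" for n
      by (auto simp: indicator_def)
  qed
  then show ?thesis unfolding sums_def sum .
qed

text \<open>A Dynkin class argument for a signed set function: the Borel sets with \<nu> = 0 are
  closed under complements, thanks to \<open>top\<close>, and under countable disjoint unions, and
  the open intervals form an intersection-stable generator.\<close>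

lemma signed_measure_zero:
  fixes \<nu> :: "real set \<Rightarrow> real"
  assumes add: "\<And>A :: nat \<Rightarrow> real set. range A \<subseteq> sets borel \<Longrightarrow> disjoint_family A \<Longrightarrow> (\<lambda>i. \<nu> (A i)) sums \<nu> (\<Union>i. A i)"
    and int: "\<And>c d. \<nu> {c<..<d} = 0" and top: "\<nu> UNIV = 0"
    and A: "A \<in> sets borel"
  shows "\<nu> A = 0"
proof -
  let ?G = "range (\<lambda>(c, d). {c<..<d::real})"
  have e: "\<nu> {} = 0" using int[of 0 0] by simp
  have un: "\<nu> (A \<union> B) = \<nu> A + \<nu> B" if "A \<in> sets borel" "B \<in> sets borel" "A \<inter> B = {}" for A B
  proof -
    let ?A = "binaryset A B"
    have "(\<lambda>i. \<nu> (?A i)) sums \<nu> (\<Union>i. ?A i)"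
      using that by (intro add) (auto simp: binaryset_def disjoint_family_on_def)
    moreover have "(\<lambda>i. \<nu> (?A i)) sums (\<nu> A + \<nu> B)" by (rule binaryset_sums[of \<nu>, OF e])
    ultimately show ?thesis using sums_unique2 by (simp add: UN_binaryset_eq)
  qed
  have isG: "Int_stable ?G"
  proof (rule Int_stableI)
    fix A B assume "A \<in> ?G" "B \<in> ?G"
    then obtain c d c' d' where "A = {c<..<d}" "B = {c'<..<d'}" by auto
    then have "A \<inter> B = {max c c'<..<min d d'}" by auto
    then show "A \<inter> B \<in> ?G" by auto
  qed
  have B: "sets borel = sigma_sets UNIV ?G"
    by (subst borel_eq_box) (simp add: box_real case_prod_unfold)
  have sub: "?G \<subseteq> Pow UNIV" by simp
  from A have sA: "A \<in> sigma_sets UNIV ?G" by (simp add: B)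
  from isG sub sA have "A \<in> sets borel \<and> \<nu> A = 0"
  proof (induction rule: sigma_sets_induct_disjoint)
    case (compl A)
    then have "\<nu> (A \<union> (UNIV - A)) = \<nu> A + \<nu> (UNIV - A)"
      by (intro un) auto
    moreover have "A \<union> (UNIV - A) = UNIV" by auto
    ultimately show ?case using compl top by auto
  next
    case (union A)
    then have "(\<lambda>i. \<nu> (A i)) sums \<nu> (\<Union>i. A i)" by (intro add) auto
    moreover have "(\<lambda>i. \<nu> (A i)) sums 0" using union by simp
    ultimately show ?case using sums_unique2 union(3) by auto
  qed (use e int in auto)
  then show ?thesis by simp
qed

lemma finite_borel_measure_Int:
  assumes "finite_borel_measure_on \<Omega> \<mu>" "\<Omega> \<in> sets borel" "A \<in> sets borel"
  shows "measure \<mu> A = measure \<mu> (A \<inter> \<Omega>)"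
proof -
  have s: "sets \<mu> = sets borel" and e: "emeasure \<mu> (- \<Omega>) = 0"
    using assms(1) by (auto simp: finite_borel_measure_on_def)
  have "- \<Omega> \<in> null_sets \<mu>" using assms(2) s e by (auto simp: null_sets_def)
  then have "AE x in \<mu>. x \<notin> - \<Omega>" by (rule AE_not_in)
  then show ?thesis
    by (intro measure_eq_AE) (use assms s in auto)
qed

lemma finite_borel_measure_borel:
  fixes f :: "real \<Rightarrow> real"
  assumes "finite_borel_measure_on \<Omega> \<mu>" "f \<in> borel_measurable borel"
  shows "f \<in> borel_measurable \<mu>"
proof -
  have "sets \<mu> = sets borel" using assms(1) by (auto simp: finite_borel_measure_on_def)
  from measurable_cong_sets[OF this refl] assms(2) show ?thesis by blast
qed

lemma finite_borel_measure_test_limit: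
  assumes \<mu>: "finite_borel_measure_on \<Omega> \<mu>"
    and \<psi>: "\<And>n. smooth (\<psi> n)" "\<And>n x. 0 \<le> \<psi> n x" "\<And>n x. \<psi> n x \<le> 1"
     "\<And>x. (\<lambda>n. \<psi> n x) \<longlonglongrightarrow> indicator B x" and B: "B \<in> sets borel"
  shows "(\<lambda>n. LINT x|\<mu>. \<psi> n x) \<longlonglongrightarrow> measure \<mu> B"
proof -
  have s: "sets \<mu> = sets borel" and "finite_measure \<mu>"
    using \<mu> by (auto simp: finite_borel_measure_on_def)
  interpret finite_measure \<mu> by fact
  have sp: "space \<mu> = UNIV" using sets_eq_imp_space_eq[OF s] by simp
  have "(\<lambda>n. LINT x|\<mu>. \<psi> n x) \<longlonglongrightarrow> (LINT x|\<mu>. indicator B x)"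
    by (rule integral_dominated_convergence[where w = "\<lambda>_. 1"])
      (use \<psi> B s in \<open>auto intro!: finite_borel_measure_borel[OF \<mu>] smooth_borel\<close>)
  then show ?thesis by (simp add: sp)
qed

text \<open>Two decompositions of one derivative are compared by subtraction, hence one density and
  four measures. Testing with functions that tend to indicators gives zero on open intervals, and
  additivity extends this to Borel sets.\<close>

lemma weak_measure_zero:
  fixes a b :: real
  assumes ab: "a < b" and h: "integrable (lebesgue_on {a<..<b}) h"
    and m: "finite_borel_measure_on {a<..<b} \<sigma>" "finite_borel_measure_on {a<..<b} \<tau>"
      "finite_borel_measure_on {a<..<b} \<sigma>'" "finite_borel_measure_on {a<..<b} \<tau>'"
    and z: "\<And>\<psi>. \<psi> \<in> test_functions {a<..<b} \<Longrightarrow>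
      (LINT x|lebesgue_on {a<..<b}. h x * \<psi> x) + ((LINT x|\<sigma>. \<psi> x) - (LINT x|\<tau>. \<psi> x))
        - ((LINT x|\<sigma>'. \<psi> x) - (LINT x|\<tau>'. \<psi> x)) = 0"
    and A: "A \<in> sets borel"
  shows "(LINT x|lebesgue_on {a<..<b}. indicator A x * h x) + (measure \<sigma> A - measure \<tau> A)
    - (measure \<sigma>' A - measure \<tau>' A) = 0" (is "?\<nu> A = 0")
proof -
  have fm: "finite_measure \<sigma>" "finite_measure \<tau>" "finite_measure \<sigma>'" "finite_measure \<tau>'"
    and s: "sets \<sigma> = sets borel" "sets \<tau> = sets borel" "sets \<sigma>' = sets borel" "sets \<tau>' = sets borel"
    using m by (auto simp: finite_borel_measure_on_def)
  \<comment> \<open>Stated for every Borel set \<open>B\<close> whose trace on ]a, b[ is an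
    interval, so that it covers both \<open>{c<..<d}\<close> and \<open>UNIV\<close>, the two cases
    that \<open>signed_measure_zero\<close> asks for.\<close>
  have ev: "?\<nu> B = 0" if B: "B \<in> sets borel" "B \<inter> {a<..<b} = {c<..<d}" "a \<le> c" "c < d" "d \<le> b" for B c d
  proof -
    obtain \<psi> :: "nat \<Rightarrow> real \<Rightarrow> real" where \<psi>: "\<And>n. \<psi> n \<in> test_functions {a<..<b}"
      "\<And>n x. 0 \<le> \<psi> n x" "\<And>n x. \<psi> n x \<le> 1" "\<And>x. (\<lambda>n. \<psi> n x) \<longlonglongrightarrow> indicator {c<..<d} x"
      using indicator_test_functions[OF B(3-5)] by auto
    have sm: "smooth (\<psi> n)" for n using \<psi>(1) test_functions_smooth by blast
    have eq: "measure \<mu> B = measure \<mu> {c<..<d}" if "finite_borel_measure_on {a<..<b} \<mu>" for \<mu>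
      using finite_borel_measure_Int[OF that borel_open[OF open_greaterThanLessThan] B(1)] unfolding B(2) .
    have eqh: "(LINT x|lebesgue_on {a<..<b}. indicator B x * h x) = (LINT x|lebesgue_on {a<..<b}. h x * indicator {c<..<d} x)"
    proof (rule Bochner_Integration.integral_cong[OF refl])
      fix x assume "x \<in> space (lebesgue_on {a<..<b})"
      then have "x \<in> {a<..<b}" by simp
      then have "x \<in> B \<longleftrightarrow> x \<in> {c<..<d}" unfolding B(2)[symmetric] by blast
      then show "indicator B x * h x = h x * indicator {c<..<d} x" by (simp add: indicator_def)
    qed
    have lim: "(\<lambda>n. LINT x|\<mu>. \<psi> n x) \<longlonglongrightarrow> measure \<mu> {c<..<d}"
      if "finite_borel_measure_on {a<..<b} \<mu>" for \<mu>
      by (rule finite_borel_measure_test_limit[where \<psi> = \<psi> and B = "{c<..<d}", OF that]) (use sm \<psi> in auto)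
    have "(\<lambda>n. LINT x|lebesgue_on {a<..<b}. h x * \<psi> n x) \<longlonglongrightarrow> (LINT x|lebesgue_on {a<..<b}. h x * indicator {c<..<d} x)"
    proof (rule integral_dominated_convergence[where w = "\<lambda>x. \<bar>h x\<bar>"])
      show "(\<lambda>x. h x * \<psi> n x) \<in> borel_measurable (lebesgue_on {a<..<b})" for n
        by (rule borel_measurable_times[OF borel_measurable_integrable[OF h]
              borel_measurable_lebesgue_on_borel[OF smooth_borel[OF sm]]])
      show "(\<lambda>x. h x * indicator {c<..<d} x) \<in> borel_measurable (lebesgue_on {a<..<b})"
        by (rule borel_measurable_times[OF borel_measurable_integrable[OF h]
              borel_measurable_lebesgue_on_borel]) auto
      show "integrable (lebesgue_on {a<..<b}) (\<lambda>x. \<bar>h x\<bar>)" using h by simp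
      show "AE x in lebesgue_on {a<..<b}. (\<lambda>n. h x * \<psi> n x) \<longlonglongrightarrow> h x * indicator {c<..<d} x"
        by (intro AE_I2 tendsto_mult tendsto_const \<psi>)
      show "AE x in lebesgue_on {a<..<b}. norm (h x * \<psi> n x) \<le> \<bar>h x\<bar>" for n
        using \<psi>(2,3) by (auto simp: abs_mult mult_left_le)
    qed
    then have "(\<lambda>n. (LINT x|lebesgue_on {a<..<b}. h x * \<psi> n x) + ((LINT x|\<sigma>. \<psi> n x) - (LINT x|\<tau>. \<psi> n x))
        - ((LINT x|\<sigma>'. \<psi> n x) - (LINT x|\<tau>'. \<psi> n x))) \<longlonglongrightarrow> 
        (LINT x|lebesgue_on {a<..<b}. h x * indicator {c<..<d} x) + (measure \<sigma> {c<..<d} - measure \<tau> {c<..<d})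
        - (measure \<sigma>' {c<..<d} - measure \<tau>' {c<..<d})"
      by (intro tendsto_intros lim[OF m(1)] lim[OF m(2)] lim[OF m(3)] lim[OF m(4)]) auto
    then have "(\<lambda>n. 0) \<longlonglongrightarrow> 
        (LINT x|lebesgue_on {a<..<b}. h x * indicator {c<..<d} x) + (measure \<sigma> {c<..<d} - measure \<tau> {c<..<d})
        - (measure \<sigma>' {c<..<d} - measure \<tau>' {c<..<d})"
      by (simp only: z[OF \<psi>(1)])
    from LIMSEQ_unique[OF this tendsto_const] show ?thesis
      by (simp add: eq m eqh)
  qed
  show ?thesis
  proof (rule signed_measure_zero[of ?\<nu>, OF _ _ _ A])
    show "(\<lambda>i. ?\<nu> (A i)) sums ?\<nu> (\<Union>i. A i)" if "range A \<subseteq> sets borel" "disjoint_family A" for A :: "nat \<Rightarrow> real set"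
    proof (intro sums_add sums_diff)
      show "(\<lambda>i. LINT x|lebesgue_on {a<..<b}. indicator (A i) x * h x) sums
        (LINT x|lebesgue_on {a<..<b}. indicator (\<Union>i. A i) x * h x)"
      proof (rule integral_indicator_sums[OF h _ that(2)])
        show "A i \<inter> space (lebesgue_on {a<..<b}) \<in> sets (lebesgue_on {a<..<b})" for i
          using that(1) by (auto simp: sets_restrict_space intro!: image_eqI[of _ _ "A i"])
      qed
    next
      have U: "(\<lambda>i. measure \<mu> (A i)) sums measure \<mu> (\<Union>i. A i)"
        if "finite_measure \<mu>" "sets \<mu> = sets borel" for \<mu>
        using finite_measure.finite_measure_UNION[OF that(1) _ \<open>disjoint_family A\<close>]
          \<open>range A \<subseteq> sets borel\<close> that(2) by simp
      show "(\<lambda>i. measure \<sigma> (A i)) sums measure \<sigma> (\<Union>i. A i)" by (rule U[OF fm(1) s(1)])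
      show "(\<lambda>i. measure \<tau> (A i)) sums measure \<tau> (\<Union>i. A i)" by (rule U[OF fm(2) s(2)])
      show "(\<lambda>i. measure \<sigma>' (A i)) sums measure \<sigma>' (\<Union>i. A i)" by (rule U[OF fm(3) s(3)])
      show "(\<lambda>i. measure \<tau>' (A i)) sums measure \<tau>' (\<Union>i. A i)" by (rule U[OF fm(4) s(4)])
    qed
    show "?\<nu> {c<..<d} = 0" for c d
    proof (cases "max a c < min b d")
      case True
      show ?thesis by (rule ev[of _ "max a c" "min b d"]) (use True in auto)
    next
      case False
      then have e: "{c<..<d} \<inter> {a<..<b} = {}" by auto
      have "measure \<mu> {c<..<d} = 0" if "finite_borel_measure_on {a<..<b} \<mu>" for \<mu>
        using finite_borel_measure_Int[OF that, of "{c<..<d}"] e by simp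
      moreover have "(LINT x|lebesgue_on {a<..<b}. indicator {c<..<d} x * h x) = 0"
      proof (rule integral_eq_zero_AE, rule AE_I2)
        fix x assume "x \<in> space (lebesgue_on {a<..<b})"
        with e have "x \<notin> {c<..<d}" by auto
        then show "indicator {c<..<d} x * h x = 0" by simp
      qed
      ultimately show ?thesis using m by simp
    qed
    show "?\<nu> UNIV = 0" by (rule ev[of _ a b]) (use ab in auto)
  qed
qed

text \<open>The integrals are taken over Borel sets, whereas \<open>h\<close> is Lebesgue
  measurable. A Borel function \<open>k\<close> equal to \<open>h\<close> almost everywhere on
  \<open>S\<close> supplies Borel sets on which the sign is constant, and there a vanishing integral
  forces a vanishing function.\<close>

lemma AE_zero_if_borel_integrals_zero:
  fixes h :: "real \<Rightarrow> real"
  assumes S: "S \<in> sets lebesgue" and h: "integrable (lebesgue_on S) h"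
    and z: "\<And>A. A \<in> sets borel \<Longrightarrow> (LINT x|lebesgue_on S. indicator A x * h x) = 0"
  shows "AE x in lebesgue_on S. h x = 0"
proof -
  have hm: "(\<lambda>x. indicator S x * h x) \<in> borel_measurable lebesgue"
    using h S borel_measurable_integrable[of lebesgue "\<lambda>x. indicator S x *\<^sub>R h x"]
    by (auto simp: integrable_restrict_space)
  obtain k where k: "k \<in> borel_measurable lborel" "AE x in lborel. indicator S x * h x = k x"
    using completion_ex_borel_measurable_real[OF hm] by blast
  have "AE x in lebesgue. indicator S x * h x = k x" using AE_completion[OF k(2)] .
  then have hk: "AE x in lebesgue_on S. h x = k x"
    using S by (auto simp: AE_restrict_space_iff elim!: eventually_mono)
  have half: "AE x in lebesgue_on S. s * k x \<le> 0" if s: "s = 1 \<or> s = -1" for s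
  proof -
    define A where "A = {x. s * k x > 0}"
    have A: "A \<in> sets borel"
      using k(1) unfolding A_def by measurable
    have Am: "(indicator A :: real \<Rightarrow> real) \<in> borel_measurable (lebesgue_on S)"
      using A by (intro borel_measurable_lebesgue_on_borel) auto
    have "integrable (lebesgue_on S) (\<lambda>x. h x * indicator A x)"
      by (rule integrable_mult_bounded[OF h Am, of 1]) (auto simp: indicator_def)
    then have int: "integrable (lebesgue_on S) (\<lambda>x. indicator A x * h x)" by (simp add: mult.commute)
    have "(LINT x|lebesgue_on S. s * (indicator A x * h x)) = 0" using z[OF A] by simp
    moreover have "AE x in lebesgue_on S. 0 \<le> s * (indicator A x * h x)"
      using hk by eventually_elim (auto simp: A_def indicator_def)
    ultimately have "AE x in lebesgue_on S. s * (indicator A x * h x) = 0"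
      using int by (subst (asm) integral_nonneg_eq_0_iff_AE) auto
    then show ?thesis using hk by eventually_elim (auto simp: A_def indicator_def split: if_splits)
  qed
  from half[OF disjI1[OF refl]] half[OF disjI2[OF refl]] hk show ?thesis
    by eventually_elim auto
qed

section \<open>Functions of bounded variation on an interval\<close>

text \<open>The derivative of the Heaviside function with jump at \<open>y\<close> is the Dirac mass
  at \<open>y\<close>. The cut \<open>c = max a y\<close> also covers \<open>y\<close> to the left
  of \<open>a\<close>, where both sides are 0.\<close>

lemma integral_deriv_test_tail:
  assumes ab: "a < b" and \<psi>: "\<psi> \<in> test_functions {a<..<b}"
  shows "(LINT x|lborel. (if y < x then 1 else 0) * deriv \<psi> x) = - \<psi> y"
proof -
  have sm: "smooth \<psi>" using test_functions_smooth[OF \<psi>] .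
  have van: "deriv \<psi> x = 0" if "x \<notin> {a<..<b}" for x
    using test_functions_vanish[OF test_functions_deriv[OF ab \<psi>] that] .
  show ?thesis
  proof (cases "b \<le> y")
    case True
    then have "(\<lambda>x. (if y < x then 1 else 0) * deriv \<psi> x) = (\<lambda>x. 0)" using van by auto
    moreover have "\<psi> y = 0" using test_functions_vanish[OF \<psi>] True by auto
    ultimately show ?thesis by simp
  next
    case False
    define c where "c = max a y"
    have c: "c \<le> b" using False ab by (simp add: c_def)
    have "AE x in lborel. x \<noteq> c" by (rule AE_lborel_singleton)
    then have "AE x in lborel. (if y < x then 1 else 0) * deriv \<psi> x = deriv \<psi> x * indicator {c..b} x"
    proof eventually_elim
      case (elim x)
      then show ?case using van[of x] by (cases "x \<in> {a<..<b}") (auto simp: c_def indicator_def max_def)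
    qed
    then have "(LINT x|lborel. (if y < x then 1 else 0) * deriv \<psi> x) = (LINT x|lborel. deriv \<psi> x * indicator {c..b} x)"
    proof (intro integral_cong_AE)
      have [measurable]: "deriv \<psi> \<in> borel_measurable borel" using sm smooth_borel smooth_deriv by blast
      show "(\<lambda>x. (if y < x then 1 else 0) * deriv \<psi> x) \<in> borel_measurable lborel" by measurable
      show "(\<lambda>x. deriv \<psi> x * indicator {c..b} x) \<in> borel_measurable lborel" by measurable
    qed
    also have "\<dots> = \<psi> b - \<psi> c"
      by (rule integral_FTC_Icc_real[OF c]) (use smooth_DERIV[OF sm] smooth_DERIV[OF smooth_deriv[OF sm]] in \<open>auto intro: DERIV_isCont\<close>)
    also have "\<dots> = - \<psi> y"
      using test_functions_vanish[OF \<psi>, of b] test_functions_vanish[OF \<psi>, of a] test_functions_vanish[OF \<psi>, of y]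
      by (auto simp: c_def max_def)
    finally show ?thesis .
  qed
qed

text \<open>By Fubini the primitive of the measure h M is a superposition of Heaviside functions,
  which reduces the claim to a single jump. General \<open>M\<close> and \<open>h\<close> serve the
  absolutely continuous part, with h = g, as well as the singular measures, with h = 1.\<close>

lemma primitive_test:
  fixes M :: "real measure" and h :: "real \<Rightarrow> real"
  assumes ab: "a < b" and \<psi>: "\<psi> \<in> test_functions {a<..<b}" and "sigma_finite_measure M"
    and idM[measurable]: "(\<lambda>y. y) \<in> borel_measurable M" and h: "integrable M h"
  shows "(LINT x|lebesgue_on {a<..<b}. (LINT y|M. h y * (if y < x then 1 else 0)) * deriv \<psi> x)
    = - (LINT y|M. h y * \<psi> y)"
proof -
  interpret M: sigma_finite_measure M by fact
  interpret pair_sigma_finite lborel M by standard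
  have sm: "smooth \<psi>" using test_functions_smooth[OF \<psi>] .
  have [measurable]: "\<psi> \<in> borel_measurable borel" "deriv \<psi> \<in> borel_measurable borel"
    using sm smooth_borel smooth_deriv by blast+
  have hm[measurable]: "h \<in> borel_measurable M" using h by simp
  have van: "deriv \<psi> x = 0" if "x \<notin> {a<..<b}" for x
    using test_functions_vanish[OF test_functions_deriv[OF ab \<psi>] that] .
  have "integrable lborel (\<lambda>x. indicator {a..b} x *\<^sub>R deriv \<psi> x)"
    by (rule borel_integrable_compact) (auto intro: smooth_continuous_on smooth_deriv sm)
  moreover have "(\<lambda>x. indicator {a..b} x *\<^sub>R deriv \<psi> x) = deriv \<psi>"
  proof (rule ext)
    show "indicator {a..b} x *\<^sub>R deriv \<psi> x = deriv \<psi> x" for x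
      using van[of x] by (cases "x \<in> {a<..<b}") (auto simp: indicator_def)
  qed
  ultimately have dint: "integrable lborel (deriv \<psi>)" by simp
  let ?f = "\<lambda>x y. h y * (if y < x then 1 else 0) * deriv \<psi> x"
  have meas: "case_prod ?f \<in> borel_measurable (lborel \<Otimes>\<^sub>M M)" by measurable
  have int1: "integrable M (\<lambda>y. h y * (if y < x then 1 else 0))" for x
    by (rule integrable_mult_bounded[OF h, where B = 1]) auto
  have int: "integrable (lborel \<Otimes>\<^sub>M M) (case_prod ?f)"
  proof (rule Fubini_integrable[OF meas])
    show "AE x in lborel. integrable M (\<lambda>y. case_prod ?f (x, y))" using int1 by simp
    show "integrable lborel (\<lambda>x. LINT y|M. norm (case_prod ?f (x, y)))"
    proof (rule Bochner_Integration.integrable_bound)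
      show "integrable lborel (\<lambda>x. (LINT y|M. \<bar>h y\<bar>) * \<bar>deriv \<psi> x\<bar>)" using dint by simp
      show "(\<lambda>x. LINT y|M. norm (case_prod ?f (x, y))) \<in> borel_measurable lborel" by measurable
      have "(LINT y|M. norm (case_prod ?f (x, y))) \<le> (LINT y|M. \<bar>h y\<bar>) * \<bar>deriv \<psi> x\<bar>" for x
      proof -
        have "(LINT y|M. norm (case_prod ?f (x, y))) \<le> (LINT y|M. \<bar>h y\<bar> * \<bar>deriv \<psi> x\<bar>)"
        proof (rule integral_mono)
          have "integrable M (\<lambda>y. h y * (if y < x then 1 else 0) * deriv \<psi> x)"
            using int1[of x] by (rule integrable_mult_left)
          then show "integrable M (\<lambda>y. norm (case_prod ?f (x, y)))" by (simp only: prod.case integrable_norm)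
          show "integrable M (\<lambda>y. \<bar>h y\<bar> * \<bar>deriv \<psi> x\<bar>)" using h by simp
        qed (auto simp: abs_mult mult_right_mono)
        then show ?thesis by simp
      qed
      then show "AE x in lborel. norm (LINT y|M. norm (case_prod ?f (x, y))) \<le> norm ((LINT y|M. \<bar>h y\<bar>) * \<bar>deriv \<psi> x\<bar>)"
        by (auto simp: abs_mult)
    qed
  qed
  let ?W = "\<lambda>x. LINT y|M. h y * (if y < x then 1 else 0)"
  have Wm: "?W \<in> borel_measurable borel"
  proof -
    have "(\<lambda>(x, y). h y * (if y < x then 1 else 0)) \<in> borel_measurable (lborel \<Otimes>\<^sub>M M)" by measurable
    from M.borel_measurable_lebesgue_integral[OF this] show ?thesis by simp
  qed
  have "(LINT x|lebesgue_on {a<..<b}. ?W x * deriv \<psi> x) = (LINT x|lebesgue. indicator {a<..<b} x *\<^sub>R (?W x * deriv \<psi> x))"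
    by (rule integral_restrict_space) auto
  also have "\<dots> = (LINT x|lebesgue. ?W x * deriv \<psi> x)"
    by (rule Bochner_Integration.integral_cong) (use van in \<open>auto simp: indicator_def\<close>)
  also have "\<dots> = (LINT x|lborel. ?W x * deriv \<psi> x)"
  proof (rule integral_completion)
    show "(\<lambda>x. ?W x * deriv \<psi> x) \<in> borel_measurable lborel"
      using borel_measurable_times[OF Wm \<open>deriv \<psi> \<in> borel_measurable borel\<close>] by (simp only: measurable_lborel2)
  qed
  also have "\<dots> = (LINT x|lborel. LINT y|M. ?f x y)"
    by (simp only: integral_mult_left_zero)
  also have "\<dots> = (LINT y|M. LINT x|lborel. ?f x y)" by (rule Fubini_integral[OF int, symmetric])
  also have "\<dots> = (LINT y|M. h y * (LINT x|lborel. (if y < x then 1 else 0) * deriv \<psi> x))"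
    by (simp only: mult.assoc integral_mult_right_zero)
  also have "\<dots> = (LINT y|M. - (h y * \<psi> y))"
    by (simp only: integral_deriv_test_tail[OF ab \<psi>] mult_minus_right)
  also have "\<dots> = - (LINT y|M. h y * \<psi> y)"
    by (rule integral_minus)
  finally show ?thesis .
qed

text \<open>The left-continuous primitive of the measure \<open>g \<L>\<^sup>1 + \<sigma> - \<tau>\<close> on \<open>]a, b[\<close>.\<close>

definition BV_primitive :: "real \<Rightarrow> (real \<Rightarrow> real) \<Rightarrow> real measure \<Rightarrow> real measure \<Rightarrow> real \<Rightarrow> real" where
  "BV_primitive a g \<sigma> \<tau> x = integral {a..x} g + (measure \<sigma> {..<x} - measure \<tau> {..<x})"

lemma integral_lebesgue_on_Ioo:
  fixes g :: "real \<Rightarrow> real"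
  assumes "integrable (lebesgue_on {a<..<b}) g" "a \<le> x" "x \<le> b"
  shows "(LINT y|lebesgue_on {a<..<b}. g y * (if y < x then 1 else 0)) = integral {a..x} g"
    and "g absolutely_integrable_on {a..x}"
proof -
  have g: "set_integrable lebesgue {a<..<b} g"
    using assms(1) by (simp add: integrable_restrict_space set_integrable_def)
  then have gx: "set_integrable lebesgue {a<..<x} g"
    by (rule set_integrable_subset) (use assms in auto)
  then have gx': "integrable (lebesgue_on {a<..<x}) g" 
    by (simp add: integrable_restrict_space set_integrable_def)
  have "(LINT y|lebesgue_on {a<..<b}. g y * (if y < x then 1 else 0)) =
      (LINT y|lebesgue. indicator {a<..<b} y *\<^sub>R (g y * (if y < x then 1 else 0)))"
    by (rule integral_restrict_space) auto
  also have "\<dots> = (LINT y|lebesgue. indicator {a<..<x} y *\<^sub>R g y)"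
    by (rule Bochner_Integration.integral_cong) (use assms in \<open>auto simp: indicator_def\<close>)
  also have "\<dots> = (LINT y|lebesgue_on {a<..<x}. g y)"
    by (rule integral_restrict_space[symmetric]) auto
  also have "\<dots> = integral {a<..<x} g"
    by (rule lebesgue_integral_eq_integral[OF gx']) auto
  also have "\<dots> = integral {a..x} g" by (metis integral_open_interval_real)
  finally show "(LINT y|lebesgue_on {a<..<b}. g y * (if y < x then 1 else 0)) = integral {a..x} g" .
  show "g absolutely_integrable_on {a..x}"
  proof (rule absolutely_integrable_spike_set[OF gx])
    show "negligible {y \<in> {a<..<x} - {a..x}. g y \<noteq> 0}" by (rule negligible_subset[of "{}"]) auto
    show "negligible {y \<in> {a..x} - {a<..<x}. g y \<noteq> 0}" by (rule negligible_subset[of "{a, x}"]) auto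
  qed
qed

lemma finite_borel_measure_id:
  "finite_borel_measure_on \<Omega> \<mu> \<Longrightarrow> (\<lambda>y. y) \<in> borel_measurable \<mu>"
  by (rule finite_borel_measure_borel) auto

lemma finite_borel_measure_sigma_finite:
  "finite_borel_measure_on \<Omega> \<mu> \<Longrightarrow> sigma_finite_measure \<mu>"
  unfolding finite_borel_measure_on_def by (blast dest: finite_measure.axioms(1))

lemma integral_lessThan_measure:
  assumes "finite_borel_measure_on \<Omega> \<mu>"
  shows "(LINT y|\<mu>. 1 * (if y < x then 1 else 0)) = measure \<mu> {..<x::real}"
proof -
  have s: "sets \<mu> = sets borel" using assms by (auto simp: finite_borel_measure_on_def)
  have sp: "space \<mu> = UNIV" using sets_eq_imp_space_eq[OF s] by simp
  have "(\<lambda>y. 1 * (if y < x then 1 else 0)) = (indicator {..<x} :: real \<Rightarrow> real)" by (auto simp: indicator_def)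
  then show ?thesis by (simp add: sp)
qed

lemma lebesgue_on_id: "(\<lambda>y. y) \<in> borel_measurable (lebesgue_on (S::real set))"
  by (rule borel_measurable_lebesgue_on_borel) auto

lemma finite_measure_lebesgue_on_Ioo: "finite_measure (lebesgue_on {a<..<b::real})"
proof (intro finite_measureI)
  have "emeasure lborel {a<..<b} \<noteq> \<infinity>" by (cases "a \<le> b") auto
  then show "emeasure (lebesgue_on {a<..<b}) (space (lebesgue_on {a<..<b})) \<noteq> \<infinity>"
    by (simp add: emeasure_restrict_space)
qed

lemma sigma_finite_lebesgue_on_Ioo: "sigma_finite_measure (lebesgue_on {a<..<b::real})"
  using finite_measure_lebesgue_on_Ioo by (rule finite_measure.axioms)

text \<open>Brings the three parts of the primitive into the one form that
  \<open>primitive_test\<close> and \<open>integrable_primitive\<close> accept.\<close>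

lemma BV_primitive_eq:
  assumes g: "integrable (lebesgue_on {a<..<b}) g" and x: "x \<in> {a<..<b}"
    and m: "finite_borel_measure_on {a<..<b} \<sigma>" "finite_borel_measure_on {a<..<b} \<tau>"
  shows "BV_primitive a g \<sigma> \<tau> x = (LINT y|lebesgue_on {a<..<b}. g y * (if y < x then 1 else 0))
    + ((LINT y|\<sigma>. 1 * (if y < x then 1 else 0)) - (LINT y|\<tau>. 1 * (if y < x then 1 else 0)))"
proof -
  have e: "(LINT y|lebesgue_on {a<..<b}. g y * (if y < x then 1 else 0)) = integral {a..x} g"
    by (rule integral_lebesgue_on_Ioo(1)[OF g]) (use x in auto)
  show ?thesis
    unfolding BV_primitive_def integral_lessThan_measure[OF m(1)] integral_lessThan_measure[OF m(2)] e by (rule refl)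
qed

text \<open>The primitive is bounded by the total mass of |h| M, its measurability comes with
  Fubini, and bounded measurable functions are integrable on a bounded interval.\<close>

lemma integrable_primitive:
  fixes M :: "real measure" and h :: "real \<Rightarrow> real"
  assumes "sigma_finite_measure M" and idM[measurable]: "(\<lambda>y. y) \<in> borel_measurable M" and h: "integrable M h"
  shows "integrable (lebesgue_on {a<..<b}) (\<lambda>x. LINT y|M. h y * (if y < x then 1 else 0))"
proof -
  interpret M: sigma_finite_measure M by fact
  interpret finite_measure "lebesgue_on {a<..<b}" by (rule finite_measure_lebesgue_on_Ioo)
  have hm[measurable]: "h \<in> borel_measurable M" using h by simp
  have "(\<lambda>(x, y). h y * (if y < x then 1 else 0)) \<in> borel_measurable (lborel \<Otimes>\<^sub>M M)" by measurable
  from M.borel_measurable_lebesgue_integral[OF this] have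
    "(\<lambda>x. LINT y|M. h y * (if y < x then 1 else 0)) \<in> borel_measurable borel" by simp
  moreover have "\<bar>LINT y|M. h y * (if y < x then 1 else 0)\<bar> \<le> (LINT y|M. \<bar>h y\<bar>)" for x
  proof -
    have "\<bar>LINT y|M. h y * (if y < x then 1 else 0)\<bar> \<le> (LINT y|M. \<bar>h y * (if y < x then 1 else 0)\<bar>)"
      by (rule integral_abs_bound)
    also have "\<dots> \<le> (LINT y|M. \<bar>h y\<bar>)"
    proof (rule integral_mono)
      have "integrable M (\<lambda>y. h y * (if y < x then 1 else 0))"
        by (rule integrable_mult_bounded[OF h, where B = 1]) auto
      then show "integrable M (\<lambda>y. \<bar>h y * (if y < x then 1 else 0)\<bar>)" by (rule integrable_abs)
    qed (use h in \<open>auto simp: abs_mult\<close>)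
    finally show ?thesis .
  qed
  ultimately show ?thesis
    by (intro integrable_const_bound[where B = "LINT y|M. \<bar>h y\<bar>"] borel_measurable_lebesgue_on_borel AE_I2)
      (simp_all only: real_norm_def)
qed

lemma BV_primitive_integrable:
  assumes g: "integrable (lebesgue_on {a<..<b}) g"
    and m: "finite_borel_measure_on {a<..<b} \<sigma>" "finite_borel_measure_on {a<..<b} \<tau>"
  shows "integrable (lebesgue_on {a<..<b}) (BV_primitive a g \<sigma> \<tau>)"
proof -
  have fm: "finite_measure \<sigma>" "finite_measure \<tau>" using m by (auto simp: finite_borel_measure_on_def)
  note I = integrable_primitive[OF sigma_finite_lebesgue_on_Ioo lebesgue_on_id g]
    integrable_primitive[OF finite_borel_measure_sigma_finite[OF m(1)] finite_borel_measure_id[OF m(1)] finite_measure.integrable_const[OF fm(1), of 1]]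
    integrable_primitive[OF finite_borel_measure_sigma_finite[OF m(2)] finite_borel_measure_id[OF m(2)] finite_measure.integrable_const[OF fm(2), of 1]]
  have "integrable (lebesgue_on {a<..<b}) (\<lambda>x. (LINT y|lebesgue_on {a<..<b}. g y * (if y < x then 1 else 0))
    + ((LINT y|\<sigma>. 1 * (if y < x then 1 else 0)) - (LINT y|\<tau>. 1 * (if y < x then 1 else 0))))"
    by (intro Bochner_Integration.integrable_add Bochner_Integration.integrable_diff I)
  then show ?thesis
    by (rule Bochner_Integration.integrable_cong[THEN iffD1, OF refl _, rotated])
       (use BV_primitive_eq[OF g _ m] in auto)
qed

lemma BV_primitive_test:
  assumes ab: "a < b" and \<psi>: "\<psi> \<in> test_functions {a<..<b}"
    and g: "integrable (lebesgue_on {a<..<b}) g"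
    and m: "finite_borel_measure_on {a<..<b} \<sigma>" "finite_borel_measure_on {a<..<b} \<tau>"
  shows "(LINT x|lebesgue_on {a<..<b}. BV_primitive a g \<sigma> \<tau> x * deriv \<psi> x) =
      - ((LINT x|lebesgue_on {a<..<b}. g x * \<psi> x) + (LINT x|\<sigma>. \<psi> x) - (LINT x|\<tau>. \<psi> x))"
proof -
  let ?L = "lebesgue_on {a<..<b}"
  have fm: "finite_measure \<sigma>" "finite_measure \<tau>" using m by (auto simp: finite_borel_measure_on_def)
  note args = sigma_finite_lebesgue_on_Ioo lebesgue_on_id g
  note args1 = finite_borel_measure_sigma_finite[OF m(1)] finite_borel_measure_id[OF m(1)] finite_measure.integrable_const[OF fm(1), of 1]
  note args2 = finite_borel_measure_sigma_finite[OF m(2)] finite_borel_measure_id[OF m(2)] finite_measure.integrable_const[OF fm(2), of 1]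
  have I: "integrable ?L (\<lambda>x. (LINT y|M. h y * (if y < x then 1 else 0)) * deriv \<psi> x)"
    if "sigma_finite_measure M" "(\<lambda>y. y) \<in> borel_measurable M" "integrable M h" for M :: "real measure" and h
    by (rule integrable_mult_test[OF ab test_functions_deriv[OF ab \<psi>] integrable_primitive[OF that]])
      (rule borel_measurable_lebesgue_on_borel)
  have "(LINT x|?L. BV_primitive a g \<sigma> \<tau> x * deriv \<psi> x) = (LINT x|?L. (LINT y|?L. g y * (if y < x then 1 else 0)) * deriv \<psi> x
    + ((LINT y|\<sigma>. 1 * (if y < x then 1 else 0)) * deriv \<psi> x - (LINT y|\<tau>. 1 * (if y < x then 1 else 0)) * deriv \<psi> x))"
    by (rule Bochner_Integration.integral_cong[OF refl])
      (simp add: BV_primitive_eq[OF g _ m] algebra_simps)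
  also have "\<dots> = (LINT x|?L. (LINT y|?L. g y * (if y < x then 1 else 0)) * deriv \<psi> x)
    + ((LINT x|?L. (LINT y|\<sigma>. 1 * (if y < x then 1 else 0)) * deriv \<psi> x)
      - (LINT x|?L. (LINT y|\<tau>. 1 * (if y < x then 1 else 0)) * deriv \<psi> x))"
    by (simp only: Bochner_Integration.integral_add[OF I[OF args] Bochner_Integration.integrable_diff[OF I[OF args1] I[OF args2]]]
        Bochner_Integration.integral_diff[OF I[OF args1] I[OF args2]])
  also have "\<dots> = - (LINT x|?L. g x * \<psi> x) + (- (LINT x|\<sigma>. 1 * \<psi> x) - - (LINT x|\<tau>. 1 * \<psi> x))"
    by (simp only: primitive_test[OF ab \<psi> args] primitive_test[OF ab \<psi> args1] primitive_test[OF ab \<psi> args2])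
  finally show ?thesis by simp
qed

lemma AE_lebesgue_on_lborel:
  assumes "S \<in> sets lebesgue" "AE x in lborel. P x"
  shows "AE x in lebesgue_on S. P x"
proof -
  have "AE x in lebesgue. P x" using AE_completion[OF assms(2)] .
  then show ?thesis using assms(1) by (subst AE_restrict_space_iff) auto
qed

lemma borel_measurable_lebesgue_on_AE:
  fixes f g :: "real \<Rightarrow> real"
  assumes S: "S \<in> sets lebesgue" and f: "f \<in> borel_measurable (lebesgue_on S)"
    and ae: "AE x in lebesgue_on S. f x = g x"
  shows "g \<in> borel_measurable (lebesgue_on S)"
proof -
  have "(\<lambda>x. if x \<in> S then f x else 0) \<in> borel_measurable lebesgue"
    using borel_measurable_if[OF S] f by blast
  moreover have "AE x in lebesgue. (if x \<in> S then f x else 0) = (if x \<in> S then g x else 0)"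
    using ae S by (subst (asm) AE_restrict_space_iff) (auto elim: eventually_mono)
  ultimately have "(\<lambda>x. if x \<in> S then g x else 0) \<in> borel_measurable lebesgue"
    by (rule borel_measurable_AE)
  then show ?thesis using borel_measurable_if[OF S] by blast
qed

lemma integrable_lebesgue_on_AE:
  fixes f g :: "real \<Rightarrow> real"
  assumes S: "S \<in> sets lebesgue" and f: "integrable (lebesgue_on S) f"
    and ae: "AE x in lebesgue_on S. f x = g x"
  shows "integrable (lebesgue_on S) g"
  by (rule integrable_cong_AE_imp[OF f borel_measurable_lebesgue_on_AE[OF S borel_measurable_integrable[OF f] ae]])
    (use ae in \<open>auto elim: eventually_mono\<close>)

lemma measure_lebesgue_on_Ioo: "a \<le> b \<Longrightarrow> measure (lebesgue_on {a<..<b}) (space (lebesgue_on {a<..<b})) = b - a"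
  for a b :: real
  by (simp add: measure_restrict_space)

lemma finite_borel_measure_null: "finite_borel_measure_on \<Omega> (null_measure borel)"
  unfolding finite_borel_measure_on_def
  by (auto intro!: finite_measureI)

lemma lebesgue_singular_null: "lebesgue_singular (null_measure borel)"
  unfolding lebesgue_singular_def by (auto intro!: bexI[of _ "{}"])

lemma finite_borel_measure_Diff_null:
  assumes "finite_borel_measure_on \<Omega> \<mu>" "Z \<in> sets borel" "A \<in> sets borel" "emeasure \<mu> (- Z') = 0" "Z' \<subseteq> Z" "Z' \<in> sets borel"
  shows "measure \<mu> (A - Z) = 0" and "measure \<mu> (A \<inter> Z) = measure \<mu> A"
proof -
  have s: "sets \<mu> = sets borel" using assms(1) by (auto simp: finite_borel_measure_on_def)
  interpret finite_measure \<mu> using assms(1) by (auto simp: finite_borel_measure_on_def)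
  have "emeasure \<mu> (A - Z) \<le> emeasure \<mu> (- Z')"
    by (rule emeasure_mono) (use assms s in auto)
  then show 1: "measure \<mu> (A - Z) = 0" using assms(4) by (simp only: measure_def le_zero_eq enn2real_0)
  have "measure \<mu> ((A \<inter> Z) \<union> (A - Z)) = measure \<mu> (A \<inter> Z) + measure \<mu> (A - Z)"
    by (rule finite_measure_Union) (use assms s in auto)
  moreover have "(A \<inter> Z) \<union> (A - Z) = A" by blast
  ultimately show "measure \<mu> (A \<inter> Z) = measure \<mu> A" using 1 by (simp only: add_0_right)
qed

text \<open>The union \<open>Z\<close> of the four carriers is Lebesgue null. Removing
  \<open>Z\<close> kills all singular measures without changing integrals of \<open>h\<close>, so
  \<open>h\<close> vanishes almost everywhere, and what is left of the identity equates the singular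
  parts.\<close>

lemma weak_measure_decomp_zero:
  fixes a b :: real
  assumes ab: "a < b" and h: "integrable (lebesgue_on {a<..<b}) h"
    and m: "finite_borel_measure_on {a<..<b} \<sigma>" "finite_borel_measure_on {a<..<b} \<tau>"
      "finite_borel_measure_on {a<..<b} \<sigma>'" "finite_borel_measure_on {a<..<b} \<tau>'"
    and sing: "lebesgue_singular \<sigma>" "lebesgue_singular \<tau>" "lebesgue_singular \<sigma>'" "lebesgue_singular \<tau>'"
    and z: "\<And>\<psi>. \<psi> \<in> test_functions {a<..<b} \<Longrightarrow>
      (LINT x|lebesgue_on {a<..<b}. h x * \<psi> x) + ((LINT x|\<sigma>. \<psi> x) - (LINT x|\<tau>. \<psi> x))
        - ((LINT x|\<sigma>'. \<psi> x) - (LINT x|\<tau>'. \<psi> x)) = 0"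
  shows "AE x in lebesgue_on {a<..<b}. h x = 0"
    and "A \<in> sets borel \<Longrightarrow> measure \<sigma> A - measure \<tau> A = measure \<sigma>' A - measure \<tau>' A"
proof -
  obtain Z1 where Z1: "Z1 \<in> null_sets lborel" "emeasure \<sigma> (- Z1) = 0" using sing(1) unfolding lebesgue_singular_def by blast
  obtain Z2 where Z2: "Z2 \<in> null_sets lborel" "emeasure \<tau> (- Z2) = 0" using sing(2) unfolding lebesgue_singular_def by blast
  obtain Z3 where Z3: "Z3 \<in> null_sets lborel" "emeasure \<sigma>' (- Z3) = 0" using sing(3) unfolding lebesgue_singular_def by blast
  obtain Z4 where Z4: "Z4 \<in> null_sets lborel" "emeasure \<tau>' (- Z4) = 0" using sing(4) unfolding lebesgue_singular_def by blast
  define Z where "Z = Z1 \<union> Z2 \<union> Z3 \<union> Z4"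
  have Zn: "Z \<in> null_sets lborel" unfolding Z_def by (intro null_sets.Un Z1 Z2 Z3 Z4)
  have Zb: "Z \<in> sets borel" "Z1 \<in> sets borel" "Z2 \<in> sets borel" "Z3 \<in> sets borel" "Z4 \<in> sets borel"
    using Zn Z1 Z2 Z3 Z4 by (auto simp: null_sets_def)
  have sub: "Z1 \<subseteq> Z" "Z2 \<subseteq> Z" "Z3 \<subseteq> Z" "Z4 \<subseteq> Z" by (auto simp: Z_def)
  have M: "(LINT x|lebesgue_on {a<..<b}. indicator A x * h x) + (measure \<sigma> A - measure \<tau> A)
    - (measure \<sigma>' A - measure \<tau>' A) = 0" if "A \<in> sets borel" for A
    by (rule weak_measure_zero[OF ab h m _ that]) (rule z)
  have d: "measure \<sigma> (A - Z) = 0" "measure \<tau> (A - Z) = 0" "measure \<sigma>' (A - Z) = 0" "measure \<tau>' (A - Z) = 0"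
    if "A \<in> sets borel" for A
    using finite_borel_measure_Diff_null(1)[OF m(1) Zb(1) that Z1(2) sub(1) Zb(2)]
      finite_borel_measure_Diff_null(1)[OF m(2) Zb(1) that Z2(2) sub(2) Zb(3)]
      finite_borel_measure_Diff_null(1)[OF m(3) Zb(1) that Z3(2) sub(3) Zb(4)]
      finite_borel_measure_Diff_null(1)[OF m(4) Zb(1) that Z4(2) sub(4) Zb(5)] by blast+
  have notZ: "AE x in lebesgue_on {a<..<b}. x \<notin> Z"
    by (rule AE_lebesgue_on_lborel[OF _ AE_not_in[OF Zn]]) auto
  have hz: "(LINT x|lebesgue_on {a<..<b}. indicator A x * h x) = 0" if A: "A \<in> sets borel" for A
  proof -
    have "(LINT x|lebesgue_on {a<..<b}. indicator (A - Z) x * h x) = 0"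
      using M[of "A - Z"] A Zb(1) d[OF A] by simp
    also have "(LINT x|lebesgue_on {a<..<b}. indicator (A - Z) x * h x) = (LINT x|lebesgue_on {a<..<b}. indicator A x * h x)"
    proof (rule integral_cong_AE)
      have "(\<lambda>x. indicator B x * h x) \<in> borel_measurable (lebesgue_on {a<..<b})" if "B \<in> sets borel" for B
        by (rule borel_measurable_times[OF borel_measurable_lebesgue_on_borel borel_measurable_integrable[OF h]])
          (use that in auto)
      then show "(\<lambda>x. indicator (A - Z) x * h x) \<in> borel_measurable (lebesgue_on {a<..<b})"
        "(\<lambda>x. indicator A x * h x) \<in> borel_measurable (lebesgue_on {a<..<b})"
        using A Zb(1) by auto
      show "AE x in lebesgue_on {a<..<b}. indicator (A - Z) x * h x = indicator A x * h x"
        using notZ by eventually_elim (auto simp: indicator_def)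
    qed
    finally show ?thesis .
  qed
  show "AE x in lebesgue_on {a<..<b}. h x = 0"
    by (rule AE_zero_if_borel_integrals_zero[OF _ h hz]) auto
  show "measure \<sigma> A - measure \<tau> A = measure \<sigma>' A - measure \<tau>' A" if A: "A \<in> sets borel"
    using M[OF A] unfolding hz[OF A] by linarith
qed

text \<open>Needed because \<open>approx_grad\<close> is an arbitrary choice of density and because
  membership in \<open>SBV_space\<close> quantifies over all decompositions.\<close>

lemma BV_deriv_unique:
  assumes ab: "a < b" and 1: "BV_deriv {a<..<b} u g \<sigma> \<tau>" and 2: "BV_deriv {a<..<b} u g' \<sigma>' \<tau>'"
  shows "AE x in lebesgue_on {a<..<b}. g x = g' x"
    and "A \<in> sets borel \<Longrightarrow> measure \<sigma> A - measure \<tau> A = measure \<sigma>' A - measure \<tau>' A"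
proof -
  let ?L = "lebesgue_on {a<..<b}"
  have g: "integrable ?L g" "integrable ?L g'" using 1 2 by (auto simp: BV_deriv_def L1_space_def)
  have h: "integrable ?L (\<lambda>x. g x - g' x)" using g by simp
  have z: "(LINT x|?L. (g x - g' x) * \<psi> x) + ((LINT x|\<sigma>. \<psi> x) - (LINT x|\<tau>. \<psi> x))
        - ((LINT x|\<sigma>'. \<psi> x) - (LINT x|\<tau>'. \<psi> x)) = 0" if \<psi>: "\<psi> \<in> test_functions {a<..<b}" for \<psi>
  proof -
    have i: "integrable ?L (\<lambda>x. g x * \<psi> x)" "integrable ?L (\<lambda>x. g' x * \<psi> x)"
      using integrable_mult_test[OF ab \<psi> g(1) borel_measurable_lebesgue_on_borel]
        integrable_mult_test[OF ab \<psi> g(2) borel_measurable_lebesgue_on_borel] by auto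
    have "(LINT x|?L. (g x - g' x) * \<psi> x) = (LINT x|?L. g x * \<psi> x) - (LINT x|?L. g' x * \<psi> x)"
      using Bochner_Integration.integral_diff[OF i] by (simp only: left_diff_distrib)
    moreover have "(LINT x|?L. u x * deriv \<psi> x) = - ((LINT x|?L. g x * \<psi> x) + (LINT x|\<sigma>. \<psi> x) - (LINT x|\<tau>. \<psi> x))"
      "(LINT x|?L. u x * deriv \<psi> x) = - ((LINT x|?L. g' x * \<psi> x) + (LINT x|\<sigma>'. \<psi> x) - (LINT x|\<tau>'. \<psi> x))"
      using 1 2 \<psi> unfolding BV_deriv_def by blast+
    ultimately show ?thesis by linarith
  qed
  have m: "finite_borel_measure_on {a<..<b} \<sigma>" "finite_borel_measure_on {a<..<b} \<tau>"
      "finite_borel_measure_on {a<..<b} \<sigma>'" "finite_borel_measure_on {a<..<b} \<tau>'"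
      "lebesgue_singular \<sigma>" "lebesgue_singular \<tau>" "lebesgue_singular \<sigma>'" "lebesgue_singular \<tau>'"
    using 1 2 unfolding BV_deriv_def by blast+
  show "AE x in ?L. g x = g' x"
    using weak_measure_decomp_zero(1)[OF ab h m z] by (auto elim: eventually_mono)
  show "A \<in> sets borel \<Longrightarrow> measure \<sigma> A - measure \<tau> A = measure \<sigma>' A - measure \<tau>' A"
    by (rule weak_measure_decomp_zero(2)[OF ab h m z])
qed

section \<open>From distributional derivatives to primitives\<close>

lemma integral_deriv_test:
  assumes ab: "a < b" and \<psi>: "\<psi> \<in> test_functions {a<..<b}"
  shows "(LINT x|lebesgue_on {a<..<b}. deriv \<psi> x) = 0"
proof -
  have sm: "smooth \<psi>" using test_functions_smooth[OF \<psi>] .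
  have "set_integrable lebesgue {a..b} (deriv \<psi>)"
    by (rule absolutely_integrable_continuous_real[OF smooth_continuous_on[OF smooth_deriv[OF sm]]])
  then have "set_integrable lebesgue {a<..<b} (deriv \<psi>)"
    by (rule set_integrable_subset) auto
  then have "integrable (lebesgue_on {a<..<b}) (deriv \<psi>)" by (simp add: integrable_restrict_space set_integrable_def)
  then have "(LINT x|lebesgue_on {a<..<b}. deriv \<psi> x) = integral {a<..<b} (deriv \<psi>)"
    by (rule lebesgue_integral_eq_integral) auto
  also have "\<dots> = integral {a..b} (deriv \<psi>)" by (metis integral_open_interval_real)
  also have "\<dots> = \<psi> b - \<psi> a"
    by (intro integral_unique fundamental_theorem_of_calculus)
      (use ab smooth_DERIV[OF sm] in \<open>auto simp: has_real_derivative_iff_has_vector_derivative[symmetric] intro: DERIV_subset\<close>)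
  also have "\<dots> = 0" using test_functions_vanish[OF \<psi>, of a] test_functions_vanish[OF \<psi>, of b] by simp
  finally show ?thesis .
qed

text \<open>Otherwise the constant 1 would annihilate every test function and hence vanish almost
  everywhere.\<close>

lemma test_function_integral_nonzero:
  fixes a b :: real
  assumes ab: "a < b"
  shows "\<exists>\<psi>\<in>test_functions {a<..<b}. (LINT x|lebesgue_on {a<..<b}. \<psi> x) \<noteq> 0"
proof (rule ccontr)
  assume n: "\<not> ?thesis"
  interpret finite_measure "lebesgue_on {a<..<b}" by (rule finite_measure_lebesgue_on_Ioo)
  have one: "integrable (lebesgue_on {a<..<b}) (\<lambda>x. 1 :: real)" by simp
  have "AE x in lebesgue_on {a<..<b}. (1::real) = 0"
    by (rule weak_measure_decomp_zero(1)[OF ab one finite_borel_measure_null finite_borel_measure_null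
          finite_borel_measure_null finite_borel_measure_null lebesgue_singular_null lebesgue_singular_null
          lebesgue_singular_null lebesgue_singular_null]) (use n in auto)
  then have "AE x in lebesgue_on {a<..<b}. False" by simp
  then have "emeasure (lebesgue_on {a<..<b}) (space (lebesgue_on {a<..<b})) = 0"
    by (simp only: trivial_limit_def[symmetric] ae_filter_eq_bot_iff)
  then show False using ab by (simp add: emeasure_restrict_space)
qed

text \<open>The du Bois-Reymond lemma. Subtracting the right multiple of a fixed
  \<open>\<eta>\<close> with nonzero integral leaves a test function of mean zero, which is the
  derivative of a test function; the constant is the mean of \<open>w\<close> weighted by
  \<open>\<eta>\<close>.\<close>

lemma weak_constant:
  assumes ab: "a < b" and w: "integrable (lebesgue_on {a<..<b}) w"
    and z: "\<And>\<psi>. \<psi> \<in> test_functions {a<..<b} \<Longrightarrow> (LINT x|lebesgue_on {a<..<b}. w x * deriv \<psi> x) = 0"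
  shows "\<exists>c. AE x in lebesgue_on {a<..<b}. w x = c"
proof -
  let ?L = "lebesgue_on {a<..<b}"
  interpret finite_measure ?L by (rule finite_measure_lebesgue_on_Ioo)
  obtain \<eta> where \<eta>: "\<eta> \<in> test_functions {a<..<b}" "(LINT x|?L. \<eta> x) \<noteq> 0"
    using test_function_integral_nonzero[OF ab] by blast
  define c where "c = (LINT x|?L. w x * \<eta> x) / (LINT x|?L. \<eta> x)"
  have one: "integrable ?L (\<lambda>x. 1 :: real)" by simp
  have i1: "integrable ?L \<psi>" if "\<psi> \<in> test_functions {a<..<b}" for \<psi>
    using integrable_mult_test[OF ab that one borel_measurable_lebesgue_on_borel] by simp
  have iw: "integrable ?L (\<lambda>x. w x * \<psi> x)" if "\<psi> \<in> test_functions {a<..<b}" for \<psi>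
    using integrable_mult_test[OF ab that w borel_measurable_lebesgue_on_borel] by simp
  have wc: "integrable ?L (\<lambda>x. w x - c)" using w by simp
  have zero: "(LINT x|?L. (w x - c) * \<psi> x) = 0" if \<psi>: "\<psi> \<in> test_functions {a<..<b}" for \<psi>
  proof -
    define k where "k = (LINT x|?L. \<psi> x) / (LINT x|?L. \<eta> x)"
    define \<theta> where "\<theta> = (\<lambda>x. 1 * \<psi> x + (- k) * \<eta> x)"
    have \<theta>t: "\<theta> \<in> test_functions {a<..<b}"
    proof -
      obtain c1 d1 where 1: "smooth \<psi>" "a < c1" "c1 \<le> d1" "d1 < b" "\<And>x. x \<notin> {c1..d1} \<Longrightarrow> \<psi> x = 0"
        using \<psi> test_functions_iff[OF ab] by blast
      obtain c2 d2 where 2: "smooth \<eta>" "a < c2" "c2 \<le> d2" "d2 < b" "\<And>x. x \<notin> {c2..d2} \<Longrightarrow> \<eta> x = 0"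
        using \<eta>(1) test_functions_iff[OF ab] by blast
      have "smooth \<theta>" unfolding \<theta>_def by (rule smooth_lincomb[OF 1(1) 2(1)])
      moreover have "\<theta> x = 0" if "x \<notin> {min c1 c2..max d1 d2}" for x
      proof -
        have "x \<notin> {c1..d1}" "x \<notin> {c2..d2}" using that by auto
        then show ?thesis using 1(5) 2(5) by (simp add: \<theta>_def)
      qed
      moreover have "a < min c1 c2" "min c1 c2 \<le> max d1 d2" "max d1 d2 < b" using 1 2 by auto
      ultimately show ?thesis using test_functions_iff[OF ab] by blast
    qed
    have "(LINT x|?L. \<theta> x) = (LINT x|?L. \<psi> x) - k * (LINT x|?L. \<eta> x)"
      unfolding \<theta>_def using i1[OF \<psi>] i1[OF \<eta>(1)] by simp
    also have "\<dots> = 0" using \<eta>(2) by (simp add: k_def)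
    finally have "(LINT x|?L. \<theta> x) = 0" .
    then obtain F where F: "F \<in> test_functions {a<..<b}" "deriv F = \<theta>"
      by (rule test_functions_antideriv[OF ab \<theta>t])
    have "0 = (LINT x|?L. w x * \<theta> x)" using z[OF F(1)] F(2) by simp
    also have "\<dots> = (LINT x|?L. w x * \<psi> x - k * (w x * \<eta> x))"
      unfolding \<theta>_def by (simp add: algebra_simps)
    also have "\<dots> = (LINT x|?L. w x * \<psi> x) - k * (LINT x|?L. w x * \<eta> x)"
      using iw[OF \<psi>] iw[OF \<eta>(1)] by simp
    also have "k * (LINT x|?L. w x * \<eta> x) = c * (LINT x|?L. \<psi> x)"
      by (simp add: k_def c_def)
    also have "(LINT x|?L. w x * \<psi> x) - c * (LINT x|?L. \<psi> x) = (LINT x|?L. w x * \<psi> x - c * \<psi> x)"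
      using iw[OF \<psi>] i1[OF \<psi>] by simp
    finally show ?thesis by (simp add: left_diff_distrib)
  qed
  have "AE x in ?L. w x - c = 0"
    by (rule weak_measure_decomp_zero(1)[OF ab wc finite_borel_measure_null finite_borel_measure_null
          finite_borel_measure_null finite_borel_measure_null lebesgue_singular_null lebesgue_singular_null
          lebesgue_singular_null lebesgue_singular_null]) (simp add: zero)
  then show ?thesis by (auto elim: eventually_mono)
qed

text \<open>\<open>u\<close> and the primitive of its derivative measure have the same
  distributional derivative, so they differ by a constant.\<close>

lemma BV_deriv_representation:
  assumes ab: "a < b" and u: "integrable (lebesgue_on {a<..<b}) u" and D: "BV_deriv {a<..<b} u g \<sigma> \<tau>"
  shows "\<exists>c. AE x in lebesgue_on {a<..<b}. u x = c + BV_primitive a g \<sigma> \<tau> x"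
proof -
  let ?L = "lebesgue_on {a<..<b}"
  have g: "integrable ?L g" and m: "finite_borel_measure_on {a<..<b} \<sigma>" "finite_borel_measure_on {a<..<b} \<tau>"
    using D unfolding BV_deriv_def L1_space_def by blast+
  note P = BV_primitive_integrable[OF g m]
  have w: "integrable ?L (\<lambda>x. u x - BV_primitive a g \<sigma> \<tau> x)" using u P by (rule Bochner_Integration.integrable_diff)
  have "(LINT x|?L. (u x - BV_primitive a g \<sigma> \<tau> x) * deriv \<psi> x) = 0" if \<psi>: "\<psi> \<in> test_functions {a<..<b}" for \<psi>
  proof -
    note d = test_functions_deriv[OF ab \<psi>]
    have i: "integrable ?L (\<lambda>x. u x * deriv \<psi> x)" "integrable ?L (\<lambda>x. BV_primitive a g \<sigma> \<tau> x * deriv \<psi> x)"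
      using integrable_mult_test[OF ab d u borel_measurable_lebesgue_on_borel]
        integrable_mult_test[OF ab d P borel_measurable_lebesgue_on_borel] by auto
    have "(LINT x|?L. (u x - BV_primitive a g \<sigma> \<tau> x) * deriv \<psi> x)
      = (LINT x|?L. u x * deriv \<psi> x) - (LINT x|?L. BV_primitive a g \<sigma> \<tau> x * deriv \<psi> x)"
      using Bochner_Integration.integral_diff[OF i] by (simp only: left_diff_distrib)
    moreover have "(LINT x|?L. u x * deriv \<psi> x) = - ((LINT x|?L. g x * \<psi> x) + (LINT x|\<sigma>. \<psi> x) - (LINT x|\<tau>. \<psi> x))"
      using D \<psi> unfolding BV_deriv_def by blast
    ultimately show ?thesis using BV_primitive_test[OF ab \<psi> g m] by linarith
  qed
  then obtain c where "AE x in ?L. u x - BV_primitive a g \<sigma> \<tau> x = c" using weak_constant[OF ab w] by blast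
  then have "AE x in ?L. u x = c + BV_primitive a g \<sigma> \<tau> x" by eventually_elim linarith
  then show ?thesis by blast
qed

text \<open>Converse of the representation: the primitive has the prescribed derivative, and the
  constant drops out because \<open>deriv \<psi>\<close> has integral 0.\<close>

lemma BV_derivI:
  assumes ab: "a < b" and g: "integrable (lebesgue_on {a<..<b}) g"
    and m: "finite_borel_measure_on {a<..<b} \<sigma>" "finite_borel_measure_on {a<..<b} \<tau>"
    and s: "lebesgue_singular \<sigma>" "lebesgue_singular \<tau>"
    and u: "AE x in lebesgue_on {a<..<b}. u x = c + BV_primitive a g \<sigma> \<tau> x"
  shows "BV_deriv {a<..<b} u g \<sigma> \<tau>" and "integrable (lebesgue_on {a<..<b}) u"
proof -
  let ?L = "lebesgue_on {a<..<b}"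
  interpret finite_measure ?L by (rule finite_measure_lebesgue_on_Ioo)
  note P = BV_primitive_integrable[OF g m]
  have cP: "integrable ?L (\<lambda>x. c + BV_primitive a g \<sigma> \<tau> x)" using P by simp
  have u': "AE x in ?L. c + BV_primitive a g \<sigma> \<tau> x = u x" using u by (auto elim: eventually_mono)
  show ui: "integrable ?L u" by (rule integrable_lebesgue_on_AE[OF _ cP u']) auto
  have one: "integrable ?L (\<lambda>x. c)" by simp
  have "(LINT x|?L. u x * deriv \<psi> x) = - ((LINT x|?L. g x * \<psi> x) + (LINT x|\<sigma>. \<psi> x) - (LINT x|\<tau>. \<psi> x))"
    if \<psi>: "\<psi> \<in> test_functions {a<..<b}" for \<psi>
  proof -
    note d = test_functions_deriv[OF ab \<psi>]
    have i: "integrable ?L (\<lambda>x. c * deriv \<psi> x)" "integrable ?L (\<lambda>x. BV_primitive a g \<sigma> \<tau> x * deriv \<psi> x)"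
      "integrable ?L (\<lambda>x. u x * deriv \<psi> x)"
      using integrable_mult_test[OF ab d one borel_measurable_lebesgue_on_borel]
        integrable_mult_test[OF ab d P borel_measurable_lebesgue_on_borel]
        integrable_mult_test[OF ab d ui borel_measurable_lebesgue_on_borel] by auto
    have "(LINT x|?L. u x * deriv \<psi> x) = (LINT x|?L. c * deriv \<psi> x + BV_primitive a g \<sigma> \<tau> x * deriv \<psi> x)"
    proof (rule integral_cong_AE)
      show "AE x in ?L. u x * deriv \<psi> x = c * deriv \<psi> x + BV_primitive a g \<sigma> \<tau> x * deriv \<psi> x"
        using u by eventually_elim (simp add: distrib_right)
    qed (use i in \<open>auto intro: borel_measurable_integrable\<close>)
    also have "\<dots> = c * (LINT x|?L. deriv \<psi> x) + (LINT x|?L. BV_primitive a g \<sigma> \<tau> x * deriv \<psi> x)"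
      using Bochner_Integration.integral_add[OF i(1,2)] by (simp only: integral_mult_right_zero)
    finally show ?thesis unfolding integral_deriv_test[OF ab \<psi>] BV_primitive_test[OF ab \<psi> g m] by simp
  qed
  then show "BV_deriv {a<..<b} u g \<sigma> \<tau>"
    using g m s unfolding BV_deriv_def L1_space_def by blast
qed

section \<open>Sobolev functions on an interval\<close>

lemma integral_lebesgue_on_Ioo_mono:
  fixes f \<psi> :: "real \<Rightarrow> real"
  assumes "a \<le> a'" "b' \<le> b" "\<And>x. x \<notin> {a'<..<b'} \<Longrightarrow> \<psi> x = 0"
  shows "(LINT x|lebesgue_on {a<..<b}. f x * \<psi> x) = (LINT x|lebesgue_on {a'<..<b'}. f x * \<psi> x)"
proof -
  have "(LINT x|lebesgue_on {a<..<b}. f x * \<psi> x) = (LINT x|lebesgue. indicator {a<..<b} x *\<^sub>R (f x * \<psi> x))"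
    by (rule integral_restrict_space) auto
  also have "\<dots> = (LINT x|lebesgue. indicator {a'<..<b'} x *\<^sub>R (f x * \<psi> x))"
  proof (rule Bochner_Integration.integral_cong[OF refl])
    show "indicator {a<..<b} x *\<^sub>R (f x * \<psi> x) = indicator {a'<..<b'} x *\<^sub>R (f x * \<psi> x)" for x
      using assms(1,2) assms(3)[of x] by (cases "x \<in> {a'<..<b'}") (auto simp: indicator_def)
  qed
  also have "\<dots> = (LINT x|lebesgue_on {a'<..<b'}. f x * \<psi> x)"
    by (rule integral_restrict_space[symmetric]) auto
  finally show ?thesis .
qed

lemma integrable_lebesgue_on_subset:
  fixes f :: "real \<Rightarrow> real"
  assumes "integrable (lebesgue_on S) f" "T \<subseteq> S" "S \<in> sets lebesgue" "T \<in> sets lebesgue"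
  shows "integrable (lebesgue_on T) f"
proof -
  have "set_integrable lebesgue S f"
    using assms by (simp add: integrable_restrict_space set_integrable_def)
  then have "set_integrable lebesgue T f"
    by (rule set_integrable_subset) (use assms in auto)
  then show ?thesis using assms by (simp add: integrable_restrict_space set_integrable_def)
qed

lemma L1_loc_integrable_Ioo:
  assumes "g \<in> L1_loc {a<..<b}" "a < a'" "b' < b"
  shows "integrable (lebesgue_on {a'<..<b'}) g"
proof -
  have "integrable (lebesgue_on {a'..b'}) g" 
  proof -
    have "{a'..b'} \<subseteq> {a<..<b}" using assms(2,3) by auto
    moreover have "compact {a'..b'}" by simp
    ultimately show ?thesis using assms(1) unfolding L1_loc_def by blast
  qed
  then show ?thesis by (rule integrable_lebesgue_on_subset) auto
qed

lemma test_functions_mono: "\<Omega>' \<subseteq> \<Omega> \<Longrightarrow> \<psi> \<in> test_functions \<Omega>' \<Longrightarrow> \<psi> \<in> test_functions \<Omega>"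
  unfolding test_functions_def by blast

text \<open>\<open>is_weak_deriv\<close> asks for local integrability, so uniqueness of weak
  derivatives is proved on compactly contained subintervals and passed on by a countable
  exhaustion.\<close>

lemma AE_lebesgue_on_Ioo_exhaust:
  fixes a b :: real
  assumes ab: "a < b" and "\<And>a' b'. a < a' \<Longrightarrow> a' < b' \<Longrightarrow> b' < b \<Longrightarrow> AE x in lebesgue_on {a'<..<b'}. P x"
  shows "AE x in lebesgue_on {a<..<b}. P x"
proof -
  \<comment> \<open>The summand 3 keeps \<open>\<delta> n\<close> at most a third of the length, so
    that every shrunken interval is nonempty.\<close>
  define \<delta> where "\<delta> = (\<lambda>n::nat. (b - a) / (real n + 3))"
  have \<delta>: "0 < \<delta> n" "\<delta> n \<le> (b - a) / 3" for n
    unfolding \<delta>_def using ab by (simp, intro divide_left_mono) auto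
  have lim: "\<delta> \<longlonglongrightarrow> 0"
    unfolding \<delta>_def
    by (rule tendsto_divide_0[OF tendsto_const])
      (intro filterlim_at_top_imp_at_infinity filterlim_tendsto_add_at_top[OF tendsto_const, of _ _ 3, simplified add.commute] filterlim_real_sequentially)
  have "AE x in lebesgue. x \<in> {a + \<delta> n<..<b - \<delta> n} \<longrightarrow> P x" for n
  proof -
    have "a < a + \<delta> n" using \<delta>[of n] by linarith
    moreover have "a + \<delta> n < b - \<delta> n" using \<delta>(2)[of n] ab by (simp add: field_simps)
    moreover have "b - \<delta> n < b" using \<delta>[of n] by linarith
    ultimately have *: "a < a + \<delta> n" "a + \<delta> n < b - \<delta> n" "b - \<delta> n < b" by blast+
    from assms(2)[OF *] show ?thesis by (subst (asm) AE_restrict_space_iff) auto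
  qed
  then have "AE x in lebesgue. \<forall>n::nat. x \<in> {a + \<delta> n<..<b - \<delta> n} \<longrightarrow> P x"
    by (intro AE_all_countable[THEN iffD2] allI)
  then have "AE x in lebesgue. x \<in> {a<..<b} \<longrightarrow> P x"
  proof eventually_elim
    case (elim x)
    show ?case
    proof
      assume x: "x \<in> {a<..<b}"
      then have "eventually (\<lambda>n. \<delta> n < min (x - a) (b - x)) sequentially"
        using lim by (intro order_tendstoD) auto
      then obtain n where "\<delta> n < min (x - a) (b - x)" by (auto simp: eventually_sequentially)
      then have "x \<in> {a + \<delta> n<..<b - \<delta> n}" by auto
      then show "P x" using elim by blast
    qed
  qed
  then show ?thesis by (subst AE_restrict_space_iff) auto
qed

lemma weak_deriv_unique:
  assumes ab: "a < b" and 1: "is_weak_deriv {a<..<b} u g" and 2: "is_weak_deriv {a<..<b} u g'"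
  shows "AE x in lebesgue_on {a<..<b}. g x = g' x"
proof (rule AE_lebesgue_on_Ioo_exhaust[OF ab])
  fix a' b' assume ab': "a < a'" "a' < b'" "b' < b"
  let ?L = "lebesgue_on {a'<..<b'}"
  have g: "integrable ?L g" "integrable ?L g'"
    using L1_loc_integrable_Ioo[OF _ ab'(1,3)] 1 2 unfolding is_weak_deriv_def by blast+
  have h: "integrable ?L (\<lambda>x. g x - g' x)" using g by simp
  have "(LINT x|?L. (g x - g' x) * \<psi> x) = 0" if \<psi>: "\<psi> \<in> test_functions {a'<..<b'}" for \<psi>
  proof -
    have \<psi>': "\<psi> \<in> test_functions {a<..<b}" by (rule test_functions_mono[OF _ \<psi>]) (use ab' in auto)
    note van = test_functions_vanish[OF \<psi>]
    have i: "integrable ?L (\<lambda>x. g x * \<psi> x)" "integrable ?L (\<lambda>x. g' x * \<psi> x)"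
      using integrable_mult_test[OF ab'(2) \<psi> g(1) borel_measurable_lebesgue_on_borel]
        integrable_mult_test[OF ab'(2) \<psi> g(2) borel_measurable_lebesgue_on_borel] by auto
    have "(LINT x|lebesgue_on {a<..<b}. g x * \<psi> x) = (LINT x|lebesgue_on {a<..<b}. g' x * \<psi> x)"
    proof -
      have "(LINT x|lebesgue_on {a<..<b}. u x * deriv \<psi> x) = - (LINT x|lebesgue_on {a<..<b}. g x * \<psi> x)"
        "(LINT x|lebesgue_on {a<..<b}. u x * deriv \<psi> x) = - (LINT x|lebesgue_on {a<..<b}. g' x * \<psi> x)"
        using 1 2 \<psi>' unfolding is_weak_deriv_def by blast+
      then show ?thesis by linarith
    qed
    moreover have "(LINT x|lebesgue_on {a<..<b}. f x * \<psi> x) = (LINT x|?L. f x * \<psi> x)" for f :: "real \<Rightarrow> real"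
      by (rule integral_lebesgue_on_Ioo_mono) (use ab' van in auto)
    ultimately have "(LINT x|?L. g x * \<psi> x) - (LINT x|?L. g' x * \<psi> x) = 0" by simp
    then show ?thesis using Bochner_Integration.integral_diff[OF i] by (simp only: left_diff_distrib)
  qed
  then have "AE x in ?L. g x - g' x = 0"
    by (intro weak_measure_decomp_zero(1)[OF ab'(2) h finite_borel_measure_null finite_borel_measure_null
          finite_borel_measure_null finite_borel_measure_null lebesgue_singular_null lebesgue_singular_null
          lebesgue_singular_null lebesgue_singular_null]) simp
  then show "AE x in ?L. g x = g' x" by (auto elim: eventually_mono)
qed

lemma L2_imp_integrable:
  assumes "g \<in> L2_space {a<..<b}"
  shows "integrable (lebesgue_on {a<..<b}) g"
proof -
  let ?L = "lebesgue_on {a<..<b}"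
  interpret finite_measure ?L by (rule finite_measure_lebesgue_on_Ioo)
  have g: "g \<in> borel_measurable ?L" "integrable ?L (\<lambda>x. (g x)\<^sup>2)" using assms by (auto simp: L2_space_def)
  have i: "integrable ?L (\<lambda>x. 1 + (g x)\<^sup>2)" using g(2) by simp
  have "\<bar>t\<bar> \<le> 1 + t\<^sup>2" for t :: real
  proof -
    have "0 \<le> (\<bar>t\<bar> - 1)\<^sup>2" by simp
    then have "2 * \<bar>t\<bar> \<le> 1 + t\<^sup>2" by (simp add: power2_diff)
    then show ?thesis by linarith
  qed
  then show ?thesis
    by (intro Bochner_Integration.integrable_bound[OF i g(1)] AE_I2) (auto simp: abs_of_nonneg add_nonneg_nonneg)
qed

lemma L2_space_AE:
  assumes "g \<in> L2_space {a<..<b}" and ae: "AE x in lebesgue_on {a<..<b}. g x = h x"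
  shows "h \<in> L2_space {a<..<b}"
proof -
  have "h \<in> borel_measurable (lebesgue_on {a<..<b})"
    by (rule borel_measurable_lebesgue_on_AE[OF _ _ ae]) (use assms in \<open>auto simp: L2_space_def\<close>)
  moreover have "integrable (lebesgue_on {a<..<b}) (\<lambda>x. (h x)\<^sup>2)"
    by (rule integrable_lebesgue_on_AE[where f = "\<lambda>x. (g x)\<^sup>2"])
      (use assms in \<open>auto simp: L2_space_def elim: eventually_mono\<close>)
  ultimately show ?thesis by (simp add: L2_space_def)
qed

text \<open>Integrable weak derivatives are derivatives without singular part; this carries the
  results on bounded variation over to Sobolev functions.\<close>

lemma BV_deriv_null_iff:
  assumes "u \<in> L1_loc {a<..<b}" "g \<in> L1_loc {a<..<b}" "integrable (lebesgue_on {a<..<b}) g"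
  shows "BV_deriv {a<..<b} u g (null_measure borel) (null_measure borel) \<longleftrightarrow> is_weak_deriv {a<..<b} u g"
  using assms finite_borel_measure_null lebesgue_singular_null
  unfolding BV_deriv_def is_weak_deriv_def L1_space_def by simp

lemma integrable_imp_L1_loc:
  fixes g :: "real \<Rightarrow> real"
  assumes "integrable (lebesgue_on {a<..<b}) g"
  shows "g \<in> L1_loc {a<..<b}"
  unfolding L1_loc_def
  using integrable_lebesgue_on_subset[OF assms] by (auto intro: lmeasurable_compact fmeasurableD)

lemma BV_primitive_null: "BV_primitive a g (null_measure borel) (null_measure borel) x = integral {a..x} g"
  by (simp add: BV_primitive_def)

text \<open>\<open>weak_deriv\<close> is chosen among all weak derivatives, with no mention of L2;
  it inherits square integrability from the witness in \<open>H1_space\<close> because the two agree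
  almost everywhere.\<close>

lemma H1_representation:
  assumes ab: "a < b" and u: "u \<in> H1_space {a<..<b}"
  shows "weak_deriv {a<..<b} u \<in> L2_space {a<..<b}"
    and "\<exists>c. AE x in lebesgue_on {a<..<b}. u x = c + integral {a..x} (weak_deriv {a<..<b} u)"
proof -
  let ?L = "lebesgue_on {a<..<b}" and ?w = "weak_deriv {a<..<b} u"
  obtain g where g: "g \<in> L2_space {a<..<b}" "is_weak_deriv {a<..<b} u g" using u by (auto simp: H1_space_def)
  have uL2: "u \<in> L2_space {a<..<b}" using u by (auto simp: H1_space_def)
  have w: "is_weak_deriv {a<..<b} u ?w" unfolding weak_deriv_def by (rule someI[of _ g]) (rule g)
  show L2: "?w \<in> L2_space {a<..<b}"
    by (rule L2_space_AE[OF g(1) weak_deriv_unique[OF ab g(2) w]])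
  have "BV_deriv {a<..<b} u ?w (null_measure borel) (null_measure borel)"
    using w BV_deriv_null_iff[OF _ _ L2_imp_integrable[OF L2]] unfolding is_weak_deriv_def by blast
  from BV_deriv_representation[OF ab L2_imp_integrable[OF uL2] this]
  show "\<exists>c. AE x in ?L. u x = c + integral {a..x} ?w" unfolding BV_primitive_null .
qed

lemma integral_primitive_bound:
  fixes q :: "real \<Rightarrow> real"
  assumes "integrable (lebesgue_on {a<..<b}) q" "x \<in> {a<..<b}"
  shows "\<bar>integral {a..x} q\<bar> \<le> (LINT y|lebesgue_on {a<..<b}. \<bar>q y\<bar>)"
proof -
  have "integral {a..x} q = (LINT y|lebesgue_on {a<..<b}. q y * (if y < x then 1 else 0))"
    using integral_lebesgue_on_Ioo(1)[OF assms(1), of x] assms(2) by simp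
  also have "\<bar>\<dots>\<bar> \<le> (LINT y|lebesgue_on {a<..<b}. \<bar>q y * (if y < x then 1 else 0)\<bar>)"
    by (rule integral_abs_bound)
  also have "\<dots> \<le> (LINT y|lebesgue_on {a<..<b}. \<bar>q y\<bar>)"
  proof (rule integral_mono)
    have "integrable (lebesgue_on {a<..<b}) (\<lambda>y. q y * (if y < x then 1 else 0))"
      by (rule integrable_mult_bounded[OF assms(1) borel_measurable_lebesgue_on_borel, where B = 1]) auto
    then show "integrable (lebesgue_on {a<..<b}) (\<lambda>y. \<bar>q y * (if y < x then 1 else 0)\<bar>)" by (rule integrable_abs)
  qed (use assms(1) in \<open>auto simp: abs_mult\<close>)
  finally show ?thesis .
qed

text \<open>The way back, used to show that recovery sequences are admissible. Square integrability
  of \<open>u\<close> follows from the uniform bound by |c| plus the integral of |q|.\<close>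

lemma H1_spaceI:
  assumes ab: "a < b" and q: "q \<in> L2_space {a<..<b}"
    and u: "AE x in lebesgue_on {a<..<b}. u x = c + integral {a..x} q"
  shows "u \<in> H1_space {a<..<b}" and "AE x in lebesgue_on {a<..<b}. weak_deriv {a<..<b} u x = q x"
proof -
  let ?L = "lebesgue_on {a<..<b}"
  interpret finite_measure ?L by (rule finite_measure_lebesgue_on_Ioo)
  note qi = L2_imp_integrable[OF q]
  have u': "AE x in ?L. u x = c + BV_primitive a q (null_measure borel) (null_measure borel) x"
    using u by (simp only: BV_primitive_null)
  note B = BV_derivI[OF ab qi finite_borel_measure_null finite_borel_measure_null lebesgue_singular_null lebesgue_singular_null u']
  have w: "is_weak_deriv {a<..<b} u q"
    using B BV_deriv_null_iff[OF integrable_imp_L1_loc[OF B(2)] integrable_imp_L1_loc[OF qi] qi] by blast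
  have "AE x in ?L. norm ((u x)\<^sup>2) \<le> (\<bar>c\<bar> + (LINT y|?L. \<bar>q y\<bar>))\<^sup>2"
  proof -
    have "AE x in ?L. x \<in> {a<..<b}" by (intro AE_I2) simp
    with u show ?thesis
    proof eventually_elim
      case (elim x)
      have "\<bar>u x\<bar> \<le> \<bar>c\<bar> + (LINT y|?L. \<bar>q y\<bar>)"
        using integral_primitive_bound[OF qi elim(2)] elim(1) by linarith
      then have "\<bar>u x\<bar>\<^sup>2 \<le> (\<bar>c\<bar> + (LINT y|?L. \<bar>q y\<bar>))\<^sup>2" by (rule power_mono) simp
      then show ?case by simp
    qed
  qed
  then have "integrable ?L (\<lambda>x. (u x)\<^sup>2)"
    by (rule integrable_const_bound) (use B(2) in measurable)
  then have "u \<in> L2_space {a<..<b}" using B(2) by (auto simp: L2_space_def)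
  then show "u \<in> H1_space {a<..<b}" using q w by (auto simp: H1_space_def)
  have "is_weak_deriv {a<..<b} u (weak_deriv {a<..<b} u)" unfolding weak_deriv_def by (rule someI[of _ q]) (rule w)
  then show "AE x in ?L. weak_deriv {a<..<b} u x = q x" by (rule weak_deriv_unique[OF ab _ w])
qed

text \<open>The density picked by \<open>approx_grad\<close> belongs to a decomposition of its own,
  which uniqueness compares with the given one.\<close>

lemma approx_grad_AE:
  assumes ab: "a < b" and D: "BV_deriv {a<..<b} u g \<sigma> \<tau>"
  shows "AE x in lebesgue_on {a<..<b}. approx_grad {a<..<b} u x = g x"
    and "\<exists>\<sigma> \<tau>. BV_deriv {a<..<b} u (approx_grad {a<..<b} u) \<sigma> \<tau>"
proof -
  show "\<exists>\<sigma> \<tau>. BV_deriv {a<..<b} u (approx_grad {a<..<b} u) \<sigma> \<tau>" (is ?E)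
    unfolding approx_grad_def by (rule someI[of _ g]) (use D in blast)
  then show "AE x in lebesgue_on {a<..<b}. approx_grad {a<..<b} u x = g x"
    using BV_deriv_unique(1)[OF ab _ D] by blast
qed

section \<open>Jumps and piecewise Sobolev functions\<close>

text \<open>The strict inequality makes it left-continuous, in agreement with
  \<open>BV_primitive\<close>, which counts mass on \<open>{..<x}\<close>.\<close>

definition step_fun :: "real set \<Rightarrow> (real \<Rightarrow> real) \<Rightarrow> real \<Rightarrow> real" where
  "step_fun J s x = (\<Sum>p\<in>J. s p * (if p < x then 1 else 0))"

text \<open>The purely atomic measure with mass \<open>f p\<close> at each point \<open>p\<close> of
  \<open>J\<close>, pushed forward to the Borel sets of the line as
  \<open>finite_borel_measure_on\<close> requires.\<close>

definition atomic_measure :: "real set \<Rightarrow> (real \<Rightarrow> real) \<Rightarrow> real measure" where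
  "atomic_measure J f = distr (point_measure J (\<lambda>p. ennreal (f p))) borel (\<lambda>x. x)"

lemma emeasure_atomic_measure:
  assumes "finite J" "\<And>p. 0 \<le> f p" "A \<in> sets borel"
  shows "emeasure (atomic_measure J f) A = ennreal (\<Sum>p\<in>A \<inter> J. f p)"
proof -
  have "(\<lambda>x. x) \<in> measurable (point_measure J (\<lambda>p. ennreal (f p))) borel"
    by (simp add: measurable_point_measure_eq1)
  then have "emeasure (atomic_measure J f) A = emeasure (point_measure J (\<lambda>p. ennreal (f p))) (A \<inter> J)"
    unfolding atomic_measure_def using assms(3) by (subst emeasure_distr) (auto simp: space_point_measure)
  also have "\<dots> = (\<Sum>p\<in>A \<inter> J. ennreal (f p))"
    by (rule emeasure_point_measure_finite) (use assms(1) in auto)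
  finally show ?thesis using assms(2) by (simp add: sum_ennreal)
qed

lemma measure_atomic_measure:
  assumes "finite J" "\<And>p. 0 \<le> f p" "A \<in> sets borel"
  shows "measure (atomic_measure J f) A = (\<Sum>p\<in>A \<inter> J. f p)"
  unfolding measure_def emeasure_atomic_measure[OF assms] using assms(2) by (simp add: sum_nonneg)

lemma finite_borel_atomic_measure:
  assumes "finite J" "\<And>p. 0 \<le> f p" "J \<subseteq> \<Omega>" "\<Omega> \<in> sets borel"
  shows "finite_borel_measure_on \<Omega> (atomic_measure J f)"
  unfolding finite_borel_measure_on_def
proof (intro conjI)
  show s: "sets (atomic_measure J f) = sets borel" by (simp add: atomic_measure_def)
  show "finite_measure (atomic_measure J f)"
    by (rule finite_measureI) (simp add: sets_eq_imp_space_eq[OF s] emeasure_atomic_measure assms(1,2))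
  have "- \<Omega> \<inter> J = {}" using assms(3) by blast
  then show "emeasure (atomic_measure J f) (- \<Omega>) = 0"
    using assms by (subst emeasure_atomic_measure) auto
qed

lemma lebesgue_singular_atomic_measure:
  assumes "finite J" "\<And>p. 0 \<le> f p"
  shows "lebesgue_singular (atomic_measure J f)"
  unfolding lebesgue_singular_def
proof (intro bexI)
  have J: "J \<in> sets borel" using assms(1) by (simp add: finite_imp_closed)
  have "- J \<inter> J = {}" by blast
  then show "emeasure (atomic_measure J f) (- J) = 0"
    using assms J by (subst emeasure_atomic_measure) auto
  show "J \<in> null_sets lborel" using assms(1) by (rule finite_imp_null_set_lborel)
qed

text \<open>\<open>BV_deriv\<close> works with two positive measures, so jump heights of either sign
  are split into positive and negative parts.\<close>

lemma atomic_measure_step_fun: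
  assumes "finite J"
  shows "measure (atomic_measure J (\<lambda>p. max (s p) 0)) {..<x} - measure (atomic_measure J (\<lambda>p. max (- s p) 0)) {..<x}
    = step_fun J s x"
proof -
  have "measure (atomic_measure J (\<lambda>p. max (s p) 0)) {..<x} - measure (atomic_measure J (\<lambda>p. max (- s p) 0)) {..<x}
    = (\<Sum>p\<in>{..<x} \<inter> J. max (s p) 0) - (\<Sum>p\<in>{..<x} \<inter> J. max (- s p) 0)"
    by (simp only: measure_atomic_measure[OF assms] max.cobounded2 lessThan_borel)
  also have "\<dots> = (\<Sum>p\<in>{..<x} \<inter> J. s p)"
    by (simp add: sum_subtractf[symmetric]) (intro sum.cong, auto)
  also have "\<dots> = step_fun J s x"
    unfolding step_fun_def using assms
    by (intro sum.mono_neutral_cong_left) auto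
  finally show ?thesis .
qed

section \<open>One-sided averages and jump points\<close>

lemma average_tendsto:
  fixes \<phi> :: "real \<Rightarrow> real"
  assumes l: "\<And>r. y r - x r = r"
    and "\<And>e. 0 < e \<Longrightarrow> eventually (\<lambda>r. integrable (lebesgue_on {x r<..<y r}) \<phi> \<and>
      (AE t in lebesgue_on {x r<..<y r}. \<bar>\<phi> t - m\<bar> \<le> e)) (at_right 0)"
  shows "((\<lambda>r. (LINT t|lebesgue_on {x r<..<y r}. \<phi> t) / r) \<longlongrightarrow> m) (at_right 0)"
proof (rule tendstoI)
  fix e :: real assume e: "0 < e"
  have e2: "0 < e / 2" using e by simp
  have "eventually (\<lambda>r. (0::real) < r) (at_right 0)" by (simp add: eventually_at_right_less)
  with assms(2)[OF e2] show "eventually (\<lambda>r. dist ((LINT t|lebesgue_on {x r<..<y r}. \<phi> t) / r) m < e) (at_right 0)"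
  proof eventually_elim
    case (elim r)
    let ?L = "lebesgue_on {x r<..<y r}"
    interpret finite_measure ?L by (rule finite_measure_lebesgue_on_Ioo)
    have r: "x r \<le> y r" using l[of r] elim by simp
    have c: "(LINT t|?L. k) = k * r" for k :: real
      using measure_lebesgue_on_Ioo[OF r] l[of r] by (simp add: mult.commute)
    from elim have ae: "AE t in ?L. \<bar>\<phi> t - m\<bar> \<le> e / 2" and i: "integrable ?L \<phi>" by blast+
    from ae have up: "AE t in ?L. \<phi> t \<le> m + e / 2" by eventually_elim linarith
    from ae have lo: "AE t in ?L. m - e / 2 \<le> \<phi> t" by eventually_elim linarith
    have "(LINT t|?L. \<phi> t) \<le> (LINT t|?L. m + e / 2)"
      by (rule integral_mono_AE[OF i _ up]) simp
    moreover have "(LINT t|?L. m - e / 2) \<le> (LINT t|?L. \<phi> t)"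
      by (rule integral_mono_AE[OF _ i lo]) simp
    ultimately have "(LINT t|?L. \<phi> t) \<le> (m + e / 2) * r" "(m - e / 2) * r \<le> (LINT t|?L. \<phi> t)"
      unfolding c .
    then have "(LINT t|?L. \<phi> t) / r \<le> m + e / 2" "m - e / 2 \<le> (LINT t|?L. \<phi> t) / r"
      using elim by (simp_all add: field_simps)
    then show ?case using e by (simp add: dist_real_def abs_less_iff)
  qed
qed

text \<open>The limit |L - k| of the means vanishes for exactly one k, so the averages in
  \<open>jump_set\<close> determine the one-sided trace.\<close>

lemma one_sided_average_left:
  fixes u w :: "real \<Rightarrow> real"
  assumes u: "integrable (lebesgue_on {a<..<b}) u" and ae: "AE x in lebesgue_on {a<..<b}. u x = w x"
    and p: "p \<in> {a<..<b}" and w: "(w \<longlongrightarrow> L) (at_left p)"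
  shows "((\<lambda>r. (LINT y|lebesgue_on {p - r<..<p}. \<bar>u y - k\<bar>) / r) \<longlongrightarrow> \<bar>L - k\<bar>) (at_right 0)"
proof (rule average_tendsto)
  fix e :: real assume e: "0 < e"
  have "eventually (\<lambda>x. dist (w x) L < e) (at_left p)" using w e by (rule tendstoD)
  moreover have "eventually (\<lambda>x. x \<in> {a<..<p}) (at_left p)"
    using p by (intro eventually_at_left_real) auto
  ultimately have "eventually (\<lambda>x. dist (w x) L < e \<and> x \<in> {a<..<p}) (at_left p)" by eventually_elim auto
  then obtain d where d: "d < p" "\<And>x. d < x \<Longrightarrow> x < p \<Longrightarrow> dist (w x) L < e \<and> x \<in> {a<..<p}"
    unfolding eventually_at_left_field by blast
  have "eventually (\<lambda>r. r \<in> {0<..<p - max a d}) (at_right 0)"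
    using d(1) p by (intro eventually_at_right_real) auto
  then show "eventually (\<lambda>r. integrable (lebesgue_on {p - r<..<p}) (\<lambda>y. \<bar>u y - k\<bar>) \<and>
      (AE t in lebesgue_on {p - r<..<p}. \<bar>\<bar>u t - k\<bar> - \<bar>L - k\<bar>\<bar> \<le> e)) (at_right 0)"
  proof eventually_elim
    case (elim r)
    interpret finite_measure "lebesgue_on {p - r<..<p}" by (rule finite_measure_lebesgue_on_Ioo)
    have sub: "{p - r<..<p} \<subseteq> {a<..<b}" using elim p by auto
    have "integrable (lebesgue_on {p - r<..<p}) u"
      by (rule integrable_lebesgue_on_subset[OF u sub]) auto
    moreover have "AE t in lebesgue. t \<in> {a<..<b} \<longrightarrow> u t = w t"
      using ae by (subst (asm) AE_restrict_space_iff) auto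
    then have "AE t in lebesgue. t \<in> {p - r<..<p} \<longrightarrow> \<bar>\<bar>u t - k\<bar> - \<bar>L - k\<bar>\<bar> \<le> e"
    proof eventually_elim
      case (elim t)
      show ?case
      proof
        assume t: "t \<in> {p - r<..<p}"
        then have "u t = w t" using elim sub by blast
        moreover have "d < t" "t < p" using t \<open>r \<in> {0<..<p - max a d}\<close> by auto
        then have "\<bar>w t - L\<bar> < e" using d(2) by (simp add: dist_real_def)
        ultimately show "\<bar>\<bar>u t - k\<bar> - \<bar>L - k\<bar>\<bar> \<le> e" by linarith
      qed
    qed
    then have "AE t in lebesgue_on {p - r<..<p}. \<bar>\<bar>u t - k\<bar> - \<bar>L - k\<bar>\<bar> \<le> e"
      by (subst AE_restrict_space_iff) auto
    ultimately show ?case by simp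
  qed
qed simp

lemma one_sided_average_right:
  fixes u w :: "real \<Rightarrow> real"
  assumes u: "integrable (lebesgue_on {a<..<b}) u" and ae: "AE x in lebesgue_on {a<..<b}. u x = w x"
    and p: "p \<in> {a<..<b}" and w: "(w \<longlongrightarrow> L) (at_right p)"
  shows "((\<lambda>r. (LINT y|lebesgue_on {p<..<p + r}. \<bar>u y - k\<bar>) / r) \<longlongrightarrow> \<bar>L - k\<bar>) (at_right 0)"
proof (rule average_tendsto)
  fix e :: real assume e: "0 < e"
  have "eventually (\<lambda>x. dist (w x) L < e) (at_right p)" using w e by (rule tendstoD)
  moreover have "eventually (\<lambda>x. x \<in> {p<..<b}) (at_right p)"
    using p by (intro eventually_at_right_real) auto
  ultimately have "eventually (\<lambda>x. dist (w x) L < e \<and> x \<in> {p<..<b}) (at_right p)" by eventually_elim auto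
  then obtain d where d: "p < d" "\<And>x. p < x \<Longrightarrow> x < d \<Longrightarrow> dist (w x) L < e \<and> x \<in> {p<..<b}"
    unfolding eventually_at_right_field by blast
  have "eventually (\<lambda>r. r \<in> {0<..<min b d - p}) (at_right 0)"
    using d(1) p by (intro eventually_at_right_real) auto
  then show "eventually (\<lambda>r. integrable (lebesgue_on {p<..<p + r}) (\<lambda>y. \<bar>u y - k\<bar>) \<and>
      (AE t in lebesgue_on {p<..<p + r}. \<bar>\<bar>u t - k\<bar> - \<bar>L - k\<bar>\<bar> \<le> e)) (at_right 0)"
  proof eventually_elim
    case (elim r)
    interpret finite_measure "lebesgue_on {p<..<p + r}" by (rule finite_measure_lebesgue_on_Ioo)
    have sub: "{p<..<p + r} \<subseteq> {a<..<b}" using elim p by auto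
    have "integrable (lebesgue_on {p<..<p + r}) u"
      by (rule integrable_lebesgue_on_subset[OF u sub]) auto
    moreover have "AE t in lebesgue. t \<in> {a<..<b} \<longrightarrow> u t = w t"
      using ae by (subst (asm) AE_restrict_space_iff) auto
    then have "AE t in lebesgue. t \<in> {p<..<p + r} \<longrightarrow> \<bar>\<bar>u t - k\<bar> - \<bar>L - k\<bar>\<bar> \<le> e"
    proof eventually_elim
      case (elim t)
      show ?case
      proof
        assume t: "t \<in> {p<..<p + r}"
        then have "u t = w t" using elim sub by blast
        moreover have "t < d" "p < t" using t \<open>r \<in> {0<..<min b d - p}\<close> by auto
        then have "\<bar>w t - L\<bar> < e" using d(2) by (simp add: dist_real_def)
        ultimately show "\<bar>\<bar>u t - k\<bar> - \<bar>L - k\<bar>\<bar> \<le> e" by linarith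
      qed
    qed
    then have "AE t in lebesgue_on {p<..<p + r}. \<bar>\<bar>u t - k\<bar> - \<bar>L - k\<bar>\<bar> \<le> e"
      by (subst AE_restrict_space_iff) auto
    ultimately show ?case by simp
  qed
qed simp

text \<open>The averages in \<open>jump_set\<close> vanish in the limit only if the two traces are
  \<open>L\<close> and \<open>R\<close>, so the existence of two different traces is the inequality
  of these limits.\<close>

lemma jump_set_iff:
  assumes u: "integrable (lebesgue_on {a<..<b}) u" and ae: "AE x in lebesgue_on {a<..<b}. u x = w x"
    and p: "p \<in> {a<..<b}" and w: "(w \<longlongrightarrow> L) (at_left p)" "(w \<longlongrightarrow> R) (at_right p)"
  shows "p \<in> jump_set {a<..<b} u \<longleftrightarrow> L \<noteq> R"
proof -
  note l = one_sided_average_left[OF u ae p w(1)]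
  note r = one_sided_average_right[OF u ae p w(2)]
  have nb: "at_right (0::real) \<noteq> bot" by simp
  have 1: "((\<lambda>r. (LINT y|lebesgue_on {p - r<..<p}. \<bar>u y - k\<bar>) / r) \<longlongrightarrow> 0) (at_right 0) \<longleftrightarrow> k = L" for k
    using tendsto_unique[OF nb l[of k], of 0] l[of k] by auto
  have 2: "((\<lambda>r. (LINT y|lebesgue_on {p<..<p + r}. \<bar>u y - k\<bar>) / r) \<longlongrightarrow> 0) (at_right 0) \<longleftrightarrow> k = R" for k
    using tendsto_unique[OF nb r[of k], of 0] r[of k] by auto
  show ?thesis using p unfolding jump_set_def mem_Collect_eq 1 2 by blast
qed

lemma step_fun_left: "(step_fun J s \<longlongrightarrow> step_fun J s p) (at_left p)"
proof -
  have "((\<lambda>x. \<Sum>q\<in>J. s q * (if q < x then 1 else 0)) \<longlongrightarrow> (\<Sum>q\<in>J. s q * (if q < p then 1 else 0))) (at_left p)"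
  proof (intro tendsto_intros)
    fix q
    show "((\<lambda>x. if q < x then 1 else 0 :: real) \<longlongrightarrow> (if q < p then 1 else 0)) (at_left p)"
    proof (cases "q < p")
      case True
      have "eventually (\<lambda>x. x \<in> {q<..<p}) (at_left p)" using True by (rule eventually_at_left_real)
      then show ?thesis using True by (intro tendsto_eventually) (auto elim: eventually_mono)
    next
      case False
      have "eventually (\<lambda>x. x \<in> {p - 1<..<p}) (at_left p)" by (rule eventually_at_left_real) simp
      then show ?thesis using False by (intro tendsto_eventually) (auto elim!: eventually_mono)
    qed
  qed
  then show ?thesis by (simp add: step_fun_def[abs_def])
qed

lemma step_fun_right:
  assumes "finite J"
  shows "(step_fun J s \<longlongrightarrow> step_fun J s p + (if p \<in> J then s p else 0)) (at_right p)"
proof -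
  have "((\<lambda>x. \<Sum>q\<in>J. s q * (if q < x then 1 else 0)) \<longlongrightarrow> (\<Sum>q\<in>J. s q * (if q \<le> p then 1 else 0))) (at_right p)"
  proof (intro tendsto_intros)
    fix q
    show "((\<lambda>x. if q < x then 1 else 0 :: real) \<longlongrightarrow> (if q \<le> p then 1 else 0)) (at_right p)"
    proof (cases "q \<le> p")
      case True
      have "eventually (\<lambda>x. x \<in> {p<..<p + 1}) (at_right p)" by (rule eventually_at_right_real) simp
      then show ?thesis using True by (intro tendsto_eventually) (auto elim!: eventually_mono)
    next
      case False
      then have "eventually (\<lambda>x. x \<in> {p<..<q}) (at_right p)" by (intro eventually_at_right_real) simp
      then show ?thesis using False by (intro tendsto_eventually) (auto elim!: eventually_mono)
    qed
  qed
  also have "(\<Sum>q\<in>J. s q * (if q \<le> p then 1 else 0)) = (\<Sum>q\<in>J. s q * (if q < p then 1 else 0) + (if q = p then s q else 0))"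
    by (intro sum.cong) auto
  also have "\<dots> = step_fun J s p + (if p \<in> J then s p else 0)"
    using assms by (simp add: sum.distrib step_fun_def)
  finally show ?thesis by (simp add: step_fun_def[abs_def])
qed

section \<open>Functions with finitely many jumps\<close>

lemma primitive_continuous:
  fixes g :: "real \<Rightarrow> real"
  assumes "integrable (lebesgue_on {a<..<b}) g" "a \<le> b"
  shows "continuous_on {a..b} (\<lambda>x. integral {a..x} g)"
  using integral_lebesgue_on_Ioo(2)[OF assms(1), of b] assms(2)
  by (intro indefinite_integral_continuous_1 set_lebesgue_integral_eq_integral(1)) auto

text \<open>The form of an \<open>SBV\<close> function with finitely many jumps.\<close>

definition pw_sobolev :: "real \<Rightarrow> real \<Rightarrow> (real \<Rightarrow> real) \<Rightarrow> real \<Rightarrow> (real \<Rightarrow> real) \<Rightarrow> real set \<Rightarrow> (real \<Rightarrow> real) \<Rightarrow> bool" where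
  "pw_sobolev a b u c g J s \<longleftrightarrow> integrable (lebesgue_on {a<..<b}) g \<and> finite J \<and> J \<subseteq> {a<..<b} \<and>
    (AE x in lebesgue_on {a<..<b}. u x = c + integral {a..x} g + step_fun J s x)"

text \<open>The jumps are encoded in two atomic measures, which gives one decomposition explicitly;
  uniqueness transfers its properties to all others. Points of \<open>J\<close> with height 0 drop
  out of the jump set.\<close>

lemma pw_sobolev_SBV:
  assumes ab: "a < b" and pw: "pw_sobolev a b u c g J s"
  shows "u \<in> SBV_space {a<..<b}" and "jump_set {a<..<b} u = {p\<in>J. s p \<noteq> 0}"
    and "AE x in lebesgue_on {a<..<b}. approx_grad {a<..<b} u x = g x"
proof -
  let ?L = "lebesgue_on {a<..<b}"
  let ?\<sigma> = "atomic_measure J (\<lambda>p. max (s p) 0)" and ?\<tau> = "atomic_measure J (\<lambda>p. max (- s p) 0)"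
  have g: "integrable ?L g" and J: "finite J" "J \<subseteq> {a<..<b}"
    and u: "AE x in ?L. u x = c + integral {a..x} g + step_fun J s x"
    using pw by (auto simp: pw_sobolev_def)
  have m: "finite_borel_measure_on {a<..<b} ?\<sigma>" "finite_borel_measure_on {a<..<b} ?\<tau>"
    using J by (auto intro!: finite_borel_atomic_measure)
  have sing: "lebesgue_singular ?\<sigma>" "lebesgue_singular ?\<tau>"
    using J by (auto intro!: lebesgue_singular_atomic_measure)
  have u': "AE x in ?L. u x = c + BV_primitive a g ?\<sigma> ?\<tau> x"
    using u unfolding BV_primitive_def atomic_measure_step_fun[OF J(1)] by (simp only: add.assoc)
  note D = BV_derivI[OF ab g m sing u']
  show "AE x in ?L. approx_grad {a<..<b} u x = g x" by (rule approx_grad_AE(1)[OF ab D(1)])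
  show jump: "jump_set {a<..<b} u = {p\<in>J. s p \<noteq> 0}"
  proof (rule set_eqI)
    fix p
    show "p \<in> jump_set {a<..<b} u \<longleftrightarrow> p \<in> {p\<in>J. s p \<noteq> 0}"
    proof (cases "p \<in> {a<..<b}")
      case True
      let ?w = "\<lambda>x. c + integral {a..x} g + step_fun J s x"
      have "isCont (\<lambda>x. integral {a..x} g) p"
        using continuous_on_interior[OF primitive_continuous[OF g]] True ab by simp
      then have G: "((\<lambda>x. integral {a..x} g) \<longlongrightarrow> integral {a..p} g) (at p)" by (simp add: isCont_def)
      have "(?w \<longlongrightarrow> c + integral {a..p} g + step_fun J s p) (at_left p)"
        by (intro tendsto_add tendsto_const step_fun_left filterlim_at_split[THEN iffD1, THEN conjunct1, OF G])
      moreover have "(?w \<longlongrightarrow> c + integral {a..p} g + (step_fun J s p + (if p \<in> J then s p else 0))) (at_right p)"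
        by (intro tendsto_add tendsto_const step_fun_right J filterlim_at_split[THEN iffD1, THEN conjunct2, OF G])
      ultimately show ?thesis using jump_set_iff[OF D(2) u True] by auto
    next
      case False
      then show ?thesis using J(2) by (auto simp: jump_set_def)
    qed
  qed
  have "measure \<sigma>' A = measure \<tau>' A"
    if D': "BV_deriv {a<..<b} u g' \<sigma>' \<tau>'" and A: "A \<in> sets borel" "A \<subseteq> {a<..<b} - jump_set {a<..<b} u" for g' \<sigma>' \<tau>' A
  proof -
    have "measure \<sigma>' A - measure \<tau>' A = measure ?\<sigma> A - measure ?\<tau> A"
      by (rule BV_deriv_unique(2)[OF ab D' D(1) A(1)])
    also have "\<dots> = (\<Sum>p\<in>A \<inter> J. max (s p) 0) - (\<Sum>p\<in>A \<inter> J. max (- s p) 0)"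
      using measure_atomic_measure[OF J(1) _ A(1), of "\<lambda>p. max (s p) 0"]
        measure_atomic_measure[OF J(1) _ A(1), of "\<lambda>p. max (- s p) 0"] by (simp only: max.cobounded2)
    also have "\<dots> = 0"
    proof -
      have "s p = 0" if "p \<in> A \<inter> J" for p using that A(2) jump by blast
      then show ?thesis by simp
    qed
    finally show ?thesis by simp
  qed
  moreover have "u \<in> BV_space {a<..<b}" using D unfolding BV_space_def L1_space_def by blast
  ultimately show "u \<in> SBV_space {a<..<b}" unfolding SBV_space_def by blast
qed

text \<open>Off the jump set the two singular measures cancel, so a finite jump set leaves finitely
  many atoms, whose net masses are the jump heights.\<close>

lemma SBV_pw_sobolev:
  assumes ab: "a < b" and u: "u \<in> SBV_space {a<..<b}" and J: "finite (jump_set {a<..<b} u)"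
  shows "\<exists>c s. pw_sobolev a b u c (approx_grad {a<..<b} u) (jump_set {a<..<b} u) s"
proof -
  let ?L = "lebesgue_on {a<..<b}" and ?J = "jump_set {a<..<b} u" and ?g = "approx_grad {a<..<b} u"
  have ui: "integrable ?L u" using u by (auto simp: SBV_space_def BV_space_def L1_space_def)
  obtain g0 \<sigma>0 \<tau>0 where "BV_deriv {a<..<b} u g0 \<sigma>0 \<tau>0" using u by (auto simp: SBV_space_def BV_space_def)
  from approx_grad_AE(2)[OF ab this] obtain \<sigma> \<tau> where D: "BV_deriv {a<..<b} u ?g \<sigma> \<tau>" by blast
  have g: "integrable ?L ?g" and m: "finite_borel_measure_on {a<..<b} \<sigma>" "finite_borel_measure_on {a<..<b} \<tau>"
    using D unfolding BV_deriv_def L1_space_def by blast+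
  have off: "measure \<sigma> A = measure \<tau> A" if "A \<in> sets borel" "A \<subseteq> {a<..<b} - ?J" for A
    using u D that unfolding SBV_space_def by blast
  have Jb: "?J \<in> sets borel" using J by (simp add: finite_imp_closed)
  define s where "s = (\<lambda>p. measure \<sigma> {p} - measure \<tau> {p})"
  have split: "measure \<mu> {..<x} = measure \<mu> (({..<x} - ?J) \<inter> {a<..<b}) + (\<Sum>p\<in>{..<x} \<inter> ?J. measure \<mu> {p})"
    if \<mu>: "finite_borel_measure_on {a<..<b} \<mu>" for \<mu> x
  proof -
    have sb: "sets \<mu> = sets borel" using \<mu> by (auto simp: finite_borel_measure_on_def)
    interpret finite_measure \<mu> using \<mu> by (auto simp: finite_borel_measure_on_def)
    have "measure \<mu> (({..<x} - ?J) \<union> ({..<x} \<inter> ?J)) = measure \<mu> ({..<x} - ?J) + measure \<mu> ({..<x} \<inter> ?J)"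
      by (rule finite_measure_Union) (use sb Jb in auto)
    moreover have "({..<x} - ?J) \<union> ({..<x} \<inter> ?J) = {..<x}" by blast
    moreover have "measure \<mu> ({..<x} - ?J) = measure \<mu> (({..<x} - ?J) \<inter> {a<..<b})"
      by (rule finite_borel_measure_Int[OF \<mu>]) (use Jb in auto)
    moreover have "measure \<mu> ({..<x} \<inter> ?J) = (\<Sum>p\<in>{..<x} \<inter> ?J. measure \<mu> {p})"
      by (rule finite_measure_eq_sum_singleton) (use J sb in auto)
    ultimately show ?thesis by (simp only:)
  qed
  have P: "BV_primitive a ?g \<sigma> \<tau> x = integral {a..x} ?g + step_fun ?J s x" for x
  proof -
    have "measure \<sigma> (({..<x} - ?J) \<inter> {a<..<b}) = measure \<tau> (({..<x} - ?J) \<inter> {a<..<b})"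
      by (rule off) (use Jb in auto)
    then have "measure \<sigma> {..<x} - measure \<tau> {..<x} = (\<Sum>p\<in>{..<x} \<inter> ?J. s p)"
      unfolding split[OF m(1)] split[OF m(2)] s_def by (simp only: sum_subtractf)
    also have "\<dots> = step_fun ?J s x"
      unfolding step_fun_def using J by (intro sum.mono_neutral_cong_left) auto
    finally show ?thesis by (simp only: BV_primitive_def)
  qed
  obtain c where "AE x in ?L. u x = c + BV_primitive a ?g \<sigma> \<tau> x" using BV_deriv_representation[OF ab ui D] by blast
  then have "AE x in ?L. u x = c + integral {a..x} ?g + step_fun ?J s x" unfolding P by (simp only: add.assoc)
  moreover have "?J \<subseteq> {a<..<b}" by (auto simp: jump_set_def)
  ultimately show ?thesis using g J unfolding pw_sobolev_def by blast
qed

section \<open>Lower semicontinuity and weak limits\<close>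

lemma fatou_real:
  fixes F :: "nat \<Rightarrow> 'a \<Rightarrow> real"
  assumes F: "\<And>n. integrable M (F n)" "\<And>n. AE x in M. 0 \<le> F n x"
    and C: "eventually (\<lambda>n. (LINT x|M. F n x) \<le> C) sequentially"
    and G: "G \<in> borel_measurable M" "AE x in M. (\<lambda>n. F n x) \<longlonglongrightarrow> G x"
  shows "integrable M G" and "(LINT x|M. G x) \<le> C"
proof -
  have [measurable]: "F n \<in> borel_measurable M" for n using F(1) by simp
  have all: "AE x in M. \<forall>n. 0 \<le> F n x" using F(2) by (intro AE_all_countable[THEN iffD2] allI)
  have G0: "AE x in M. 0 \<le> G x"
    using all G(2) by eventually_elim (auto intro: LIMSEQ_le_const)
  have C0: "0 \<le> C"
  proof -
    obtain n where "(LINT x|M. F n x) \<le> C" using C by (auto simp: eventually_sequentially)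
    moreover have "0 \<le> (LINT x|M. F n x)" by (rule integral_nonneg_AE[OF F(2)])
    ultimately show ?thesis by linarith
  qed
  have "(\<integral>\<^sup>+x. ennreal (G x) \<partial>M) = (\<integral>\<^sup>+x. liminf (\<lambda>n. ennreal (F n x)) \<partial>M)"
  proof (rule nn_integral_cong_AE)
    show "AE x in M. ennreal (G x) = liminf (\<lambda>n. ennreal (F n x))"
      using G(2)
    proof eventually_elim
      case (elim x)
      then have "(\<lambda>n. ennreal (F n x)) \<longlonglongrightarrow> ennreal (G x)" by (intro tendsto_ennrealI)
      then show ?case by (simp add: lim_imp_Liminf)
    qed
  qed
  also have "\<dots> \<le> liminf (\<lambda>n. \<integral>\<^sup>+x. ennreal (F n x) \<partial>M)"
    by (rule nn_integral_liminf) measurable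
  also have "\<dots> \<le> liminf (\<lambda>n::nat. ennreal C)"
  proof (rule Liminf_mono)
    show "eventually (\<lambda>n. (\<integral>\<^sup>+x. ennreal (F n x) \<partial>M) \<le> ennreal C) sequentially"
      using C by eventually_elim (use F in \<open>simp add: nn_integral_eq_integral ennreal_leI\<close>)
  qed
  also have "\<dots> = ennreal C" by (rule Liminf_const) simp
  finally have le: "(\<integral>\<^sup>+x. ennreal (G x) \<partial>M) \<le> ennreal C" .
  show GI: "integrable M G"
    by (rule integrableI_nonneg[OF G(1) G0 le_less_trans[OF le]]) simp
  show "(LINT x|M. G x) \<le> C"
    using le C0 by (subst (asm) nn_integral_eq_integral[OF GI G0]) simp
qed

lemma integrable_square_add:
  fixes f g :: "'a \<Rightarrow> real"
  assumes "f \<in> borel_measurable M" "g \<in> borel_measurable M" "integrable M (\<lambda>x. (f x)\<^sup>2)" "integrable M (\<lambda>x. (g x)\<^sup>2)"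
  shows "integrable M (\<lambda>x. (\<alpha> * f x + \<beta> * g x)\<^sup>2)"
proof (rule Bochner_Integration.integrable_bound)
  show "integrable M (\<lambda>x. 2 * \<alpha>\<^sup>2 * (f x)\<^sup>2 + 2 * \<beta>\<^sup>2 * (g x)\<^sup>2)" using assms by simp
  show "(\<lambda>x. (\<alpha> * f x + \<beta> * g x)\<^sup>2) \<in> borel_measurable M" using assms by measurable
  have "(s + t)\<^sup>2 \<le> 2 * s\<^sup>2 + 2 * t\<^sup>2" for s t :: real
    using zero_le_power2[of "s - t"] by (simp add: power2_sum power2_diff)
  then have "(\<alpha> * f x + \<beta> * g x)\<^sup>2 \<le> 2 * \<alpha>\<^sup>2 * (f x)\<^sup>2 + 2 * \<beta>\<^sup>2 * (g x)\<^sup>2" for x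
    by (simp only: power_mult_distrib[symmetric] mult.assoc)
  then show "AE x in M. norm ((\<alpha> * f x + \<beta> * g x)\<^sup>2) \<le> norm (2 * \<alpha>\<^sup>2 * (f x)\<^sup>2 + 2 * \<beta>\<^sup>2 * (g x)\<^sup>2)"
    by (intro AE_I2) (simp add: abs_of_nonneg)
qed

text \<open>Young's inequality |t| \<le> t^2/(2s) + s/2 with a free weight \<open>s\<close>: on a
  finite measure space a small L2 norm makes the L1 norm small for a suitable
  \<open>s\<close>.\<close>

lemma (in finite_measure) integrable_square_bound:
  fixes f :: "'a \<Rightarrow> real"
  assumes f: "f \<in> borel_measurable M" "integrable M (\<lambda>x. (f x)\<^sup>2)"
  shows "integrable M f" and "0 < s \<Longrightarrow> (LINT x|M. \<bar>f x\<bar>) \<le> (LINT x|M. (f x)\<^sup>2) / (2 * s) + s / 2 * measure M (space M)"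
proof -
  have ineq: "\<bar>t\<bar> \<le> t\<^sup>2 / (2 * s) + s / 2" if "0 < s" for s t :: real
  proof -
    have "0 \<le> (\<bar>t\<bar> - s)\<^sup>2" by simp
    then have "2 * s * \<bar>t\<bar> \<le> t\<^sup>2 + s\<^sup>2" by (simp add: power2_diff mult_ac)
    then show ?thesis using that by (simp add: field_simps power2_eq_square)
  qed
  have i: "integrable M (\<lambda>x. (f x)\<^sup>2 / (2 * s) + s / 2)" for s using f(2) by simp
  show fi: "integrable M f"
  proof (rule Bochner_Integration.integrable_bound[OF i[of 1] f(1)])
    show "AE x in M. norm (f x) \<le> norm ((f x)\<^sup>2 / (2 * 1) + 1 / 2)"
      using ineq[of 1] by (intro AE_I2) (simp add: abs_of_nonneg)
  qed
  show "(LINT x|M. \<bar>f x\<bar>) \<le> (LINT x|M. (f x)\<^sup>2) / (2 * s) + s / 2 * measure M (space M)" if s: "0 < s"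
  proof -
    have "(LINT x|M. \<bar>f x\<bar>) \<le> (LINT x|M. (f x)\<^sup>2 / (2 * s) + s / 2)"
      by (rule integral_mono) (use fi i ineq[OF s] in auto)
    also have "\<dots> = (LINT x|M. (f x)\<^sup>2) / (2 * s) + s / 2 * measure M (space M)"
      using f(2) by simp
    finally show ?thesis .
  qed
qed

text \<open>
  A substitute for weak sequential compactness: near-minimisers of the norm over nested convex sets
  form a Cauchy sequence by the parallelogram identity.
\<close>

lemma (in finite_measure) L2_weak_limit:
  fixes h :: "nat \<Rightarrow> 'a \<Rightarrow> real" and T :: "('a \<Rightarrow> real) set" and \<alpha> :: "('a \<Rightarrow> real) \<Rightarrow> real"
  assumes h: "\<And>j. h j \<in> borel_measurable M" "\<And>j. integrable M (\<lambda>x. (h j x)\<^sup>2)" "\<And>j. (LINT x|M. (h j x)\<^sup>2) \<le> C"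
    and T: "\<And>k. k \<in> T \<Longrightarrow> k \<in> borel_measurable M" "\<And>k x. k \<in> T \<Longrightarrow> \<bar>k x\<bar> \<le> 1"
    and conv: "\<And>k. k \<in> T \<Longrightarrow> (\<lambda>j. LINT x|M. h j x * k x) \<longlonglongrightarrow> \<alpha> k"
  shows "\<exists>g. g \<in> borel_measurable M \<and> integrable M (\<lambda>x. (g x)\<^sup>2) \<and> (LINT x|M. (g x)\<^sup>2) \<le> C \<and>
    (\<forall>k\<in>T. (LINT x|M. g x * k x) = \<alpha> k)"
proof -
  define N where "N = (\<lambda>f. LINT x|M. (f x)\<^sup>2 :: real)"
  define L2 where "L2 = {f \<in> borel_measurable M. integrable M (\<lambda>x. (f x)\<^sup>2 :: real)}"
  \<comment> \<open>\<open>K n\<close> collects the functions with \<open>N f \<le> C\<close> that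
    satisfy every error bound shared by all \<open>h j\<close> with j \<ge> n. These sets are convex
    and decrease with n, and \<open>h n\<close> lies in \<open>K n\<close>.\<close>
  define K where "K = (\<lambda>n. {f \<in> L2. N f \<le> C \<and> (\<forall>k\<in>T. \<forall>e. (\<forall>j\<ge>n. \<bar>(LINT x|M. h j x * k x) - \<alpha> k\<bar> \<le> e)
      \<longrightarrow> \<bar>(LINT x|M. f x * k x) - \<alpha> k\<bar> \<le> e)})"
  have L2i: "integrable M f" if "f \<in> L2" for f
  proof -
    from that have "f \<in> borel_measurable M" "integrable M (\<lambda>x. (f x)\<^sup>2)" unfolding L2_def by blast+
    then show ?thesis by (rule integrable_square_bound(1))
  qed
  have L2k: "integrable M (\<lambda>x. f x * k x)" if "f \<in> L2" "k \<in> T" for f k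
    by (rule integrable_mult_bounded[where B = 1, OF L2i[OF that(1)] T(1)[OF that(2)]]) (rule T(2)[OF that(2)])
  have N0: "0 \<le> N f" for f by (simp add: N_def)
  have hL2: "h n \<in> L2" for n unfolding L2_def using h(1,2) by blast
  have hC: "N (h n) \<le> C" for n unfolding N_def by (rule h(3))
  have hK: "h n \<in> K n" for n unfolding K_def using hL2 hC by blast
  have Kmono: "f \<in> K m" if "f \<in> K n" "m \<le> n" for f m n
    using that(1) order_trans[OF that(2)] unfolding K_def by blast
  \<comment> \<open>The infima increase because the sets shrink, and they stay below
    \<open>C\<close>; their convergence is what brings near-minimisers close together.\<close>
  define m where "m = (\<lambda>n. Inf (N ` K n))"
  have bb: "bdd_below (N ` K n)" for n by (rule bdd_belowI[of _ 0]) (use N0 in auto)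
  have ne: "N ` K n \<noteq> {}" for n using hK by blast
  have mle: "m n \<le> N f" if "f \<in> K n" for f n
    unfolding m_def by (rule cInf_lower[OF _ bb]) (use that in blast)
  have mC: "m n \<le> C" for n using mle[OF hK, of n] hC[of n] by linarith
  have minc: "incseq m"
  proof (rule incseq_SucI)
    fix n
    show "m n \<le> m (Suc n)" unfolding m_def
      by (rule cInf_superset_mono[OF ne bb]) (use Kmono in auto)
  qed
  obtain L where L: "m \<longlonglongrightarrow> L" "\<And>n. m n \<le> L"
    using incseq_convergent[OF minc] mC by auto
  have "\<exists>f. f \<in> K n \<and> N f < m n + 1 / real (Suc n)" for n
  proof -
    have "Inf (N ` K n) < m n + 1 / real (Suc n)" by (simp add: m_def)
    from cInf_lessD[OF ne this] show ?thesis by auto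
  qed
  then obtain f where f: "\<And>n. f n \<in> K n" "\<And>n. N (f n) < m n + 1 / real (Suc n)" by metis
  have fL2: "f n \<in> L2" for n using f(1) unfolding K_def by blast
  have fm[measurable]: "f n \<in> borel_measurable M" for n using fL2 by (auto simp: L2_def)
  have f2: "integrable M (\<lambda>x. (f n x)\<^sup>2)" for n using fL2 by (auto simp: L2_def)
  \<comment> \<open>The midpoint of \<open>f n\<close> and \<open>f p\<close> lies in
    \<open>K n\<close>, so the parallelogram identity bounds the squared distance by 2 N(f n) + 2
    N(f p) - 4 m(n). Near-minimality and \<open>m p \<le> L\<close> turn this into
    \<open>d n\<close>.\<close>
  define d where "d = (\<lambda>n. 2 * (L - m n) + 4 / real (Suc n))"
  have dlim: "d \<longlonglongrightarrow> 0"
  proof -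
    have "d \<longlonglongrightarrow> 2 * (L - L) + 4 * 0"
      unfolding d_def using LIMSEQ_inverse_real_of_nat
      by (intro tendsto_intros L) (simp add: divide_inverse tendsto_mult_right_zero)
    then show ?thesis by simp
  qed
  have i2: "integrable M (\<lambda>x. (f n x - f p x)\<^sup>2)" for n p
    using integrable_square_add[OF fm fm f2 f2, of 1 n "-1" p] by simp
  have key: "N (\<lambda>x. f n x - f p x) \<le> d n" if np: "n \<le> p" for n p
  proof -
    let ?mid = "\<lambda>x. (1/2) * f n x + (1/2) * f p x"
    have im: "integrable M (\<lambda>x. (?mid x)\<^sup>2)" by (rule integrable_square_add[OF fm fm f2 f2])
    have mL2: "?mid \<in> L2" using im unfolding L2_def by simp
    have "N (\<lambda>x. f n x - f p x) + 4 * N ?mid = (LINT x|M. (f n x - f p x)\<^sup>2 + 4 * (?mid x)\<^sup>2)"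
      unfolding N_def using i2 im by (simp only: Bochner_Integration.integral_add integral_mult_right_zero integrable_mult_right)
    also have "\<dots> = (LINT x|M. 2 * (f n x)\<^sup>2 + 2 * (f p x)\<^sup>2)"
      by (rule Bochner_Integration.integral_cong) (auto simp: power2_eq_square algebra_simps)
    also have "\<dots> = 2 * N (f n) + 2 * N (f p)"
      unfolding N_def using f2 by (simp only: Bochner_Integration.integral_add integral_mult_right_zero integrable_mult_right)
    finally have par: "N (\<lambda>x. f n x - f p x) + 4 * N ?mid = 2 * N (f n) + 2 * N (f p)" .
    have fpK: "f p \<in> K n" using Kmono[OF f(1) np] .
    have "?mid \<in> K n"
    proof -
      have "N ?mid \<le> C"
      proof -
        have "N (f n) \<le> C" "N (f p) \<le> C" using f(1)[of n] fpK unfolding K_def by blast+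
        then show ?thesis using par N0[of "\<lambda>x. f n x - f p x"] by linarith
      qed
      moreover have "\<bar>(LINT x|M. ?mid x * k x) - \<alpha> k\<bar> \<le> e"
        if k: "k \<in> T" and e: "\<forall>j\<ge>n. \<bar>(LINT x|M. h j x * k x) - \<alpha> k\<bar> \<le> e" for k e
      proof -
        have "(LINT x|M. ?mid x * k x) = (LINT x|M. (1/2) * (f n x * k x) + (1/2) * (f p x * k x))"
          by (simp add: algebra_simps)
        also have "\<dots> = (1/2) * (LINT x|M. f n x * k x) + (1/2) * (LINT x|M. f p x * k x)"
          using L2k[OF fL2 k] by simp
        moreover have "\<bar>(LINT x|M. f n x * k x) - \<alpha> k\<bar> \<le> e" "\<bar>(LINT x|M. f p x * k x) - \<alpha> k\<bar> \<le> e"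
          using f(1)[of n] fpK k e unfolding K_def by blast+
        ultimately show ?thesis by (simp add: abs_le_iff)
      qed
      ultimately show ?thesis using mL2 unfolding K_def by blast
    qed
    then have "m n \<le> N ?mid" by (rule mle)
    moreover have "1 / real (Suc p) \<le> 1 / real (Suc n)" using np by (simp add: divide_left_mono)
    moreover have "D \<le> 2 * (L - s) + 4 * q"
      if "s \<le> t" "q' \<le> q" "D + 4 * t = 2 * y + 2 * z" "y < s + q" "z < s' + q'" "s' \<le> L" for D s t q q' y z s' :: real
      using that by argo
    ultimately have "N (\<lambda>x. f n x - f p x) \<le> 2 * (L - m n) + 4 * (1 / real (Suc n))"
      using par f(2)[of n] f(2)[of p] L(2)[of p] by blast
    then show ?thesis unfolding d_def by simp
  qed
  have L1: "\<exists>n0. \<forall>n\<ge>n0. \<forall>F. F \<in> borel_measurable M \<longrightarrow> integrable M (\<lambda>x. (F x)\<^sup>2) \<longrightarrow> N F \<le> d n \<longrightarrow> (LINT x|M. \<bar>F x\<bar>) < e"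
    if e: "0 < e" for e
  proof -
    \<comment> \<open>With this weight the term \<open>s / 2 * measure M (space M)\<close> is at
      most e/2; the added 1 avoids a division by 0.\<close>
    define s where "s = e / (measure M (space M) + 1)"
    have s: "0 < s" using e by (simp add: s_def add_nonneg_pos)
    have sM: "s / 2 * measure M (space M) \<le> e / 2"
    proof -
      have "s * measure M (space M) \<le> s * (measure M (space M) + 1)" using s by simp
      also have "\<dots> = e" by (simp add: s_def add_nonneg_eq_0_iff)
      finally show ?thesis by simp
    qed
    have "eventually (\<lambda>n. d n < s * e) sequentially"
      using dlim s e by (intro order_tendstoD) auto
    then obtain n0 where n0: "\<And>n. n \<ge> n0 \<Longrightarrow> d n < s * e" by (auto simp: eventually_sequentially)
    have "(LINT x|M. \<bar>F x\<bar>) < e" if "n \<ge> n0" "F \<in> borel_measurable M" "integrable M (\<lambda>x. (F x)\<^sup>2)" "N F \<le> d n" for n F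
    proof -
      have "(LINT x|M. \<bar>F x\<bar>) \<le> N F / (2 * s) + s / 2 * measure M (space M)"
        unfolding N_def by (rule integrable_square_bound(2)[OF that(2,3) s])
      moreover have "N F / (2 * s) < e / 2" using that(4) n0[OF that(1)] s by (simp add: field_simps)
      ultimately show ?thesis using sM by linarith
    qed
    then show ?thesis by blast
  qed
  have cau: "\<exists>n0. \<forall>i\<ge>n0. \<forall>j\<ge>n0. (LINT x|M. norm (f i x - f j x)) < e" if e: "0 < e" for e
  proof -
    obtain n0 where n0: "\<And>n F. n \<ge> n0 \<Longrightarrow> F \<in> borel_measurable M \<Longrightarrow> integrable M (\<lambda>x. (F x)\<^sup>2) \<Longrightarrow> N F \<le> d n \<Longrightarrow> (LINT x|M. \<bar>F x\<bar>) < e"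
      using L1[OF e] by blast
    have lt: "(LINT x|M. \<bar>f i x - f j x\<bar>) < e" if "i \<ge> n0" "i \<le> j" for i j
      by (rule n0[OF that(1) _ i2 key[OF that(2)]]) measurable
    have "(LINT x|M. \<bar>f i x - f j x\<bar>) < e" if "i \<ge> n0" "j \<ge> n0" for i j
      using lt[of i j] lt[of j i] that by (cases "i \<le> j") (auto simp: abs_minus_commute)
    then show ?thesis by auto
  qed
  \<comment> \<open>A Cauchy sequence in L1 has a subsequence that converges almost everywhere;
    Fatou then bounds both the norm of the limit and its distance to each
    \<open>f n\<close>.\<close>
  obtain r where r: "strict_mono r" "AE x in M. Cauchy (\<lambda>i. f (r i) x)"
    using cauchy_L1_AE_cauchy_subseq[of M f, OF L2i[OF fL2] cau] by blast
  define g where "g = (\<lambda>x. lim (\<lambda>i. f (r i) x))"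
  have gm[measurable]: "g \<in> borel_measurable M" unfolding g_def by measurable
  have glim: "AE x in M. (\<lambda>i. f (r i) x) \<longlonglongrightarrow> g x"
    using r(2) by eventually_elim (auto simp: g_def Cauchy_convergent_iff convergent_LIMSEQ_iff)
  have NfC: "N (f n) \<le> C" for n using f(1) unfolding K_def by blast
  have f0: "AE x in M. 0 \<le> (f n x)\<^sup>2" for n by simp
  have g2m: "(\<lambda>x. (g x)\<^sup>2) \<in> borel_measurable M" by measurable
  have fC: "eventually (\<lambda>i. (LINT x|M. (f (r i) x)\<^sup>2) \<le> C) sequentially"
    using NfC unfolding N_def by (intro always_eventually allI)
  have g2l: "AE x in M. (\<lambda>i. (f (r i) x)\<^sup>2) \<longlonglongrightarrow> (g x)\<^sup>2"
    using glim by eventually_elim (intro tendsto_intros)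
  note g2 = fatou_real[OF f2 f0 fC g2m g2l]
  have gL2: "g \<in> L2" using g2 by (simp add: L2_def)
  have gd: "integrable M (\<lambda>x. (f n x - g x)\<^sup>2)" "N (\<lambda>x. f n x - g x) \<le> d n" for n
  proof -
    have ev: "eventually (\<lambda>i. (LINT x|M. (f n x - f (r i) x)\<^sup>2) \<le> d n) sequentially"
    proof -
      have "n \<le> r i" if "n \<le> i" for i using seq_suble[OF r(1), of i] that by linarith
      then show ?thesis using key unfolding N_def eventually_sequentially by blast
    qed
    have lm: "AE x in M. (\<lambda>i. (f n x - f (r i) x)\<^sup>2) \<longlonglongrightarrow> (f n x - g x)\<^sup>2"
      using glim by eventually_elim (intro tendsto_intros)
    show "integrable M (\<lambda>x. (f n x - g x)\<^sup>2)" "N (\<lambda>x. f n x - g x) \<le> d n"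
      unfolding N_def by (rule fatou_real[OF i2 _ ev _ lm]; measurable)+
  qed
  have "(LINT x|M. g x * k x) = \<alpha> k" if k: "k \<in> T" for k
  proof -
    have "\<bar>(LINT x|M. g x * k x) - \<alpha> k\<bar> \<le> 0 + e" if e: "0 < e" for e
    proof -
      have e2: "0 < e / 2" using e by simp
      obtain n0 where n0: "\<And>n F. n \<ge> n0 \<Longrightarrow> F \<in> borel_measurable M \<Longrightarrow> integrable M (\<lambda>x. (F x)\<^sup>2) \<Longrightarrow> N F \<le> d n \<Longrightarrow> (LINT x|M. \<bar>F x\<bar>) < e / 2"
        using L1[OF e2] by blast
      have "eventually (\<lambda>j. \<bar>(LINT x|M. h j x * k x) - \<alpha> k\<bar> < e / 2) sequentially"
        using tendstoD[OF conv[OF k] e2] by (simp add: dist_real_def)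
      then obtain n1 where n1: "\<And>j. j \<ge> n1 \<Longrightarrow> \<bar>(LINT x|M. h j x * k x) - \<alpha> k\<bar> < e / 2"
        by (auto simp: eventually_sequentially)
      define n where "n = max n0 n1"
      have "\<bar>(LINT x|M. f n x * k x) - \<alpha> k\<bar> \<le> e / 2"
      proof -
        have "\<forall>j\<ge>n. \<bar>(LINT x|M. h j x * k x) - \<alpha> k\<bar> \<le> e / 2" using n1 by (auto simp: n_def intro: less_imp_le)
        then show ?thesis using f(1)[of n] k unfolding K_def by blast
      qed
      moreover have "\<bar>(LINT x|M. f n x * k x) - (LINT x|M. g x * k x)\<bar> \<le> e / 2"
      proof -
        have fg: "integrable M (\<lambda>x. f n x - g x)" using L2i[OF fL2] L2i[OF gL2] by simp
        have "(LINT x|M. f n x * k x) - (LINT x|M. g x * k x) = (LINT x|M. (f n x - g x) * k x)"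
          using L2k[OF fL2 k] L2k[OF gL2 k] by (simp add: left_diff_distrib)
        also have "\<bar>\<dots>\<bar> \<le> (LINT x|M. \<bar>(f n x - g x) * k x\<bar>)" by (rule integral_abs_bound)
        also have "\<dots> \<le> (LINT x|M. \<bar>f n x - g x\<bar>)"
        proof (rule integral_mono)
          have "integrable M (\<lambda>x. (f n x - g x) * k x)"
            by (rule integrable_mult_bounded[where B = 1, OF fg T(1)[OF k]]) (rule T(2)[OF k])
          then show "integrable M (\<lambda>x. \<bar>(f n x - g x) * k x\<bar>)" by (rule integrable_abs)
          show "integrable M (\<lambda>x. \<bar>f n x - g x\<bar>)" using fg by (rule integrable_abs)
          show "\<bar>(f n x - g x) * k x\<bar> \<le> \<bar>f n x - g x\<bar>" for x
            using T(2)[OF k, of x] mult_left_le[of "\<bar>k x\<bar>" "\<bar>f n x - g x\<bar>"] by (simp only: abs_mult abs_ge_zero)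
        qed
        also have "\<dots> < e / 2" by (rule n0[OF _ _ gd]) (auto simp: n_def)
        finally show ?thesis by simp
      qed
      ultimately show ?thesis by linarith
    qed
    then have "\<bar>(LINT x|M. g x * k x) - \<alpha> k\<bar> \<le> 0" by (rule field_le_epsilon)
    then show ?thesis by simp
  qed
  then show ?thesis using g2 gm by blast
qed

section \<open>Continuous representatives and the chain rule\<close>

lemma AE_continuous_nonneg:
  fixes f :: "real \<Rightarrow> real"
  assumes "open S" "continuous_on S f" "AE x in lebesgue_on S. 0 \<le> f x" "x \<in> S"
  shows "0 \<le> f x"
proof (rule ccontr)
  assume "\<not> 0 \<le> f x"
  define W where "W = {x \<in> S. f x < 0}"
  have "W = S \<inter> f -` {..<0}" by (auto simp: W_def)
  then have W: "open W"
    using continuous_open_preimage[OF assms(2,1), of "{..<0}"] by simp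
  have "AE x in lebesgue. x \<in> S \<longrightarrow> 0 \<le> f x"
    using assms(1,3) by (subst (asm) AE_restrict_space_iff) auto
  then have "AE x in lebesgue. x \<notin> W" by eventually_elim (auto simp: W_def)
  then have "negligible W" using W by (subst negligible_iff_null_sets) (auto simp: AE_iff_null_sets)
  moreover have "W \<noteq> {}" using \<open>\<not> 0 \<le> f x\<close> assms(4) by (auto simp: W_def)
  ultimately show False using W open_not_negligible by blast
qed

lemma integral_Icc_indicator:
  fixes f :: "real \<Rightarrow> real"
  assumes f: "integrable (lebesgue_on {a<..<b}) f" and "a \<le> x" "x \<le> y" "y \<le> b"
  shows "f absolutely_integrable_on {x..y}"
    and "integral {x..y} f = (LINT t|lebesgue_on {a<..<b}. f t * indicator {x..y} t)"
proof -
  have ai: "f absolutely_integrable_on {a..b}" using integral_lebesgue_on_Ioo(2)[OF f, of b] assms by auto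
  then show xy: "f absolutely_integrable_on {x..y}"
    by (rule set_integrable_subset) (use assms in auto)
  then have "integrable (lebesgue_on {x..y}) f" by (simp add: integrable_restrict_space set_integrable_def)
  then have "integral {x..y} f = (LINT t|lebesgue_on {x..y}. f t)"
    by (rule lebesgue_integral_eq_integral[symmetric]) auto
  also have "\<dots> = (LINT t|lebesgue. indicator {x..y} t *\<^sub>R f t)" by (rule integral_restrict_space) auto
  also have "\<dots> = (LINT t|lebesgue. indicator {a<..<b} t *\<^sub>R (f t * indicator {x..y} t))"
  proof (rule integral_cong_AE)
    show "(\<lambda>t. indicator {x..y} t *\<^sub>R f t) \<in> borel_measurable lebesgue"
      using xy unfolding set_integrable_def by (rule borel_measurable_integrable)
    have "integrable (lebesgue_on {a<..<b}) (\<lambda>t. f t * indicator {x..y} t)"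
      by (rule integrable_mult_bounded[OF f borel_measurable_lebesgue_on_borel, where B = 1]) auto
    then have "integrable lebesgue (\<lambda>t. indicator {a<..<b} t *\<^sub>R (f t * indicator {x..y} t))"
      by (subst (asm) integrable_restrict_space) auto
    then show "(\<lambda>t. indicator {a<..<b} t *\<^sub>R (f t * indicator {x..y} t)) \<in> borel_measurable lebesgue"
      by (rule borel_measurable_integrable)
    have "AE t in lebesgue. t \<noteq> a \<and> t \<noteq> b"
      by (intro AE_completion eventually_conj AE_lborel_singleton)
    then show "AE t in lebesgue. indicator {x..y} t *\<^sub>R f t = indicator {a<..<b} t *\<^sub>R (f t * indicator {x..y} t)"
      by eventually_elim (use assms in \<open>auto simp: indicator_def\<close>)
  qed
  also have "\<dots> = (LINT t|lebesgue_on {a<..<b}. f t * indicator {x..y} t)"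
    by (rule integral_restrict_space[symmetric]) auto
  finally show "integral {x..y} f = (LINT t|lebesgue_on {a<..<b}. f t * indicator {x..y} t)" .
qed

lemma primitive_diff:
  fixes q :: "real \<Rightarrow> real"
  assumes "integrable (lebesgue_on {a<..<b}) q" "a \<le> x" "x \<le> y" "y \<le> b"
  shows "integral {a..y} q - integral {a..x} q = integral {x..y} q"
proof -
  have "q integrable_on {a..y}"
    using integral_lebesgue_on_Ioo(2)[OF assms(1), of y] assms set_lebesgue_integral_eq_integral(1) by fastforce
  then have "integral {a..x} q + integral {x..y} q = integral {a..y} q"
    by (intro Henstock_Kurzweil_Integration.integral_combine assms)
  then show ?thesis by simp
qed

text \<open>
  The chain rule for absolutely continuous functions as an inequality, without differentiating \<open>V\<close>:
  locally \<open>H \<circ> V\<close> is constant up to \<open>\<eta>\<close>, and the local estimates add up.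
\<close>

lemma chain_rule_bound:
  fixes H q e V :: "real \<Rightarrow> real"
  assumes H: "continuous_on {0..1} H" "\<And>t. t \<in> {0..1} \<Longrightarrow> 0 \<le> H t"
    and q: "integrable (lebesgue_on {a<..<b}) q" and e: "integrable (lebesgue_on {a<..<b}) e"
    and V: "\<And>x. x \<in> {a<..<b} \<Longrightarrow> V x = c + integral {a..x} q" "\<And>x. x \<in> {a<..<b} \<Longrightarrow> V x \<in> {0..1}"
    and le: "\<And>x. x \<in> {a<..<b} \<Longrightarrow> H (V x) * \<bar>q x\<bar> \<le> e x"
    and xy: "a < x" "x \<le> y" "y < b"
  shows "\<bar>integral {0..V y} H - integral {0..V x} H\<bar> \<le> integral {x..y} e"
proof -
  define \<Psi> where "\<Psi> = (\<lambda>t. integral {0..t} H)"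
  have Hi: "H integrable_on {0..t}" if "t \<in> {0..1}" for t
    using H(1) that by (intro integrable_continuous_interval) (auto intro: continuous_on_subset)
  have \<Psi>diff: "\<bar>\<Psi> t - \<Psi> s\<bar> \<le> K * \<bar>t - s\<bar>"
    if st: "s \<in> {0..1}" "t \<in> {0..1}" and K: "\<And>\<tau>. \<tau> \<in> {min s t..max s t} \<Longrightarrow> H \<tau> \<le> K" for s t K
  proof -
    have main: "0 \<le> \<Psi> t' - \<Psi> s' \<and> \<Psi> t' - \<Psi> s' \<le> K * (t' - s')"
      if "s' \<in> {0..1}" "t' \<in> {0..1}" "s' \<le> t'" "\<And>\<tau>. \<tau> \<in> {s'..t'} \<Longrightarrow> H \<tau> \<le> K" for s' t'
    proof -
      have "integral {0..s'} H + integral {s'..t'} H = integral {0..t'} H"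
        by (rule Henstock_Kurzweil_Integration.integral_combine) (use that Hi in auto)
      then have d: "\<Psi> t' - \<Psi> s' = integral {s'..t'} H" by (simp add: \<Psi>_def)
      have Hst: "H integrable_on {s'..t'}"
        using H(1) that by (intro integrable_continuous_interval) (auto intro: continuous_on_subset)
      have "integral {s'..t'} H \<le> integral {s'..t'} (\<lambda>_. K)"
        by (rule integral_le[OF Hst]) (use that in auto)
      moreover have "0 \<le> integral {s'..t'} H"
        by (rule integral_nonneg[OF Hst]) (use that H(2) in auto)
      ultimately show ?thesis using d that by (simp add: mult.commute)
    qed
    show ?thesis
    proof (cases "s \<le> t")
      case True
      then show ?thesis using main[OF st True] K by (simp add: min_def max_def)
    next
      case False
      then have ts: "t \<le> s" by simp
      then have "0 \<le> \<Psi> s - \<Psi> t \<and> \<Psi> s - \<Psi> t \<le> K * (s - t)"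
        using K by (intro main[OF st(2,1) ts]) (simp add: min_def max_def)
      then show ?thesis using ts by (simp add: abs_if)
    qed
  qed
  have Vc: "continuous_on {a<..<b} V"
  proof -
    have "continuous_on {a..b} (\<lambda>x. c + integral {a..x} q)"
      using xy by (intro continuous_intros primitive_continuous[OF q]) auto
    then have "continuous_on {a<..<b} (\<lambda>x. c + integral {a..x} q)" by (rule continuous_on_subset) auto
    then show ?thesis by (rule continuous_on_eq) (simp add: V(1))
  qed
  have HVc: "continuous_on {a<..<b} (\<lambda>x. H (V x))"
    by (rule continuous_on_compose2[OF H(1) Vc]) (use V(2) in blast)
  have qi: "q absolutely_integrable_on {s..t}" "e absolutely_integrable_on {s..t}" if "a < s" "s \<le> t" "t < b" for s t
    using integral_Icc_indicator(1)[OF q, of s t] integral_Icc_indicator(1)[OF e, of s t] that by auto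
  \<comment> \<open>The extra term \<open>\<eta> * \<bar>q t\<bar>\<close> absorbs the oscillation
    of \<open>H \<circ> V\<close> on short intervals; \<eta> is sent to 0 at the end.\<close>
  have eta: "\<bar>\<Psi> (V y) - \<Psi> (V x)\<bar> \<le> integral {x..y} (\<lambda>t. e t + \<eta> * \<bar>q t\<bar>)" if \<eta>: "0 < \<eta>" for \<eta>
  proof -
    let ?f = "\<lambda>t. e t + \<eta> * \<bar>q t\<bar>"
    have fi: "?f integrable_on {s..t}" if "a < s" "s \<le> t" "t < b" for s t
    proof -
      have "(\<lambda>t. \<bar>q t\<bar>) integrable_on {s..t}" "e integrable_on {s..t}"
        using qi[OF that] absolutely_integrable_on_def[of "{s..t}" q] absolutely_integrable_on_def[of "{s..t}" e] by auto
      then show ?thesis by (intro integrable_add integrable_on_mult_right)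
    qed
    let ?P = "\<lambda>s t. a < s \<and> t < b \<longrightarrow> \<bar>\<Psi> (V t) - \<Psi> (V s)\<bar> \<le> integral {s..t} ?f"
    \<comment> \<open>By bisection: \<open>?P\<close> is inherited by the union of adjacent
      intervals and holds on short intervals around each point, hence on
      \<open>{x..y}\<close>.\<close>
    have "?P x y"
    proof (rule Bolzano[OF xy(2), of ?P])
      fix s m t assume *: "?P s m" "?P m t" "s \<le> m" "m \<le> t"
      show "?P s t"
      proof
        assume st: "a < s \<and> t < b"
        then have "integral {s..m} ?f + integral {m..t} ?f = integral {s..t} ?f"
          using * by (intro Henstock_Kurzweil_Integration.integral_combine fi) auto
        moreover have "\<bar>\<Psi> (V m) - \<Psi> (V s)\<bar> \<le> integral {s..m} ?f" "\<bar>\<Psi> (V t) - \<Psi> (V m)\<bar> \<le> integral {m..t} ?f"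
          using * st by auto
        ultimately show "\<bar>\<Psi> (V t) - \<Psi> (V s)\<bar> \<le> integral {s..t} ?f" by linarith
      qed
    next
      fix z assume z: "x \<le> z" "z \<le> y"
      then have z': "z \<in> {a<..<b}" using xy by auto
      have "isCont (\<lambda>x. V x) z" using continuous_on_eq_continuous_at[of "{a<..<b}" V] Vc z' by auto
      obtain d1 where d1: "0 < d1" "\<And>\<tau>. \<tau> \<in> {0..1} \<Longrightarrow> \<bar>\<tau> - V z\<bar> < d1 \<Longrightarrow> \<bar>H \<tau> - H (V z)\<bar> < \<eta> / 2"
        using H(1) V(2)[OF z'] \<eta> unfolding continuous_on_iff dist_real_def
        by (metis half_gt_zero)
      obtain d2 where d2: "0 < d2" "\<And>s. \<bar>s - z\<bar> < d2 \<Longrightarrow> \<bar>V s - V z\<bar> < d1"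
        using \<open>isCont (\<lambda>x. V x) z\<close> d1(1) unfolding continuous_at_eps_delta dist_real_def by blast
      show "\<exists>d>0. \<forall>s t. s \<le> z \<and> z \<le> t \<and> t - s < d \<longrightarrow> ?P s t"
      proof (intro exI[of _ d2] conjI d2(1) allI impI)
        fix s t assume st: "s \<le> z \<and> z \<le> t \<and> t - s < d2" and ab': "a < s \<and> t < b"
        have in\<Omega>: "\<tau> \<in> {a<..<b}" if "\<tau> \<in> {s..t}" for \<tau> using that ab' by auto
        have near: "\<bar>V \<tau> - V z\<bar> < d1" if "\<tau> \<in> {s..t}" for \<tau> using that st d2(2)[of \<tau>] by auto
        have Hn: "\<bar>H \<tau> - H (V z)\<bar> < \<eta> / 2" if "\<tau> \<in> {min (V s) (V t)..max (V s) (V t)}" for \<tau>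
        proof (rule d1(2))
          show "\<tau> \<in> {0..1}" using that V(2)[OF in\<Omega>, of s] V(2)[OF in\<Omega>, of t] st by (auto simp: min_def max_def split: if_splits)
          show "\<bar>\<tau> - V z\<bar> < d1" using that near[of s] near[of t] st by (auto simp: min_def max_def split: if_splits)
        qed
        \<comment> \<open>Between \<open>V s\<close> and \<open>V t\<close> the function
          \<open>H\<close> is at most \<open>H (V z) + \<eta> / 2\<close>; the other half of \<eta>
          pays below for replacing \<open>H (V z)\<close> by \<open>H (V \<tau>)\<close>.\<close>
        have b1: "\<bar>\<Psi> (V t) - \<Psi> (V s)\<bar> \<le> (H (V z) + \<eta> / 2) * \<bar>V t - V s\<bar>"
        proof (rule \<Psi>diff)
          show "V s \<in> {0..1}" "V t \<in> {0..1}" using V(2) in\<Omega> st by auto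
          show "H \<tau> \<le> H (V z) + \<eta> / 2" if "\<tau> \<in> {min (V s) (V t)..max (V s) (V t)}" for \<tau>
            using Hn[OF that] by linarith
        qed
        have "V t - V s = integral {s..t} q"
          using primitive_diff[OF q, of s t] V(1)[OF in\<Omega>, of s] V(1)[OF in\<Omega>, of t] st ab' by auto
        moreover have absq: "(\<lambda>t. \<bar>q t\<bar>) integrable_on {s..t}" "q integrable_on {s..t}"
          using qi(1)[of s t] ab' st absolutely_integrable_on_def[of "{s..t}" q] by auto
        ultimately have b2: "\<bar>V t - V s\<bar> \<le> integral {s..t} (\<lambda>t. \<bar>q t\<bar>)"
          using integral_norm_bound_integral[OF absq(2,1)] by simp
        have "0 \<le> H (V z) + \<eta> / 2" using H(2)[OF V(2)[OF z']] \<eta> by simp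
        with b1 b2 have "\<bar>\<Psi> (V t) - \<Psi> (V s)\<bar> \<le> (H (V z) + \<eta> / 2) * integral {s..t} (\<lambda>t. \<bar>q t\<bar>)"
          by (meson mult_left_mono order_trans)
        also have "\<dots> = integral {s..t} (\<lambda>\<tau>. (H (V z) + \<eta> / 2) * \<bar>q \<tau>\<bar>)"
          by (rule integral_mult_right[symmetric])
        also have "\<dots> \<le> integral {s..t} ?f"
        proof (rule integral_le[OF integrable_on_mult_right[OF absq(1)] fi])
          fix \<tau> assume \<tau>: "\<tau> \<in> {s..t}"
          have "\<bar>H (V \<tau>) - H (V z)\<bar> < \<eta> / 2" using d1(2)[OF V(2)[OF in\<Omega>[OF \<tau>]] near[OF \<tau>]] .
          then have "(H (V z) + \<eta> / 2) * \<bar>q \<tau>\<bar> \<le> (H (V \<tau>) + \<eta>) * \<bar>q \<tau>\<bar>" by (intro mult_right_mono abs_ge_zero) linarith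
          also have "\<dots> \<le> ?f \<tau>" using le[OF in\<Omega>[OF \<tau>]] by (simp add: distrib_right)
          finally show "(H (V z) + \<eta> / 2) * \<bar>q \<tau>\<bar> \<le> ?f \<tau>" .
        qed (use ab' st in auto)
        finally show "\<bar>\<Psi> (V t) - \<Psi> (V s)\<bar> \<le> integral {s..t} ?f" .
      qed
    qed
    then show ?thesis using xy by blast
  qed
  have "\<bar>\<Psi> (V y) - \<Psi> (V x)\<bar> \<le> integral {x..y} e + d" if d: "0 < d" for d
  proof -
    define I where "I = integral {x..y} (\<lambda>t. \<bar>q t\<bar>)"
    have absq: "(\<lambda>t. \<bar>q t\<bar>) integrable_on {x..y}" and ei: "e integrable_on {x..y}"
      using qi[OF xy] absolutely_integrable_on_def[of "{x..y}" q] absolutely_integrable_on_def[of "{x..y}" e] by auto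
    have I0: "0 \<le> I" unfolding I_def by (rule integral_nonneg[OF absq]) simp
    define \<eta> where "\<eta> = d / (I + 1)"
    have \<eta>: "0 < \<eta>" "\<eta> * I \<le> d"
      using d I0 by (auto simp: \<eta>_def field_simps)
    have "\<bar>\<Psi> (V y) - \<Psi> (V x)\<bar> \<le> integral {x..y} (\<lambda>t. e t + \<eta> * \<bar>q t\<bar>)" by (rule eta[OF \<eta>(1)])
    also have "\<dots> = integral {x..y} e + \<eta> * I"
      unfolding I_def using absq ei by (simp add: integral_add integrable_on_mult_right)
    finally show ?thesis using \<eta>(2) by linarith
  qed
  then have "\<bar>\<Psi> (V y) - \<Psi> (V x)\<bar> \<le> integral {x..y} e" by (rule field_le_epsilon)
  then show ?thesis by (simp only: \<Psi>_def)
qed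

section \<open>The phase-field energy\<close>

locale phase_field =
  fixes a b \<phi>inf :: real and l Q \<omega> \<phi> :: "real \<Rightarrow> real" and \<zeta> :: ereal
  assumes ab: "a < b"
    and l: "continuous_on {0..1} l" "\<And>t. t \<in> {0..1} \<Longrightarrow> 0 \<le> l t" "\<And>t. t \<in> {0..1} \<Longrightarrow> l t = 0 \<longleftrightarrow> t = 0"
    and Q: "continuous_on {0..1} Q" "\<And>t. t \<in> {0..1} \<Longrightarrow> 0 \<le> Q t" "\<And>t. t \<in> {0..1} \<Longrightarrow> Q t = 0 \<longleftrightarrow> t = 0"
    and \<omega>: "continuous_on {0..1} \<omega>" "\<And>t. t \<in> {0..1} \<Longrightarrow> 0 \<le> \<omega> t" "\<And>t. t \<in> {0..1} \<Longrightarrow> \<omega> t = 0 \<longleftrightarrow> t = 0"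
    and \<zeta>: "((\<lambda>t. ereal (sqrt (\<omega> t / Q t))) \<longlongrightarrow> \<zeta>) (at_right 0)" "0 < \<zeta>"
    and \<phi>: "continuous_on {0..} \<phi>" "\<And>t. 0 \<le> t \<Longrightarrow> 0 \<le> \<phi> t" "mono_on {0..} \<phi>" "\<And>t. 0 \<le> t \<Longrightarrow> \<phi> t = 0 \<longleftrightarrow> t = 0"
    and \<phi>inf: "(\<phi> \<longlongrightarrow> \<phi>inf) at_top" "0 < \<phi>inf"
    and \<phi>_deriv: "\<exists>D>0. (\<phi> has_real_derivative D) (at_right 0)"
begin

text \<open>Near 0 the ratio \<omega>/Q exceeds a positive number because its square root has a
  positive limit; away from 0 compactness bounds \<omega> from below and Q from above.\<close>

lemma \<omega>_lower: "\<exists>c>0. \<forall>s\<in>{0..1}. c * Q s \<le> \<omega> s"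
proof -
  \<comment> \<open>The limit may be infinite, so a finite positive number below it is used in its
    place.\<close>
  obtain \<kappa> where \<kappa>: "0 < ereal \<kappa>" "ereal \<kappa> < \<zeta>" using ereal_dense2[OF \<zeta>(2)] by blast
  have "eventually (\<lambda>t. ereal \<kappa> < ereal (sqrt (\<omega> t / Q t))) (at_right 0)"
    using \<zeta>(1) \<kappa>(2) by (rule order_tendstoD)
  then obtain d where d: "0 < d" "\<And>t. 0 < t \<Longrightarrow> t < d \<Longrightarrow> \<kappa> < sqrt (\<omega> t / Q t)"
    unfolding eventually_at_right_field by auto
  define d' where "d' = min (d / 2) 1"
  have d': "0 < d'" "d' < d" "d' \<le> 1" using d(1) by (auto simp: d'_def)
  have near: "\<kappa>\<^sup>2 * Q t \<le> \<omega> t" if t: "0 \<le> t" "t \<le> d'" for t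
  proof (cases "t = 0")
    case True
    then show ?thesis using \<omega>(2)[of 0] Q(3)[of 0] by simp
  next
    case False
    then have t': "0 < t" "t < d" "t \<in> {0..1}" using t d' by auto
    have Qt: "0 < Q t" using Q(2,3)[OF t'(3)] t'(1) by (simp add: order_less_le)
    have "\<kappa> < sqrt (\<omega> t / Q t)" by (rule d(2)[OF t'(1,2)])
    then have "\<kappa>\<^sup>2 \<le> (sqrt (\<omega> t / Q t))\<^sup>2" using \<kappa>(1) by (intro power_mono) auto
    also have "\<dots> = \<omega> t / Q t" using \<omega>(2)[OF t'(3)] Qt by simp
    finally show ?thesis using Qt by (simp add: field_simps)
  qed
  have sub: "{d'..1} \<subseteq> {0..1}" using d' by auto
  obtain x where x: "x \<in> {d'..1}" "\<And>y. y \<in> {d'..1} \<Longrightarrow> \<omega> x \<le> \<omega> y"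
    using continuous_attains_inf[of "{d'..1}" \<omega>] continuous_on_subset[OF \<omega>(1) sub] d' by auto
  obtain z where z: "z \<in> {d'..1}" "\<And>y. y \<in> {d'..1} \<Longrightarrow> Q y \<le> Q z"
    using continuous_attains_sup[of "{d'..1}" Q] continuous_on_subset[OF Q(1) sub] d' by auto
  have pos: "0 < \<omega> x" "0 < Q z"
    using \<omega>(2,3)[of x] Q(2,3)[of z] x(1) z(1) d' by (auto simp: order_less_le)
  define c where "c = min (\<kappa>\<^sup>2) (\<omega> x / Q z)"
  have "0 < c" using \<kappa>(1) pos by (simp add: c_def)
  moreover have "c * Q s \<le> \<omega> s" if s: "s \<in> {0..1}" for s
  proof (cases "s \<le> d'")
    case True
    have "c * Q s \<le> \<kappa>\<^sup>2 * Q s" using Q(2)[OF s] by (intro mult_right_mono) (auto simp: c_def)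
    also have "\<dots> \<le> \<omega> s" using near True s by auto
    finally show ?thesis .
  next
    case False
    then have s': "s \<in> {d'..1}" using s by auto
    have "c * Q s \<le> (\<omega> x / Q z) * Q z"
      using Q(2)[OF s] z(2)[OF s'] pos by (intro mult_mono) (auto simp: c_def)
    also have "\<dots> \<le> \<omega> s" using pos x(2)[OF s'] by simp
    finally show ?thesis .
  qed
  ultimately show ?thesis by blast
qed

lemma \<phi>_le: "0 \<le> t \<Longrightarrow> \<phi> t \<le> \<phi>inf"
proof (rule tendsto_lowerbound[OF \<phi>inf(1)])
  assume t: "0 \<le> t"
  show "eventually (\<lambda>s. \<phi> t \<le> \<phi> s) at_top"
    using eventually_ge_at_top[of t] by eventually_elim (use t \<phi>(3) in \<open>auto simp: mono_on_def\<close>)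
qed simp

text \<open>Being bounded, \<phi> has no linear lower bound at large arguments; the condition
  \<open>\<phi> t < (1 - \<theta>) * \<phi>inf\<close> confines t to a bounded range. There the
  right derivative settles small t, and monotonicity the rest.\<close>

lemma \<phi>_lower:
  assumes \<theta>: "0 < \<theta>"
  shows "\<exists>c>0. \<forall>t\<ge>0. \<phi> t < (1 - \<theta>) * \<phi>inf \<longrightarrow> c * t \<le> \<phi> t"
proof -
  obtain D where D: "0 < D" "(\<phi> has_real_derivative D) (at_right 0)" using \<phi>_deriv by blast
  have \<phi>0: "\<phi> 0 = 0" using \<phi>(4)[of 0] by simp
  have "((\<lambda>t. \<phi> t / t) \<longlongrightarrow> D) (at_right 0)"
    using D(2) unfolding has_field_derivative_iff by (simp add: \<phi>0)
  then have "eventually (\<lambda>t. D / 2 < \<phi> t / t) (at_right 0)" by (rule order_tendstoD) (use D in simp)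
  then obtain d where d: "0 < d" "\<And>t. 0 < t \<Longrightarrow> t < d \<Longrightarrow> D / 2 < \<phi> t / t"
    unfolding eventually_at_right_field by auto
  have "(1 - \<theta>) * \<phi>inf < \<phi>inf" using \<theta> \<phi>inf(2) by simp
  then have "eventually (\<lambda>t. (1 - \<theta>) * \<phi>inf < \<phi> t) at_top" by (rule order_tendstoD(1)[OF \<phi>inf(1)])
  then obtain M where M: "\<And>t. M \<le> t \<Longrightarrow> (1 - \<theta>) * \<phi>inf < \<phi> t" unfolding eventually_at_top_linorder by blast
  define M' where "M' = max M 1"
  define c where "c = min (D / 2) (\<phi> (d / 2) / M')"
  have \<phi>d: "0 < \<phi> (d / 2)" using \<phi>(2,4)[of "d / 2"] d(1) by (auto simp: order_less_le)
  have M': "0 < M'" by (simp add: M'_def)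
  have cD: "c \<le> D / 2" unfolding c_def by (rule min.cobounded1)
  have "0 < c" using D(1) \<phi>d M' by (simp add: c_def)
  moreover have "c * t \<le> \<phi> t" if t: "0 \<le> t" "\<phi> t < (1 - \<theta>) * \<phi>inf" for t
  proof -
    consider "t = 0" | "0 < t" "t < d" | "d \<le> t" using t by linarith
    then show ?thesis
    proof cases
      case 1
      then show ?thesis using \<phi>0 by simp
    next
      case 2
      have "c * t \<le> D / 2 * t" using 2 cD by (intro mult_right_mono) auto
      also have "\<dots> \<le> \<phi> t" using d(2)[OF 2] 2 by (simp add: field_simps)
      finally show ?thesis .
    next
      case 3
      have tM: "t \<le> M'" using M[of t] t(2) by (force simp: M'_def)
      have "c * t \<le> \<phi> (d / 2) / M' * M'"
        using tM t(1) \<phi>d M' by (intro mult_mono) (auto simp: c_def)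
      also have "\<dots> = \<phi> (d / 2)" using M' by simp
      also have "\<dots> \<le> \<phi> t" using 3 d(1) \<phi>(3) by (auto simp: mono_on_def)
      finally show ?thesis .
    qed
  qed
  ultimately show ?thesis by blast
qed

section \<open>The elastic coefficient\<close>

abbreviation E :: "real \<Rightarrow> real \<Rightarrow> real" where "E \<equiv> elastic_coeff \<phi> \<phi>inf l Q"

lemma Q_pos: "0 \<le> t \<Longrightarrow> t < 1 \<Longrightarrow> 0 < Q (1 - t)"
  using Q(2,3)[of "1 - t"] by (auto simp: order_less_le)

lemma E_eq: "0 \<le> t \<Longrightarrow> t < 1 \<Longrightarrow> E \<gamma> t = \<phi> (\<gamma> * (l t / Q (1 - t)))"
  using Q_pos[of t] l(2)[of t] by (simp add: elastic_coeff_def f_fun_def)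

lemma E_arg_nonneg: "0 \<le> t \<Longrightarrow> t < 1 \<Longrightarrow> 0 \<le> \<gamma> \<Longrightarrow> 0 \<le> \<gamma> * (l t / Q (1 - t))"
  using Q_pos[of t] l(2)[of t] by simp

lemma E_bounds:
  assumes "t \<in> {0..1}" "0 \<le> \<gamma>"
  shows "0 \<le> E \<gamma> t" "E \<gamma> t \<le> \<phi>inf"
proof -
  have "0 \<le> E \<gamma> t \<and> E \<gamma> t \<le> \<phi>inf"
  proof (cases "t = 1")
    case True
    then show ?thesis using \<phi>inf by (simp add: elastic_coeff_def)
  next
    case False
    then have "0 \<le> t" "t < 1" using assms by auto
    then show ?thesis
      using \<phi>(2) \<phi>_le E_arg_nonneg[of t \<gamma>] assms by (simp only: E_eq)
  qed
  then show "0 \<le> E \<gamma> t" "E \<gamma> t \<le> \<phi>inf" by auto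
qed

lemma E_0: "E \<gamma> 0 = 0"
  using l(3)[of 0] \<phi>(4)[of 0] by (simp add: E_eq)

text \<open>Here Q(1 - t) cancels: the coefficient is at least a multiple of \<gamma> l(t)/Q(1 - t),
  and \<omega>(1 - t) at least a multiple of Q(1 - t). What remains is \<gamma> l(t), and l has a
  positive minimum on \<open>{\<delta>..1}\<close>. The constant is uniform in \<gamma>.\<close>

lemma E_\<omega>_lower:
  assumes \<theta>: "0 < \<theta>" and \<delta>: "0 < \<delta>" "\<delta> < 1"
  shows "\<exists>c>0. \<forall>\<gamma>>0. \<forall>t\<in>{\<delta>..1}. E \<gamma> t < (1 - \<theta>) * \<phi>inf \<longrightarrow> c * \<gamma> \<le> E \<gamma> t * \<omega> (1 - t)"
proof -
  obtain c1 where c1: "0 < c1" "\<And>s. s \<in> {0..1} \<Longrightarrow> c1 * Q s \<le> \<omega> s" using \<omega>_lower by blast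
  obtain c2 where c2: "0 < c2" "\<And>t. 0 \<le> t \<Longrightarrow> \<phi> t < (1 - \<theta>) * \<phi>inf \<Longrightarrow> c2 * t \<le> \<phi> t" using \<phi>_lower[OF \<theta>] by blast
  have sub: "{\<delta>..1} \<subseteq> {0..1}" using \<delta> by auto
  obtain x where x: "x \<in> {\<delta>..1}" "\<And>y. y \<in> {\<delta>..1} \<Longrightarrow> l x \<le> l y"
    using continuous_attains_inf[of "{\<delta>..1}" l] continuous_on_subset[OF l(1) sub] \<delta> by auto
  have lx: "0 < l x" using l(2,3)[of x] x(1) \<delta> by (auto simp: order_less_le)
  have "c1 * c2 * l x * \<gamma> \<le> E \<gamma> t * \<omega> (1 - t)"
    if \<gamma>: "0 < \<gamma>" and t: "t \<in> {\<delta>..1}" and lt: "E \<gamma> t < (1 - \<theta>) * \<phi>inf" for \<gamma> t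
  proof -
    have "(1 - \<theta>) * \<phi>inf < \<phi>inf" using \<theta> \<phi>inf(2) by simp
    then have "t \<noteq> 1" using lt by (auto simp: elastic_coeff_def)
    then have t': "0 \<le> t" "t < 1" using t \<delta> by auto
    have q: "0 < Q (1 - t)" by (rule Q_pos[OF t'])
    have "c2 * (\<gamma> * (l t / Q (1 - t))) \<le> E \<gamma> t"
      using c2(2)[OF E_arg_nonneg[OF t', of \<gamma>]] lt \<gamma> t' by (simp add: E_eq)
    moreover have "c1 * Q (1 - t) \<le> \<omega> (1 - t)" using c1(2)[of "1 - t"] t' by simp
    ultimately have "c2 * (\<gamma> * (l t / Q (1 - t))) * (c1 * Q (1 - t)) \<le> E \<gamma> t * \<omega> (1 - t)"
      using q c1(1) c2(1) \<gamma> l(2)[of t] t' E_bounds[of t \<gamma>] by (intro mult_mono) auto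
    moreover have "c2 * (\<gamma> * (l t / Q (1 - t))) * (c1 * Q (1 - t)) = c1 * c2 * \<gamma> * l t"
      using q by (simp add: field_simps)
    moreover have "c1 * c2 * \<gamma> * l x \<le> c1 * c2 * \<gamma> * l t"
      using x(2)[OF t] c1(1) c2(1) \<gamma> by (intro mult_left_mono) auto
    ultimately show ?thesis by (simp add: mult_ac)
  qed
  moreover have "0 < c1 * c2 * l x" using c1 c2 lx by simp
  ultimately show ?thesis by blast
qed

text \<open>The quotient l(t)/Q(1 - t) is continuous on [0, 1[ and has a zero denominator at 1; the
  prescribed value at 1 is added as a multiple of an indicator.\<close>

lemma E_measurable:
  assumes \<gamma>: "0 \<le> \<gamma>"
  shows "(\<lambda>t. if t \<in> {0..1} then E \<gamma> t else 0) \<in> borel_measurable borel"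
proof -
  have "continuous_on {0..<1} (\<lambda>t. \<phi> (\<gamma> * (l t / Q (1 - t))))"
  proof (rule continuous_on_compose2[OF \<phi>(1)])
    have "continuous_on {0..<1} (\<lambda>t. Q (1 - t))"
      by (rule continuous_on_compose2[OF Q(1)]) (auto intro!: continuous_intros)
    moreover have "continuous_on {0..<1} l" by (rule continuous_on_subset[OF l(1)]) auto
    ultimately show "continuous_on {0..<1} (\<lambda>t. \<gamma> * (l t / Q (1 - t)))"
      using Q_pos by (intro continuous_intros) force+
    show "(\<lambda>t. \<gamma> * (l t / Q (1 - t))) ` {0..<1} \<subseteq> {0..}" using E_arg_nonneg \<gamma> by auto
  qed
  then have m: "(\<lambda>t. indicator {0..<1} t *\<^sub>R \<phi> (\<gamma> * (l t / Q (1 - t)))) \<in> borel_measurable borel"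
    by (rule borel_measurable_continuous_on_indicator[rotated]) simp
  have "(\<lambda>t. indicator {0..<1} t *\<^sub>R \<phi> (\<gamma> * (l t / Q (1 - t))) + \<phi>inf * indicator {1} t) \<in> borel_measurable borel"
    by (intro borel_measurable_add m borel_measurable_times borel_measurable_const borel_measurable_indicator) simp
  also have "(\<lambda>t. indicator {0..<1} t *\<^sub>R \<phi> (\<gamma> * (l t / Q (1 - t))) + \<phi>inf * indicator {1} t) = (\<lambda>t. if t \<in> {0..1} then E \<gamma> t else 0)"
  proof (rule ext)
    fix t :: real
    consider "t = 1" | "0 \<le> t" "t < 1" | "t \<notin> {0..1}" by fastforce
    then show "indicator {0..<1} t *\<^sub>R \<phi> (\<gamma> * (l t / Q (1 - t))) + \<phi>inf * indicator {1} t = (if t \<in> {0..1} then E \<gamma> t else 0)"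
    proof cases
      case 1 then show ?thesis by (simp add: elastic_coeff_def)
    next
      case 2 then show ?thesis by (simp add: E_eq)
    next
      case 3 then show ?thesis by (auto simp: indicator_def)
    qed
  qed
  finally show ?thesis .
qed

abbreviation \<Omega> :: "real set" where "\<Omega> \<equiv> {a<..<b}"
abbreviation LL :: "real measure" where "LL \<equiv> lebesgue_on {a<..<b}"

lemma composite_measurable:
  assumes V: "continuous_on \<Omega> V" "\<And>x. x \<in> \<Omega> \<Longrightarrow> V x \<in> {0..1}" and \<gamma>: "0 \<le> \<gamma>"
  shows "(\<lambda>x. E \<gamma> (V x)) \<in> borel_measurable LL" and "(\<lambda>x. \<omega> (1 - V x)) \<in> borel_measurable LL"
    and "integrable LL (\<lambda>x. \<omega> (1 - V x))"
proof -
  have Vm: "V \<in> borel_measurable LL" by (rule continuous_imp_measurable_on_sets_lebesgue[OF V(1)]) auto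
  have "(\<lambda>x. if V x \<in> {0..1} then E \<gamma> (V x) else 0) \<in> borel_measurable LL"
    using measurable_compose[OF Vm E_measurable[OF \<gamma>]] .
  then show "(\<lambda>x. E \<gamma> (V x)) \<in> borel_measurable LL"
    by (subst measurable_lebesgue_cong[where g = "\<lambda>x. if V x \<in> {0..1} then E \<gamma> (V x) else 0"]) (use V(2) in auto)
  have "continuous_on \<Omega> (\<lambda>x. \<omega> (1 - V x))"
    by (rule continuous_on_compose2[OF \<omega>(1)]) (use V in \<open>auto intro!: continuous_intros\<close>)
  then show m: "(\<lambda>x. \<omega> (1 - V x)) \<in> borel_measurable LL"
    by (rule continuous_imp_measurable_on_sets_lebesgue) auto
  have "bounded (\<omega> ` {0..1})" by (intro compact_imp_bounded compact_continuous_image \<omega>) auto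
  then have "\<exists>B. \<forall>t\<in>{0..1}. \<bar>\<omega> t\<bar> \<le> B" unfolding bounded_iff by simp
  then obtain B where B: "\<And>t. t \<in> {0..1} \<Longrightarrow> \<bar>\<omega> t\<bar> \<le> B" by blast
  interpret finite_measure LL by (rule finite_measure_lebesgue_on_Ioo)
  show "integrable LL (\<lambda>x. \<omega> (1 - V x))"
  proof (rule integrable_const_bound[OF AE_I2 m])
    fix x assume "x \<in> space LL"
    then have "V x \<in> {0..1}" using V(2) by simp
    then show "norm (\<omega> (1 - V x)) \<le> B" using B[of "1 - V x"] by simp
  qed
qed

text \<open>\<open>v\<close> is replaced by its continuous representative \<open>V\<close>, which
  has values in [0, 1] at every point and not just almost everywhere. The extended integral becomes
  a sum of two real ones, bulk and surface, which the lower bound estimates separately.\<close>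

lemma phase_field_energy_eq:
  assumes \<epsilon>: "0 < \<epsilon>" and \<gamma>: "0 \<le> \<gamma>" and u: "u \<in> H1_space \<Omega>" and v: "v \<in> H1_space \<Omega>"
    and v01: "AE x in LL. v x \<in> {0..1}"
  shows "\<exists>cu cv p q V. p \<in> L2_space \<Omega> \<and> q \<in> L2_space \<Omega> \<and>
    (AE x in LL. u x = cu + integral {a..x} p) \<and> (AE x in LL. v x = V x) \<and>
    (\<forall>x\<in>\<Omega>. V x = cv + integral {a..x} q \<and> V x \<in> {0..1}) \<and> continuous_on \<Omega> V \<and>
    integrable LL (\<lambda>x. E \<gamma> (V x) * (p x)\<^sup>2) \<and> integrable LL (\<lambda>x. \<omega> (1 - V x) / (4 * \<epsilon>) + \<epsilon> * (q x)\<^sup>2) \<and>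
    phase_field_energy \<Omega> \<phi> \<phi>inf l Q \<omega> \<gamma> \<epsilon> u v =
      ennreal ((LINT x|LL. E \<gamma> (V x) * (p x)\<^sup>2) + (LINT x|LL. \<omega> (1 - V x) / (4 * \<epsilon>) + \<epsilon> * (q x)\<^sup>2))"
proof -
  let ?p = "weak_deriv \<Omega> u" and ?q = "weak_deriv \<Omega> v"
  note pr = H1_representation[OF ab u] and qr = H1_representation[OF ab v]
  obtain cu where cu: "AE x in LL. u x = cu + integral {a..x} ?p" using pr(2) by blast
  obtain cv where cv: "AE x in LL. v x = cv + integral {a..x} ?q" using qr(2) by blast
  define V where "V = (\<lambda>x. cv + integral {a..x} ?q)"
  have vV: "AE x in LL. v x = V x" using cv by (simp add: V_def)
  have "continuous_on {a..b} V" unfolding V_def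
    by (intro continuous_intros primitive_continuous[OF L2_imp_integrable[OF qr(1)]]) (use ab in auto)
  then have Vc: "continuous_on \<Omega> V" by (rule continuous_on_subset) auto
  have V01: "V x \<in> {0..1}" if x: "x \<in> \<Omega>" for x
  proof -
    have "AE x in LL. 0 \<le> V x" using v01 vV by eventually_elim auto
    then have "0 \<le> V x" by (rule AE_continuous_nonneg[OF open_greaterThanLessThan Vc _ x])
    moreover have "AE x in LL. 0 \<le> 1 - V x" using v01 vV by eventually_elim auto
    moreover have "continuous_on \<Omega> (\<lambda>x. 1 - V x)" by (intro continuous_intros Vc)
    ultimately have "0 \<le> V x \<and> 0 \<le> 1 - V x"
      using AE_continuous_nonneg[OF open_greaterThanLessThan, of a b "\<lambda>x. 1 - V x"] x by blast
    then show ?thesis by simp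
  qed
  note meas = composite_measurable[OF Vc V01 \<gamma>]
  have p2: "integrable LL (\<lambda>x. (?p x)\<^sup>2)" and q2: "integrable LL (\<lambda>x. (?q x)\<^sup>2)"
    and pm: "?p \<in> borel_measurable LL"
    using pr(1) qr(1) by (auto simp: L2_space_def)
  have B: "integrable LL (\<lambda>x. E \<gamma> (V x) * (?p x)\<^sup>2)"
  proof (rule Bochner_Integration.integrable_bound)
    show "integrable LL (\<lambda>x. \<phi>inf * (?p x)\<^sup>2)" using p2 by simp
    show "(\<lambda>x. E \<gamma> (V x) * (?p x)\<^sup>2) \<in> borel_measurable LL" using meas(1) pm by measurable
    show "AE x in LL. norm (E \<gamma> (V x) * (?p x)\<^sup>2) \<le> norm (\<phi>inf * (?p x)\<^sup>2)"
    proof (rule AE_I2)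
      fix x assume "x \<in> space LL"
      then have "V x \<in> {0..1}" using V01 by simp
      from E_bounds[OF this \<gamma>] show "norm (E \<gamma> (V x) * (?p x)\<^sup>2) \<le> norm (\<phi>inf * (?p x)\<^sup>2)"
        by (simp add: abs_mult mult_right_mono)
    qed
  qed
  have S: "integrable LL (\<lambda>x. \<omega> (1 - V x) / (4 * \<epsilon>) + \<epsilon> * (?q x)\<^sup>2)"
    using meas(3) q2 by (intro Bochner_Integration.integrable_add integrable_mult_right) auto
  have "phase_field_energy \<Omega> \<phi> \<phi>inf l Q \<omega> \<gamma> \<epsilon> u v =
    (\<integral>\<^sup>+x. ennreal (E \<gamma> (v x) * \<bar>?p x\<bar>\<^sup>2 + \<omega> (1 - v x) / (4 * \<epsilon>) + \<epsilon> * \<bar>?q x\<bar>\<^sup>2) \<partial>LL)"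
    using u v v01 by (simp only: phase_field_energy_def simp_thms if_True)
  also have "\<dots> = (\<integral>\<^sup>+x. ennreal (E \<gamma> (V x) * (?p x)\<^sup>2 + (\<omega> (1 - V x) / (4 * \<epsilon>) + \<epsilon> * (?q x)\<^sup>2)) \<partial>LL)"
  proof (rule nn_integral_cong_AE)
    show "AE x in LL. ennreal (E \<gamma> (v x) * \<bar>?p x\<bar>\<^sup>2 + \<omega> (1 - v x) / (4 * \<epsilon>) + \<epsilon> * \<bar>?q x\<bar>\<^sup>2) =
      ennreal (E \<gamma> (V x) * (?p x)\<^sup>2 + (\<omega> (1 - V x) / (4 * \<epsilon>) + \<epsilon> * (?q x)\<^sup>2))"
      using vV by eventually_elim (simp add: add.assoc)
  qed
  also have "\<dots> = ennreal (LINT x|LL. E \<gamma> (V x) * (?p x)\<^sup>2 + (\<omega> (1 - V x) / (4 * \<epsilon>) + \<epsilon> * (?q x)\<^sup>2))"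
  proof (rule nn_integral_eq_integral[OF Bochner_Integration.integrable_add[OF B S]], rule AE_I2)
    fix x assume "x \<in> space LL"
    then have "V x \<in> {0..1}" using V01 by simp
    then show "0 \<le> E \<gamma> (V x) * (?p x)\<^sup>2 + (\<omega> (1 - V x) / (4 * \<epsilon>) + \<epsilon> * (?q x)\<^sup>2)"
      using E_bounds[of "V x" \<gamma>] \<gamma> \<epsilon> \<omega>(2)[of "1 - V x"] by (intro add_nonneg_nonneg mult_nonneg_nonneg divide_nonneg_nonneg) auto
  qed
  also have "\<dots> = ennreal ((LINT x|LL. E \<gamma> (V x) * (?p x)\<^sup>2) + (LINT x|LL. \<omega> (1 - V x) / (4 * \<epsilon>) + \<epsilon> * (?q x)\<^sup>2))"
    by (simp only: Bochner_Integration.integral_add[OF B S])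
  finally have F: "phase_field_energy \<Omega> \<phi> \<phi>inf l Q \<omega> \<gamma> \<epsilon> u v = \<dots>" .
  have rep: "\<forall>x\<in>\<Omega>. V x = cv + integral {a..x} ?q \<and> V x \<in> {0..1}" using V01 by (simp add: V_def)
  show ?thesis
    by (intro exI[of _ cu] exI[of _ cv] exI[of _ ?p] exI[of _ ?q] exI[of _ V] conjI pr(1) qr(1) cu vV rep Vc B S F)
qed

end

section \<open>The lower bound\<close>

lemma AE_Ioo_ex:
  fixes a b c d :: real
  assumes ae: "AE x in lebesgue_on {a<..<b}. P x" and cd: "a \<le> c" "c < d" "d \<le> b"
  shows "\<exists>x\<in>{c<..<d}. P x"
proof (rule ccontr)
  assume n: "\<not> ?thesis"
  have "AE x in lebesgue. x \<in> {a<..<b} \<longrightarrow> P x"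
    using ae by (subst (asm) AE_restrict_space_iff) auto
  then have "AE x in lebesgue. x \<in> {c<..<d} \<longrightarrow> False"
    by eventually_elim (use n cd in auto)
  then have "AE x in lebesgue_on {c<..<d}. False"
    by (subst AE_restrict_space_iff) auto
  then have "emeasure (lebesgue_on {c<..<d}) (space (lebesgue_on {c<..<d})) = 0"
    by (simp only: trivial_limit_def[symmetric] ae_filter_eq_bot_iff)
  then show False using cd by (simp add: emeasure_restrict_space)
qed

text \<open>Indices are picked recursively, each larger than the one before; frequent validity
  guarantees a next one.\<close>

lemma frequently_subseq_ex:
  fixes P :: "nat \<Rightarrow> nat \<Rightarrow> bool"
  assumes "\<And>n. frequently (P n) sequentially"
  shows "\<exists>s. strict_mono s \<and> (\<forall>n. P n (s n))"
proof -
  have ex: "\<exists>j>k. P n j" for n k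
    using assms[of n] unfolding frequently_sequentially by (metis Suc_le_eq)
  have "\<exists>s. \<forall>n. P n (s n) \<and> s n < s (Suc n)"
  proof (rule dependent_nat_choice)
    show "\<exists>x. P 0 x" using ex[of 0 0] by auto
    show "\<exists>y. P (Suc n) y \<and> x < y" for x n using ex[of x "Suc n"] by auto
  qed
  then obtain s where s: "\<forall>n. P n (s n) \<and> s n < s (Suc n)" by (elim exE)
  have "strict_mono s" using s by (simp add: strict_mono_Suc_iff)
  moreover have "\<forall>n. P n (s n)" using s by simp
  ultimately show ?thesis by (intro exI[of _ s] conjI)
qed

context phase_field
begin

section \<open>The transition energy\<close>

lemma sqrt_\<omega>_continuous: "continuous_on {0..1} (\<lambda>s. sqrt (\<omega> (1 - s)))"
proof (rule continuous_on_real_sqrt)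
  show "continuous_on {0..1} (\<lambda>s. \<omega> (1 - s))"
    by (rule continuous_on_compose2[OF \<omega>(1)]) (auto intro!: continuous_intros)
qed

lemma sqrt_\<omega>_nonneg: "s \<in> {0..1} \<Longrightarrow> 0 \<le> sqrt (\<omega> (1 - s))"
  using \<omega>(2)[of "1 - s"] by simp

lemma sqrt_\<omega>_integrable:
  assumes "0 \<le> s" "t \<le> 1"
  shows "(\<lambda>s. sqrt (\<omega> (1 - s))) integrable_on {s..t}"
  by (intro integrable_continuous_interval continuous_on_subset[OF sqrt_\<omega>_continuous]) (use assms in auto)

lemma Psi_combine:
  assumes "0 \<le> s" "s \<le> t" "t \<le> 1"
  shows "Psi \<omega> s + integral {s..t} (\<lambda>s. sqrt (\<omega> (1 - s))) = Psi \<omega> t"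
  unfolding Psi_def
  by (rule Henstock_Kurzweil_Integration.integral_combine[OF assms(1,2) sqrt_\<omega>_integrable[OF order_refl assms(3)]])

lemma Psi_continuous: "continuous_on {0..1} (Psi \<omega>)"
  unfolding Psi_def[abs_def]
  by (rule indefinite_integral_continuous_1[OF sqrt_\<omega>_integrable[OF order_refl order_refl]])

lemma Psi_mono:
  assumes "0 \<le> s" "s \<le> t" "t \<le> 1"
  shows "Psi \<omega> s \<le> Psi \<omega> t"
proof -
  have "0 \<le> integral {s..t} (\<lambda>s. sqrt (\<omega> (1 - s)))"
  proof (rule integral_nonneg[OF sqrt_\<omega>_integrable[OF assms(1,3)]])
    fix x assume "x \<in> {s..t}"
    then have "x \<in> {0..1}" using assms by auto
    then show "0 \<le> sqrt (\<omega> (1 - x))" by (rule sqrt_\<omega>_nonneg)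
  qed
  then show ?thesis using Psi_combine[OF assms] by linarith
qed

text \<open>The integrand is continuous and nonnegative, and positive at t because \<omega> vanishes
  only at 0; so it cannot integrate to 0 over \<open>{t..1}\<close>.\<close>

lemma Psi_less:
  assumes t: "0 \<le> t" "t < 1"
  shows "Psi \<omega> t < Psi \<omega> 1"
proof -
  let ?H = "\<lambda>s. sqrt (\<omega> (1 - s))"
  have sub: "{t..1} \<subseteq> {0..1}" using t by auto
  have Hc: "continuous_on {t..1} ?H" by (rule continuous_on_subset[OF sqrt_\<omega>_continuous sub])
  have H0: "\<And>x. x \<in> {t..1} \<Longrightarrow> 0 \<le> ?H x" using sub sqrt_\<omega>_nonneg by blast
  have "integral {t..1} ?H \<noteq> 0"
  proof
    assume "integral {t..1} ?H = 0"
    then have "?H t = 0" using integral_eq_0_iff[OF Hc t(2) H0] t by simp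
    then show False using \<omega>(3)[of "1 - t"] t by simp
  qed
  moreover have "0 \<le> integral {t..1} ?H"
    by (rule integral_nonneg[OF sqrt_\<omega>_integrable[OF t(1) order_refl] H0])
  ultimately show ?thesis using Psi_combine[of t 1] t by linarith
qed

end

text \<open>The situation after all extractions: the pairs are given by their continuous
  representatives, converge almost everywhere, and have convergent energies. \<open>u\<close> and
  \<open>v\<close> form the limit pair, whose regularity is to be derived.\<close>

locale phase_field_sequence = phase_field +
  fixes \<epsilon> \<gamma> cu cv :: "nat \<Rightarrow> real" and p q V :: "nat \<Rightarrow> real \<Rightarrow> real" and u v :: "real \<Rightarrow> real" and L :: real
  assumes \<epsilon>: "\<And>j. 0 < \<epsilon> j" "\<epsilon> \<longlonglongrightarrow> 0"
    and \<gamma>: "\<And>j. 0 < \<gamma> j" "filterlim (\<lambda>j. \<gamma> j / \<epsilon> j) at_top sequentially"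
    and p: "\<And>j. p j \<in> L2_space {a<..<b}" and q: "\<And>j. q j \<in> L2_space {a<..<b}"
    and V: "\<And>j x. x \<in> {a<..<b} \<Longrightarrow> V j x = cv j + integral {a..x} (q j)"
      "\<And>j x. x \<in> {a<..<b} \<Longrightarrow> V j x \<in> {0..1}" "\<And>j. continuous_on {a<..<b} (V j)"
    and U_conv: "AE x in lebesgue_on {a<..<b}. (\<lambda>j. cu j + integral {a..x} (p j)) \<longlonglongrightarrow> u x"
    and V_conv: "AE x in lebesgue_on {a<..<b}. (\<lambda>j. V j x) \<longlonglongrightarrow> v x"
    and bulk_int: "\<And>j. integrable (lebesgue_on {a<..<b}) (\<lambda>x. E (\<gamma> j) (V j x) * (p j x)\<^sup>2)"
    and surf_int: "\<And>j. integrable (lebesgue_on {a<..<b}) (\<lambda>x. \<omega> (1 - V j x) / (4 * \<epsilon> j) + \<epsilon> j * (q j x)\<^sup>2)"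
    and energy: "(\<lambda>j. (LINT x|lebesgue_on {a<..<b}. E (\<gamma> j) (V j x) * (p j x)\<^sup>2) +
      (LINT x|lebesgue_on {a<..<b}. \<omega> (1 - V j x) / (4 * \<epsilon> j) + \<epsilon> j * (q j x)\<^sup>2)) \<longlonglongrightarrow> L"
begin

section \<open>Sequences with converging energy\<close>

definition U :: "nat \<Rightarrow> real \<Rightarrow> real" where "U j x = cu j + integral {a..x} (p j)"
definition e :: "nat \<Rightarrow> real \<Rightarrow> real" where "e j x = \<omega> (1 - V j x) / (4 * \<epsilon> j) + \<epsilon> j * (q j x)\<^sup>2"
definition bulk :: "nat \<Rightarrow> real" where "bulk j = (LINT x|LL. E (\<gamma> j) (V j x) * (p j x)\<^sup>2)"
definition surf :: "nat \<Rightarrow> real" where "surf j = (LINT x|LL. e j x)"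

lemma \<omega>V: "x \<in> \<Omega> \<Longrightarrow> 0 \<le> \<omega> (1 - V j x)"
  using \<omega>(2)[of "1 - V j x"] V(2)[of x j] by simp

lemma e_nonneg: "x \<in> \<Omega> \<Longrightarrow> 0 \<le> e j x"
  unfolding e_def using \<omega>V[of x j] \<epsilon>(1)[of j] by (intro add_nonneg_nonneg mult_nonneg_nonneg divide_nonneg_nonneg) auto

lemma e_int: "integrable LL (e j)"
  unfolding e_def[abs_def] by (rule surf_int)

lemma E_nonneg: "x \<in> \<Omega> \<Longrightarrow> 0 \<le> E (\<gamma> j) (V j x)"
  by (rule E_bounds(1)[OF V(2) less_imp_le[OF \<gamma>(1)]])

lemma bulk_nonneg: "0 \<le> bulk j"
  unfolding bulk_def
proof (intro integral_nonneg_AE AE_I2)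
  show "0 \<le> E (\<gamma> j) (V j x) * (p j x)\<^sup>2" if "x \<in> space LL" for x
    using E_nonneg[of x j] that by simp
qed

lemma energy_lim: "(\<lambda>j. bulk j + surf j) \<longlonglongrightarrow> L"
  using energy by (simp only: bulk_def surf_def e_def)

lemma energy_bounded: "\<exists>C>0. \<forall>j. bulk j + surf j \<le> C"
proof -
  have "Bseq (\<lambda>j. bulk j + surf j)" using energy_lim by (intro convergent_imp_Bseq convergentI)
  then obtain C where "0 < C" "\<And>j. norm (bulk j + surf j) \<le> C" by (auto simp: Bseq_def)
  moreover have "bulk j + surf j \<le> norm (bulk j + surf j)" for j by simp
  ultimately show ?thesis by (meson order_trans)
qed

text \<open>The energy bound makes the integral of \<omega>(1 - V) of order \<epsilon>, so Fatou
  forces \<omega>(1 - v) = 0 almost everywhere, and \<omega> vanishes only at 0.\<close>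

lemma v_eq_1: "AE x in LL. v x = 1"
proof -
  \<comment> \<open>\<open>G\<close> is built from the sequence, which makes it measurable; it
    equals \<omega>(1 - v) almost everywhere.\<close>
  define G where "G = (\<lambda>x. lim (\<lambda>j. \<omega> (1 - V j x)))"
  have m: "(\<lambda>x. \<omega> (1 - V j x)) \<in> borel_measurable LL" and i: "integrable LL (\<lambda>x. \<omega> (1 - V j x))" for j
    using composite_measurable(2,3)[OF V(3) V(2), of 0] by simp_all
  have Gm: "G \<in> borel_measurable LL" unfolding G_def by (rule borel_measurable_lim_metric) (rule m)
  have sp: "AE x in LL. x \<in> \<Omega>" by (rule AE_I2) simp
  have lim: "AE x in LL. v x \<in> {0..1} \<and> (\<lambda>j. \<omega> (1 - V j x)) \<longlonglongrightarrow> \<omega> (1 - v x)"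
    using V_conv sp
  proof eventually_elim
    case (elim x)
    have "v x \<in> {0..1}"
      by (rule closed_sequentially[OF closed_atLeastAtMost _ elim(1)]) (use V(2)[OF elim(2)] in blast)
    moreover have "(\<lambda>j. \<omega> (1 - V j x)) \<longlonglongrightarrow> \<omega> (1 - v x)"
      by (rule continuous_on_tendsto_compose[OF \<omega>(1)])
        (use V(2)[OF elim(2)] calculation elim(1) in \<open>auto intro!: tendsto_intros\<close>)
    ultimately show ?case by blast
  qed
  have Glim: "AE x in LL. (\<lambda>j. \<omega> (1 - V j x)) \<longlonglongrightarrow> G x"
    using lim by eventually_elim (auto simp: G_def limI)
  have nn: "AE x in LL. 0 \<le> \<omega> (1 - V j x)" for j by (rule AE_I2) (use \<omega>V in simp)
  obtain C where C: "0 < C" "\<And>j. bulk j + surf j \<le> C" using energy_bounded by blast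
  have le: "(LINT x|LL. \<omega> (1 - V j x)) \<le> 4 * \<epsilon> j * C" for j
  proof -
    have "(LINT x|LL. \<omega> (1 - V j x)) \<le> (LINT x|LL. 4 * \<epsilon> j * e j x)"
    proof (rule integral_mono[OF i integrable_mult_right[OF e_int]])
      fix x assume "x \<in> space LL"
      have "4 * \<epsilon> j * e j x = \<omega> (1 - V j x) + 4 * (\<epsilon> j)\<^sup>2 * (q j x)\<^sup>2"
        using \<epsilon>(1)[of j] by (simp add: e_def field_simps power2_eq_square)
      then show "\<omega> (1 - V j x) \<le> 4 * \<epsilon> j * e j x" by simp
    qed
    also have "\<dots> = 4 * \<epsilon> j * surf j" by (simp add: surf_def)
    also have "\<dots> \<le> 4 * \<epsilon> j * C"
      using C(2)[of j] bulk_nonneg[of j] \<epsilon>(1)[of j] by (intro mult_left_mono) auto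
    finally show ?thesis .
  qed
  have lim0: "(\<lambda>j. 4 * \<epsilon> j * C) \<longlonglongrightarrow> 4 * 0 * C" by (intro tendsto_intros \<epsilon>)
  have ev: "eventually (\<lambda>j. (LINT x|LL. \<omega> (1 - V j x)) \<le> d) sequentially" if "0 < d" for d
  proof -
    have "eventually (\<lambda>j. 4 * \<epsilon> j * C < d) sequentially"
      using lim0 that by (intro order_tendstoD) auto
    then show ?thesis
    proof eventually_elim
      case (elim j)
      then show ?case using le[of j] by linarith
    qed
  qed
  note fat = fatou_real[OF i nn ev Gm Glim]
  have Gi: "integrable LL G" by (rule fat(1)[of 1]) simp
  have "(LINT x|LL. G x) \<le> 0"
    by (rule field_le_epsilon) (use fat(2) in simp)
  moreover have G0: "AE x in LL. 0 \<le> G x"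
    using lim by eventually_elim (use \<omega>(2) in \<open>auto simp: G_def limI\<close>)
  ultimately have "(LINT x|LL. G x) = 0" using integral_nonneg_AE[OF G0] by linarith
  then have "AE x in LL. G x = 0" using integral_nonneg_eq_0_iff_AE[OF Gi G0] by blast
  with lim show ?thesis
  proof eventually_elim
    case (elim x)
    then have "lim (\<lambda>j. \<omega> (1 - V j x)) = \<omega> (1 - v x)" by (intro limI) blast
    then have "\<omega> (1 - v x) = 0" using elim(2) by (simp only: G_def)
    moreover have "1 - v x \<in> {0..1}" using elim(1) by simp
    ultimately have "1 - v x = 0" using \<omega>(3) by blast
    then show ?case by simp
  qed
qed

lemma V_conv_1: "AE x in LL. (\<lambda>j. V j x) \<longlonglongrightarrow> 1"
  using V_conv v_eq_1 by eventually_elim simp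

text \<open>Expanding (sqrt \<omega> - 2 \<epsilon> |q|)^2 \<ge> 0, with \<omega> taken at 1 - V,
  gives sqrt \<omega> |q| \<le> e, which is the hypothesis of
  \<open>chain_rule_bound\<close>.\<close>

lemma Psi_V_diff:
  assumes "a < x" "x \<le> y" "y < b"
  shows "\<bar>Psi \<omega> (V j y) - Psi \<omega> (V j x)\<bar> \<le> integral {x..y} (e j)"
  unfolding Psi_def
proof (rule chain_rule_bound[OF sqrt_\<omega>_continuous _ L2_imp_integrable[OF q] e_int V(1,2) _ assms])
  show "0 \<le> sqrt (\<omega> (1 - t))" if "t \<in> {0..1}" for t using \<omega>(2)[of "1 - t"] that by simp
  fix x assume x: "x \<in> \<Omega>"
  define w where "w = \<omega> (1 - V j x)"
  have w: "0 \<le> w" unfolding w_def by (rule \<omega>V[OF x])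
  have "0 \<le> (sqrt w - 2 * \<epsilon> j * \<bar>q j x\<bar>)\<^sup>2" by simp
  also have "\<dots> = w - 4 * \<epsilon> j * (sqrt w * \<bar>q j x\<bar>) + 4 * (\<epsilon> j)\<^sup>2 * (q j x)\<^sup>2"
    using w by (simp add: power2_diff power_mult_distrib)
  also have "\<dots> = 4 * \<epsilon> j * (e j x - sqrt w * \<bar>q j x\<bar>)"
    using \<epsilon>(1)[of j] by (simp add: e_def w_def[symmetric] field_simps power2_eq_square)
  finally have "0 \<le> e j x - sqrt w * \<bar>q j x\<bar>" using \<epsilon>(1)[of j] by (simp add: zero_le_mult_iff)
  then show "sqrt (\<omega> (1 - V j x)) * \<bar>q j x\<bar> \<le> e j x" by (simp add: w_def)
qed

text \<open>Stated with \<open>eventually\<close> along a subsequence, so that the property survives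
  passage to further subsequences; this allows exceptional points to be added one at a time.\<close>

definition dips :: "real \<Rightarrow> (nat \<Rightarrow> nat) \<Rightarrow> real \<Rightarrow> bool" where
  "dips \<delta> r x \<longleftrightarrow> (\<forall>d>0. eventually (\<lambda>j. \<exists>z\<in>\<Omega>. \<bar>z - x\<bar> < d \<and> V (r j) z < \<delta>) sequentially)"

lemma e_indicator_mono:
  assumes "A \<subseteq> B" "A \<in> sets borel" "B \<in> sets borel"
  shows "(LINT x|LL. e j x * indicator A x) \<le> (LINT x|LL. e j x * indicator B x)"
proof (rule integral_mono)
  have "integrable LL (\<lambda>x. e j x * indicator S x)" if "S \<in> sets borel" for S
    by (rule integrable_mult_bounded[OF e_int borel_measurable_lebesgue_on_borel, where B = 1]) (use that in auto)
  then show "integrable LL (\<lambda>x. e j x * indicator A x)" "integrable LL (\<lambda>x. e j x * indicator B x)"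
    using assms by blast+
  show "e j x * indicator A x \<le> e j x * indicator B x" if "x \<in> space LL" for x
    using e_nonneg[of x j] that assms(1) by (intro mult_left_mono) (auto simp: indicator_def)
qed

text \<open>\<open>V\<close> is near 1 at some point on each side of \<open>x\<close> and below
  \<delta> in between, so \<Psi>(V) falls and rises again by almost \<Psi>(1) - \<Psi>(\<delta>).
  This is the origin of the factor 2 in the limit energy.\<close>

lemma surface_at_point:
  assumes r: "strict_mono r" and x: "dips \<delta> r x" and \<delta>: "0 < \<delta>" "\<delta> < 1"
    and R: "0 < R" "a \<le> x - R" "x + R \<le> b" and \<rho>: "0 < \<rho>"
  shows "eventually (\<lambda>j. 2 * (Psi \<omega> 1 - Psi \<omega> \<delta>) - \<rho> \<le> (LINT t|LL. e (r j) t * indicator {x - R<..<x + R} t)) sequentially"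
proof -
  \<comment> \<open>Convergence to 1 holds almost everywhere, hence at some point of every
    subinterval.\<close>
  have "\<exists>y\<in>{x - R<..<x}. (\<lambda>j. V j y) \<longlonglongrightarrow> 1" by (rule AE_Ioo_ex[OF V_conv_1]) (use R in auto)
  then obtain y where y: "y \<in> {x - R<..<x}" "(\<lambda>j. V j y) \<longlonglongrightarrow> 1" by blast
  have "\<exists>z\<in>{x<..<x + R}. (\<lambda>j. V j z) \<longlonglongrightarrow> 1" by (rule AE_Ioo_ex[OF V_conv_1]) (use R in auto)
  then obtain z where z: "z \<in> {x<..<x + R}" "(\<lambda>j. V j z) \<longlonglongrightarrow> 1" by blast
  have yz: "y \<in> \<Omega>" "z \<in> \<Omega>" using y z R by auto
  have near: "eventually (\<lambda>j. Psi \<omega> 1 - \<rho> / 2 < Psi \<omega> (V (r j) t)) sequentially"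
    if t: "t \<in> \<Omega>" "(\<lambda>j. V j t) \<longlonglongrightarrow> 1" for t
  proof -
    have "(\<lambda>j. V (r j) t) \<longlonglongrightarrow> 1" using LIMSEQ_subseq_LIMSEQ[OF t(2) r] by (simp add: o_def)
    then have "(\<lambda>j. Psi \<omega> (V (r j) t)) \<longlonglongrightarrow> Psi \<omega> 1"
      by (rule continuous_on_tendsto_compose[OF Psi_continuous]) (use V(2)[OF t(1)] in auto)
    then show ?thesis by (rule order_tendstoD) (use \<rho> in simp)
  qed
  have d: "0 < min (x - y) (z - x)" using y z by auto
  have "eventually (\<lambda>j. \<exists>w\<in>\<Omega>. \<bar>w - x\<bar> < min (x - y) (z - x) \<and> V (r j) w < \<delta>) sequentially"
    using x d unfolding dips_def by blast
  with near[OF yz(1) y(2)] near[OF yz(2) z(2)] show ?thesis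
  proof eventually_elim
    case (elim j)
    then obtain w where w: "w \<in> \<Omega>" "\<bar>w - x\<bar> < min (x - y) (z - x)" "V (r j) w < \<delta>" by blast
    have yw: "y \<le> w" "w \<le> z" using w(2) by auto
    have "Psi \<omega> (V (r j) w) \<le> Psi \<omega> \<delta>" using w(3) V(2)[OF w(1), of "r j"] \<delta> by (intro Psi_mono) auto
    moreover have "\<bar>Psi \<omega> (V (r j) w) - Psi \<omega> (V (r j) y)\<bar> \<le> integral {y..w} (e (r j))"
      by (rule Psi_V_diff) (use yz yw w in auto)
    moreover have "\<bar>Psi \<omega> (V (r j) z) - Psi \<omega> (V (r j) w)\<bar> \<le> integral {w..z} (e (r j))"
      by (rule Psi_V_diff) (use yz yw w in auto)
    moreover have "integral {y..w} (e (r j)) + integral {w..z} (e (r j)) = integral {y..z} (e (r j))"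
      using primitive_diff[OF e_int, of y w "r j"] primitive_diff[OF e_int, of w z "r j"]
        primitive_diff[OF e_int, of y z "r j"] yz yw w(1) by auto
    moreover have "integral {y..z} (e (r j)) = (LINT t|LL. e (r j) t * indicator {y..z} t)"
      by (rule integral_Icc_indicator(2)[OF e_int]) (use yz yw in auto)
    moreover have "\<dots> \<le> (LINT t|LL. e (r j) t * indicator {x - R<..<x + R} t)"
      by (rule e_indicator_mono) (use y z in auto)
    ultimately show ?case using elim by argo
  qed
qed

text \<open>Disjoint intervals around the points of \<open>B\<close> carry separate amounts of
  surface energy.\<close>

lemma surface_lower:
  assumes r: "strict_mono r" and B: "finite B" "B \<subseteq> \<Omega>" "\<And>x. x \<in> B \<Longrightarrow> dips \<delta> r x"
    and \<delta>: "0 < \<delta>" "\<delta> < 1" and \<rho>: "0 < \<rho>"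
  shows "eventually (\<lambda>j. real (card B) * (2 * (Psi \<omega> 1 - Psi \<omega> \<delta>) - \<rho>) \<le> surf (r j)) sequentially"
proof -
  obtain R where R: "0 < R" "\<And>x. x \<in> B \<Longrightarrow> a \<le> x - R \<and> x + R \<le> b"
    "\<And>x y. x \<in> B \<Longrightarrow> y \<in> B \<Longrightarrow> x \<noteq> y \<Longrightarrow> {x - R<..<x + R} \<inter> {y - R<..<y + R} = {}"
  proof -
    \<comment> \<open>The minimum of \<open>D\<close> bounds the common radius by the distances to
      the ends and by half the mutual distances; the entry 1 covers empty \<open>B\<close>.\<close>
    define D where "D = insert 1 ((\<lambda>x. x - a) ` B \<union> (\<lambda>x. b - x) ` B \<union> (\<lambda>(x, y). \<bar>x - y\<bar> / 2) ` {(x, y) \<in> B \<times> B. x \<noteq> y})"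
    have fin: "finite D"
    proof -
      have "finite {(x, y) \<in> B \<times> B. x \<noteq> y}" by (rule finite_subset[of _ "B \<times> B"]) (use B(1) in auto)
      then show ?thesis unfolding D_def using B(1) by simp
    qed
    have "0 < d" if "d \<in> D" for d using that B(2) unfolding D_def by auto
    then have pos: "0 < Min D" using fin by (subst Min_gr_iff) (auto simp: D_def)
    have le: "Min D \<le> d" if "d \<in> D" for d using fin that by (rule Min_le)
    show ?thesis
    proof (rule that[OF pos])
      show "a \<le> x - Min D \<and> x + Min D \<le> b" if "x \<in> B" for x
        using le[of "x - a"] le[of "b - x"] that by (auto simp: D_def)
      fix x y assume xy: "x \<in> B" "y \<in> B" "x \<noteq> y"
      have "\<bar>x - y\<bar> / 2 \<in> D" unfolding D_def using xy by (intro insertI2 UnI2 image_eqI[of _ _ "(x, y)"]) auto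
      from le[OF this] show "{x - Min D<..<x + Min D} \<inter> {y - Min D<..<y + Min D} = {}" by auto
    qed
  qed
  let ?I = "\<lambda>x. {x - R<..<x + R}"
  have int: "integrable LL (\<lambda>t. e j t * indicator (?I x) t)" for j x
    by (rule integrable_mult_bounded[OF e_int borel_measurable_lebesgue_on_borel, where B = 1]) auto
  have "eventually (\<lambda>j. \<forall>x\<in>B. 2 * (Psi \<omega> 1 - Psi \<omega> \<delta>) - \<rho> \<le> (LINT t|LL. e (r j) t * indicator (?I x) t)) sequentially"
    using B(1)
  proof (rule eventually_ball_finite, intro ballI)
    fix x assume x: "x \<in> B"
    show "eventually (\<lambda>j. 2 * (Psi \<omega> 1 - Psi \<omega> \<delta>) - \<rho> \<le> (LINT t|LL. e (r j) t * indicator (?I x) t)) sequentially"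
      by (rule surface_at_point[OF r B(3)[OF x] \<delta> R(1) _ _ \<rho>]) (use R(2)[OF x] in auto)
  qed
  then show ?thesis
  proof eventually_elim
    case (elim j)
    have "real (card B) * (2 * (Psi \<omega> 1 - Psi \<omega> \<delta>) - \<rho>) = (\<Sum>x\<in>B. 2 * (Psi \<omega> 1 - Psi \<omega> \<delta>) - \<rho>)" by simp
    also have "\<dots> \<le> (\<Sum>x\<in>B. LINT t|LL. e (r j) t * indicator (?I x) t)"
      by (rule sum_mono) (use elim in blast)
    also have "\<dots> = (LINT t|LL. (\<Sum>x\<in>B. e (r j) t * indicator (?I x) t))"
      by (rule Bochner_Integration.integral_sum[symmetric]) (rule int)
    also have "\<dots> \<le> (LINT t|LL. e (r j) t)"
    proof (rule integral_mono[OF Bochner_Integration.integrable_sum[OF int] e_int])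
      fix t assume "t \<in> space LL"
      then have et: "0 \<le> e (r j) t" using e_nonneg by simp
      have "(\<Sum>x\<in>B. indicator (?I x) t) = (indicator (\<Union>x\<in>B. ?I x) t :: real)"
        by (rule indicator_UN_disjoint[symmetric, OF B(1)]) (use R(3) in \<open>auto simp: disjoint_family_on_def\<close>)
      also have "\<dots> \<le> 1" by (simp add: indicator_def)
      finally show "(\<Sum>x\<in>B. e (r j) t * indicator (?I x) t) \<le> e (r j) t"
        using et by (simp add: sum_distrib_left[symmetric] mult_left_le)
    qed
    finally show ?case by (simp only: surf_def)
  qed
qed

text \<open>
  Every maximal set of points where, along a subsequence, \<open>V\<close> keeps dipping below \<open>\<delta>\<close> is finite, and
  off such a set \<open>V\<close> eventually stays above \<open>\<delta>\<close>: otherwise a further subsequence would add a point.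
\<close>

lemma maximal_dips:
  assumes \<delta>: "0 < \<delta>" "\<delta> < 1"
  shows "\<exists>r B. strict_mono r \<and> finite B \<and> B \<subseteq> \<Omega> \<and> (\<forall>x\<in>B. dips \<delta> r x) \<and>
    (\<forall>x\<in>\<Omega> - B. \<exists>d>0. eventually (\<lambda>j. \<forall>z\<in>\<Omega>. \<bar>z - x\<bar> < d \<longrightarrow> \<delta> \<le> V (r j) z) sequentially)"
proof -
  define P where "P = (\<lambda>n. \<exists>r B. strict_mono r \<and> finite B \<and> B \<subseteq> \<Omega> \<and> card B = n \<and> (\<forall>x\<in>B. dips \<delta> r x))"
  have P0: "P 0" unfolding P_def
    by (rule exI[of _ "\<lambda>j. j"], rule exI[of _ "{}"]) (simp add: strict_mono_def)
  \<comment> \<open>With \<rho> = k each dip still costs 2k - k = k, so energy bounded by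
    \<open>C\<close> admits at most C/k dips.\<close>
  define k where "k = Psi \<omega> 1 - Psi \<omega> \<delta>"
  have k: "0 < k" unfolding k_def using Psi_less[of \<delta>] \<delta> by simp
  obtain C where C: "0 < C" "\<And>j. bulk j + surf j \<le> C" using energy_bounded by blast
  have Pb: "n \<le> nat \<lceil>C / k\<rceil>" if Pn: "P n" for n
  proof -
    obtain r B where rB: "strict_mono r" "finite B" "B \<subseteq> \<Omega>" "card B = n" "\<forall>x\<in>B. dips \<delta> r x"
      using Pn unfolding P_def by blast
    have "eventually (\<lambda>j. real (card B) * (2 * (Psi \<omega> 1 - Psi \<omega> \<delta>) - k) \<le> surf (r j)) sequentially"
      by (rule surface_lower[OF rB(1-3) _ \<delta> k]) (use rB(5) in blast)
    then obtain j where "real (card B) * (2 * (Psi \<omega> 1 - Psi \<omega> \<delta>) - k) \<le> surf (r j)"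
      unfolding eventually_sequentially by blast
    then have "real n * k \<le> surf (r j)" using rB(4) by (simp add: k_def)
    also have "\<dots> \<le> C" using C(2)[of "r j"] bulk_nonneg[of "r j"] by linarith
    finally have "real n \<le> C / k" using k by (simp add: field_simps)
    then show ?thesis by linarith
  qed
  have "\<exists>n. P n \<and> (\<forall>m. P m \<longrightarrow> m \<le> n)"
    using Greatest_le_nat[of P] GreatestI_nat[of P, OF P0] Pb by blast
  then obtain n where n: "P n" "\<And>m. P m \<Longrightarrow> m \<le> n" by blast
  obtain r B where rB: "strict_mono r" "finite B" "B \<subseteq> \<Omega>" "card B = n" "\<forall>x\<in>B. dips \<delta> r x"
    using n(1) unfolding P_def by blast
  have "\<exists>d>0. eventually (\<lambda>j. \<forall>z\<in>\<Omega>. \<bar>z - x\<bar> < d \<longrightarrow> \<delta> \<le> V (r j) z) sequentially" if x: "x \<in> \<Omega> - B" for x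
  proof (rule ccontr)
    assume neg: "\<not> ?thesis"
    \<comment> \<open>If \<open>V\<close> does not stay above \<delta> near \<open>x\<close>, it
      dips at every scale 1/(m+1) for infinitely many indices; one index per scale gives a
      subsequence that dips at \<open>x\<close>.\<close>
    have fr: "frequently (\<lambda>j. \<exists>z\<in>\<Omega>. \<bar>z - x\<bar> < 1 / real (Suc m) \<and> V (r j) z < \<delta>) sequentially" for m
    proof -
      have "\<not> eventually (\<lambda>j. \<forall>z\<in>\<Omega>. \<bar>z - x\<bar> < 1 / real (Suc m) \<longrightarrow> \<delta> \<le> V (r j) z) sequentially"
        using neg by auto
      then have "frequently (\<lambda>j. \<not> (\<forall>z\<in>\<Omega>. \<bar>z - x\<bar> < 1 / real (Suc m) \<longrightarrow> \<delta> \<le> V (r j) z)) sequentially"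
        unfolding not_eventually .
      then show ?thesis by (rule frequently_elim1) (auto simp: not_le)
    qed
    obtain s where s: "strict_mono s" "\<And>m. \<exists>z\<in>\<Omega>. \<bar>z - x\<bar> < 1 / real (Suc m) \<and> V (r (s m)) z < \<delta>"
      using frequently_subseq_ex[of "\<lambda>m j. \<exists>z\<in>\<Omega>. \<bar>z - x\<bar> < 1 / real (Suc m) \<and> V (r j) z < \<delta>", OF fr] by blast
    have "dips \<delta> (r \<circ> s) y" if y: "y \<in> insert x B" for y
    proof (cases "y = x")
      case True
      show ?thesis unfolding dips_def
      proof (intro allI impI)
        fix d :: real assume "0 < d"
        then have "eventually (\<lambda>m. 1 / real (Suc m) < d) sequentially"
          using LIMSEQ_inverse_real_of_nat by (intro order_tendstoD) (auto simp: divide_inverse)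
        then show "eventually (\<lambda>j. \<exists>z\<in>\<Omega>. \<bar>z - y\<bar> < d \<and> V ((r \<circ> s) j) z < \<delta>) sequentially"
        proof eventually_elim
          case (elim m)
          then show ?case using s(2)[of m] True unfolding comp_def by (meson less_trans)
        qed
      qed
    next
      case False
      then have "dips \<delta> r y" using y rB(5) by blast
      show ?thesis unfolding dips_def
      proof (intro allI impI)
        fix d :: real assume "0 < d"
        with \<open>dips \<delta> r y\<close> have "eventually (\<lambda>j. \<exists>z\<in>\<Omega>. \<bar>z - y\<bar> < d \<and> V (r j) z < \<delta>) sequentially"
          unfolding dips_def by blast
        from eventually_subseq[OF s(1) this]
        show "eventually (\<lambda>j. \<exists>z\<in>\<Omega>. \<bar>z - y\<bar> < d \<and> V ((r \<circ> s) j) z < \<delta>) sequentially" by simp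
      qed
    qed
    moreover have "card (insert x B) = Suc n" using x rB by simp
    moreover have "strict_mono (r \<circ> s)" using rB(1) s(1) by (rule strict_mono_o)
    ultimately have "P (Suc n)" unfolding P_def using rB x
      by (intro exI[of _ "r \<circ> s"] exI[of _ "insert x B"]) auto
    then show False using n(2) by fastforce
  qed
  then show ?thesis using rB by blast
qed

end

text \<open>Induction over \<open>B\<close> with the largest point \<open>m\<close> added last:
  subtracting the jump at \<open>m\<close> leaves a function that is constant across
  \<open>m\<close>. Constancy is known on the dense set \<open>E\<close>, so the jump is read off at
  points of \<open>E\<close> on either side.\<close>

lemma piecewise_constant_step_fun:
  fixes w :: "real \<Rightarrow> real" and E :: "real set"
  assumes "finite B"
    and dense: "\<And>c d. a \<le> c \<Longrightarrow> c < d \<Longrightarrow> d \<le> b \<Longrightarrow> \<exists>x\<in>{c<..<d}. x \<in> E"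
    and "B \<subseteq> {a<..<b}" and E: "E \<subseteq> {a<..<b}" and ab: "a < b"
    and "\<And>x y. x \<in> E \<Longrightarrow> y \<in> E \<Longrightarrow> x < y \<Longrightarrow> {x..y} \<inter> B = {} \<Longrightarrow> w x = w y"
  shows "\<exists>c s. \<forall>x\<in>E - B. w x = c + step_fun B s x"
  using assms(1,3,6)
proof (induction B arbitrary: w rule: finite_linorder_max_induct)
  case empty
  have "\<exists>x\<in>{a<..<b}. x \<in> E" by (rule dense[OF order_refl ab order_refl])
  then obtain x0 where x0: "x0 \<in> E" by blast
  have "w x = w x0" if x: "x \<in> E" for x
  proof (cases x x0 rule: linorder_cases)
    case less
    show ?thesis by (rule empty(2)[OF x x0 less]) simp
  next
    case greater
    show ?thesis by (rule empty(2)[OF x0 x greater, symmetric]) simp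
  qed simp
  then show ?case by (intro exI[of _ "w x0"] exI[of _ "\<lambda>_. 0"]) (simp add: step_fun_def)
next
  case (insert m B)
  \<comment> \<open>The left neighbour of \<open>m\<close> in \<open>B\<close>, or the end
    \<open>a\<close> if there is none; \<open>w\<close> is constant on the part of \<open>E\<close>
    between \<open>k\<close> and \<open>m\<close>.\<close>
  define k where "k = Max (insert a B)"
  have k: "a \<le> k" "k < m" "\<And>x. x \<in> B \<Longrightarrow> x \<le> k"
    unfolding k_def using insert by auto
  have kB: "k = a \<or> k \<in> B"
    using Max_in[of "insert a B"] insert(1) unfolding k_def by blast
  have m: "a < m" "m < b" using insert(4) by auto
  have "\<exists>x\<in>{k<..<m}. x \<in> E" by (rule dense[OF k(1,2) less_imp_le[OF m(2)]])
  then obtain x1 where x1: "k < x1" "x1 < m" "x1 \<in> E" by auto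
  have "\<exists>x\<in>{m<..<b}. x \<in> E" by (rule dense[OF less_imp_le[OF m(1)] m(2) order_refl])
  then obtain x2 where x2: "m < x2" "x2 < b" "x2 \<in> E" by auto
  define w' where "w' = (\<lambda>x. w x - (w x2 - w x1) * (if m < x then 1 else 0))"
  have left: "w x = w x1" if "x \<in> E" "k < x" "x < m" for x
  proof (cases x x1 rule: linorder_cases)
    case less
    have "{x..x1} \<inter> insert m B = {}" using k(3) that x1 by force
    then show ?thesis using insert(5)[OF that(1) x1(3) less] by simp
  next
    case greater
    have "{x1..x} \<inter> insert m B = {}" using k(3) that x1 by force
    then show ?thesis using insert(5)[OF x1(3) that(1) greater] by simp
  qed simp
  have right: "w x = w x2" if "x \<in> E" "m < x" for x
  proof (cases x x2 rule: linorder_cases)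
    case less
    have "{x..x2} \<inter> insert m B = {}" using k(2,3) that x2 by force
    then show ?thesis using insert(5)[OF that(1) x2(3) less] by simp
  next
    case greater
    have "{x2..x} \<inter> insert m B = {}" using k(2,3) that x2 by force
    then show ?thesis using insert(5)[OF x2(3) that(1) greater] by simp
  qed simp
  define E' where "E' = E - {m}"
  have "w' x = w' y" if xy: "x \<in> E" "y \<in> E" "x < y" "{x..y} \<inter> B = {}" "x \<noteq> m" "y \<noteq> m" for x y
  proof -
    consider "y < m" | "m < x" | "x < m" "m < y" using xy by linarith
    then show ?thesis
    proof cases
      case 1
      then have "{x..y} \<inter> insert m B = {}" using xy by auto
      then show ?thesis using insert(5)[OF xy(1-3)] 1 xy(3) by (simp add: w'_def)
    next
      case 2
      then have "{x..y} \<inter> insert m B = {}" using xy by auto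
      then show ?thesis using insert(5)[OF xy(1-3)] 2 xy(3) by (simp add: w'_def)
    next
      case 3
      have "k < x"
      proof (rule ccontr)
        assume "\<not> k < x"
        then have "k \<noteq> a" using xy(1) E by auto
        then have "k \<in> {x..y} \<inter> B" using kB \<open>\<not> k < x\<close> k(2) 3 by auto
        then show False using xy(4) by blast
      qed
      then show ?thesis using left[OF xy(1) _ 3(1)] right[OF xy(2) 3(2)] 3 by (simp add: w'_def)
    qed
  qed
  note w'eq = this
  \<comment> \<open>For the smaller set \<open>B\<close> the point \<open>m\<close> counts as an
    ordinary point of \<open>E\<close>, but \<open>w\<close> is arbitrary there; resetting this
    value makes the function constant across \<open>m\<close>.\<close>
  define w'' where "w'' = (\<lambda>x. if x = m then w x1 else w' x)"
  have "w'' x = w'' y" if xy: "x \<in> E" "y \<in> E" "x < y" "{x..y} \<inter> B = {}" for x y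
  proof -
    have near_m: "w' z = w x1" if z: "z \<in> E" "z \<noteq> m" "k < z" for z
    proof (cases "z < m")
      case True
      then show ?thesis using left[OF z(1,3)] by (simp add: w'_def)
    next
      case False
      then have "m < z" using z(2) by simp
      then show ?thesis using right[OF z(1)] by (simp add: w'_def)
    qed
    consider "x \<noteq> m" "y \<noteq> m" | "x = m" | "y = m" by blast
    then show ?thesis
    proof cases
      case 1
      then show ?thesis using w'eq[OF xy] by (simp add: w''_def)
    next
      case 2
      then show ?thesis using near_m[OF xy(2)] xy(3) k(2) by (simp add: w''_def)
    next
      case 3
      have "k < x"
      proof (rule ccontr)
        assume "\<not> k < x"
        then have "k \<noteq> a" using xy(1) E by auto
        then have "k \<in> {x..y} \<inter> B" using kB \<open>\<not> k < x\<close> k(2) 3 by auto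
        then show False using xy(4) by blast
      qed
      then show ?thesis using near_m[OF xy(1)] xy(3) 3 by (simp add: w''_def)
    qed
  qed
  then obtain c s where cs: "\<And>x. x \<in> E - B \<Longrightarrow> w'' x = c + step_fun B s x"
    using insert(3)[of w''] insert(4) by blast
  have mB: "m \<notin> B" using insert(2) by auto
  define s' where "s' = s(m := w x2 - w x1)"
  have st: "step_fun (insert m B) s' x = (w x2 - w x1) * (if m < x then 1 else 0) + step_fun B s x" for x
  proof -
    have "(\<Sum>p\<in>B. s' p * (if p < x then 1 else 0)) = (\<Sum>p\<in>B. s p * (if p < x then 1 else 0))"
      by (rule sum.cong) (use mB in \<open>auto simp: s'_def\<close>)
    then show ?thesis using insert(1) mB by (simp add: step_fun_def s'_def)
  qed
  have "w x = c + step_fun (insert m B) s' x" if "x \<in> E - insert m B" for x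
    using cs[of x] that unfolding st by (auto simp: w''_def w'_def)
  then show ?case by blast
qed

section \<open>Compactness of the truncated gradients\<close>

context phase_field_sequence
begin

text \<open>Where the coefficient is at least \<open>(1 - \<theta>) * \<phi>inf\<close> the bulk
  energy controls the gradient in L2; the part cut off becomes negligible in L1 away from the
  dips.\<close>

definition h :: "real \<Rightarrow> nat \<Rightarrow> real \<Rightarrow> real" where
  "h \<theta> j x = p j x * (if E (\<gamma> j) (V j x) < (1 - \<theta>) * \<phi>inf then 0 else 1)"

lemma h_L2:
  shows "h \<theta> j \<in> borel_measurable LL" and "integrable LL (\<lambda>x. (h \<theta> j x)\<^sup>2)"
    and "(1 - \<theta>) * \<phi>inf * (LINT x|LL. (h \<theta> j x)\<^sup>2) \<le> bulk j"
proof -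
  have [measurable]: "p j \<in> borel_measurable LL" and p2: "integrable LL (\<lambda>x. (p j x)\<^sup>2)" using p[of j] by (auto simp: L2_space_def)
  have [measurable]: "(\<lambda>x. E (\<gamma> j) (V j x)) \<in> borel_measurable LL"
    by (rule composite_measurable(1)[OF V(3) V(2) less_imp_le[OF \<gamma>(1)]])
  show m: "h \<theta> j \<in> borel_measurable LL" unfolding h_def[abs_def] by measurable
  have le: "(h \<theta> j x)\<^sup>2 \<le> (p j x)\<^sup>2" for x by (simp add: h_def)
  show i: "integrable LL (\<lambda>x. (h \<theta> j x)\<^sup>2)"
    by (rule Bochner_Integration.integrable_bound[OF p2]) (use m le in auto)
  have "(LINT x|LL. (1 - \<theta>) * \<phi>inf * (h \<theta> j x)\<^sup>2) \<le> bulk j"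
    unfolding bulk_def
  proof (rule integral_mono[OF integrable_mult_right[OF i] bulk_int])
    fix x assume "x \<in> space LL"
    then have x: "x \<in> \<Omega>" by simp
    show "(1 - \<theta>) * \<phi>inf * (h \<theta> j x)\<^sup>2 \<le> E (\<gamma> j) (V j x) * (p j x)\<^sup>2"
      using E_nonneg[OF x, of j] by (auto simp: h_def intro: mult_right_mono)
  qed
  then show "(1 - \<theta>) * \<phi>inf * (LINT x|LL. (h \<theta> j x)\<^sup>2) \<le> bulk j" by simp
qed

lemma h_integrable: "integrable LL (h \<theta> j)"
  by (rule finite_measure.integrable_square_bound(1)[OF finite_measure_lebesgue_on_Ioo h_L2(1,2)])

text \<open>
  Where the coefficient is small, \<open>E \<omega> \<ge> c \<gamma>\<close>, so the energy controls \<open>\<bar>u'\<bar>\<close> with the factor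
  \<open>(\<epsilon> / \<gamma>)\<^sup>1\<^sup>/\<^sup>2\<close> by the inequality of the means. This is where \<open>\<gamma> / \<epsilon> \<rightarrow> \<infinity>\<close> enters.
\<close>

lemma small_coefficient_estimate:
  assumes c: "0 < c" "\<And>t. t \<in> {\<delta>..1} \<Longrightarrow> E (\<gamma> j) t < (1 - \<theta>) * \<phi>inf \<Longrightarrow> c * \<gamma> j \<le> E (\<gamma> j) t * \<omega> (1 - t)"
    and xy: "a < x" "x \<le> y" "y < b" and Vge: "\<And>z. z \<in> {x..y} \<Longrightarrow> \<delta> \<le> V j z"
  shows "\<bar>integral {x..y} (p j) - (LINT t|LL. h \<theta> j t * indicator {x..y} t)\<bar> \<le> sqrt (\<epsilon> j / (c * \<gamma> j)) * (bulk j + surf j)"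
proof -
  define K where "K = sqrt (\<epsilon> j / (c * \<gamma> j))"
  have K0: "0 \<le> K" unfolding K_def using c(1) \<epsilon>(1)[of j] \<gamma>(1)[of j] by simp
  have pi: "integrable LL (p j)" by (rule L2_imp_integrable[OF p])
  have ind: "integrable LL (\<lambda>t. f t * indicator {x..y} t)" if "integrable LL f" for f :: "real \<Rightarrow> real"
    by (rule integrable_mult_bounded[OF that borel_measurable_lebesgue_on_borel, where B = 1]) auto
  have bs: "integrable LL (\<lambda>t. E (\<gamma> j) (V j t) * (p j t)\<^sup>2 + e j t)"
    by (rule Bochner_Integration.integrable_add[OF bulk_int e_int])
  have eq: "integral {x..y} (p j) - (LINT t|LL. h \<theta> j t * indicator {x..y} t) = (LINT t|LL. p j t * indicator {x..y} t - h \<theta> j t * indicator {x..y} t)"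
    using integral_Icc_indicator(2)[OF pi, of x y] xy Bochner_Integration.integral_diff[OF ind[OF pi] ind[OF h_integrable]] by simp
  have "\<bar>integral {x..y} (p j) - (LINT t|LL. h \<theta> j t * indicator {x..y} t)\<bar>
    \<le> (LINT t|LL. \<bar>p j t * indicator {x..y} t - h \<theta> j t * indicator {x..y} t\<bar>)"
    unfolding eq by (rule integral_abs_bound)
  also have "\<dots> \<le> (LINT t|LL. K * (E (\<gamma> j) (V j t) * (p j t)\<^sup>2 + e j t))"
  proof (rule integral_mono[OF integrable_abs[OF Bochner_Integration.integrable_diff[OF ind[OF pi] ind[OF h_integrable]]] integrable_mult_right[OF bs]])
    fix t assume "t \<in> space LL"
    then have t: "t \<in> \<Omega>" by simp
    define X where "X = E (\<gamma> j) (V j t)"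
    define w where "w = \<omega> (1 - V j t)"
    have X0: "0 \<le> X" and w0: "0 \<le> w" and e0: "0 \<le> e j t"
      unfolding X_def w_def using E_nonneg[OF t] \<omega>V[OF t] e_nonneg[OF t] by auto
    have rhs: "0 \<le> K * (X * (p j t)\<^sup>2 + e j t)" using K0 X0 e0 by simp
    show "\<bar>p j t * indicator {x..y} t - h \<theta> j t * indicator {x..y} t\<bar> \<le> K * (E (\<gamma> j) (V j t) * (p j t)\<^sup>2 + e j t)"
    proof (cases "t \<in> {x..y} \<and> X < (1 - \<theta>) * \<phi>inf")
      case False
      then have "p j t * indicator {x..y} t - h \<theta> j t * indicator {x..y} t = 0" by (auto simp: h_def X_def indicator_def)
      then show ?thesis using rhs unfolding X_def by (simp only: abs_zero)
    next
      case True
      have "V j t \<in> {\<delta>..1}" using Vge[of t] V(2)[OF t, of j] True by auto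
      then have Xw: "c * \<gamma> j \<le> X * w" unfolding X_def w_def by (rule c(2)) (use True in \<open>simp add: X_def\<close>)
      \<comment> \<open>The reciprocal of \<open>K\<close>. Splitting sqrt(X w/\<epsilon>) as 2 sqrt
        X sqrt(w/(4 \<epsilon>)) lets the product be bounded by one bulk and one surface term of the
        energy density.\<close>
      define k where "k = sqrt (c * \<gamma> j / \<epsilon> j)"
      have cg: "0 < c * \<gamma> j / \<epsilon> j" using c(1) \<gamma>(1)[of j] \<epsilon>(1)[of j] by simp
      have kK: "K * k = 1"
        unfolding K_def k_def real_sqrt_mult[symmetric] using c(1) \<gamma>(1)[of j] \<epsilon>(1)[of j] by simp
      have "k \<le> sqrt (X * w / \<epsilon> j)" unfolding k_def using Xw \<epsilon>(1)[of j] by (intro real_sqrt_le_mono divide_right_mono) auto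
      then have "k * \<bar>p j t\<bar> \<le> sqrt (X * w / \<epsilon> j) * \<bar>p j t\<bar>" by (rule mult_right_mono) simp
      also have "\<dots> = 2 * (sqrt X * \<bar>p j t\<bar>) * sqrt (w / (4 * \<epsilon> j))"
        by (simp add: real_sqrt_mult real_sqrt_divide)
      also have "\<dots> \<le> (sqrt X * \<bar>p j t\<bar>)\<^sup>2 + (sqrt (w / (4 * \<epsilon> j)))\<^sup>2"
        by (rule sum_squares_bound)
      also have "\<dots> = X * (p j t)\<^sup>2 + w / (4 * \<epsilon> j)"
        using X0 w0 \<epsilon>(1)[of j] by (simp add: power_mult_distrib)
      also have "\<dots> \<le> X * (p j t)\<^sup>2 + e j t"
        using \<epsilon>(1)[of j] by (simp add: e_def w_def)
      finally have "K * (k * \<bar>p j t\<bar>) \<le> K * (X * (p j t)\<^sup>2 + e j t)" using K0 by (rule mult_left_mono)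
      then have "\<bar>p j t\<bar> \<le> K * (X * (p j t)\<^sup>2 + e j t)" using kK by (simp add: mult.assoc[symmetric])
      then show ?thesis using True by (simp add: h_def X_def)
    qed
  qed
  also have "\<dots> = K * (bulk j + surf j)"
    using Bochner_Integration.integral_add[OF bulk_int e_int, of j] by (simp add: bulk_def surf_def)
  finally show ?thesis by (simp only: K_def)
qed

text \<open>Compactness of \<open>{x..y}\<close> by bisection: each point has a neighbourhood with
  an index from which \<open>V\<close> stays above \<delta>, and two such indices combine on
  adjacent intervals.\<close>

lemma eventually_above:
  assumes r: "\<And>x. x \<in> \<Omega> - B \<Longrightarrow> \<exists>d>0. eventually (\<lambda>j. \<forall>z\<in>\<Omega>. \<bar>z - x\<bar> < d \<longrightarrow> \<delta> \<le> V (r j) z) sequentially"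
    and xy: "a < x" "x \<le> y" "y < b" "{x..y} \<inter> B = {}"
  shows "eventually (\<lambda>j. \<forall>z\<in>{x..y}. \<delta> \<le> V (r j) z) sequentially"
proof -
  let ?P = "\<lambda>s t. x \<le> s \<and> t \<le> y \<longrightarrow> eventually (\<lambda>j. \<forall>z\<in>{s..t}. \<delta> \<le> V (r j) z) sequentially"
  have "?P x y"
  proof (rule Bolzano[OF xy(2), of ?P])
    fix s m t assume *: "?P s m" "?P m t" "s \<le> m" "m \<le> t"
    show "?P s t"
    proof
      assume "x \<le> s \<and> t \<le> y"
      then have "eventually (\<lambda>j. \<forall>z\<in>{s..m}. \<delta> \<le> V (r j) z) sequentially" "eventually (\<lambda>j. \<forall>z\<in>{m..t}. \<delta> \<le> V (r j) z) sequentially"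
        using * by auto
      then show "eventually (\<lambda>j. \<forall>z\<in>{s..t}. \<delta> \<le> V (r j) z) sequentially"
      proof eventually_elim
        case (elim j)
        show ?case
        proof
          fix z assume "z \<in> {s..t}"
          then have "z \<in> {s..m} \<or> z \<in> {m..t}" by auto
          then show "\<delta> \<le> V (r j) z" using elim by blast
        qed
      qed
    qed
  next
    fix w assume w: "x \<le> w" "w \<le> y"
    then have "w \<in> \<Omega> - B" using xy by auto
    then obtain d where d: "0 < d" "eventually (\<lambda>j. \<forall>z\<in>\<Omega>. \<bar>z - w\<bar> < d \<longrightarrow> \<delta> \<le> V (r j) z) sequentially" using r by blast
    show "\<exists>d>0. \<forall>s t. s \<le> w \<and> w \<le> t \<and> t - s < d \<longrightarrow> ?P s t"
    proof (intro exI[of _ d] conjI d(1) allI impI)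
      fix s t assume st: "s \<le> w \<and> w \<le> t \<and> t - s < d" "x \<le> s \<and> t \<le> y"
      show "eventually (\<lambda>j. \<forall>z\<in>{s..t}. \<delta> \<le> V (r j) z) sequentially"
        using d(2)
      proof eventually_elim
        case (elim j)
        show ?case
        proof
          fix z assume "z \<in> {s..t}"
          then have "z \<in> \<Omega>" "\<bar>z - w\<bar> < d" using st xy by auto
          then show "\<delta> \<le> V (r j) z" using elim by blast
        qed
      qed
    qed
  qed
  then show ?thesis by simp
qed

text \<open>The number n of exceptional points is fixed before \<rho>, since the subsequence and
  \<open>B\<close> depend on \<theta> only; this allows \<rho> to tend to 0 with n unchanged. The
  parameter \<theta> is both the threshold for \<open>V\<close> and the relative loss in the
  coefficient.\<close>

lemma liminf_core:
  assumes \<theta>: "0 < \<theta>" "\<theta> < 1"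
  shows "\<exists>n. \<forall>\<rho>>0. \<exists>g B c s. pw_sobolev a b u c g B s \<and> card B = n \<and> integrable LL (\<lambda>x. (g x)\<^sup>2) \<and>
    (1 - \<theta>) * \<phi>inf * (LINT x|LL. (g x)\<^sup>2) + real n * (2 * (Psi \<omega> 1 - Psi \<omega> \<theta>) - \<rho>) \<le> L + \<rho>"
proof -
  obtain r B where rB: "strict_mono r" "finite B" "B \<subseteq> \<Omega>" "\<And>x. x \<in> B \<Longrightarrow> dips \<theta> r x"
    "\<And>x. x \<in> \<Omega> - B \<Longrightarrow> \<exists>d>0. eventually (\<lambda>j. \<forall>z\<in>\<Omega>. \<bar>z - x\<bar> < d \<longrightarrow> \<theta> \<le> V (r j) z) sequentially"
    using maximal_dips[OF \<theta>] by blast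
  obtain c0 where c0: "0 < c0" "\<And>\<gamma> t. 0 < \<gamma> \<Longrightarrow> t \<in> {\<theta>..1} \<Longrightarrow> E \<gamma> t < (1 - \<theta>) * \<phi>inf \<Longrightarrow> c0 * \<gamma> \<le> E \<gamma> t * \<omega> (1 - t)"
    using E_\<omega>_lower[OF \<theta>(1) \<theta>] by blast
  define \<kappa> where "\<kappa> = (1 - \<theta>) * \<phi>inf"
  have \<kappa>: "0 < \<kappa>" using \<theta> \<phi>inf(2) by (simp add: \<kappa>_def)
  \<comment> \<open>The points where \<open>U\<close> converges to \<open>u\<close>; limits of
    increments are available between such points.\<close>
  define G where "G = {x \<in> \<Omega>. (\<lambda>j. U j x) \<longlonglongrightarrow> u x}"
  have G: "AE x in LL. x \<in> G"
  proof -
    have "AE x in LL. x \<in> \<Omega>" by (rule AE_I2) simp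
    with U_conv show ?thesis by eventually_elim (simp add: G_def U_def)
  qed
  obtain C where C: "0 < C" "\<And>j. bulk j + surf j \<le> C" using energy_bounded by blast
  have \<epsilon>\<gamma>: "(\<lambda>j. sqrt (\<epsilon> j / (c0 * \<gamma> j)) * C) \<longlonglongrightarrow> 0"
  proof -
    have "(\<lambda>j. inverse (\<gamma> j / \<epsilon> j)) \<longlonglongrightarrow> 0" by (rule filterlim_compose[OF tendsto_inverse_0_at_top[OF filterlim_ident] \<gamma>(2)])
    then have "(\<lambda>j. sqrt (inverse (\<gamma> j / \<epsilon> j) / c0) * C) \<longlonglongrightarrow> sqrt (0 / c0) * C"
      by (intro tendsto_intros) (use c0 in auto)
    then show ?thesis by (simp add: field_simps)
  qed
  \<comment> \<open>Away from \<open>B\<close> the increments of \<open>U\<close> and the integrals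
    of \<open>h\<close> differ by a vanishing amount, so the truncated gradients converge when
    tested with indicators of intervals.\<close>
  have hconv: "(\<lambda>j. LINT t|LL. h \<theta> (r j) t * indicator {x..y} t) \<longlonglongrightarrow> u y - u x"
    if x: "x \<in> G" and y: "y \<in> G" and xy: "x < y" "{x..y} \<inter> B = {}" for x y
  proof -
    have ab': "a < x" "y < b" using x y by (auto simp: G_def)
    have Uxy: "(\<lambda>j. U j y - U j x) \<longlonglongrightarrow> u y - u x" using x y unfolding G_def by (auto intro: tendsto_diff)
    have Ur: "(\<lambda>j. U (r j) y - U (r j) x) \<longlonglongrightarrow> u y - u x"
      using LIMSEQ_subseq_LIMSEQ[OF Uxy rB(1)] by (simp add: o_def)
    have above: "eventually (\<lambda>j. \<forall>z\<in>{x..y}. \<theta> \<le> V (r j) z) sequentially"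
      by (rule eventually_above[OF _ ab'(1) less_imp_le[OF xy(1)] ab'(2) xy(2)]) (rule rB(5))
    have bnd: "eventually (\<lambda>j. \<bar>(U (r j) y - U (r j) x) - (LINT t|LL. h \<theta> (r j) t * indicator {x..y} t)\<bar> \<le> sqrt (\<epsilon> (r j) / (c0 * \<gamma> (r j))) * C) sequentially"
      using above
    proof eventually_elim
      case (elim j)
      have "U (r j) y - U (r j) x = integral {x..y} (p (r j))"
        using primitive_diff[OF L2_imp_integrable[OF p], of x y "r j"] ab' xy(1) by (simp add: U_def)
      moreover have "\<bar>integral {x..y} (p (r j)) - (LINT t|LL. h \<theta> (r j) t * indicator {x..y} t)\<bar>
        \<le> sqrt (\<epsilon> (r j) / (c0 * \<gamma> (r j))) * (bulk (r j) + surf (r j))"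
        by (rule small_coefficient_estimate[OF c0(1) c0(2)[OF \<gamma>(1)] ab'(1) less_imp_le[OF xy(1)] ab'(2)]) (use elim in auto)
      moreover have "\<dots> \<le> sqrt (\<epsilon> (r j) / (c0 * \<gamma> (r j))) * C"
        using C(2)[of "r j"] c0(1) \<epsilon>(1)[of "r j"] \<gamma>(1)[of "r j"] by (intro mult_left_mono) auto
      ultimately show ?case by simp
    qed
    have lim0: "(\<lambda>j. sqrt (\<epsilon> (r j) / (c0 * \<gamma> (r j))) * C) \<longlonglongrightarrow> 0"
      using LIMSEQ_subseq_LIMSEQ[OF \<epsilon>\<gamma> rB(1)] by (simp add: o_def)
    have "(\<lambda>j. (U (r j) y - U (r j) x) - (LINT t|LL. h \<theta> (r j) t * indicator {x..y} t)) \<longlonglongrightarrow> 0"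
      by (rule Lim_null_comparison[OF bnd[folded real_norm_def] lim0])
    from tendsto_diff[OF Ur this] show ?thesis by simp
  qed
  show ?thesis
  proof (intro exI[of _ "card B"] allI impI)
    fix \<rho> :: real assume \<rho>: "0 < \<rho>"
    \<comment> \<open>What the energy leaves for the squared gradient after the points of
      \<open>B\<close> have taken their share; bulk and surface parts are thus estimated
      jointly.\<close>
    define M where "M = (L + \<rho> - real (card B) * (2 * (Psi \<omega> 1 - Psi \<omega> \<theta>) - \<rho>)) / \<kappa>"
    have "eventually (\<lambda>j. bulk (r j) + surf (r j) < L + \<rho>) sequentially"
    proof -
      have "(\<lambda>j. bulk (r j) + surf (r j)) \<longlonglongrightarrow> L"
        using LIMSEQ_subseq_LIMSEQ[OF energy_lim rB(1)] by (simp add: o_def)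
      then show ?thesis by (rule order_tendstoD) (use \<rho> in simp)
    qed
    moreover have "eventually (\<lambda>j. real (card B) * (2 * (Psi \<omega> 1 - Psi \<omega> \<theta>) - \<rho>) \<le> surf (r j)) sequentially"
      by (rule surface_lower[OF rB(1-4) \<theta> \<rho>])
    ultimately have "eventually (\<lambda>j. (LINT x|LL. (h \<theta> (r j) x)\<^sup>2) \<le> M) sequentially"
    proof eventually_elim
      case (elim j)
      have "\<kappa> * (LINT x|LL. (h \<theta> (r j) x)\<^sup>2) \<le> bulk (r j)" unfolding \<kappa>_def by (rule h_L2(3))
      also have "\<dots> \<le> \<kappa> * M" using elim \<kappa> by (simp add: M_def)
      finally show ?case using \<kappa> by simp
    qed
    then obtain j0 where j0: "\<And>j. j \<ge> j0 \<Longrightarrow> (LINT x|LL. (h \<theta> (r j) x)\<^sup>2) \<le> M" unfolding eventually_sequentially by blast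
    define k where "k = (\<lambda>j. h \<theta> (r (j + j0)))"
    \<comment> \<open>Indicators of intervals that avoid \<open>B\<close> and end in
      \<open>G\<close> are just enough to identify the increments of the primitive of the limit
      gradient.\<close>
    define T where "T = {indicator {x..y} :: real \<Rightarrow> real |x y. x \<in> G \<and> y \<in> G \<and> x < y \<and> {x..y} \<inter> B = {}}"
    have kconv: "(\<lambda>j. LINT t|LL. k j t * indicator {x..y} t) \<longlonglongrightarrow> u y - u x"
      if "x \<in> G" "y \<in> G" "x < y" "{x..y} \<inter> B = {}" for x y
      unfolding k_def by (rule LIMSEQ_ignore_initial_segment[OF hconv[OF that]])
    have "\<exists>g. g \<in> borel_measurable LL \<and> integrable LL (\<lambda>x. (g x)\<^sup>2) \<and> (LINT x|LL. (g x)\<^sup>2) \<le> M \<and>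
      (\<forall>f\<in>T. (LINT x|LL. g x * f x) = lim (\<lambda>j. LINT t|LL. k j t * f t))"
    proof (rule finite_measure.L2_weak_limit[OF finite_measure_lebesgue_on_Ioo])
      show "k j \<in> borel_measurable LL" for j unfolding k_def by (rule h_L2(1))
      show "integrable LL (\<lambda>x. (k j x)\<^sup>2)" for j unfolding k_def by (rule h_L2(2))
      show "(LINT x|LL. (k j x)\<^sup>2) \<le> M" for j unfolding k_def by (rule j0) simp
      show "f \<in> borel_measurable LL" if "f \<in> T" for f
        using that unfolding T_def by (auto intro: borel_measurable_lebesgue_on_borel)
      show "\<bar>f x\<bar> \<le> 1" if "f \<in> T" for f x using that unfolding T_def by (auto simp: indicator_def)
      show "(\<lambda>j. LINT t|LL. k j t * f t) \<longlonglongrightarrow> lim (\<lambda>j. LINT t|LL. k j t * f t)" if "f \<in> T" for f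
      proof -
        obtain x y where xy: "f = indicator {x..y}" "x \<in> G" "y \<in> G" "x < y" "{x..y} \<inter> B = {}" using \<open>f \<in> T\<close> unfolding T_def by blast
        have "(\<lambda>j. LINT t|LL. k j t * f t) \<longlonglongrightarrow> u y - u x" unfolding xy(1) by (rule kconv[OF xy(2-5)])
        moreover from limI[OF this] have "lim (\<lambda>j. LINT t|LL. k j t * f t) = u y - u x" .
        ultimately show ?thesis by (simp only:)
      qed
    qed
    then obtain g where g: "g \<in> borel_measurable LL" "integrable LL (\<lambda>x. (g x)\<^sup>2)" "(LINT x|LL. (g x)\<^sup>2) \<le> M"
      "\<And>f. f \<in> T \<Longrightarrow> (LINT x|LL. g x * f x) = lim (\<lambda>j. LINT t|LL. k j t * f t)" by blast
    have gL2: "g \<in> L2_space \<Omega>" using g(1,2) by (simp add: L2_space_def)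
    note gi = L2_imp_integrable[OF gL2]
    have gxy: "integral {x..y} g = u y - u x" if xy: "x \<in> G" "y \<in> G" "x < y" "{x..y} \<inter> B = {}" for x y
    proof -
      have "indicator {x..y} \<in> T" unfolding T_def using xy by blast
      then have "(LINT t|LL. g t * indicator {x..y} t) = lim (\<lambda>j. LINT t|LL. k j t * indicator {x..y} t)" by (rule g(4))
      also have "\<dots> = u y - u x" by (rule limI[OF kconv[OF xy]])
      finally show ?thesis using integral_Icc_indicator(2)[OF gi, of x y] xy by (auto simp: G_def)
    qed
    \<comment> \<open>\<open>u\<close> minus the primitive of \<open>g\<close> takes equal values at
      points of \<open>G\<close> that \<open>B\<close> does not separate, so it is a step function
      with jumps in \<open>B\<close>.\<close>
    define w where "w = (\<lambda>x. u x - integral {a..x} g)"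
    have "\<exists>c s. \<forall>x\<in>G - B. w x = c + step_fun B s x"
    proof (rule piecewise_constant_step_fun[OF rB(2) _ rB(3) _ ab])
      show "\<exists>x\<in>{c<..<d}. x \<in> G" if "a \<le> c" "c < d" "d \<le> b" for c d by (rule AE_Ioo_ex[OF G that])
      show "G \<subseteq> \<Omega>" by (auto simp: G_def)
      fix x y assume xy: "x \<in> G" "y \<in> G" "x < y" "{x..y} \<inter> B = {}"
      have "integral {a..y} g - integral {a..x} g = integral {x..y} g"
        by (rule primitive_diff[OF gi]) (use xy in \<open>auto simp: G_def\<close>)
      then show "w x = w y" using gxy[OF xy] by (simp add: w_def)
    qed
    then obtain c s where cs: "\<And>x. x \<in> G - B \<Longrightarrow> w x = c + step_fun B s x" by blast
    have "AE x in LL. x \<notin> B"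
      by (rule AE_lebesgue_on_lborel[OF _ AE_not_in[OF finite_imp_null_set_lborel[OF rB(2)]]]) auto
    with G have "AE x in LL. u x = c + integral {a..x} g + step_fun B s x"
    proof eventually_elim
      case (elim x)
      then show ?case using cs[of x] by (simp add: w_def)
    qed
    then have pw: "pw_sobolev a b u c g B s" unfolding pw_sobolev_def using gi rB by blast
    have "\<kappa> * (LINT x|LL. (g x)\<^sup>2) \<le> \<kappa> * M" using g(3) \<kappa> by simp
    also have "\<kappa> * M = L + \<rho> - real (card B) * (2 * (Psi \<omega> 1 - Psi \<omega> \<theta>) - \<rho>)"
      unfolding M_def using \<kappa> by simp
    finally have "(1 - \<theta>) * \<phi>inf * (LINT x|LL. (g x)\<^sup>2) + real (card B) * (2 * (Psi \<omega> 1 - Psi \<omega> \<theta>) - \<rho>) \<le> L + \<rho>"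
      unfolding \<kappa>_def by linarith
    then show "\<exists>g B' c s. pw_sobolev a b u c g B' s \<and> card B' = card B \<and> integrable LL (\<lambda>x. (g x)\<^sup>2) \<and>
      (1 - \<theta>) * \<phi>inf * (LINT x|LL. (g x)\<^sup>2) + real (card B) * (2 * (Psi \<omega> 1 - Psi \<omega> \<theta>) - \<rho>) \<le> L + \<rho>"
      using pw g(2) by blast
  qed
qed

end

context phase_field_sequence
begin

text \<open>\<rho> tends to 0 for fixed \<theta>, afterwards \<theta> tends to 0. The jump set may
  have fewer than n points, which only lowers the left side. \<open>approx_grad\<close> agrees
  almost everywhere with each limit gradient, so all bounds refer to one function.\<close>

lemma limit_energy_le: "limit_energy \<Omega> \<phi>inf \<omega> u v \<le> ennreal L"
proof -
  let ?g = "approx_grad \<Omega> u" and ?J = "jump_set \<Omega> u"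
  have core: "u \<in> SBV_space \<Omega> \<and> finite ?J \<and> ?g \<in> borel_measurable LL \<and> integrable LL (\<lambda>x. (?g x)\<^sup>2) \<and>
    (1 - \<theta>) * \<phi>inf * (LINT x|LL. (?g x)\<^sup>2) + 2 * real (card ?J) * (Psi \<omega> 1 - Psi \<omega> \<theta>) \<le> L"
    if \<theta>: "0 < \<theta>" "\<theta> < 1" for \<theta>
  proof -
    obtain n where n: "\<And>\<rho>. 0 < \<rho> \<Longrightarrow> \<exists>g B c s. pw_sobolev a b u c g B s \<and> card B = n \<and> integrable LL (\<lambda>x. (g x)\<^sup>2) \<and>
      (1 - \<theta>) * \<phi>inf * (LINT x|LL. (g x)\<^sup>2) + real n * (2 * (Psi \<omega> 1 - Psi \<omega> \<theta>) - \<rho>) \<le> L + \<rho>"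
      using liminf_core[OF \<theta>] by blast
    have D0: "0 \<le> Psi \<omega> 1 - Psi \<omega> \<theta>" using Psi_mono[of \<theta> 1] \<theta> by simp
    have step: "u \<in> SBV_space \<Omega> \<and> finite ?J \<and> card ?J \<le> n \<and> ?g \<in> borel_measurable LL \<and> integrable LL (\<lambda>x. (?g x)\<^sup>2) \<and>
      (1 - \<theta>) * \<phi>inf * (LINT x|LL. (?g x)\<^sup>2) + real n * (2 * (Psi \<omega> 1 - Psi \<omega> \<theta>) - \<rho>) \<le> L + \<rho>"
      if \<rho>: "0 < \<rho>" for \<rho>
    proof -
      obtain g B c s where g: "pw_sobolev a b u c g B s" "card B = n" "integrable LL (\<lambda>x. (g x)\<^sup>2)"
        "(1 - \<theta>) * \<phi>inf * (LINT x|LL. (g x)\<^sup>2) + real n * (2 * (Psi \<omega> 1 - Psi \<omega> \<theta>) - \<rho>) \<le> L + \<rho>"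
        using n[OF \<rho>] by blast
      note S = pw_sobolev_SBV[OF ab g(1)]
      have B: "finite B" and gm: "g \<in> borel_measurable LL" using g(1) by (auto simp: pw_sobolev_def)
      have fJ: "finite ?J" unfolding S(2) using B by simp
      have cJ: "card ?J \<le> n" unfolding S(2) g(2)[symmetric] by (rule card_mono[OF B]) auto
      have ae: "AE x in LL. g x = ?g x" using S(3) by eventually_elim simp
      have m: "?g \<in> borel_measurable LL" by (rule borel_measurable_lebesgue_on_AE[OF _ gm ae]) simp
      have ae2: "AE x in LL. (g x)\<^sup>2 = (?g x)\<^sup>2" using ae by eventually_elim simp
      have i: "integrable LL (\<lambda>x. (?g x)\<^sup>2)" by (rule integrable_lebesgue_on_AE[OF _ g(3) ae2]) simp
      have eq: "(LINT x|LL. (g x)\<^sup>2) = (LINT x|LL. (?g x)\<^sup>2)"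
        by (rule integral_cong_AE[OF borel_measurable_integrable[OF g(3)] borel_measurable_integrable[OF i] ae2])
      show ?thesis using S(1) fJ cJ m i g(4) unfolding eq by blast
    qed
    have "(1 - \<theta>) * \<phi>inf * (LINT x|LL. (?g x)\<^sup>2) + real n * (2 * (Psi \<omega> 1 - Psi \<omega> \<theta>)) \<le> L"
    proof (rule field_le_epsilon)
      fix d :: real assume d: "0 < d"
      define \<rho> where "\<rho> = d / (real n + 1)"
      have \<rho>: "0 < \<rho>" "real n * \<rho> + \<rho> = d" using d by (auto simp: \<rho>_def field_simps add_nonneg_eq_0_iff)
      have "(1 - \<theta>) * \<phi>inf * (LINT x|LL. (?g x)\<^sup>2) + real n * (2 * (Psi \<omega> 1 - Psi \<omega> \<theta>) - \<rho>) \<le> L + \<rho>"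
        using step[OF \<rho>(1)] by blast
      moreover have "real n * (2 * (Psi \<omega> 1 - Psi \<omega> \<theta>) - \<rho>) = real n * (2 * (Psi \<omega> 1 - Psi \<omega> \<theta>)) - real n * \<rho>"
        by (rule right_diff_distrib)
      ultimately show "(1 - \<theta>) * \<phi>inf * (LINT x|LL. (?g x)\<^sup>2) + real n * (2 * (Psi \<omega> 1 - Psi \<omega> \<theta>)) \<le> L + d"
        using \<rho>(2) by argo
    qed
    moreover have "2 * real (card ?J) * (Psi \<omega> 1 - Psi \<omega> \<theta>) \<le> real n * (2 * (Psi \<omega> 1 - Psi \<omega> \<theta>))"
    proof -
      have "real (card ?J) * (2 * (Psi \<omega> 1 - Psi \<omega> \<theta>)) \<le> real n * (2 * (Psi \<omega> 1 - Psi \<omega> \<theta>))"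
        using step[of 1] D0 by (intro mult_right_mono) auto
      then show ?thesis by (simp only: mult_ac)
    qed
    ultimately show ?thesis using step[of 1] by simp
  qed
  define A where "A = (LINT x|LL. (?g x)\<^sup>2)"
  have half: "u \<in> SBV_space \<Omega>" "finite ?J" "integrable LL (\<lambda>x. (?g x)\<^sup>2)" using core[of "1/2"] by auto
  have "((\<lambda>\<theta>. (1 - \<theta>) * \<phi>inf * A + 2 * real (card ?J) * (Psi \<omega> 1 - Psi \<omega> \<theta>)) \<longlongrightarrow>
    (1 - 0) * \<phi>inf * A + 2 * real (card ?J) * (Psi \<omega> 1 - Psi \<omega> 0)) (at_right 0)"
  proof (intro tendsto_intros)
    have "(Psi \<omega> \<longlongrightarrow> Psi \<omega> 0) (at 0 within {0..1})"
      using Psi_continuous unfolding continuous_on_def by simp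
    then show "(Psi \<omega> \<longlongrightarrow> Psi \<omega> 0) (at_right 0)" by (simp add: at_within_Icc_at_right)
  qed
  then have "(1 - 0) * \<phi>inf * A + 2 * real (card ?J) * (Psi \<omega> 1 - Psi \<omega> 0) \<le> L"
  proof (rule tendsto_upperbound)
    have "eventually (\<lambda>\<theta>::real. \<theta> \<in> {0<..<1}) (at_right 0)" by (rule eventually_at_right_real) simp
    then show "eventually (\<lambda>\<theta>. (1 - \<theta>) * \<phi>inf * A + 2 * real (card ?J) * (Psi \<omega> 1 - Psi \<omega> \<theta>) \<le> L) (at_right 0)"
    proof eventually_elim
      case (elim \<theta>)
      then have "0 < \<theta>" "\<theta> < 1" by auto
      from core[OF this] show ?case unfolding A_def by blast
    qed
  qed simp
  moreover have "Psi \<omega> 0 = 0" by (simp add: Psi_def)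
  ultimately have le: "\<phi>inf * A + 2 * Psi \<omega> 1 * real (card ?J) \<le> L" by (simp add: mult_ac)
  have A0: "0 \<le> A" unfolding A_def by simp
  have P0: "0 \<le> Psi \<omega> 1" using Psi_mono[of 0 1] \<open>Psi \<omega> 0 = 0\<close> by simp
  have "(\<integral>\<^sup>+x. ennreal (\<bar>?g x\<bar>\<^sup>2) \<partial>LL) = ennreal A"
    unfolding A_def using half(3) by (simp add: nn_integral_eq_integral)
  moreover have "emeasure (count_space UNIV) ?J = ennreal (real (card ?J))"
    using half(2) by (simp add: emeasure_count_space_finite ennreal_of_nat_eq_real_of_nat)
  ultimately have "limit_energy \<Omega> \<phi>inf \<omega> u v = ennreal \<phi>inf * ennreal A + 2 * ennreal (Psi \<omega> 1) * ennreal (real (card ?J))"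
    using half(1) v_eq_1 by (simp only: limit_energy_def simp_thms if_True)
  also have "\<dots> = ennreal (\<phi>inf * A + 2 * Psi \<omega> 1 * real (card ?J))"
    using A0 P0 \<phi>inf(2) by (simp add: ennreal_mult ennreal_plus)
  also have "\<dots> \<le> ennreal L" by (rule ennreal_leI[OF le])
  finally show ?thesis .
qed

end

text \<open>A subsequence realises the lower limit, and a further one converges almost everywhere. A
  finite lower limit makes the energies finite from some index on, and the shift by \<open>N\<close>
  leaves only pairs in H1.\<close>

lemma (in phase_field) Gamma_liminf:
  fixes y :: "nat \<Rightarrow> real \<Rightarrow> real \<times> real" and w :: "real \<Rightarrow> real \<times> real"
  assumes \<epsilon>: "\<And>j. 0 < \<epsilon> j" "\<epsilon> \<longlonglongrightarrow> 0"
    and \<gamma>: "\<And>j. 0 < \<gamma> j" "filterlim (\<lambda>j. \<gamma> j / \<epsilon> j) at_top sequentially"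
    and w: "integrable LL w" and y: "\<And>j. integrable LL (y j)" "(\<lambda>j. L1_dist \<Omega> (y j) w) \<longlonglongrightarrow> 0"
  shows "limit_energy \<Omega> \<phi>inf \<omega> (fst \<circ> w) (snd \<circ> w) \<le>
    liminf (\<lambda>j. phase_field_energy \<Omega> \<phi> \<phi>inf l Q \<omega> (\<gamma> j) (\<epsilon> j) (fst \<circ> y j) (snd \<circ> y j))"
proof -
  let ?F = "\<lambda>j. phase_field_energy \<Omega> \<phi> \<phi>inf l Q \<omega> (\<gamma> j) (\<epsilon> j) (fst \<circ> y j) (snd \<circ> y j)"
  show ?thesis
  proof (cases "liminf ?F = \<infinity>")
    case True
    then show ?thesis by simp
  next
    case False
    define L where "L = enn2real (liminf ?F)"
    have L: "liminf ?F = ennreal L" using False by (simp add: L_def less_top)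
    obtain r1 where r1: "strict_mono r1" "(?F \<circ> r1) \<longlonglongrightarrow> liminf ?F" using liminf_subseq_lim by blast
    have d: "integrable LL (\<lambda>x. y (r1 j) x - w x)" for j using y(1) w by simp
    have dl: "(\<lambda>j. LINT x|LL. norm (y (r1 j) x - w x)) \<longlonglongrightarrow> 0"
      using LIMSEQ_subseq_LIMSEQ[OF y(2) r1(1)] by (simp add: o_def L1_dist_def)
    obtain r2 where r2: "strict_mono r2" "AE x in LL. (\<lambda>j. y (r1 (r2 j)) x - w x) \<longlonglongrightarrow> 0"
      using tendsto_L1_AE_subseq[OF d dl] by blast
    have "liminf ?F < \<infinity>" using False by (simp add: less_top)
    then have "eventually (\<lambda>j. (?F \<circ> r1) j < \<infinity>) sequentially" by (rule order_tendstoD(2)[OF r1(2)])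
    then obtain N where N: "\<And>j. N \<le> j \<Longrightarrow> ?F (r1 j) < \<infinity>" by (auto simp: eventually_sequentially)
    define r where "r = (\<lambda>j. r1 (r2 (j + N)))"
    have r: "strict_mono r" unfolding r_def using r1(1) r2(1) by (simp add: strict_mono_def)
    have fin: "?F (r j) < \<infinity>" for j
      unfolding r_def by (rule N) (use seq_suble[OF r2(1), of "j + N"] in linarith)
    have Fr: "(\<lambda>j. ?F (r j)) \<longlonglongrightarrow> ennreal L"
      using LIMSEQ_ignore_initial_segment[OF LIMSEQ_subseq_LIMSEQ[OF r1(2) r2(1)], of N]
      unfolding r_def L[symmetric] by (simp only: comp_apply)
    have conv: "AE x in LL. (\<lambda>j. y (r j) x) \<longlonglongrightarrow> w x"
      using r2(2)
    proof eventually_elim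
      case (elim x)
      then have "(\<lambda>j. y (r1 (r2 j)) x) \<longlonglongrightarrow> w x" by (simp add: LIM_zero_iff)
      then show ?case unfolding r_def by (rule LIMSEQ_ignore_initial_segment)
    qed
    have H1: "fst \<circ> y (r j) \<in> H1_space \<Omega>" "snd \<circ> y (r j) \<in> H1_space \<Omega>" "AE x in LL. (snd \<circ> y (r j)) x \<in> {0..1}" for j
      using fin[of j] by (auto simp: phase_field_energy_def split: if_splits)
    \<comment> \<open>The data of \<open>phase_field_energy_eq\<close> are packed into one predicate
      so that they can be chosen simultaneously for every j.\<close>
    define R where "R = (\<lambda>j cu cv p q V. p \<in> L2_space \<Omega> \<and> q \<in> L2_space \<Omega> \<and>
      (AE x in LL. (fst \<circ> y (r j)) x = cu + integral {a..x} p) \<and> (AE x in LL. (snd \<circ> y (r j)) x = V x) \<and>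
      (\<forall>x\<in>\<Omega>. V x = cv + integral {a..x} q \<and> V x \<in> {0..1}) \<and> continuous_on \<Omega> V \<and>
      integrable LL (\<lambda>x. E (\<gamma> (r j)) (V x) * (p x)\<^sup>2) \<and> integrable LL (\<lambda>x. \<omega> (1 - V x) / (4 * \<epsilon> (r j)) + \<epsilon> (r j) * (q x)\<^sup>2) \<and>
      ?F (r j) = ennreal ((LINT x|LL. E (\<gamma> (r j)) (V x) * (p x)\<^sup>2) + (LINT x|LL. \<omega> (1 - V x) / (4 * \<epsilon> (r j)) + \<epsilon> (r j) * (q x)\<^sup>2)))"
    have "\<forall>j. \<exists>cu cv p q V. R j cu cv p q V"
      unfolding R_def by (intro allI phase_field_energy_eq[OF \<epsilon>(1) less_imp_le[OF \<gamma>(1)] H1])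
    then obtain cu cv p q V where R: "\<forall>j. R j (cu j) (cv j) (p j) (q j) (V j)" by metis
    note Z = R[unfolded R_def]
    have uc: "AE x in LL. \<forall>j. (fst \<circ> y (r j)) x = cu j + integral {a..x} (p j)"
      by (intro AE_all_countable[THEN iffD2] allI) (use Z in blast)
    have vc: "AE x in LL. \<forall>j. (snd \<circ> y (r j)) x = V j x"
      by (intro AE_all_countable[THEN iffD2] allI) (use Z in blast)
    have nn: "0 \<le> (LINT x|LL. E (\<gamma> (r j)) (V j x) * (p j x)\<^sup>2) + (LINT x|LL. \<omega> (1 - V j x) / (4 * \<epsilon> (r j)) + \<epsilon> (r j) * (q j x)\<^sup>2)" for j
    proof (intro add_nonneg_nonneg integral_nonneg_AE AE_I2)
      fix x assume "x \<in> space LL"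
      then have "x \<in> \<Omega>" by simp
      then have V01: "V j x \<in> {0..1}" using Z by blast
      show "0 \<le> E (\<gamma> (r j)) (V j x) * (p j x)\<^sup>2"
        using E_bounds(1)[OF V01 less_imp_le[OF \<gamma>(1)]] by simp
      show "0 \<le> \<omega> (1 - V j x) / (4 * \<epsilon> (r j))" using \<omega>(2)[of "1 - V j x"] V01 \<epsilon>(1)[of "r j"] by simp
      show "0 \<le> \<epsilon> (r j) * (q j x)\<^sup>2" using \<epsilon>(1)[of "r j"] by simp
    qed
    interpret S: phase_field_sequence a b \<phi>inf l Q \<omega> \<phi> \<zeta> "\<lambda>j. \<epsilon> (r j)" "\<lambda>j. \<gamma> (r j)" cu cv p q V "fst \<circ> w" "snd \<circ> w" L
    proof
      show "0 < \<epsilon> (r j)" "0 < \<gamma> (r j)" for j by (rule \<epsilon>(1) \<gamma>(1))+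
      show "(\<lambda>j. \<epsilon> (r j)) \<longlonglongrightarrow> 0" using LIMSEQ_subseq_LIMSEQ[OF \<epsilon>(2) r] by (simp add: o_def)
      show "filterlim (\<lambda>j. \<gamma> (r j) / \<epsilon> (r j)) at_top sequentially"
        by (rule filterlim_compose[OF \<gamma>(2) filterlim_subseq[OF r]])
      show "p j \<in> L2_space \<Omega>" "q j \<in> L2_space \<Omega>" for j using Z by blast+
      show "V j x = cv j + integral {a..x} (q j)" "V j x \<in> {0..1}" if "x \<in> \<Omega>" for j x using Z that by blast+
      show "continuous_on \<Omega> (V j)" for j using Z by blast
      show "integrable LL (\<lambda>x. E (\<gamma> (r j)) (V j x) * (p j x)\<^sup>2)" for j using Z by blast
      show "integrable LL (\<lambda>x. \<omega> (1 - V j x) / (4 * \<epsilon> (r j)) + \<epsilon> (r j) * (q j x)\<^sup>2)" for j using Z by blast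
      show "AE x in LL. (\<lambda>j. cu j + integral {a..x} (p j)) \<longlonglongrightarrow> (fst \<circ> w) x"
        using conv uc
      proof eventually_elim
        case (elim x)
        have "(\<lambda>j. (fst \<circ> y (r j)) x) \<longlonglongrightarrow> (fst \<circ> w) x" using tendsto_fst[OF elim(1)] by simp
        then show ?case using elim(2) by simp
      qed
      show "AE x in LL. (\<lambda>j. V j x) \<longlonglongrightarrow> (snd \<circ> w) x"
        using conv vc
      proof eventually_elim
        case (elim x)
        have "(\<lambda>j. (snd \<circ> y (r j)) x) \<longlonglongrightarrow> (snd \<circ> w) x" using tendsto_snd[OF elim(1)] by simp
        then show ?case using elim(2) by simp
      qed
      show "(\<lambda>j. (LINT x|LL. E (\<gamma> (r j)) (V j x) * (p j x)\<^sup>2) + (LINT x|LL. \<omega> (1 - V j x) / (4 * \<epsilon> (r j)) + \<epsilon> (r j) * (q j x)\<^sup>2)) \<longlonglongrightarrow> L"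
      proof -
        have "(\<lambda>j. enn2real (?F (r j))) \<longlonglongrightarrow> L"
          by (rule tendsto_enn2real[OF Fr]) (simp add: L_def)
        moreover have "enn2real (?F (r j)) = (LINT x|LL. E (\<gamma> (r j)) (V j x) * (p j x)\<^sup>2) + (LINT x|LL. \<omega> (1 - V j x) / (4 * \<epsilon> (r j)) + \<epsilon> (r j) * (q j x)\<^sup>2)" for j
        proof -
          have F: "?F (r j) = ennreal ((LINT x|LL. E (\<gamma> (r j)) (V j x) * (p j x)\<^sup>2) + (LINT x|LL. \<omega> (1 - V j x) / (4 * \<epsilon> (r j)) + \<epsilon> (r j) * (q j x)\<^sup>2))"
            using Z by blast
          show ?thesis unfolding F by (rule enn2real_ennreal[OF nn])
        qed
        ultimately show ?thesis by (simp only:)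
      qed
    qed
    show ?thesis using S.limit_energy_le L by simp
  qed
qed

section \<open>The recovery sequence\<close>

lemma FTC_piecewise:
  fixes F f :: "real \<Rightarrow> real"
  assumes "finite S" "continuous_on {a..b} F" "\<And>x. x \<in> {a<..<b} - S \<Longrightarrow> (F has_real_derivative f x) (at x)"
    and x: "x \<in> {a..b}"
  shows "f integrable_on {a..x}" and "F x = F a + integral {a..x} f"
proof -
  have "(f has_integral (F x - F a)) {a..x}"
  proof (rule fundamental_theorem_of_calculus_interior_strong[OF assms(1)])
    show "a \<le> x" using x by simp
    show "(F has_vector_derivative f t) (at t)" if "t \<in> {a<..<x} - S" for t
      using assms(3)[of t] that x by (auto simp: has_real_derivative_iff_has_vector_derivative)
    show "continuous_on {a..x} F" by (rule continuous_on_subset[OF assms(2)]) (use x in auto)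
  qed
  then show "f integrable_on {a..x}" "F x = F a + integral {a..x} f"
    by (auto simp: integral_unique integrable_on_def)
qed

context phase_field
begin

text \<open>
  The optimal profile solves \<open>W' = (\<omega>(1 - W) + \<eta>)\<^sup>1\<^sup>/\<^sup>2 / 2\<close>; the regularisation \<open>\<eta> > 0\<close> makes it reach
  the value 1 in finite time.
\<close>

lemma optimal_profile:
  assumes \<eta>: "0 < \<eta>"
  shows "\<exists>T W. 0 < T \<and> T \<le> 2 / sqrt \<eta> \<and> continuous_on {0..T} W \<and> W 0 = 0 \<and> W T = 1 \<and>
    (\<forall>t\<in>{0..T}. W t \<in> {0..1}) \<and> (\<forall>t\<in>{0<..<T}. (W has_real_derivative sqrt (\<omega> (1 - W t) + \<eta>) / 2) (at t))"
proof -
  \<comment> \<open>The reciprocal of the speed at level s. Its integral \<open>f\<close> is the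
    time needed to reach a level, at most 2/sqrt \<eta>, and the profile is the inverse of
    \<open>f\<close>.\<close>
  define k where "k = (\<lambda>s. 2 / sqrt (\<omega> (1 - s) + \<eta>))"
  have \<omega>c: "continuous_on {0..1} (\<lambda>s. \<omega> (1 - s))"
    by (rule continuous_on_compose2[OF \<omega>(1)]) (auto intro!: continuous_intros)
  have pos: "0 < \<omega> (1 - s) + \<eta>" if "s \<in> {0..1}" for s using \<omega>(2)[of "1 - s"] that \<eta> by simp
  have kc: "continuous_on {0..1} k"
    unfolding k_def using pos by (intro continuous_intros \<omega>c) (auto simp: less_le)
  have k0: "0 < k s" if "s \<in> {0..1}" for s unfolding k_def using pos[OF that] by simp
  have kle: "k s \<le> 2 / sqrt \<eta>" if s: "s \<in> {0..1}" for s
  proof -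
    have "sqrt \<eta> \<le> sqrt (\<omega> (1 - s) + \<eta>)" using \<omega>(2)[of "1 - s"] s by simp
    then show ?thesis unfolding k_def using \<eta> by (intro divide_left_mono) (auto intro: mult_pos_pos pos[OF s])
  qed
  define f where "f = (\<lambda>t. integral {0..t} k)"
  have fd: "(f has_real_derivative k t) (at t within {0..1})" if "t \<in> {0..1}" for t
    unfolding f_def by (rule integral_has_real_derivative[OF kc that])
  have fc: "continuous_on {0..1} f"
    by (rule DERIV_continuous_on[OF fd])
  have fd': "(f has_real_derivative k t) (at t)" if "0 < t" "t < 1" for t
    using fd[of t] that by (simp add: at_within_Icc_at)
  have smono: "f s < f t" if "0 \<le> s" "s < t" "t \<le> 1" for s t
  proof (rule DERIV_pos_imp_increasing_open[where f = f])
    show "s < t" by fact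
    show "\<exists>y. (f has_real_derivative y) (at x) \<and> 0 < y" if "s < x" "x < t" for x
      using fd'[of x] k0[of x] that \<open>0 \<le> s\<close> \<open>t \<le> 1\<close> by (intro exI[of _ "k x"]) auto
    show "continuous_on {s..t} f" by (rule continuous_on_subset[OF fc]) (use that in auto)
  qed
  have inj: "inj_on f {0..1}"
    by (rule inj_onI) (metis atLeastAtMost_iff less_irrefl linorder_neqE_linordered_idom smono)
  define T where "T = f 1"
  have f0: "f 0 = 0" by (simp add: f_def)
  have T0: "0 < T" using smono[of 0 1] f0 by (simp add: T_def)
  have fim: "f ` {0..1} = {0..T}"
  proof
    show "f ` {0..1} \<subseteq> {0..T}"
    proof
      fix y assume "y \<in> f ` {0..1}"
      then obtain t where t: "t \<in> {0..1}" "y = f t" by blast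
      have "0 \<le> f t" using smono[of 0 t] f0 t by (cases "t = 0") (auto simp: less_le)
      moreover have "f t \<le> T" using smono[of t 1] t by (cases "t = 1") (auto simp: T_def less_le)
      ultimately show "y \<in> {0..T}" using t by simp
    qed
    show "{0..T} \<subseteq> f ` {0..1}"
    proof
      fix y assume "y \<in> {0..T}"
      then show "y \<in> f ` {0..1}"
        using IVT'[of f 0 y 1] fc f0 by (auto simp: T_def)
    qed
  qed
  define W where "W = inv_into {0..1} f"
  have Wf: "W (f t) = t" if "t \<in> {0..1}" for t unfolding W_def by (rule inv_into_f_f[OF inj that])
  have fW: "f (W y) = y" and W01: "W y \<in> {0..1}" if "y \<in> {0..T}" for y
    unfolding W_def using that fim by (auto simp: f_inv_into_f inv_into_into[of y f "{0..1}", simplified] intro: f_inv_into_f)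
  have Wc: "continuous_on {0..T} W"
    using continuous_on_inv[OF fc compact_Icc, of W] Wf fim by simp
  have T: "T \<le> 2 / sqrt \<eta>"
  proof -
    have c: "(\<lambda>_. 2 / sqrt \<eta>) integrable_on {0..1::real}" by (rule integrable_const_ivl)
    have "integral {0..1} k \<le> integral {0..1::real} (\<lambda>_. 2 / sqrt \<eta>)"
      by (rule integral_le[OF integrable_continuous_interval[OF kc] c kle])
    then show ?thesis by (simp add: T_def f_def)
  qed
  have Wd: "(W has_real_derivative sqrt (\<omega> (1 - W t) + \<eta>) / 2) (at t)" if t: "t \<in> {0<..<T}" for t
  proof -
    have Wt: "W t \<in> {0..1}" "f (W t) = t" using fW[of t] W01[of t] t by auto
    have "W t \<noteq> 0" "W t \<noteq> 1" using Wt(2) t f0 by (auto simp: T_def)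
    then have W': "0 < W t" "W t < 1" using Wt(1) by auto
    have "(W has_real_derivative inverse (k (W t))) (at t)"
    proof (rule DERIV_inverse_function[where f = f and a = 0 and b = T])
      show "(f has_real_derivative k (W t)) (at (W t))" by (rule fd'[OF W'])
      show "k (W t) \<noteq> 0" using k0[OF Wt(1)] by simp
      show "0 < t" "t < T" using t by auto
      show "f (W y) = y" if "0 < y" "y < T" for y using fW[of y] that by simp
      show "isCont W t" using continuous_on_interior[OF Wc, of t] t by simp
    qed
    then show ?thesis by (simp add: k_def)
  qed
  have "W 0 = 0" "W T = 1" using Wf[of 0] Wf[of 1] f0 by (auto simp: T_def)
  then show ?thesis using T0 T Wc W01 Wd by blast
qed

text \<open>The cost of one transition, with \<open>\<sigma>\<close> the half-length of the zone \<open>v = 0\<close>.\<close>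

lemma transition_profile:
  assumes \<epsilon>: "0 < \<epsilon>" and \<eta>: "0 < \<eta>" and \<sigma>: "0 < \<sigma>"
  shows "\<exists>\<rho> G K N. \<sigma> < \<rho> \<and> \<rho> \<le> \<sigma> + 2 * \<epsilon> / sqrt \<eta> \<and> continuous_on UNIV G \<and> (\<forall>d. G d \<in> {0..1}) \<and>
    (\<forall>d\<le>\<sigma>. G d = 0) \<and> (\<forall>d\<ge>\<rho>. G d = 1) \<and> K \<in> borel_measurable borel \<and> bounded (range K) \<and>
    (\<forall>d. d \<notin> {\<sigma><..<\<rho>} \<longrightarrow> K d = 0) \<and>
    (\<forall>d. d \<noteq> \<sigma> \<longrightarrow> d \<noteq> \<rho> \<longrightarrow> (G has_real_derivative K d) (at d)) \<and>
    continuous_on UNIV N \<and> (\<forall>d\<le>\<sigma>. N d = 0) \<and> (\<forall>d\<ge>\<rho>. N d = N \<rho>) \<and> N \<rho> \<le> Psi \<omega> 1 + sqrt \<eta> \<and>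
    (\<forall>d. d \<noteq> \<sigma> \<longrightarrow> d \<noteq> \<rho> \<longrightarrow> (N has_real_derivative sqrt (\<omega> (1 - G d) + \<eta>) * K d) (at d)) \<and>
    (\<forall>d\<in>{\<sigma><..<\<rho>}. \<omega> (1 - G d) / (4 * \<epsilon>) + \<epsilon> * (K d)\<^sup>2 \<le> sqrt (\<omega> (1 - G d) + \<eta>) * K d) \<and>
    (\<forall>d. 0 \<le> K d)"
proof -
  obtain T W where T: "0 < T" "T \<le> 2 / sqrt \<eta>" and W: "continuous_on {0..T} W" "W 0 = 0" "W T = 1"
    "\<And>t. t \<in> {0..T} \<Longrightarrow> W t \<in> {0..1}"
    "\<And>t. t \<in> {0<..<T} \<Longrightarrow> (W has_real_derivative sqrt (\<omega> (1 - W t) + \<eta>) / 2) (at t)"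
    using optimal_profile[OF \<eta>] by blast
  define \<rho> where "\<rho> = \<sigma> + \<epsilon> * T"
  \<comment> \<open>Rescaled time, clamped to [0, T]: the profile rests at 0 up to \<sigma>, is run
    through in time T stretched to length \<epsilon> T, and rests at 1 from \<rho> on.\<close>
  define cl where "cl = (\<lambda>d. max 0 (min T ((d - \<sigma>) / \<epsilon>)))"
  define G where "G = (\<lambda>d. W (cl d))"
  define K where "K = (\<lambda>d. indicator {\<sigma><..<\<rho>} d * (sqrt (\<omega> (1 - G d) + \<eta>) / (2 * \<epsilon>)))"
  \<comment> \<open>\<open>S\<close> is \<open>Psi\<close> with \<omega> replaced by \<omega> +
    \<eta>; hence \<open>N\<close> has the derivative sqrt(\<omega> + \<eta>) K off the two corners,
    and the cost of the transition is read off as \<open>N \<rho>\<close>.\<close>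
  define S where "S = (\<lambda>t. integral {0..t} (\<lambda>s. sqrt (\<omega> (1 - s) + \<eta>)))"
  define N where "N = (\<lambda>d. S (G d))"
  have cl01: "cl d \<in> {0..T}" for d using T(1) by (auto simp: cl_def)
  have clc: "continuous_on UNIV cl" unfolding cl_def using \<epsilon> by (intro continuous_intros) auto
  have Gc: "continuous_on UNIV G" unfolding G_def by (rule continuous_on_compose2[OF W(1) clc]) (use cl01 in auto)
  have G01: "G d \<in> {0..1}" for d unfolding G_def by (rule W(4)[OF cl01])
  have Glo: "G d = 0" if "d \<le> \<sigma>" for d
  proof -
    have "(d - \<sigma>) / \<epsilon> \<le> 0" using that \<epsilon> by (simp add: divide_le_0_iff)
    then have "cl d = 0" using T(1) by (simp add: cl_def)
    then show ?thesis using W(2) by (simp add: G_def)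
  qed
  have Ghi: "G d = 1" if "\<rho> \<le> d" for d
  proof -
    have "T \<le> (d - \<sigma>) / \<epsilon>" using that \<epsilon> by (simp add: \<rho>_def field_simps)
    then have "cl d = T" using T(1) by (simp add: cl_def)
    then show ?thesis using W(3) by (simp add: G_def)
  qed
  have \<rho>: "\<sigma> < \<rho>" "\<rho> \<le> \<sigma> + 2 * \<epsilon> / sqrt \<eta>"
    using T \<epsilon> mult_left_mono[OF T(2), of \<epsilon>] by (auto simp: \<rho>_def mult.commute)
  have w0: "0 \<le> \<omega> (1 - G d)" for d using \<omega>(2)[of "1 - G d"] G01[of d] by auto
  have \<omega>Gc: "continuous_on UNIV (\<lambda>d. \<omega> (1 - G d))"
    by (rule continuous_on_compose2[OF \<omega>(1)]) (use G01 in \<open>auto intro!: continuous_intros Gc\<close>)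
  have hc: "continuous_on UNIV (\<lambda>d. sqrt (\<omega> (1 - G d) + \<eta>) / (2 * \<epsilon>))"
    using \<epsilon> by (intro continuous_intros \<omega>Gc) auto
  have Km: "K \<in> borel_measurable borel" unfolding K_def
    by (intro borel_measurable_times borel_measurable_indicator borel_measurable_continuous_onI hc) simp
  have K0: "0 \<le> K d" for d unfolding K_def using w0[of d] \<eta> \<epsilon> by simp
  have "bounded (\<omega> ` {0..1})" by (intro compact_imp_bounded compact_continuous_image \<omega>) auto
  then have "\<exists>B. \<forall>t\<in>{0..1}. \<bar>\<omega> t\<bar> \<le> B" unfolding bounded_iff by simp
  then obtain B where B: "\<And>t. t \<in> {0..1} \<Longrightarrow> \<bar>\<omega> t\<bar> \<le> B" by blast
  have KB: "\<bar>K d\<bar> \<le> sqrt (B + \<eta>) / (2 * \<epsilon>)" for d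
  proof -
    have "\<omega> (1 - G d) \<le> B" using B[of "1 - G d"] G01[of d] by auto
    then have le: "sqrt (\<omega> (1 - G d) + \<eta>) / (2 * \<epsilon>) \<le> sqrt (B + \<eta>) / (2 * \<epsilon>)"
      using \<epsilon> by (intro divide_right_mono real_sqrt_le_mono) auto
    have "0 \<le> sqrt (\<omega> (1 - G d) + \<eta>) / (2 * \<epsilon>)" using w0[of d] \<eta> \<epsilon> by simp
    then show ?thesis using le K0[of d] by (auto simp: K_def indicator_def)
  qed
  have Kout: "K d = 0" if "d \<notin> {\<sigma><..<\<rho>}" for d using that by (simp add: K_def)
  have Gd: "(G has_real_derivative K d) (at d)" if d: "d \<noteq> \<sigma>" "d \<noteq> \<rho>" for d
  proof -
    consider "d < \<sigma>" | "\<sigma> < d" "d < \<rho>" | "\<rho> < d" using d by linarith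
    then show ?thesis
    proof cases
      case 1
      have "((\<lambda>_. 0) has_real_derivative K d) (at d)" using Kout[of d] 1 by simp
      then show ?thesis
        by (rule has_field_derivative_transform_within_open[of _ _ _ "{..<\<sigma>}"]) (use 1 Glo in auto)
    next
      case 2
      define t where "t = (d - \<sigma>) / \<epsilon>"
      have t: "t \<in> {0<..<T}" using 2 \<epsilon> by (auto simp: t_def \<rho>_def field_simps)
      have lin: "((\<lambda>d. (d - \<sigma>) / \<epsilon>) has_real_derivative 1 / \<epsilon>) (at d)"
        using \<epsilon> by (auto intro!: derivative_eq_intros)
      have "((\<lambda>d. W ((d - \<sigma>) / \<epsilon>)) has_real_derivative sqrt (\<omega> (1 - W t) + \<eta>) / 2 * (1 / \<epsilon>)) (at d)"
        by (rule DERIV_chain2[OF _ lin]) (use W(5)[OF t] in \<open>simp add: t_def\<close>)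
      moreover have "cl d = t" using t by (auto simp: cl_def t_def)
      then have "sqrt (\<omega> (1 - W t) + \<eta>) / 2 * (1 / \<epsilon>) = K d" using 2 by (simp add: K_def G_def)
      ultimately have "((\<lambda>d. W ((d - \<sigma>) / \<epsilon>)) has_real_derivative K d) (at d)" by simp
      then show ?thesis
      proof (rule has_field_derivative_transform_within_open[of _ _ _ "{\<sigma><..<\<rho>}"])
        fix x assume "x \<in> {\<sigma><..<\<rho>}"
        then have "0 < (x - \<sigma>) / \<epsilon>" "(x - \<sigma>) / \<epsilon> < T" using \<epsilon> by (auto simp: \<rho>_def field_simps)
        then show "W ((x - \<sigma>) / \<epsilon>) = G x" by (simp add: G_def cl_def)
      qed (use 2 in auto)
    next
      case 3
      have "((\<lambda>_. 1) has_real_derivative K d) (at d)" using Kout[of d] 3 by simp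
      then show ?thesis
        by (rule has_field_derivative_transform_within_open[of _ _ _ "{\<rho><..}"]) (use 3 Ghi in auto)
    qed
  qed
  have sc: "continuous_on {0..1} (\<lambda>s. sqrt (\<omega> (1 - s) + \<eta>))"
  proof -
    have "continuous_on {0..1} (\<lambda>s. \<omega> (1 - s))"
      by (rule continuous_on_compose2[OF \<omega>(1)]) (auto intro!: continuous_intros)
    then show ?thesis by (intro continuous_intros)
  qed
  have Sc: "continuous_on {0..1} S" unfolding S_def
    by (rule indefinite_integral_continuous_1[OF integrable_continuous_interval[OF sc]])
  have Nc: "continuous_on UNIV N" unfolding N_def
    by (rule continuous_on_compose2[OF Sc Gc]) (use G01 in auto)
  have Sd: "(S has_real_derivative sqrt (\<omega> (1 - t) + \<eta>)) (at t within {0..1})" if "t \<in> {0..1}" for t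
    unfolding S_def by (rule integral_has_real_derivative[OF sc that])
  have Nd: "(N has_real_derivative sqrt (\<omega> (1 - G d) + \<eta>) * K d) (at d)" if d: "d \<noteq> \<sigma>" "d \<noteq> \<rho>" for d
  proof -
    have "(S has_real_derivative sqrt (\<omega> (1 - G d) + \<eta>)) (at (G d) within G ` UNIV)"
      by (rule has_field_derivative_subset[OF Sd[OF G01]]) (use G01 in auto)
    from DERIV_image_chain[OF this] Gd[OF d] show ?thesis by (simp add: N_def o_def)
  qed
  have Nlo: "N d = 0" if "d \<le> \<sigma>" for d using Glo[OF that] by (simp add: N_def S_def)
  have Nhi: "N d = N \<rho>" if "\<rho> \<le> d" for d using Ghi[OF that] Ghi[of \<rho>] by (simp add: N_def)
  have NS: "N \<rho> \<le> Psi \<omega> 1 + sqrt \<eta>"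
  proof -
    have "N \<rho> = integral {0..1} (\<lambda>s. sqrt (\<omega> (1 - s) + \<eta>))" using Ghi[of \<rho>] by (simp add: N_def S_def)
    also have "\<dots> \<le> integral {0..1} (\<lambda>s. sqrt (\<omega> (1 - s)) + sqrt \<eta>)"
    proof (rule integral_le)
      show "(\<lambda>s. sqrt (\<omega> (1 - s) + \<eta>)) integrable_on {0..1}" by (rule integrable_continuous_interval[OF sc])
      show "(\<lambda>s. sqrt (\<omega> (1 - s)) + sqrt \<eta>) integrable_on {0..1}"
        by (intro integrable_add sqrt_\<omega>_integrable integrable_const_ivl) auto
      show "sqrt (\<omega> (1 - s) + \<eta>) \<le> sqrt (\<omega> (1 - s)) + sqrt \<eta>" if "s \<in> {0..1}" for s
        using \<omega>(2)[of "1 - s"] that \<eta> by (intro sqrt_add_le_add_sqrt) auto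
    qed
    also have "\<dots> = Psi \<omega> 1 + sqrt \<eta>"
      unfolding Psi_def using sqrt_\<omega>_integrable[of 0 1] by (subst integral_add) auto
    finally show ?thesis .
  qed
  \<comment> \<open>On the profile \<epsilon> K^2 = (\<omega> + \<eta>)/(4 \<epsilon>); up to the
    surplus \<eta> this is the case of equality in the inequality of the means.\<close>
  have dens: "\<omega> (1 - G d) / (4 * \<epsilon>) + \<epsilon> * (K d)\<^sup>2 \<le> sqrt (\<omega> (1 - G d) + \<eta>) * K d" if d: "d \<in> {\<sigma><..<\<rho>}" for d
  proof -
    define z where "z = \<omega> (1 - G d)"
    have z: "0 \<le> z" unfolding z_def by (rule w0)
    have Kd: "K d = sqrt (z + \<eta>) / (2 * \<epsilon>)" using d by (simp add: K_def z_def)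
    have "\<epsilon> * (K d)\<^sup>2 = (z + \<eta>) / (4 * \<epsilon>)"
      unfolding Kd using z \<eta> \<epsilon> by (simp add: power_divide power_mult_distrib power2_eq_square field_simps)
    moreover have "sqrt (z + \<eta>) * K d = (z + \<eta>) / (2 * \<epsilon>)"
      unfolding Kd using z \<eta> by simp
    moreover have "z / (4 * \<epsilon>) + (z + \<eta>) / (4 * \<epsilon>) \<le> (z + \<eta>) / (2 * \<epsilon>)"
      using \<eta> \<epsilon> by (simp add: field_simps)
    ultimately show ?thesis unfolding z_def by simp
  qed
  have KB': "bounded (range K)" unfolding bounded_iff real_norm_def using KB by blast
  show ?thesis
    by (rule exI[of _ \<rho>], rule exI[of _ G], rule exI[of _ K], rule exI[of _ N],
        intro conjI \<rho> Gc Km KB' Nc NS; intro allI impI ballI; (rule G01 Glo Ghi Kout Gd Nlo Nhi Nd dens K0; assumption?))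
qed

end

section \<open>Assembling the profiles around the jumps\<close>

lemma DERIV_shift_reflect:
  fixes F :: "real \<Rightarrow> real"
  shows "(F has_real_derivative D) (at (x - p)) \<Longrightarrow> ((\<lambda>x. F (x - p)) has_real_derivative D) (at x)"
    and "(F has_real_derivative D) (at (p - x)) \<Longrightarrow> ((\<lambda>x. F (p - x)) has_real_derivative - D) (at x)"
proof -
  assume F: "(F has_real_derivative D) (at (x - p))"
  have "((\<lambda>x. x - p) has_real_derivative 1) (at x)" by (auto intro!: derivative_eq_intros)
  from DERIV_chain2[OF F this] show "((\<lambda>x. F (x - p)) has_real_derivative D) (at x)" by simp
next
  assume F: "(F has_real_derivative D) (at (p - x))"
  have "((\<lambda>x. p - x) has_real_derivative -1) (at x)" by (auto intro!: derivative_eq_intros)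
  from DERIV_chain2[OF F this] show "((\<lambda>x. F (p - x)) has_real_derivative - D) (at x)" by simp
qed

lemma L2_space_bounded:
  assumes "f \<in> borel_measurable borel" "\<And>x. \<bar>f x\<bar> \<le> B"
  shows "f \<in> L2_space {a<..<b}"
proof -
  interpret finite_measure "lebesgue_on {a<..<b}" by (rule finite_measure_lebesgue_on_Ioo)
  have m: "f \<in> borel_measurable (lebesgue_on {a<..<b})" by (rule borel_measurable_lebesgue_on_borel[OF assms(1)])
  have "norm ((f x)\<^sup>2) \<le> B\<^sup>2" for x
    using power_mono[OF assms(2)[of x], of 2] by simp
  then have "integrable (lebesgue_on {a<..<b}) (\<lambda>x. (f x)\<^sup>2)"
    by (intro integrable_const_bound[where B = "B\<^sup>2"] AE_I2 borel_measurable_power m)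
  then show ?thesis using m by (simp add: L2_space_def)
qed

lemma continuous_integrable_Ioo:
  fixes f :: "real \<Rightarrow> 'b::euclidean_space"
  assumes "continuous_on {a..b} f"
  shows "integrable (lebesgue_on {a<..<b}) f"
proof -
  have "set_integrable lebesgue {a..b} f" by (rule absolutely_integrable_continuous_real[OF assms])
  then have "set_integrable lebesgue {a<..<b} f" by (rule set_integrable_subset) auto
  then show ?thesis by (simp add: integrable_restrict_space set_integrable_def)
qed

context phase_field
begin

text \<open>The pointwise bounds hold for every \<epsilon>, while the energy estimate asks the zones
  of radius \<rho> to be separated and inside the interval. Putting the latter as an implication
  lets the pair be chosen for all \<epsilon> at once, although the zones separate only for small
  \<epsilon>.\<close>

lemma recovery_pair:
  assumes pw: "pw_sobolev a b u c g J s" and g2: "integrable LL (\<lambda>x. (g x)\<^sup>2)"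
    and \<epsilon>: "0 < \<epsilon>" and \<gamma>: "0 \<le> \<gamma>" and \<eta>: "0 < \<eta>" and \<sigma>: "0 < \<sigma>"
  shows "\<exists>\<rho> U V. 0 < \<rho> \<and> \<rho> \<le> \<sigma> + 2 * \<epsilon> / sqrt \<eta> \<and> continuous_on {a..b} U \<and> continuous_on {a..b} V \<and>
    (\<forall>x. \<bar>U x - (c + integral {a..x} g + step_fun J s x)\<bar> \<le> (\<Sum>p\<in>J. \<bar>s p\<bar>)) \<and> (\<forall>x. \<bar>V x - 1\<bar> \<le> real (card J)) \<and>
    (\<forall>x. (\<forall>p\<in>J. \<rho> \<le> \<bar>x - p\<bar>) \<longrightarrow> U x = c + integral {a..x} g + step_fun J s x \<and> V x = 1) \<and>
    ((\<forall>p\<in>J. a \<le> p - \<rho> \<and> p + \<rho> \<le> b) \<longrightarrow> (\<forall>p\<in>J. \<forall>p'\<in>J. p \<noteq> p' \<longrightarrow> 2 * \<rho> \<le> \<bar>p - p'\<bar>) \<longrightarrow>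
      phase_field_energy \<Omega> \<phi> \<phi>inf l Q \<omega> \<gamma> \<epsilon> U V \<le>
        ennreal (\<phi>inf * (LINT x|LL. (g x)\<^sup>2) + real (card J) * (\<omega> 1 / (4 * \<epsilon>) * (2 * \<sigma>) + 2 * (Psi \<omega> 1 + sqrt \<eta>))))"
proof -
  have gi: "integrable LL g" and J: "finite J" "J \<subseteq> \<Omega>" using pw by (auto simp: pw_sobolev_def)
  have gL2: "g \<in> L2_space \<Omega>" using gi g2 by (simp add: L2_space_def)
  have tp: "\<exists>\<rho> G K N. \<sigma> < \<rho> \<and> \<rho> \<le> \<sigma> + 2 * \<epsilon> / sqrt \<eta> \<and> continuous_on UNIV G \<and> (\<forall>d. G d \<in> {0..1}) \<and>
    (\<forall>d\<le>\<sigma>. G d = 0) \<and> (\<forall>d\<ge>\<rho>. G d = 1) \<and> K \<in> borel_measurable borel \<and> bounded (range K) \<and>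
    (\<forall>d. d \<notin> {\<sigma><..<\<rho>} \<longrightarrow> K d = 0) \<and>
    (\<forall>d. d \<noteq> \<sigma> \<longrightarrow> d \<noteq> \<rho> \<longrightarrow> (G has_real_derivative K d) (at d)) \<and>
    continuous_on UNIV N \<and> (\<forall>d\<le>\<sigma>. N d = 0) \<and> (\<forall>d\<ge>\<rho>. N d = N \<rho>) \<and> N \<rho> \<le> Psi \<omega> 1 + sqrt \<eta> \<and>
    (\<forall>d. d \<noteq> \<sigma> \<longrightarrow> d \<noteq> \<rho> \<longrightarrow> (N has_real_derivative sqrt (\<omega> (1 - G d) + \<eta>) * K d) (at d)) \<and>
    (\<forall>d\<in>{\<sigma><..<\<rho>}. \<omega> (1 - G d) / (4 * \<epsilon>) + \<epsilon> * (K d)\<^sup>2 \<le> sqrt (\<omega> (1 - G d) + \<eta>) * K d) \<and>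
    (\<forall>d. 0 \<le> K d)"
    by (rule transition_profile[OF \<epsilon> \<eta> \<sigma>])
  then obtain \<rho> G K N where \<rho>: "\<sigma> < \<rho>" "\<rho> \<le> \<sigma> + 2 * \<epsilon> / sqrt \<eta>" and Gc: "continuous_on UNIV G"
    and G01: "\<forall>d. G d \<in> {0..1}" and Glo: "\<forall>d\<le>\<sigma>. G d = 0" and Ghi: "\<forall>d\<ge>\<rho>. G d = 1"
    and Km: "K \<in> borel_measurable borel" and KB: "bounded (range K)" and Kout: "\<forall>d. d \<notin> {\<sigma><..<\<rho>} \<longrightarrow> K d = 0"
    and Gd: "\<forall>d. d \<noteq> \<sigma> \<longrightarrow> d \<noteq> \<rho> \<longrightarrow> (G has_real_derivative K d) (at d)"
    and Nc: "continuous_on UNIV N" and Nlo: "\<forall>d\<le>\<sigma>. N d = 0" and Nhi: "\<forall>d\<ge>\<rho>. N d = N \<rho>" and NP: "N \<rho> \<le> Psi \<omega> 1 + sqrt \<eta>"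
    and Nd: "\<forall>d. d \<noteq> \<sigma> \<longrightarrow> d \<noteq> \<rho> \<longrightarrow> (N has_real_derivative sqrt (\<omega> (1 - G d) + \<eta>) * K d) (at d)"
    and dens: "\<forall>d\<in>{\<sigma><..<\<rho>}. \<omega> (1 - G d) / (4 * \<epsilon>) + \<epsilon> * (K d)\<^sup>2 \<le> sqrt (\<omega> (1 - G d) + \<eta>) * K d"
    and K0: "\<forall>d. 0 \<le> K d"
    by (elim exE conjE) (rule that)
  \<comment> \<open>The ramp climbs on ]p, p + \<sigma>[, inside the zone where \<open>V\<close> is
    0, and coincides with the left-continuous unit step outside it.\<close>
  define ramp where "ramp = (\<lambda>p x. max 0 (min 1 ((x - p) / \<sigma>)) :: real)"
  define U where "U = (\<lambda>x. c + integral {a..x} g + (\<Sum>p\<in>J. s p * ramp p x))"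
  \<comment> \<open>One of x - p and p - x is at most 0, where \<open>G\<close> vanishes, so the sum
    is G(|x - p|) in a form that can be differentiated without the absolute value.\<close>
  define \<theta> where "\<theta> = (\<lambda>p x. G (x - p) + G (p - x))"
  \<comment> \<open>Each term 1 - \<theta> is the dip at one jump; when the zones are separated at
    most one term is nonzero at any point, which keeps \<open>V\<close> in [0, 1].\<close>
  define V where "V = (\<lambda>x. 1 - (\<Sum>p\<in>J. 1 - \<theta> p x))"
  have \<theta>_cases: "\<theta> p x = G \<bar>x - p\<bar>" for p x
  proof (cases "p \<le> x")
    case True
    then have "G (p - x) = 0" using Glo \<sigma> by auto
    then show ?thesis using True by (simp add: \<theta>_def)
  next
    case False
    then have "G (x - p) = 0" using Glo \<sigma> by auto
    then show ?thesis using False by (simp add: \<theta>_def)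
  qed
  have \<theta>01: "0 \<le> \<theta> p x" "\<theta> p x \<le> 1" for p x using G01 unfolding \<theta>_cases by auto
  have \<theta>far: "\<theta> p x = 1" if "\<rho> \<le> \<bar>x - p\<bar>" for p x using that Ghi unfolding \<theta>_cases by blast
  have \<theta>near: "\<theta> p x = 0" if "\<bar>x - p\<bar> \<le> \<sigma>" for p x using that Glo unfolding \<theta>_cases by blast
  have ramp01: "0 \<le> ramp p x" "ramp p x \<le> 1" for p x by (auto simp: ramp_def)
  have ramp_far: "ramp p x = (if p < x then 1 else 0)" if "\<rho> \<le> \<bar>x - p\<bar> \<or> x \<le> p" for p x
  proof (cases "p < x")
    case True
    then have "\<sigma> \<le> x - p" using that \<rho>(1) by auto
    then have "1 \<le> (x - p) / \<sigma>" using \<sigma> by (simp add: field_simps)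
    then show ?thesis using True by (simp add: ramp_def)
  next
    case False
    then have "(x - p) / \<sigma> \<le> 0" using \<sigma> by (simp add: divide_le_0_iff)
    then show ?thesis using False by (simp add: ramp_def)
  qed
  have Uc: "continuous_on {a..b} U" unfolding U_def ramp_def
    using primitive_continuous[OF gi] ab \<sigma> by (intro continuous_intros) auto
  have \<theta>c: "continuous_on S (\<theta> p)" for S p unfolding \<theta>_def
    by (intro continuous_intros continuous_on_compose2[OF Gc]) auto
  have Vc: "continuous_on {a..b} V" unfolding V_def by (intro continuous_intros \<theta>c)
  have Ub: "\<bar>U x - (c + integral {a..x} g + step_fun J s x)\<bar> \<le> (\<Sum>p\<in>J. \<bar>s p\<bar>)" for x
  proof -
    have "U x - (c + integral {a..x} g + step_fun J s x) = (\<Sum>p\<in>J. s p * (ramp p x - (if p < x then 1 else 0)))"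
      by (simp add: U_def step_fun_def sum_subtractf[symmetric] right_diff_distrib)
    also have "\<bar>\<dots>\<bar> \<le> (\<Sum>p\<in>J. \<bar>s p * (ramp p x - (if p < x then 1 else 0))\<bar>)" by (rule sum_abs)
    also have "\<dots> \<le> (\<Sum>p\<in>J. \<bar>s p\<bar>)"
    proof (rule sum_mono)
      fix p
      have "\<bar>ramp p x - (if p < x then 1 else 0)\<bar> \<le> 1" using ramp01[of p x] by auto
      then show "\<bar>s p * (ramp p x - (if p < x then 1 else 0))\<bar> \<le> \<bar>s p\<bar>" by (simp add: abs_mult mult_left_le)
    qed
    finally show ?thesis .
  qed
  have Vb: "\<bar>V x - 1\<bar> \<le> real (card J)" for x
  proof -
    have "\<bar>V x - 1\<bar> \<le> (\<Sum>p\<in>J. \<bar>1 - \<theta> p x\<bar>)" unfolding V_def using sum_abs[of "\<lambda>p. 1 - \<theta> p x" J] by simp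
    also have "\<dots> \<le> (\<Sum>p\<in>J. 1)"
    proof (rule sum_mono)
      show "\<bar>1 - \<theta> p x\<bar> \<le> 1" for p using \<theta>01[of p x] by simp
    qed
    finally show ?thesis by simp
  qed
  have far: "U x = c + integral {a..x} g + step_fun J s x \<and> V x = 1" if x: "\<forall>p\<in>J. \<rho> \<le> \<bar>x - p\<bar>" for x
  proof
    have "(\<Sum>p\<in>J. s p * ramp p x) = step_fun J s x"
      unfolding step_fun_def by (rule sum.cong) (use x ramp_far in auto)
    then show "U x = c + integral {a..x} g + step_fun J s x" by (simp add: U_def)
    have "(\<Sum>p\<in>J. 1 - \<theta> p x) = 0" by (rule sum.neutral) (use x \<theta>far in auto)
    then show "V x = 1" by (simp add: V_def)
  qed
  have energy: "phase_field_energy \<Omega> \<phi> \<phi>inf l Q \<omega> \<gamma> \<epsilon> U V \<le>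
      ennreal (\<phi>inf * (LINT x|LL. (g x)\<^sup>2) + real (card J) * (\<omega> 1 / (4 * \<epsilon>) * (2 * \<sigma>) + 2 * (Psi \<omega> 1 + sqrt \<eta>)))"
    if inside: "\<forall>p\<in>J. a \<le> p - \<rho> \<and> p + \<rho> \<le> b" and sep: "\<forall>p\<in>J. \<forall>p'\<in>J. p \<noteq> p' \<longrightarrow> 2 * \<rho> \<le> \<bar>p - p'\<bar>"
  proof -
    \<comment> \<open>All points at which a ramp or a profile may have a corner; they are finitely
      many, as \<open>FTC_piecewise\<close> requires.\<close>
    define S where "S = (\<Union>p\<in>J. {p, p + \<sigma>, p - \<sigma>, p + \<rho>, p - \<rho>})"
    have S: "finite S" unfolding S_def using J(1) by simp
    have Sx: "x - p \<noteq> \<sigma>" "x - p \<noteq> \<rho>" "p - x \<noteq> \<sigma>" "p - x \<noteq> \<rho>" "x \<noteq> p" "x \<noteq> p + \<sigma>" if "x \<notin> S" "p \<in> J" for x p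
      using that unfolding S_def by auto
    define q where "q = (\<lambda>x. \<Sum>p\<in>J. K (x - p) - K (p - x))"
    define f where "f = (\<lambda>x. \<Sum>p\<in>J. s p * (if p < x \<and> x < p + \<sigma> then 1 / \<sigma> else 0))"
    define nd where "nd = (\<lambda>d. sqrt (\<omega> (1 - G d) + \<eta>) * K d)"
    have near: "\<And>p'. p' \<in> J \<Longrightarrow> p' \<noteq> p \<Longrightarrow> \<rho> \<le> \<bar>x - p'\<bar>" if "p \<in> J" "\<bar>x - p\<bar> < \<rho>" for x p
    proof -
      fix p' assume "p' \<in> J" "p' \<noteq> p"
      then have "2 * \<rho> \<le> \<bar>p - p'\<bar>" using sep that(1) by auto
      then show "\<rho> \<le> \<bar>x - p'\<bar>" using that(2) by linarith
    qed
    have Vnear: "V x = G \<bar>x - p\<bar>" if "p \<in> J" "\<bar>x - p\<bar> < \<rho>" for x p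
    proof -
      have "(\<Sum>p'\<in>J. 1 - \<theta> p' x) = (\<Sum>p'\<in>J. if p' = p then 1 - \<theta> p x else 0)"
        by (rule sum.cong) (use near[OF that] \<theta>far in auto)
      also have "\<dots> = 1 - \<theta> p x" using J(1) that(1) by simp
      finally show ?thesis by (simp add: V_def \<theta>_cases)
    qed
    have qnear: "q x = K (x - p) - K (p - x)" if "p \<in> J" "\<bar>x - p\<bar> < \<rho>" for x p
    proof -
      have z: "K (x - p') - K (p' - x) = 0" if "p' \<in> J" "p' \<noteq> p" for p'
      proof -
        have "\<rho> \<le> \<bar>x - p'\<bar>" using near[OF \<open>p \<in> J\<close> \<open>\<bar>x - p\<bar> < \<rho>\<close> that] .
        then have "x - p' \<notin> {\<sigma><..<\<rho>}" "p' - x \<notin> {\<sigma><..<\<rho>}" using \<sigma> by auto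
        then show ?thesis using Kout by simp
      qed
      have "q x = (\<Sum>p'\<in>J. if p' = p then K (x - p) - K (p - x) else 0)"
        unfolding q_def by (rule sum.cong) (use z in auto)
      then show ?thesis using J(1) that(1) by simp
    qed
    have V01: "V x \<in> {0..1}" for x
    proof (cases "\<exists>p\<in>J. \<bar>x - p\<bar> < \<rho>")
      case True
      then show ?thesis using Vnear G01 by auto
    next
      case False
      then show ?thesis using far[of x] by force
    qed
    have Vd: "(V has_real_derivative q x) (at x)" if x: "x \<notin> S" for x
    proof -
      have "(\<theta> p has_real_derivative K (x - p) - K (p - x)) (at x)" if p: "p \<in> J" for p
      proof -
        have "(G has_real_derivative K (x - p)) (at (x - p))" "(G has_real_derivative K (p - x)) (at (p - x))"
          using Gd Sx[OF x p] by auto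
        from DERIV_add[OF DERIV_shift_reflect(1)[OF this(1)] DERIV_shift_reflect(2)[OF this(2)]]
        show ?thesis by (simp add: \<theta>_def)
      qed
      then have "((\<lambda>x. 1 - (\<Sum>p\<in>J. 1 - \<theta> p x)) has_real_derivative 0 - (\<Sum>p\<in>J. 0 - (K (x - p) - K (p - x)))) (at x)"
        by (intro DERIV_diff DERIV_const DERIV_sum)
      then show ?thesis by (simp add: V_def q_def sum_negf[symmetric])
    qed
    have Veq: "V x = V a + integral {a..x} q" if "x \<in> {a..b}" for x
      by (rule FTC_piecewise(2)[OF S Vc Vd that]) simp
    obtain B where B: "\<And>d. \<bar>K d\<bar> \<le> B" using KB unfolding bounded_iff real_norm_def by blast
    have qL2: "q \<in> L2_space \<Omega>"
    proof (rule L2_space_bounded)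
      show "q \<in> borel_measurable borel" unfolding q_def using Km by measurable
      fix x
      have "\<bar>q x\<bar> \<le> (\<Sum>p\<in>J. \<bar>K (x - p) - K (p - x)\<bar>)" unfolding q_def by (rule sum_abs)
      also have "\<dots> \<le> (\<Sum>p\<in>J. 2 * B)"
      proof (rule sum_mono)
        show "\<bar>K (x - p) - K (p - x)\<bar> \<le> 2 * B" for p using B[of "x - p"] B[of "p - x"] by linarith
      qed
      finally show "\<bar>q x\<bar> \<le> (\<Sum>p\<in>J. 2 * B)" .
    qed
    have in\<Omega>: "AE x in LL. x \<in> \<Omega>" by (rule AE_I2) simp
    have VH: "AE x in LL. V x = V a + integral {a..x} q"
      using in\<Omega> by eventually_elim (rule Veq, auto)
    note VH1 = H1_spaceI[OF ab qL2 VH]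
    have fL2: "f \<in> L2_space \<Omega>"
    proof (rule L2_space_bounded)
      show "f \<in> borel_measurable borel" unfolding f_def by measurable
      fix x
      have "\<bar>f x\<bar> \<le> (\<Sum>p\<in>J. \<bar>s p * (if p < x \<and> x < p + \<sigma> then 1 / \<sigma> else 0)\<bar>)" unfolding f_def by (rule sum_abs)
      also have "\<dots> \<le> (\<Sum>p\<in>J. \<bar>s p\<bar> / \<sigma>)"
        by (rule sum_mono) (use \<sigma> in \<open>auto simp: abs_mult\<close>)
      finally show "\<bar>f x\<bar> \<le> (\<Sum>p\<in>J. \<bar>s p\<bar> / \<sigma>)" .
    qed
    have rd: "((\<lambda>x. \<Sum>p\<in>J. s p * ramp p x) has_real_derivative f x) (at x)" if x: "x \<notin> S" for x
    proof -
      have "(ramp p has_real_derivative (if p < x \<and> x < p + \<sigma> then 1 / \<sigma> else 0)) (at x)" if p: "p \<in> J" for p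
      proof -
        consider "x < p" | "p < x" "x < p + \<sigma>" | "p + \<sigma> < x" using Sx(5,6)[OF x p] by linarith
        then show ?thesis
        proof cases
          case 1
          have "((\<lambda>_. 0) has_real_derivative 0) (at x)" by simp
          then have "(ramp p has_real_derivative 0) (at x)"
            by (rule has_field_derivative_transform_within_open[of _ _ _ "{..<p}"]) (use 1 ramp_far in auto)
          then show ?thesis using 1 by simp
        next
          case 2
          have "((\<lambda>x. (x - p) / \<sigma>) has_real_derivative 1 / \<sigma>) (at x)" using \<sigma> by (auto intro!: derivative_eq_intros)
          then have "(ramp p has_real_derivative 1 / \<sigma>) (at x)"
          proof (rule has_field_derivative_transform_within_open[of _ _ _ "{p<..<p + \<sigma>}"])
            fix y assume "y \<in> {p<..<p + \<sigma>}"
            then have "0 \<le> (y - p) / \<sigma>" "(y - p) / \<sigma> \<le> 1" using \<sigma> by (auto simp: field_simps)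
            then show "(y - p) / \<sigma> = ramp p y" by (simp add: ramp_def)
          qed (use 2 in auto)
          then show ?thesis using 2 by simp
        next
          case 3
          have "((\<lambda>_. 1) has_real_derivative 0) (at x)" by simp
          then have "(ramp p has_real_derivative 0) (at x)"
          proof (rule has_field_derivative_transform_within_open[of _ _ _ "{p + \<sigma><..}"])
            fix y assume "y \<in> {p + \<sigma><..}"
            then have "1 \<le> (y - p) / \<sigma>" using \<sigma> by (auto simp: field_simps)
            then show "1 = ramp p y" by (simp add: ramp_def)
          qed (use 3 in auto)
          then show ?thesis using 3 by simp
        qed
      qed
      then show ?thesis unfolding f_def by (intro DERIV_sum DERIV_cmult)
    qed
    have rc: "continuous_on {a..b} (\<lambda>x. \<Sum>p\<in>J. s p * ramp p x)" unfolding ramp_def using \<sigma> by (intro continuous_intros) auto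
    have ra: "(\<Sum>p\<in>J. s p * ramp p a) = 0"
      by (rule sum.neutral) (use J(2) ramp_far in auto)
    have Ueq: "U x = c + integral {a..x} (\<lambda>x. g x + f x)" if x: "x \<in> {a..b}" for x
    proof -
      have 1: "(\<Sum>p\<in>J. s p * ramp p x) = integral {a..x} f" and fi: "f integrable_on {a..x}"
        using FTC_piecewise[OF S rc rd x] ra by simp_all
      have "g integrable_on {a..x}"
        using integral_lebesgue_on_Ioo(2)[OF gi, of x] x set_lebesgue_integral_eq_integral(1) by auto
      then have "integral {a..x} (\<lambda>x. g x + f x) = integral {a..x} g + integral {a..x} f" using fi by (rule integral_add)
      then show ?thesis using 1 by (simp add: U_def)
    qed
    have gfL2: "(\<lambda>x. g x + f x) \<in> L2_space \<Omega>"
    proof -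
      have "g \<in> borel_measurable LL" "f \<in> borel_measurable LL" "integrable LL (\<lambda>x. (f x)\<^sup>2)"
        using gL2 fL2 by (auto simp: L2_space_def)
      then show ?thesis using integrable_square_add[of g LL f 1 1] g2 by (simp add: L2_space_def)
    qed
    have UH: "AE x in LL. U x = c + integral {a..x} (\<lambda>x. g x + f x)"
      using in\<Omega> by eventually_elim (rule Ueq, auto)
    note UH1 = H1_spaceI[OF ab gfL2 UH]
    have \<omega>G0: "0 \<le> \<omega> (1 - G d)" for d using \<omega>(2)[of "1 - G d"] G01 by auto
    have \<omega>10: "0 \<le> \<omega> 1" using \<omega>(2)[of 1] by simp
    have nd0: "0 \<le> nd d" for d using \<omega>G0[of d] K0 \<eta> by (simp add: nd_def)
    \<comment> \<open>A majorant of the surface density due to one jump: \<omega>(1)/(4 \<epsilon>)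
      on the zone where \<open>V\<close> is 0, and the derivative of \<open>N\<close> on both
      flanks.\<close>
    define m where "m = (\<lambda>p x. \<omega> 1 / (4 * \<epsilon>) * indicator {p - \<sigma>..p + \<sigma>} x + (nd (x - p) + nd (p - x)))"
    have m0: "0 \<le> m p x" for p x using nd0 \<omega>10 \<epsilon> by (simp add: m_def)
    have mint: "integrable LL (m p)" and mle: "(LINT x|LL. m p x) \<le> \<omega> 1 / (4 * \<epsilon>) * (2 * \<sigma>) + 2 * (Psi \<omega> 1 + sqrt \<eta>)" if p: "p \<in> J" for p
    proof -
      interpret finite_measure LL by (rule finite_measure_lebesgue_on_Ioo)
      \<comment> \<open>The two flanks together have the primitive N(x - p) - N(p - x), which runs
        from -N(\<rho>) to N(\<rho>) because the zone lies inside [a, b]; the total is 2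
        N(\<rho>).\<close>
      let ?N = "\<lambda>x. N (x - p) - N (p - x)" and ?n = "\<lambda>x. nd (x - p) + nd (p - x)"
      have Nc': "continuous_on {a..b} ?N" by (intro continuous_intros continuous_on_compose2[OF Nc]) auto
      have Nd': "(?N has_real_derivative ?n x) (at x)" if x: "x \<notin> S" for x
      proof -
        have "(N has_real_derivative nd (x - p)) (at (x - p))" "(N has_real_derivative nd (p - x)) (at (p - x))"
          using Nd Sx[OF x p] unfolding nd_def by auto
        from DERIV_diff[OF DERIV_shift_reflect(1)[OF this(1)] DERIV_shift_reflect(2)[OF this(2)]] show ?thesis by simp
      qed
      have bb: "b \<in> {a..b}" using ab by simp
      have ni: "?n integrable_on {a..b}" by (rule FTC_piecewise(1)[OF S Nc' Nd' bb]) simp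
      have "?N b = ?N a + integral {a..b} ?n" by (rule FTC_piecewise(2)[OF S Nc' Nd' bb]) simp
      moreover have "?N b = N \<rho>" "?N a = - N \<rho>"
      proof -
        have "a \<le> p - \<rho>" "p + \<rho> \<le> b" using inside p by auto
        then have "\<rho> \<le> b - p" "p - b \<le> \<sigma>" "\<rho> \<le> p - a" "a - p \<le> \<sigma>" using \<rho>(1) \<sigma> by auto
        then have "N (b - p) = N \<rho>" "N (p - b) = 0" "N (p - a) = N \<rho>" "N (a - p) = 0" using Nhi Nlo by blast+
        then show "?N b = N \<rho>" "?N a = - N \<rho>" by simp_all
      qed
      ultimately have nI: "integral {a..b} ?n = 2 * N \<rho>" by simp
      have "?n absolutely_integrable_on {a..b}"
        by (rule nonnegative_absolutely_integrable_1[OF ni]) (use nd0 in simp)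
      then have "set_integrable lebesgue \<Omega> ?n" by (rule set_integrable_subset) auto
      then have nint: "integrable LL ?n" by (simp add: integrable_restrict_space set_integrable_def)
      have "(LINT x|LL. ?n x) = integral \<Omega> ?n" by (rule lebesgue_integral_eq_integral[OF nint]) auto
      also have "\<dots> = integral {a..b} ?n" by (rule integral_open_interval_real[symmetric])
      finally have nL: "(LINT x|LL. ?n x) = 2 * N \<rho>" using nI by simp
      have iint: "integrable LL (indicator {p - \<sigma>..p + \<sigma>} :: real \<Rightarrow> real)"
        by (rule integrable_const_bound[where B = 1, OF AE_I2 borel_measurable_lebesgue_on_borel]) auto
      have iL: "(LINT x|LL. indicat_real {p - \<sigma>..p + \<sigma>} x) \<le> 2 * \<sigma>"
      proof -
        have "(LINT x|LL. indicat_real {p - \<sigma>..p + \<sigma>} x) = (LINT x|lebesgue. indicator \<Omega> x *\<^sub>R indicat_real {p - \<sigma>..p + \<sigma>} x)"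
          by (rule integral_restrict_space) auto
        also have "\<dots> \<le> (LINT x|lebesgue. indicat_real {p - \<sigma>..p + \<sigma>} x)"
        proof (rule integral_mono)
          show i: "integrable lebesgue (indicator {p - \<sigma>..p + \<sigma>} :: real \<Rightarrow> real)" by (rule integrable_real_indicator) (use \<sigma> in auto)
          have "integrable lebesgue (indicator (\<Omega> \<inter> {p - \<sigma>..p + \<sigma>}) :: real \<Rightarrow> real)"
          proof (rule integrable_real_indicator)
            have "emeasure lebesgue (\<Omega> \<inter> {p - \<sigma>..p + \<sigma>}) \<le> emeasure lebesgue {p - \<sigma>..p + \<sigma>}" by (rule emeasure_mono) auto
            also have "\<dots> < \<infinity>" using \<sigma> by simp
            finally show "emeasure lebesgue (\<Omega> \<inter> {p - \<sigma>..p + \<sigma>}) < \<infinity>" .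
          qed auto
          then show "integrable lebesgue (\<lambda>x. indicator \<Omega> x *\<^sub>R indicat_real {p - \<sigma>..p + \<sigma>} x :: real)"
            by (simp add: indicator_inter_arith[abs_def])
        qed (auto simp: indicator_def)
        also have "\<dots> = 2 * \<sigma>" using \<sigma> by simp
        finally show ?thesis .
      qed
      show "integrable LL (m p)" unfolding m_def using iint nint by simp
      have "(LINT x|LL. m p x) = \<omega> 1 / (4 * \<epsilon>) * (LINT x|LL. indicator {p - \<sigma>..p + \<sigma>} x) + (LINT x|LL. ?n x)"
        unfolding m_def using Bochner_Integration.integral_add[OF integrable_mult_right[OF iint] nint] by (simp only: integral_mult_right_zero)
      also have "\<dots> \<le> \<omega> 1 / (4 * \<epsilon>) * (2 * \<sigma>) + 2 * (Psi \<omega> 1 + sqrt \<eta>)"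
        unfolding nL using iL NP \<omega>10 \<epsilon> by (intro add_mono mult_left_mono) auto
      finally show "(LINT x|LL. m p x) \<le> \<omega> 1 / (4 * \<epsilon>) * (2 * \<sigma>) + 2 * (Psi \<omega> 1 + sqrt \<eta>)" .
    qed
    \<comment> \<open>Far from all jumps V = 1 and only the bulk term is left; where V = 0 the
      coefficient vanishes and hides the steep ramp; on the flanks the ramp is flat and the estimate
      of the profile applies.\<close>
    have pointwise: "E \<gamma> (V x) * (g x + f x)\<^sup>2 + \<omega> (1 - V x) / (4 * \<epsilon>) + \<epsilon> * (q x)\<^sup>2 \<le> \<phi>inf * (g x)\<^sup>2 + (\<Sum>p\<in>J. m p x)" for x
    proof -
      have Eg: "E \<gamma> (V x) * (g x)\<^sup>2 \<le> \<phi>inf * (g x)\<^sup>2" by (rule mult_right_mono[OF E_bounds(2)[OF V01 \<gamma>]]) simp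
      have f0: "f x = 0" if "\<And>p. p \<in> J \<Longrightarrow> \<not> (p < x \<and> x < p + \<sigma>)"
        unfolding f_def by (rule sum.neutral) (use that in auto)
      show ?thesis
      proof (cases "\<exists>p\<in>J. \<bar>x - p\<bar> < \<rho>")
        case False
        then have x: "\<forall>p\<in>J. \<rho> \<le> \<bar>x - p\<bar>" by auto
        have "V x = 1" using far[OF x] by blast
        moreover have "q x = 0" unfolding q_def
        proof (rule sum.neutral, rule ballI)
          fix p assume "p \<in> J"
          then have "\<rho> \<le> \<bar>x - p\<bar>" using x by blast
          then have "x - p \<notin> {\<sigma><..<\<rho>}" "p - x \<notin> {\<sigma><..<\<rho>}" using \<sigma> by auto
          then show "K (x - p) - K (p - x) = 0" using Kout by simp
        qed
        moreover have "f x = 0"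
        proof (rule f0)
          fix p assume "p \<in> J"
          then have "\<rho> \<le> \<bar>x - p\<bar>" using x by blast
          then show "\<not> (p < x \<and> x < p + \<sigma>)" using \<rho>(1) by auto
        qed
        moreover have "\<omega> 0 = 0" using \<omega>(3)[of 0] by simp
        moreover have "0 \<le> (\<Sum>p\<in>J. m p x)" by (rule sum_nonneg) (rule m0)
        ultimately show ?thesis using Eg by simp
      next
        case True
        then obtain p where p: "p \<in> J" "\<bar>x - p\<bar> < \<rho>" by blast
        have msum: "m p x \<le> (\<Sum>p\<in>J. m p x)" by (rule member_le_sum[OF p(1) m0 J(1)])
        note Vx = Vnear[OF p] and qx = qnear[OF p]
        show ?thesis
        proof (cases "\<bar>x - p\<bar> \<le> \<sigma>")
          case True
          have "V x = 0" unfolding Vx using Glo True by blast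
          moreover have "q x = 0"
          proof -
            have "x - p \<notin> {\<sigma><..<\<rho>}" "p - x \<notin> {\<sigma><..<\<rho>}" using True by auto
            then show ?thesis unfolding qx using Kout by simp
          qed
          moreover have "x \<in> {p - \<sigma>..p + \<sigma>}" using True by auto
          then have "\<omega> 1 / (4 * \<epsilon>) \<le> m p x" using nd0[of "x - p"] nd0[of "p - x"] by (simp add: m_def)
          moreover have "0 \<le> \<phi>inf * (g x)\<^sup>2" using \<phi>inf(2) by simp
          ultimately show ?thesis using msum by (simp add: E_0)
        next
          case out: False
          have fx: "f x = 0"
          proof (rule f0)
            fix p' assume "p' \<in> J"
            then show "\<not> (p' < x \<and> x < p' + \<sigma>)"
              using out near[OF p, of p'] \<rho>(1) by (cases "p' = p") auto
          qed
          have d: "\<bar>x - p\<bar> \<in> {\<sigma><..<\<rho>}" using out p(2) by auto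
          have q2: "(q x)\<^sup>2 = (K \<bar>x - p\<bar>)\<^sup>2"
          proof (cases "p \<le> x")
            case True
            then have "K (p - x) = 0" using Kout \<sigma> by auto
            then show ?thesis using True by (simp add: qx)
          next
            case False
            then have "K (x - p) = 0" using Kout \<sigma> by auto
            then show ?thesis using False by (simp add: qx)
          qed
          have ndm: "nd \<bar>x - p\<bar> \<le> m p x"
          proof (cases "p \<le> x")
            case True
            then show ?thesis using nd0[of "p - x"] \<omega>10 \<epsilon> by (simp add: m_def)
          next
            case False
            then have "\<bar>x - p\<bar> = p - x" by simp
            then show ?thesis using nd0[of "x - p"] \<omega>10 \<epsilon> by (simp add: m_def)
          qed
          have "\<omega> (1 - V x) / (4 * \<epsilon>) + \<epsilon> * (q x)\<^sup>2 \<le> nd \<bar>x - p\<bar>"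
            unfolding Vx q2 nd_def using dens d by blast
          then show ?thesis using Eg fx msum ndm by simp
        qed
      qed
    qed
    have tot: "integrable LL (\<lambda>x. \<phi>inf * (g x)\<^sup>2 + (\<Sum>p\<in>J. m p x))"
      using g2 mint by (intro Bochner_Integration.integrable_add integrable_mult_right Bochner_Integration.integrable_sum)
    have "phase_field_energy \<Omega> \<phi> \<phi>inf l Q \<omega> \<gamma> \<epsilon> U V =
      (\<integral>\<^sup>+x. ennreal (E \<gamma> (V x) * \<bar>weak_deriv \<Omega> U x\<bar>\<^sup>2 + \<omega> (1 - V x) / (4 * \<epsilon>) + \<epsilon> * \<bar>weak_deriv \<Omega> V x\<bar>\<^sup>2) \<partial>LL)"
    proof -
      have "AE x in LL. V x \<in> {0..1}" by (rule AE_I2) (rule V01)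
      then show ?thesis using UH1(1) VH1(1) by (simp only: phase_field_energy_def simp_thms if_True)
    qed
    also have "\<dots> \<le> (\<integral>\<^sup>+x. ennreal (\<phi>inf * (g x)\<^sup>2 + (\<Sum>p\<in>J. m p x)) \<partial>LL)"
    proof (rule nn_integral_mono_AE)
      show "AE x in LL. ennreal (E \<gamma> (V x) * \<bar>weak_deriv \<Omega> U x\<bar>\<^sup>2 + \<omega> (1 - V x) / (4 * \<epsilon>) + \<epsilon> * \<bar>weak_deriv \<Omega> V x\<bar>\<^sup>2)
        \<le> ennreal (\<phi>inf * (g x)\<^sup>2 + (\<Sum>p\<in>J. m p x))"
        using UH1(2) VH1(2)
      proof eventually_elim
        case (elim x)
        show ?case unfolding elim power2_abs by (rule ennreal_leI[OF pointwise])
      qed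
    qed
    also have "\<dots> = ennreal (LINT x|LL. \<phi>inf * (g x)\<^sup>2 + (\<Sum>p\<in>J. m p x))"
      by (rule nn_integral_eq_integral[OF tot], rule AE_I2)
        (use \<phi>inf(2) m0 in \<open>auto intro!: add_nonneg_nonneg sum_nonneg\<close>)
    also have "(LINT x|LL. \<phi>inf * (g x)\<^sup>2 + (\<Sum>p\<in>J. m p x)) = \<phi>inf * (LINT x|LL. (g x)\<^sup>2) + (\<Sum>p\<in>J. LINT x|LL. m p x)"
      using g2 mint by (subst Bochner_Integration.integral_add) (auto intro!: Bochner_Integration.integrable_sum simp: Bochner_Integration.integral_sum)
    also have "ennreal \<dots> \<le> ennreal (\<phi>inf * (LINT x|LL. (g x)\<^sup>2) + real (card J) * (\<omega> 1 / (4 * \<epsilon>) * (2 * \<sigma>) + 2 * (Psi \<omega> 1 + sqrt \<eta>)))"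
    proof (rule ennreal_leI)
      have "(\<Sum>p\<in>J. LINT x|LL. m p x) \<le> (\<Sum>p\<in>J. \<omega> 1 / (4 * \<epsilon>) * (2 * \<sigma>) + 2 * (Psi \<omega> 1 + sqrt \<eta>))"
        by (rule sum_mono) (rule mle)
      then show "\<phi>inf * (LINT x|LL. (g x)\<^sup>2) + (\<Sum>p\<in>J. LINT x|LL. m p x)
        \<le> \<phi>inf * (LINT x|LL. (g x)\<^sup>2) + real (card J) * (\<omega> 1 / (4 * \<epsilon>) * (2 * \<sigma>) + 2 * (Psi \<omega> 1 + sqrt \<eta>))" by simp
    qed
    finally show ?thesis .
  qed
  have \<rho>0: "0 < \<rho>" using \<rho>(1) \<sigma> by linarith
  show ?thesis
    by (rule exI[of _ \<rho>], rule exI[of _ U], rule exI[of _ V], intro conjI \<rho>0 \<rho>(2) Uc Vc; intro allI impI;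
        (rule Ub Vb far energy; assumption?))
qed

end

text \<open>Finite limit energy forces finitely many jumps, as \<Psi>(1) > 0, and a square
  integrable gradient, as \<phi>inf > 0; these are the data for \<open>recovery_pair\<close>. If the
  limit energy is infinite, the constant sequence serves.\<close>

lemma (in phase_field) Gamma_limsup:
  fixes w :: "real \<Rightarrow> real \<times> real"
  assumes \<epsilon>: "\<And>j. 0 < \<epsilon> j" "\<epsilon> \<longlonglongrightarrow> 0" and \<gamma>: "\<And>j. 0 \<le> \<gamma> j" and w: "integrable LL w"
  shows "\<exists>y. (\<forall>j. integrable LL (y j)) \<and> (\<lambda>j. L1_dist \<Omega> (y j) w) \<longlonglongrightarrow> 0 \<and>
    limsup (\<lambda>j. phase_field_energy \<Omega> \<phi> \<phi>inf l Q \<omega> (\<gamma> j) (\<epsilon> j) (fst \<circ> y j) (snd \<circ> y j)) \<le>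
    limit_energy \<Omega> \<phi>inf \<omega> (fst \<circ> w) (snd \<circ> w)"
proof (cases "limit_energy \<Omega> \<phi>inf \<omega> (fst \<circ> w) (snd \<circ> w) = \<infinity>")
  case True
  show ?thesis
    by (rule exI[of _ "\<lambda>_. w"]) (simp only: True, simp add: w L1_dist_def)
next
  case False
  define u where "u = fst \<circ> w"
  define v where "v = snd \<circ> w"
  define g where "g = approx_grad \<Omega> u"
  define J where "J = jump_set \<Omega> u"
  have w_eq: "w x = (u x, v x)" for x by (simp add: u_def v_def)
  have SBV: "u \<in> SBV_space \<Omega>" and v1: "AE x in LL. v x = 1"
    using False unfolding u_def[symmetric] v_def[symmetric] by (auto simp: limit_energy_def split: if_splits)
  have LE: "limit_energy \<Omega> \<phi>inf \<omega> (fst \<circ> w) (snd \<circ> w) =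
      ennreal \<phi>inf * (\<integral>\<^sup>+x. ennreal (\<bar>g x\<bar>\<^sup>2) \<partial>LL) + 2 * ennreal (Psi \<omega> 1) * emeasure (count_space UNIV) J"
    unfolding u_def[symmetric] v_def[symmetric] g_def J_def using SBV v1
    by (simp only: limit_energy_def simp_thms if_True)
  have P0: "0 < Psi \<omega> 1" using Psi_less[of 0] by (simp add: Psi_def)
  have I: "(\<integral>\<^sup>+x. ennreal (\<bar>g x\<bar>\<^sup>2) \<partial>LL) < \<infinity>"
    using False \<phi>inf(2) unfolding LE by (auto simp: ennreal_mult_eq_top_iff less_top)
  have fJ: "finite J"
  proof (rule ccontr)
    assume "infinite J"
    then have "emeasure (count_space UNIV) J = \<infinity>" by simp
    then show False using False P0 unfolding LE by (simp add: ennreal_mult_eq_top_iff)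
  qed
  obtain c s where pw: "pw_sobolev a b u c g J s"
    using SBV_pw_sobolev[OF ab SBV] fJ unfolding g_def J_def by blast
  have gm: "g \<in> borel_measurable LL" and J: "J \<subseteq> \<Omega>" and u: "AE x in LL. u x = c + integral {a..x} g + step_fun J s x"
    using pw by (auto simp: pw_sobolev_def)
  have g2: "integrable LL (\<lambda>x. (g x)\<^sup>2)"
    by (rule integrableI_bounded) (use gm I in auto)
  define A where "A = (LINT x|LL. (g x)\<^sup>2)"
  define M where "M = (\<Sum>p\<in>J. \<bar>s p\<bar>) + real (card J)"
  \<comment> \<open>The choice \<eta> = \<epsilon> and \<sigma> = \<epsilon>^2 makes the radius at
    most \<epsilon>^2 + 2 sqrt \<epsilon>; per jump the zero zone costs \<omega>(1) \<epsilon>/2 and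
    the regularisation 2 sqrt \<epsilon>.\<close>
  define R where "R = (\<lambda>j \<rho> U V. 0 < \<rho> \<and> \<rho> \<le> (\<epsilon> j)\<^sup>2 + 2 * \<epsilon> j / sqrt (\<epsilon> j) \<and> continuous_on {a..b} U \<and> continuous_on {a..b} V \<and>
    (\<forall>x. \<bar>U x - (c + integral {a..x} g + step_fun J s x)\<bar> \<le> (\<Sum>p\<in>J. \<bar>s p\<bar>)) \<and> (\<forall>x. \<bar>V x - 1\<bar> \<le> real (card J)) \<and>
    (\<forall>x. (\<forall>p\<in>J. \<rho> \<le> \<bar>x - p\<bar>) \<longrightarrow> U x = c + integral {a..x} g + step_fun J s x \<and> V x = 1) \<and>
    ((\<forall>p\<in>J. a \<le> p - \<rho> \<and> p + \<rho> \<le> b) \<longrightarrow> (\<forall>p\<in>J. \<forall>p'\<in>J. p \<noteq> p' \<longrightarrow> 2 * \<rho> \<le> \<bar>p - p'\<bar>) \<longrightarrow>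
      phase_field_energy \<Omega> \<phi> \<phi>inf l Q \<omega> (\<gamma> j) (\<epsilon> j) U V \<le>
        ennreal (\<phi>inf * A + real (card J) * (\<omega> 1 / (4 * \<epsilon> j) * (2 * (\<epsilon> j)\<^sup>2) + 2 * (Psi \<omega> 1 + sqrt (\<epsilon> j))))))"
  have "\<exists>\<rho> U V. R j \<rho> U V" for j
    unfolding R_def A_def by (rule recovery_pair[OF pw g2 \<epsilon>(1) \<gamma> \<epsilon>(1) zero_less_power[OF \<epsilon>(1)]])
  then obtain \<rho> U V where R: "\<forall>j. R j (\<rho> j) (U j) (V j)" by metis
  note Z = R[unfolded R_def]
  have \<rho>0: "\<rho> \<longlonglongrightarrow> 0"
  proof (rule tendsto_sandwich[OF always_eventually always_eventually tendsto_const])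
    show "\<forall>j. 0 \<le> \<rho> j" using Z less_imp_le by blast
    show "\<forall>j. \<rho> j \<le> (\<epsilon> j)\<^sup>2 + 2 * sqrt (\<epsilon> j)"
    proof
      fix j
      have "2 * \<epsilon> j / sqrt (\<epsilon> j) = 2 * sqrt (\<epsilon> j)" using \<epsilon>(1)[of j] by (simp add: field_simps)
      then show "\<rho> j \<le> (\<epsilon> j)\<^sup>2 + 2 * sqrt (\<epsilon> j)" using Z by metis
    qed
    have "(\<lambda>j. (\<epsilon> j)\<^sup>2 + 2 * sqrt (\<epsilon> j)) \<longlonglongrightarrow> 0\<^sup>2 + 2 * sqrt 0" by (intro tendsto_intros \<epsilon>(2))
    then show "(\<lambda>j. (\<epsilon> j)\<^sup>2 + 2 * sqrt (\<epsilon> j)) \<longlonglongrightarrow> 0" by simp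
  qed
  define y where "y = (\<lambda>j x. (U j x, V j x))"
  have y_int: "integrable LL (y j)" for j
    unfolding y_def by (rule continuous_integrable_Ioo, rule continuous_on_Pair) (use Z in blast)+
  have conv: "(\<lambda>j. L1_dist \<Omega> (y j) w) \<longlonglongrightarrow> 0"
  proof -
    interpret finite_measure LL by (rule finite_measure_lebesgue_on_Ioo)
    \<comment> \<open>At almost every point off the jump set the pair eventually equals the limit,
      and the deviations are bounded by the constant \<open>M\<close>.\<close>
    have "(\<lambda>j. LINT x|LL. norm (y j x - w x)) \<longlonglongrightarrow> (LINT x|LL. 0)"
    proof (rule integral_dominated_convergence[where w = "\<lambda>_. M"])
      show "(\<lambda>x. norm (y j x - w x)) \<in> borel_measurable LL" for j using y_int[of j] w by measurable
      show "AE x in LL. (\<lambda>j. norm (y j x - w x)) \<longlonglongrightarrow> 0"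
      proof -
        have "AE x in lebesgue. x \<notin> J" by (rule AE_completion[OF AE_not_in[OF finite_imp_null_set_lborel[OF fJ]]])
        then have nJ: "AE x in LL. x \<notin> J" by (subst AE_restrict_space_iff) (auto elim: eventually_mono)
        show ?thesis
          using nJ u v1
        proof eventually_elim
          case (elim x)
          have "eventually (\<lambda>j. \<forall>p\<in>J. \<rho> j \<le> \<bar>x - p\<bar>) sequentially"
          proof (rule eventually_ball_finite[OF fJ], rule ballI)
            fix p assume "p \<in> J"
            then have "0 < \<bar>x - p\<bar>" using elim(1) by auto
            from order_tendstoD(2)[OF \<rho>0 this] show "eventually (\<lambda>j. \<rho> j \<le> \<bar>x - p\<bar>) sequentially"
              by (rule eventually_mono) simp
          qed
          then have "eventually (\<lambda>j. norm (y j x - w x) = 0) sequentially"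
          proof eventually_elim
            case (elim j)
            then have "U j x = c + integral {a..x} g + step_fun J s x \<and> V j x = 1" using Z by blast
            then show ?case using \<open>u x = _\<close> \<open>v x = 1\<close> by (simp add: y_def w_eq)
          qed
          then show ?case by (rule tendsto_eventually)
        qed
      qed
      show "AE x in LL. norm (norm (y j x - w x)) \<le> M" for j
        using u v1
      proof eventually_elim
        case (elim x)
        have "norm (y j x - w x) \<le> norm (U j x - u x) + norm (V j x - v x)"
          unfolding y_def w_eq by (simp only: diff_Pair norm_Pair_le)
        also have "\<dots> \<le> M"
          unfolding elim real_norm_def M_def by (intro add_mono) (use Z in blast)+
        finally show ?case by simp
      qed
    qed simp_all
    then show ?thesis by (simp add: L1_dist_def)
  qed
  let ?F = "\<lambda>j. phase_field_energy \<Omega> \<phi> \<phi>inf l Q \<omega> (\<gamma> j) (\<epsilon> j) (fst \<circ> y j) (snd \<circ> y j)"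
  let ?B = "\<lambda>j. \<phi>inf * A + real (card J) * (\<omega> 1 * \<epsilon> j / 2 + 2 * (Psi \<omega> 1 + sqrt (\<epsilon> j)))"
  have inside: "eventually (\<lambda>j. \<forall>p\<in>J. a \<le> p - \<rho> j \<and> p + \<rho> j \<le> b) sequentially"
  proof (rule eventually_ball_finite[OF fJ], rule ballI)
    fix p assume "p \<in> J"
    then have "0 < p - a" "0 < b - p" using J by auto
    from order_tendstoD(2)[OF \<rho>0 this(1)] order_tendstoD(2)[OF \<rho>0 this(2)]
    show "eventually (\<lambda>j. a \<le> p - \<rho> j \<and> p + \<rho> j \<le> b) sequentially" by eventually_elim simp
  qed
  have sep: "eventually (\<lambda>j. \<forall>p\<in>J. \<forall>p'\<in>J. p \<noteq> p' \<longrightarrow> 2 * \<rho> j \<le> \<bar>p - p'\<bar>) sequentially"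
  proof (rule eventually_ball_finite[OF fJ], rule ballI, rule eventually_ball_finite[OF fJ], rule ballI)
    fix p p'
    show "eventually (\<lambda>j. p \<noteq> p' \<longrightarrow> 2 * \<rho> j \<le> \<bar>p - p'\<bar>) sequentially"
    proof (cases "p = p'")
      case False
      then have "0 < \<bar>p - p'\<bar> / 2" by simp
      from order_tendstoD(2)[OF \<rho>0 this] show ?thesis by eventually_elim simp
    qed simp
  qed
  have le: "eventually (\<lambda>j. ?F j \<le> ennreal (?B j)) sequentially"
    using inside sep
  proof eventually_elim
    case (elim j)
    have "phase_field_energy \<Omega> \<phi> \<phi>inf l Q \<omega> (\<gamma> j) (\<epsilon> j) (U j) (V j) \<le>
      ennreal (\<phi>inf * A + real (card J) * (\<omega> 1 / (4 * \<epsilon> j) * (2 * (\<epsilon> j)\<^sup>2) + 2 * (Psi \<omega> 1 + sqrt (\<epsilon> j))))"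
      using Z elim by blast
    moreover have "\<omega> 1 / (4 * \<epsilon> j) * (2 * (\<epsilon> j)\<^sup>2) = \<omega> 1 * \<epsilon> j / 2"
      using \<epsilon>(1)[of j] by (simp add: field_simps power2_eq_square)
    moreover have "fst \<circ> y j = U j" "snd \<circ> y j = V j" by (auto simp: y_def)
    ultimately show ?case by (simp only:)
  qed
  have "?B \<longlonglongrightarrow> \<phi>inf * A + real (card J) * (\<omega> 1 * 0 / 2 + 2 * (Psi \<omega> 1 + sqrt 0))"
    by (intro tendsto_intros \<epsilon>(2)) simp
  then have Blim: "(\<lambda>j. ennreal (?B j)) \<longlonglongrightarrow> ennreal (\<phi>inf * A + 2 * Psi \<omega> 1 * real (card J))"
    by (intro tendsto_ennrealI) (simp add: mult_ac)
  have "limsup ?F \<le> limsup (\<lambda>j. ennreal (?B j))" by (rule Limsup_mono[OF le])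
  also have "\<dots> = ennreal (\<phi>inf * A + 2 * Psi \<omega> 1 * real (card J))"
    by (rule lim_imp_Limsup[OF _ Blim]) simp
  also have "\<dots> = ennreal \<phi>inf * ennreal A + 2 * ennreal (Psi \<omega> 1) * ennreal (real (card J))"
    using P0 \<phi>inf(2) by (simp add: A_def ennreal_mult ennreal_plus)
  also have "ennreal A = (\<integral>\<^sup>+x. ennreal (\<bar>g x\<bar>\<^sup>2) \<partial>LL)"
    unfolding A_def using g2 by (simp add: nn_integral_eq_integral)
  also have "ennreal (real (card J)) = emeasure (count_space UNIV) J"
    using fJ by (simp add: emeasure_count_space_finite ennreal_of_nat_eq_real_of_nat)
  also note LE[symmetric]
  finally show ?thesis using y_int conv by blast
qed

theorem theorem1p2:
  fixes a b \<phi>inf :: real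
    and \<Omega> :: "real set"
    and l Q \<omega> \<phi> \<gamma> :: "real \<Rightarrow> real"
    and \<zeta> :: ereal
  assumes "a < b" and "\<Omega> = {a<..<b}"
    and "continuous_on {0..1} l" and "\<forall>t\<in>{0..1}. 0 \<le> l t"
    and "l 1 = 1" and "{t\<in>{0..1}. l t = 0} = {0}"
    and "continuous_on {0..1} Q" and "\<forall>t\<in>{0..1}. 0 \<le> Q t"
    and "{t\<in>{0..1}. Q t = 0} = {0}"
    and "\<exists>\<delta>\<in>{0<..<1}. mono_on {0..\<delta>} Q"
    and "\<exists>\<delta>\<in>{0<..<1}. mono_on {1 - \<delta>..<1} (f_fun l Q)"
    and "continuous_on {0..1} \<omega>" and "\<forall>t\<in>{0..1}. 0 \<le> \<omega> t"
    and "{t\<in>{0..1}. \<omega> t = 0} = {0}"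
    and "((\<lambda>t. ereal (sqrt (\<omega> t / Q t))) \<longlongrightarrow> \<zeta>) (at_right 0)"
    and "0 < \<zeta>"
    and "continuous_on {0..} \<phi>" and "\<forall>t\<ge>0. 0 \<le> \<phi> t" and "mono_on {0..} \<phi>"
    and "(\<phi> \<longlongrightarrow> \<phi>inf) at_top" and "0 < \<phi>inf"
    and "{t\<in>{0..}. \<phi> t = 0} = {0}"
    and "\<exists>D>0. (\<phi> has_real_derivative D) (at_right 0)"
    and "\<forall>\<epsilon>>0. 0 < \<gamma> \<epsilon>"
    and "filterlim (\<lambda>\<epsilon>. \<gamma> \<epsilon> / \<epsilon>) at_top (at_right 0)"
  shows "Gamma_limit (L1_space \<Omega> :: (real \<Rightarrow> real \<times> real) set) (L1_dist \<Omega>)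
           (\<lambda>\<epsilon> w. phase_field_energy \<Omega> \<phi> \<phi>inf l Q \<omega> (\<gamma> \<epsilon>) \<epsilon> (fst \<circ> w) (snd \<circ> w))
           (\<lambda>w. limit_energy \<Omega> \<phi>inf \<omega> (fst \<circ> w) (snd \<circ> w))"
proof -
  have zero: "f t = 0 \<longleftrightarrow> t = 0" if "{t\<in>T. f t = 0} = {0}" "t \<in> T" for f :: "real \<Rightarrow> real" and t T
    using that by blast
  interpret phase_field a b \<phi>inf l Q \<omega> \<phi> \<zeta>
  proof
    show "a < b" "0 < \<zeta>" "0 < \<phi>inf" by fact+
    show "continuous_on {0..1} l" "continuous_on {0..1} Q" "continuous_on {0..1} \<omega>" "continuous_on {0..} \<phi>" "mono_on {0..} \<phi>"
      by fact+
    show "((\<lambda>t. ereal (sqrt (\<omega> t / Q t))) \<longlongrightarrow> \<zeta>) (at_right 0)" "(\<phi> \<longlongrightarrow> \<phi>inf) at_top"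
      "\<exists>D>0. (\<phi> has_real_derivative D) (at_right 0)" by fact+
    show "0 \<le> l t" "0 \<le> Q t" "0 \<le> \<omega> t" if "t \<in> {0..1}" for t using assms(4,8,13) that by blast+
    show "0 \<le> \<phi> t" if "0 \<le> t" for t using assms(18) that by blast
    show "l t = 0 \<longleftrightarrow> t = 0" if "t \<in> {0..1}" for t by (rule zero[OF assms(6) that])
    show "Q t = 0 \<longleftrightarrow> t = 0" if "t \<in> {0..1}" for t by (rule zero[OF assms(9) that])
    show "\<omega> t = 0 \<longleftrightarrow> t = 0" if "t \<in> {0..1}" for t by (rule zero[OF assms(14) that])
    show "\<phi> t = 0 \<longleftrightarrow> t = 0" if "0 \<le> t" for t by (rule zero[OF assms(22)]) (use that in simp)
  qed
  show ?thesis
    unfolding Gamma_limit_def Gamma_seq_limit_def \<open>\<Omega> = {a<..<b}\<close> L1_space_def mem_Collect_eq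
  proof (intro allI impI ballI)
    fix \<epsilon> :: "nat \<Rightarrow> real" and w :: "real \<Rightarrow> real \<times> real"
    assume \<epsilon>: "(\<forall>j. 0 < \<epsilon> j) \<and> \<epsilon> \<longlonglongrightarrow> 0" and "w \<in> {w. integrable (lebesgue_on {a<..<b}) w}"
    then have w: "integrable (lebesgue_on {a<..<b}) w" by blast
    have \<epsilon>1: "0 < \<epsilon> j" for j using \<epsilon> by blast
    have \<epsilon>2: "\<epsilon> \<longlonglongrightarrow> 0" using \<epsilon> by blast
    have \<gamma>1: "0 < \<gamma> (\<epsilon> j)" for j using assms(24) \<epsilon>1 by blast
    \<comment> \<open>The growth of \<gamma>/\<epsilon> is given as \<epsilon> tends to 0 from the
      right; a positive null sequence approaches 0 in exactly this sense.\<close>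
    have "filterlim \<epsilon> (at_right 0) sequentially"
      using \<epsilon>1 \<epsilon>2 by (simp add: filterlim_at order_less_imp_not_eq2)
    then have \<gamma>2: "filterlim (\<lambda>j. \<gamma> (\<epsilon> j) / \<epsilon> j) at_top sequentially"
      by (rule filterlim_compose[OF assms(25)])
    show "(\<forall>y. (\<forall>j. integrable (lebesgue_on {a<..<b}) (y j)) \<and> (\<lambda>j. L1_dist {a<..<b} (y j) w) \<longlonglongrightarrow> 0 \<longrightarrow>
          limit_energy {a<..<b} \<phi>inf \<omega> (fst \<circ> w) (snd \<circ> w)
          \<le> liminf (\<lambda>j. phase_field_energy {a<..<b} \<phi> \<phi>inf l Q \<omega> (\<gamma> (\<epsilon> j)) (\<epsilon> j) (fst \<circ> y j) (snd \<circ> y j))) \<and>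
      (\<exists>y. (\<forall>j. integrable (lebesgue_on {a<..<b}) (y j)) \<and> (\<lambda>j. L1_dist {a<..<b} (y j) w) \<longlonglongrightarrow> 0 \<and>
          limsup (\<lambda>j. phase_field_energy {a<..<b} \<phi> \<phi>inf l Q \<omega> (\<gamma> (\<epsilon> j)) (\<epsilon> j) (fst \<circ> y j) (snd \<circ> y j))
          \<le> limit_energy {a<..<b} \<phi>inf \<omega> (fst \<circ> w) (snd \<circ> w))"
    proof (rule conjI)
      show "\<exists>y. (\<forall>j. integrable (lebesgue_on {a<..<b}) (y j)) \<and> (\<lambda>j. L1_dist {a<..<b} (y j) w) \<longlonglongrightarrow> 0 \<and>
          limsup (\<lambda>j. phase_field_energy {a<..<b} \<phi> \<phi>inf l Q \<omega> (\<gamma> (\<epsilon> j)) (\<epsilon> j) (fst \<circ> y j) (snd \<circ> y j))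
          \<le> limit_energy {a<..<b} \<phi>inf \<omega> (fst \<circ> w) (snd \<circ> w)"
        by (rule Gamma_limsup[OF \<epsilon>1 \<epsilon>2 less_imp_le[OF \<gamma>1] w])
    qed (intro allI impI, elim conjE, rule Gamma_liminf[OF \<epsilon>1 \<epsilon>2 \<gamma>1 \<gamma>2 w], blast+)
  qed
qed

end
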